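(* Let $R$ be a two dimensional Gorenstein local ring. Suppose there exists a nonsingular $R$-order $\Lambda$ for which the structure map $R \to \Lambda$ is a split monomorphism (of $R$-modules). Then the topological space $\mathfrak{CM}(R)$ is compact.
   Context: All modules are finitely generated. For a Gorenstein (commutative Noetherian) local ring $R$, $\underline{\mathrm{ann}}_R M$ denotes the annihilator in $R$ of the stable endomorphism ring $\underline{\mathrm{End}}_R(M) = \mathrm{End}_R(M)/\{\text{maps factoring through a projective module}\}$. $\mathfrak{CM}(R)$ is the set of isomorphism classes of maximal Cohen-Macaulay $R$-modules with the topology in which a subset $U$ is closed if and only if $U = \bigcup_{M \in U}\mathrm{cl}(M)$, where $\mathrm{cl}(M) = \{L : \underline{\mathrm{ann}}_R L \subseteq \underline{\mathrm{ann}}_R M\}$. An $R$-order is a (not necessarily commutative) module-finite $R$-algebra $\Lambda$ which is maximal Cohen-Macaulay as an $R$-module; orders are always assumed to have finite injective dimension as modules over themselves on both sides. $\Lambda$ is a Gorenstein order if $\omega = \mathrm{Hom}_R(\Lambda, R)$ is projective as a $\Lambda$-module, and a nonsingular order if it is a Gorenstein order of finite global dimension. Compact means every open cover has a finite subcover. *)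

theory Defs
  imports "HOL-Algebra.Ring_Divisibility" "HOL-Algebra.Module" "HOL-Analysis.Abstract_Topology" "HOL-Library.Extended_Nat"
begin

section \<open>Modules over a not necessarily commutative ring\<close>

text \<open>
  The locale \<open>module\<close> of HOL-Algebra fixes a commutative base ring. The locale below has the same
  axioms over an arbitrary ring and uses the same records; the fields \<open>mult\<close> and \<open>one\<close> of a module
  record play no role. Right modules over \<open>A\<close> are left modules over \<open>op_ring A\<close>.
\<close>

locale left_module = R?: ring A + M?: abelian_group M
  for A :: "('a, 'c) ring_scheme" (structure) and M :: "('a, 'm, 'd) module_scheme" (structure) +
  assumes smult_closed [simp, intro]:
      "\<lbrakk>a \<in> carrier A; x \<in> carrier M\<rbrakk> \<Longrightarrow> a \<odot>\<^bsub>M\<^esub> x \<in> carrier M"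
    and smult_l_distr:
      "\<lbrakk>a \<in> carrier A; b \<in> carrier A; x \<in> carrier M\<rbrakk> \<Longrightarrow>
        (a \<oplus>\<^bsub>A\<^esub> b) \<odot>\<^bsub>M\<^esub> x = a \<odot>\<^bsub>M\<^esub> x \<oplus>\<^bsub>M\<^esub> b \<odot>\<^bsub>M\<^esub> x"
    and smult_r_distr:
      "\<lbrakk>a \<in> carrier A; x \<in> carrier M; y \<in> carrier M\<rbrakk> \<Longrightarrow>
        a \<odot>\<^bsub>M\<^esub> (x \<oplus>\<^bsub>M\<^esub> y) = a \<odot>\<^bsub>M\<^esub> x \<oplus>\<^bsub>M\<^esub> a \<odot>\<^bsub>M\<^esub> y"
    and smult_assoc1:
      "\<lbrakk>a \<in> carrier A; b \<in> carrier A; x \<in> carrier M\<rbrakk> \<Longrightarrow>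
        (a \<otimes>\<^bsub>A\<^esub> b) \<odot>\<^bsub>M\<^esub> x = a \<odot>\<^bsub>M\<^esub> (b \<odot>\<^bsub>M\<^esub> x)"
    and smult_one [simp]: "x \<in> carrier M \<Longrightarrow> \<one>\<^bsub>A\<^esub> \<odot>\<^bsub>M\<^esub> x = x"

lemma module_iff_left_module: "module A M \<longleftrightarrow> cring A \<and> left_module A M"
  unfolding module_def left_module_def module_axioms_def left_module_axioms_def
  by (auto dest: cring.axioms(1))

definition op_ring :: "('a, 'c) ring_scheme \<Rightarrow> 'a ring" where
  "op_ring A = \<lparr>carrier = carrier A, monoid.mult = (\<lambda>x y. y \<otimes>\<^bsub>A\<^esub> x), one = \<one>\<^bsub>A\<^esub>,
     ring.zero = \<zero>\<^bsub>A\<^esub>, ring.add = (\<oplus>\<^bsub>A\<^esub>)\<rparr>"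

definition regular_module :: "('a, 'c) ring_scheme \<Rightarrow> ('a, 'a) module" where
  "regular_module A = \<lparr>carrier = carrier A, monoid.mult = (\<otimes>\<^bsub>A\<^esub>), one = \<one>\<^bsub>A\<^esub>,
     ring.zero = \<zero>\<^bsub>A\<^esub>, ring.add = (\<oplus>\<^bsub>A\<^esub>), smult = (\<otimes>\<^bsub>A\<^esub>)\<rparr>"

text \<open>Homomorphisms are extensional, so that equality of functions is equality of homomorphisms.\<close>

definition mod_hom ::
  "('a, 'c) ring_scheme \<Rightarrow> ('a, 'm, 'd) module_scheme \<Rightarrow> ('a, 'n, 'e) module_scheme \<Rightarrow> ('m \<Rightarrow> 'n) set"
  where
  "mod_hom A M N = {f \<in> carrier M \<rightarrow>\<^sub>E carrier N.
     (\<forall>x\<in>carrier M. \<forall>y\<in>carrier M. f (x \<oplus>\<^bsub>M\<^esub> y) = f x \<oplus>\<^bsub>N\<^esub> f y) \<and>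
     (\<forall>a\<in>carrier A. \<forall>x\<in>carrier M. f (a \<odot>\<^bsub>M\<^esub> x) = a \<odot>\<^bsub>N\<^esub> f x)}"

definition mod_iso ::
  "('a, 'c) ring_scheme \<Rightarrow> ('a, 'm, 'd) module_scheme \<Rightarrow> ('a, 'n, 'e) module_scheme \<Rightarrow> bool" where
  "mod_iso A M N \<longleftrightarrow> (\<exists>f\<in>mod_hom A M N. bij_betw f (carrier M) (carrier N))"

definition fg_module :: "('a, 'c) ring_scheme \<Rightarrow> ('a, 'm, 'd) module_scheme \<Rightarrow> bool" where
  "fg_module A M \<longleftrightarrow> left_module A M \<and>
     (\<exists>n (g :: nat \<Rightarrow> 'm). g \<in> {..<n} \<rightarrow> carrier M \<and>
        (\<forall>x\<in>carrier M. \<exists>a \<in> {..<n} \<rightarrow> carrier A. x = (\<Oplus>\<^bsub>M\<^esub>i\<in>{..<n}. a i \<odot>\<^bsub>M\<^esub> g i)))"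

definition zero_module :: "('a, 'm, 'd) module_scheme \<Rightarrow> bool" where
  "zero_module M \<longleftrightarrow> carrier M = {\<zero>\<^bsub>M\<^esub>}"

definition annihilator :: "('a, 'c) ring_scheme \<Rightarrow> ('a, 'm, 'd) module_scheme \<Rightarrow> 'a set" where
  "annihilator A M = {a \<in> carrier A. \<forall>x\<in>carrier M. a \<odot>\<^bsub>M\<^esub> x = \<zero>\<^bsub>M\<^esub>}"


section \<open>Projective and injective modules, homological dimensions\<close>

text \<open>
  HOL has no quantification over types inside a definition, so \<open>all modules\<close> and \<open>there is a
  module\<close> range over the modules whose carrier is contained in the following type \<open>'a univ\<close>, for a base
  ring \<open>A\<close> on the type \<open>'a\<close>. Nothing is lost. A finitely generated module is isomorphic to a
  quotient of some \<open>A^n\<close>, whose elements are cosets, i.e. sets of functions \<open>nat \<Rightarrow> 'a\<close>. If \<open>A\<close> is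
  nonzero, the type has cardinality \<open>\<kappa> = 2^\<lambda>\<close> with \<open>\<lambda> = |'a|^\<aleph>\<^sub>0\<close>, hence \<open>\<kappa>^|'a| = \<kappa>\<close>; so modules
  of cardinality at most \<open>\<kappa>\<close> have injective hulls, and are quotients of free modules, of cardinality
  at most \<open>\<kappa>\<close>, and the class of these modules is closed under submodules, quotients and finite
  direct sums. In particular it contains injective resolutions of all its members, and it contains
  \<open>A\<close> and its left ideals up to isomorphism, so that Baer's criterion applies to \<open>injective_module\<close>.
\<close>

type_synonym 'a univ = "(nat \<Rightarrow> 'a) set"
type_synonym 'a umodule = "('a, 'a univ) module"

definition projective_module ::
  "('a, 'c) ring_scheme \<Rightarrow> ('a, 'm, 'd) module_scheme \<Rightarrow> bool" where
  "projective_module A P \<longleftrightarrow> left_module A P \<and>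
     (\<forall>(M :: 'a umodule) (N :: 'a umodule) p f.
        left_module A M \<longrightarrow> left_module A N \<longrightarrow>
        p \<in> mod_hom A M N \<longrightarrow> p ` carrier M = carrier N \<longrightarrow> f \<in> mod_hom A P N \<longrightarrow>
        (\<exists>g\<in>mod_hom A P M. \<forall>x\<in>carrier P. p (g x) = f x))"

definition injective_module ::
  "('a, 'c) ring_scheme \<Rightarrow> ('a, 'm, 'd) module_scheme \<Rightarrow> bool" where
  "injective_module A I \<longleftrightarrow> left_module A I \<and>
     (\<forall>(M :: 'a umodule) (N :: 'a umodule) i f.
        left_module A M \<longrightarrow> left_module A N \<longrightarrow>
        i \<in> mod_hom A M N \<longrightarrow> inj_on i (carrier M) \<longrightarrow> f \<in> mod_hom A M I \<longrightarrow>
        (\<exists>g\<in>mod_hom A N I. \<forall>x\<in>carrier M. g (i x) = f x))"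

text \<open>\<open>0 \<rightarrow> M \<rightarrow> I 0 \<rightarrow> I 1 \<rightarrow> \<dots>\<close> exact with all \<open>I j\<close> injective\<close>

definition injective_resolution ::
  "('a, 'c) ring_scheme \<Rightarrow> ('a, 'm, 'd) module_scheme \<Rightarrow> (nat \<Rightarrow> 'a umodule) \<Rightarrow>
   ('m \<Rightarrow> 'a univ) \<Rightarrow> (nat \<Rightarrow> 'a univ \<Rightarrow> 'a univ) \<Rightarrow> bool" where
  "injective_resolution A M I \<epsilon> d \<longleftrightarrow>
     (\<forall>j. injective_module A (I j)) \<and>
     \<epsilon> \<in> mod_hom A M (I 0) \<and> (\<forall>j. d j \<in> mod_hom A (I j) (I (Suc j))) \<and>
     inj_on \<epsilon> (carrier M) \<and>
     \<epsilon> ` carrier M = a_kernel (I 0) (I (Suc 0)) (d 0) \<and>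
     (\<forall>j. d j ` carrier (I j) = a_kernel (I (Suc j)) (I (Suc (Suc j))) (d (Suc j)))"

definition inj_dim :: "('a, 'c) ring_scheme \<Rightarrow> ('a, 'm, 'd) module_scheme \<Rightarrow> enat" where
  "inj_dim A M = Inf {enat n | n. \<exists>I \<epsilon> d.
     injective_resolution A M I \<epsilon> d \<and> (\<forall>j>n. zero_module (I j))}"

text \<open>\<open>\<dots> \<rightarrow> P 1 \<rightarrow> P 0 \<rightarrow> M \<rightarrow> 0\<close> exact with all \<open>P j\<close> finitely generated projective\<close>

definition projective_resolution ::
  "('a, 'c) ring_scheme \<Rightarrow> ('a, 'm, 'd) module_scheme \<Rightarrow> (nat \<Rightarrow> 'a umodule) \<Rightarrow>
   ('a univ \<Rightarrow> 'm) \<Rightarrow> (nat \<Rightarrow> 'a univ \<Rightarrow> 'a univ) \<Rightarrow> bool" where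
  "projective_resolution A M P \<epsilon> d \<longleftrightarrow>
     (\<forall>j. fg_module A (P j) \<and> projective_module A (P j)) \<and>
     \<epsilon> \<in> mod_hom A (P 0) M \<and> (\<forall>j. d j \<in> mod_hom A (P (Suc j)) (P j)) \<and>
     \<epsilon> ` carrier (P 0) = carrier M \<and>
     d 0 ` carrier (P (Suc 0)) = a_kernel (P 0) M \<epsilon> \<and>
     (\<forall>j. d (Suc j) ` carrier (P (Suc (Suc j))) = a_kernel (P (Suc j)) (P j) (d j))"

definition proj_dim :: "('a, 'c) ring_scheme \<Rightarrow> ('a, 'm, 'd) module_scheme \<Rightarrow> enat" where
  "proj_dim A M = Inf {enat n | n. \<exists>P \<epsilon> d.
     projective_resolution A M P \<epsilon> d \<and> (\<forall>j>n. zero_module (P j))}"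

text \<open>Only used for Noetherian rings, where finitely generated modules suffice.\<close>

definition global_dim :: "('a, 'c) ring_scheme \<Rightarrow> enat" where
  "global_dim A = (SUP M \<in> {M :: 'a umodule. fg_module A M}. proj_dim A M)"


section \<open>Gorenstein local rings and maximal Cohen-Macaulay modules\<close>

definition krull_dim :: "('a, 'c) ring_scheme \<Rightarrow> enat" where
  "krull_dim R = (SUP n \<in> {n. \<exists>p :: nat \<Rightarrow> 'a set.
     (\<forall>i\<le>n. primeideal (p i) R) \<and> (\<forall>i<n. p i \<subset> p (Suc i))}. enat n)"

definition noetherian_local_ring :: "('a, 'c) ring_scheme \<Rightarrow> bool" where
  "noetherian_local_ring R \<longleftrightarrow> cring R \<and> noetherian_ring R \<and> (\<exists>!m. maximalideal m R)"

definition the_maximal_ideal :: "('a, 'c) ring_scheme \<Rightarrow> 'a set" where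
  "the_maximal_ideal R = (THE m. maximalideal m R)"

definition gorenstein_local_ring :: "('a, 'c) ring_scheme \<Rightarrow> bool" where
  "gorenstein_local_ring R \<longleftrightarrow> noetherian_local_ring R \<and> inj_dim R (regular_module R) < \<infinity>"

text \<open>\<open>ideal_times_module R M [x\<^sub>1, \<dots>, x\<^sub>n]\<close> is \<open>x\<^sub>1 M + \<dots> + x\<^sub>n M\<close>.\<close>

definition ideal_times_module ::
  "('a, 'c) ring_scheme \<Rightarrow> ('a, 'm, 'd) module_scheme \<Rightarrow> 'a list \<Rightarrow> 'm set" where
  "ideal_times_module R M xs =
     {\<Oplus>\<^bsub>M\<^esub>j\<in>{..<length xs}. (xs ! j) \<odot>\<^bsub>M\<^esub> m j | m. m \<in> {..<length xs} \<rightarrow> carrier M}"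

definition regular_sequence ::
  "('a, 'c) ring_scheme \<Rightarrow> ('a, 'm, 'd) module_scheme \<Rightarrow> 'a list \<Rightarrow> bool" where
  "regular_sequence R M xs \<longleftrightarrow> set xs \<subseteq> carrier R \<and>
     (\<forall>i<length xs. \<forall>m\<in>carrier M.
        (xs ! i) \<odot>\<^bsub>M\<^esub> m \<in> ideal_times_module R M (take i xs) \<longrightarrow>
        m \<in> ideal_times_module R M (take i xs)) \<and>
     ideal_times_module R M xs \<noteq> carrier M"

definition depth :: "('a, 'c) ring_scheme \<Rightarrow> ('a, 'm, 'd) module_scheme \<Rightarrow> enat" where
  "depth R M = (if zero_module M then \<infinity>
     else (SUP xs \<in> {xs. regular_sequence R M xs \<and> set xs \<subseteq> the_maximal_ideal R}. enat (length xs)))"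

definition max_cohen_macaulay ::
  "('a, 'c) ring_scheme \<Rightarrow> ('a, 'm, 'd) module_scheme \<Rightarrow> bool" where
  "max_cohen_macaulay R M \<longleftrightarrow> fg_module R M \<and> depth R M = krull_dim R"


section \<open>Stable annihilators\<close>

definition end_ring ::
  "('a, 'c) ring_scheme \<Rightarrow> ('a, 'm, 'd) module_scheme \<Rightarrow> ('m \<Rightarrow> 'm) ring" where
  "end_ring R M = \<lparr>carrier = mod_hom R M M, monoid.mult = (\<lambda>f g. compose (carrier M) f g),
     one = (\<lambda>x\<in>carrier M. x), ring.zero = (\<lambda>x\<in>carrier M. \<zero>\<^bsub>M\<^esub>),
     ring.add = (\<lambda>f g. \<lambda>x\<in>carrier M. f x \<oplus>\<^bsub>M\<^esub> g x)\<rparr>"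

definition proj_factoring_maps ::
  "('a, 'c) ring_scheme \<Rightarrow> ('a, 'm, 'd) module_scheme \<Rightarrow> ('m \<Rightarrow> 'm) set" where
  "proj_factoring_maps R M = {f. \<exists>(P :: 'a umodule) g h.
     fg_module R P \<and> projective_module R P \<and>
     g \<in> mod_hom R M P \<and> h \<in> mod_hom R P M \<and> f = compose (carrier M) h g}"

text \<open>
  The quotient ring \<open>End(M)/P(M)\<close>, with its \<open>R\<close>-module structure induced by the ring
  homomorphism that sends \<open>r\<close> to the class of the multiplication by \<open>r\<close>.
\<close>

definition stable_end ::
  "('a, 'c) ring_scheme \<Rightarrow> ('a, 'm, 'd) module_scheme \<Rightarrow> ('a, ('m \<Rightarrow> 'm) set) module" where
  "stable_end R M = (let E = end_ring R M; P = proj_factoring_maps R M; S = E Quot P in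
     \<lparr>carrier = carrier S, monoid.mult = (\<otimes>\<^bsub>S\<^esub>), one = \<one>\<^bsub>S\<^esub>, ring.zero = \<zero>\<^bsub>S\<^esub>, ring.add = (\<oplus>\<^bsub>S\<^esub>),
      smult = (\<lambda>r X. (P +>\<^bsub>E\<^esub> (\<lambda>x\<in>carrier M. r \<odot>\<^bsub>M\<^esub> x)) \<otimes>\<^bsub>S\<^esub> X)\<rparr>)"

definition stable_ann :: "('a, 'c) ring_scheme \<Rightarrow> ('a, 'm, 'd) module_scheme \<Rightarrow> 'a set" where
  "stable_ann R M = annihilator R (stable_end R M)"


section \<open>The space of maximal Cohen-Macaulay modules\<close>

definition CM :: "('a, 'c) ring_scheme \<Rightarrow> 'a umodule set set" where
  "CM R = {M. max_cohen_macaulay R M} //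
     {(M, N). max_cohen_macaulay R M \<and> max_cohen_macaulay R N \<and> mod_iso R M N}"

text \<open>The stable annihilator depends only on the isomorphism class, so any representative may be taken.\<close>

definition class_stable_ann :: "('a, 'c) ring_scheme \<Rightarrow> 'a umodule set \<Rightarrow> 'a set" where
  "class_stable_ann R X = stable_ann R (SOME M. M \<in> X)"

definition CM_cl :: "('a, 'c) ring_scheme \<Rightarrow> 'a umodule set \<Rightarrow> 'a umodule set set" where
  "CM_cl R X = {Y \<in> CM R. class_stable_ann R Y \<subseteq> class_stable_ann R X}"

definition CM_closed :: "('a, 'c) ring_scheme \<Rightarrow> 'a umodule set set \<Rightarrow> bool" where
  "CM_closed R U \<longleftrightarrow> U \<subseteq> CM R \<and> U = (\<Union>X\<in>U. CM_cl R X)"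

definition CM_space :: "('a, 'c) ring_scheme \<Rightarrow> 'a umodule set topology" where
  "CM_space R = topology (\<lambda>V. V \<subseteq> CM R \<and> CM_closed R (CM R - V))"

lemma CM_closed_iff:
  "CM_closed R U \<longleftrightarrow> U \<subseteq> CM R \<and> (\<forall>X\<in>U. \<forall>Y\<in>CM R. class_stable_ann R Y \<subseteq> class_stable_ann R X \<longrightarrow> Y \<in> U)"
  unfolding CM_closed_def CM_cl_def by blast

lemma openin_CM_space: "openin (CM_space R) V \<longleftrightarrow> V \<subseteq> CM R \<and> CM_closed R (CM R - V)"
proof -
  have "istopology (\<lambda>V. V \<subseteq> CM R \<and> CM_closed R (CM R - V))"
    unfolding istopology_def CM_closed_iff by blast
  then show ?thesis by (simp add: CM_space_def)
qed

lemma topspace_CM_space [simp]: "topspace (CM_space R) = CM R"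
proof
  show "topspace (CM_space R) \<subseteq> CM R"
    unfolding topspace_def openin_CM_space by blast
  show "CM R \<subseteq> topspace (CM_space R)"
    by (rule openin_subset) (simp add: openin_CM_space CM_closed_def)
qed

lemma closedin_CM_space: "closedin (CM_space R) U \<longleftrightarrow> CM_closed R U"
  unfolding closedin_def openin_CM_space topspace_CM_space
  by (auto simp: CM_closed_iff double_diff)


section \<open>Orders\<close>

definition is_algebra :: "('a, 'c) ring_scheme \<Rightarrow> ('l, 'e) ring_scheme \<Rightarrow> ('a \<Rightarrow> 'l) \<Rightarrow> bool" where
  "is_algebra R L \<phi> \<longleftrightarrow> cring R \<and> ring L \<and> \<phi> \<in> ring_hom R L \<and>
     (\<forall>r\<in>carrier R. \<forall>x\<in>carrier L. \<phi> r \<otimes>\<^bsub>L\<^esub> x = x \<otimes>\<^bsub>L\<^esub> \<phi> r)"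

definition algebra_module :: "('l, 'e) ring_scheme \<Rightarrow> ('a \<Rightarrow> 'l) \<Rightarrow> ('a, 'l) module" where
  "algebra_module L \<phi> = \<lparr>carrier = carrier L, monoid.mult = (\<otimes>\<^bsub>L\<^esub>), one = \<one>\<^bsub>L\<^esub>,
     ring.zero = \<zero>\<^bsub>L\<^esub>, ring.add = (\<oplus>\<^bsub>L\<^esub>), smult = (\<lambda>r x. \<phi> r \<otimes>\<^bsub>L\<^esub> x)\<rparr>"

definition is_order :: "('a, 'c) ring_scheme \<Rightarrow> ('l, 'e) ring_scheme \<Rightarrow> ('a \<Rightarrow> 'l) \<Rightarrow> bool" where
  "is_order R L \<phi> \<longleftrightarrow> is_algebra R L \<phi> \<and> max_cohen_macaulay R (algebra_module L \<phi>) \<and>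
     inj_dim L (regular_module L) < \<infinity> \<and> inj_dim (op_ring L) (regular_module (op_ring L)) < \<infinity>"

text \<open>
  \<open>\<omega> = Hom\<^sub>R(L, R)\<close>, as the dual of the left module \<open>L\<close>: a right module via \<open>(f \<cdot> a)(x) = f(ax)\<close>,
  i.e. a left module over \<open>op_ring L\<close>.
\<close>

definition dual_module ::
  "('a, 'c) ring_scheme \<Rightarrow> ('l, 'e) ring_scheme \<Rightarrow> ('a \<Rightarrow> 'l) \<Rightarrow> ('l, 'l \<Rightarrow> 'a) module" where
  "dual_module R L \<phi> = \<lparr>carrier = mod_hom R (algebra_module L \<phi>) (regular_module R),
     monoid.mult = undefined, one = undefined, ring.zero = (\<lambda>x\<in>carrier L. \<zero>\<^bsub>R\<^esub>),
     ring.add = (\<lambda>f g. \<lambda>x\<in>carrier L. f x \<oplus>\<^bsub>R\<^esub> g x),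
     smult = (\<lambda>a f. \<lambda>x\<in>carrier L. f (a \<otimes>\<^bsub>L\<^esub> x))\<rparr>"

definition gorenstein_order ::
  "('a, 'c) ring_scheme \<Rightarrow> ('l, 'e) ring_scheme \<Rightarrow> ('a \<Rightarrow> 'l) \<Rightarrow> bool" where
  "gorenstein_order R L \<phi> \<longleftrightarrow> is_order R L \<phi> \<and>
     projective_module (op_ring L) (dual_module R L \<phi>)"

definition nonsingular_order ::
  "('a, 'c) ring_scheme \<Rightarrow> ('l, 'e) ring_scheme \<Rightarrow> ('a \<Rightarrow> 'l) \<Rightarrow> bool" where
  "nonsingular_order R L \<phi> \<longleftrightarrow> gorenstein_order R L \<phi> \<and> global_dim L < \<infinity>"

definition split_structure_map ::
  "('a, 'c) ring_scheme \<Rightarrow> ('l, 'e) ring_scheme \<Rightarrow> ('a \<Rightarrow> 'l) \<Rightarrow> bool" where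
  "split_structure_map R L \<phi> \<longleftrightarrow>
     (\<exists>\<rho>\<in>mod_hom R (algebra_module L \<phi>) (regular_module R). \<forall>r\<in>carrier R. \<rho> (\<phi> r) = r)"

end

theory Submission
  imports Defs
begin

text \<open>
  If \<open>\<Lambda>\<close> is the order, then \<open>stable_ann \<Lambda> \<subseteq> stable_ann X\<close> for every maximal Cohen-Macaulay \<open>X\<close>, so that
  the whole space is the only open set that contains the class of \<open>\<Lambda>\<close>.

  For the inclusion let \<open>M\<^sup>* = Hom\<^sub>R(M, R)\<close>. The left \<open>\<Lambda>\<close>-module \<open>Y = Hom\<^sub>R(\<Lambda>, X\<^sup>*)\<close> has depth 2 and
  a finite resolution \<open>P\<close> by projectives. Modules of depth 2 have no higher Ext into \<open>R\<close>, so dualising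
  the resolution gives an exact sequence of right modules; as \<open>\<Lambda>\<^sup>*\<close> is projective, so are the \<open>P\<^sub>j\<^sup>*\<close>,
  and the dual sequence splits. Hence \<open>Y\<^sup>*\<close> is a direct summand of \<open>P\<^sub>0\<^sup>*\<close>. Since \<open>R \<rightarrow> \<Lambda>\<close> splits,
  \<open>X\<^sup>*\<close> is a summand of \<open>Y\<close>, and \<open>X = X\<^sup>*\<^sup>*\<close> a summand of \<open>Y\<^sup>*\<close>, hence of \<open>P\<^sub>0\<^sup>*\<close>. A scalar whose
  multiplication on \<open>\<Lambda>\<close> factors through a free \<open>R\<close>-module does so on \<open>P\<^sub>0\<close>, on \<open>P\<^sub>0\<^sup>*\<close> and on \<open>X\<close>.

  The vanishing of \<open>Ext\<^sup>i(-, R)\<close> for \<open>i > 2\<close> is shown by descending induction on \<open>i\<close>, on cyclic modules: an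
  ideal \<open>J\<close> maximal among those with \<open>Ext\<^sup>i(R/J, R) \<noteq> 0\<close> is the maximal ideal by Nakayama's lemma, and
  the residue field embeds into \<open>R/(a, b)\<close> for a regular sequence \<open>a, b\<close>, because the dimension is 2.
\<close>

section \<open>Linear maps, submodules and free modules\<close>

text \<open>Modules of many carrier types occur, while projectivity and injectivity are tested on
  one type. Projectivity is therefore traded for \<open>finite_rank\<close> of the identity, a
  condition that can be followed through composites and duals; injectivity is reached by coding
  finitely generated modules in \<open>univ\<close>. Quotients would create ever new types, so Ext
  is never formed: it is only said to vanish, or to be finitely generated, in terms of submodules.
  Nakayama's lemma needs Ext to be finitely generated, which cannot be read off an injective
  resolution, whose terms need not be. Covering a submodule of a free module by another free module
  lowers the degree until only maps into \<open>R\<close> are left. The regular sequence on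
  \<open>R\<close> comes from \<Lambda>: depth 2 gives one on \<Lambda>, and the splitting of the
  structure map brings it back to \<open>R\<close>. Hom rather than a tensor product leads from X to
  \<Lambda>-modules, since Hom into a module of depth 2 inherits the regular sequence. The dimension
  enters twice: as the length of that sequence, and to exclude a chain of four primes.\<close>

definition lin ::
  "('a, 'c) ring_scheme \<Rightarrow> ('a, 'm, 'd) module_scheme \<Rightarrow> ('a, 'n, 'e) module_scheme \<Rightarrow> ('m \<Rightarrow> 'n) \<Rightarrow> bool"
  where
  "lin A M N f \<longleftrightarrow> (\<forall>x\<in>carrier M. f x \<in> carrier N) \<and>
     (\<forall>x\<in>carrier M. \<forall>y\<in>carrier M. f (x \<oplus>\<^bsub>M\<^esub> y) = f x \<oplus>\<^bsub>N\<^esub> f y) \<and>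
     (\<forall>a\<in>carrier A. \<forall>x\<in>carrier M. f (a \<odot>\<^bsub>M\<^esub> x) = a \<odot>\<^bsub>N\<^esub> f x)"

definition submod :: "('a, 'c) ring_scheme \<Rightarrow> ('a, 'm, 'd) module_scheme \<Rightarrow> 'm set \<Rightarrow> bool" where
  "submod A M S \<longleftrightarrow> S \<subseteq> carrier M \<and> \<zero>\<^bsub>M\<^esub> \<in> S \<and>
     (\<forall>x\<in>S. \<forall>y\<in>S. x \<oplus>\<^bsub>M\<^esub> y \<in> S) \<and> (\<forall>a\<in>carrier A. \<forall>x\<in>S. a \<odot>\<^bsub>M\<^esub> x \<in> S)"

text \<open>Separates extensionality from linearity. Composites and lambda terms are handled with
  \<open>lin\<close>, which ignores values off the carrier; \<open>restrict\<close> is applied only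
  when an element of a Hom module is wanted.\<close>

lemma mod_hom_iff: "f \<in> mod_hom A M N \<longleftrightarrow> lin A M N f \<and> f \<in> extensional (carrier M)"
  unfolding mod_hom_def lin_def PiE_def by auto

lemma linI:
  assumes "\<And>x. x \<in> carrier M \<Longrightarrow> f x \<in> carrier N"
    and "\<And>x y. x \<in> carrier M \<Longrightarrow> y \<in> carrier M \<Longrightarrow> f (x \<oplus>\<^bsub>M\<^esub> y) = f x \<oplus>\<^bsub>N\<^esub> f y"
    and "\<And>a x. a \<in> carrier A \<Longrightarrow> x \<in> carrier M \<Longrightarrow> f (a \<odot>\<^bsub>M\<^esub> x) = a \<odot>\<^bsub>N\<^esub> f x"
  shows "lin A M N f"
  using assms unfolding lin_def by blast

lemma lin_closed: "lin A M N f \<Longrightarrow> x \<in> carrier M \<Longrightarrow> f x \<in> carrier N"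
  unfolding lin_def by blast

lemma lin_add:
  "lin A M N f \<Longrightarrow> x \<in> carrier M \<Longrightarrow> y \<in> carrier M \<Longrightarrow> f (x \<oplus>\<^bsub>M\<^esub> y) = f x \<oplus>\<^bsub>N\<^esub> f y"
  unfolding lin_def by blast

lemma lin_smult:
  "lin A M N f \<Longrightarrow> a \<in> carrier A \<Longrightarrow> x \<in> carrier M \<Longrightarrow> f (a \<odot>\<^bsub>M\<^esub> x) = a \<odot>\<^bsub>N\<^esub> f x"
  unfolding lin_def by blast

lemma submodI:
  assumes "S \<subseteq> carrier M" "\<zero>\<^bsub>M\<^esub> \<in> S"
    and "\<And>x y. x \<in> S \<Longrightarrow> y \<in> S \<Longrightarrow> x \<oplus>\<^bsub>M\<^esub> y \<in> S"
    and "\<And>a x. a \<in> carrier A \<Longrightarrow> x \<in> S \<Longrightarrow> a \<odot>\<^bsub>M\<^esub> x \<in> S"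
  shows "submod A M S"
  using assms unfolding submod_def by blast

lemma submodD:
  assumes "submod A M S"
  shows "S \<subseteq> carrier M" "\<zero>\<^bsub>M\<^esub> \<in> S" "x \<in> S \<Longrightarrow> x \<in> carrier M"
    "x \<in> S \<Longrightarrow> y \<in> S \<Longrightarrow> x \<oplus>\<^bsub>M\<^esub> y \<in> S"
    "a \<in> carrier A \<Longrightarrow> x \<in> S \<Longrightarrow> a \<odot>\<^bsub>M\<^esub> x \<in> S"
  using assms unfolding submod_def by blast+

context left_module
begin

lemma smult_l_null [simp]: "x \<in> carrier M \<Longrightarrow> \<zero>\<^bsub>A\<^esub> \<odot>\<^bsub>M\<^esub> x = \<zero>\<^bsub>M\<^esub>"
proof -
  assume x: "x \<in> carrier M"
  have "\<zero>\<^bsub>A\<^esub> \<odot>\<^bsub>M\<^esub> x \<oplus>\<^bsub>M\<^esub> \<zero>\<^bsub>A\<^esub> \<odot>\<^bsub>M\<^esub> x = \<zero>\<^bsub>A\<^esub> \<odot>\<^bsub>M\<^esub> x"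
    using smult_l_distr[of "\<zero>\<^bsub>A\<^esub>" "\<zero>\<^bsub>A\<^esub>" x] x by simp
  then show ?thesis using x by (metis M.add.l_cancel_one' smult_closed R.zero_closed)
qed

lemma smult_r_null [simp]: "a \<in> carrier A \<Longrightarrow> a \<odot>\<^bsub>M\<^esub> \<zero>\<^bsub>M\<^esub> = \<zero>\<^bsub>M\<^esub>"
proof -
  assume a: "a \<in> carrier A"
  have "a \<odot>\<^bsub>M\<^esub> \<zero>\<^bsub>M\<^esub> \<oplus>\<^bsub>M\<^esub> a \<odot>\<^bsub>M\<^esub> \<zero>\<^bsub>M\<^esub> = a \<odot>\<^bsub>M\<^esub> \<zero>\<^bsub>M\<^esub>"
    using smult_r_distr[of a "\<zero>\<^bsub>M\<^esub>" "\<zero>\<^bsub>M\<^esub>"] a by simp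
  then show ?thesis using a by (metis M.add.l_cancel_one' smult_closed M.zero_closed)
qed

lemma smult_l_minus: "a \<in> carrier A \<Longrightarrow> x \<in> carrier M \<Longrightarrow> (\<ominus>\<^bsub>A\<^esub> a) \<odot>\<^bsub>M\<^esub> x = \<ominus>\<^bsub>M\<^esub> (a \<odot>\<^bsub>M\<^esub> x)"
proof -
  assume a: "a \<in> carrier A" and x: "x \<in> carrier M"
  have "(\<ominus>\<^bsub>A\<^esub> a) \<odot>\<^bsub>M\<^esub> x \<oplus>\<^bsub>M\<^esub> a \<odot>\<^bsub>M\<^esub> x = \<zero>\<^bsub>M\<^esub>"
    using smult_l_distr[of "\<ominus>\<^bsub>A\<^esub> a" a x] a x by (simp add: R.l_neg)
  then show ?thesis using a x by (intro M.minus_equality[symmetric]) auto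
qed

lemma smult_r_minus: "a \<in> carrier A \<Longrightarrow> x \<in> carrier M \<Longrightarrow> a \<odot>\<^bsub>M\<^esub> (\<ominus>\<^bsub>M\<^esub> x) = \<ominus>\<^bsub>M\<^esub> (a \<odot>\<^bsub>M\<^esub> x)"
proof -
  assume a: "a \<in> carrier A" and x: "x \<in> carrier M"
  have "a \<odot>\<^bsub>M\<^esub> (\<ominus>\<^bsub>M\<^esub> x) \<oplus>\<^bsub>M\<^esub> a \<odot>\<^bsub>M\<^esub> x = \<zero>\<^bsub>M\<^esub>"
    using smult_r_distr[of a "\<ominus>\<^bsub>M\<^esub> x" x] a x by (simp add: M.l_neg)
  then show ?thesis using a x by (intro M.minus_equality[symmetric]) auto
qed

lemma minus_eq_smult: "x \<in> carrier M \<Longrightarrow> \<ominus>\<^bsub>M\<^esub> x = (\<ominus>\<^bsub>A\<^esub> \<one>\<^bsub>A\<^esub>) \<odot>\<^bsub>M\<^esub> x"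
  by (simp add: smult_l_minus)

lemma submod_minus:
  assumes "submod A M S" "x \<in> S" shows "\<ominus>\<^bsub>M\<^esub> x \<in> S"
proof -
  have "(\<ominus>\<^bsub>A\<^esub> \<one>\<^bsub>A\<^esub>) \<odot>\<^bsub>M\<^esub> x \<in> S"
    by (rule submodD(5)[OF assms(1) _ assms(2)]) simp
  then show ?thesis using minus_eq_smult[OF submodD(3)[OF assms]] by metis
qed

lemma submod_diff:
  assumes "submod A M S" "x \<in> S" "y \<in> S" shows "x \<ominus>\<^bsub>M\<^esub> y \<in> S"
  unfolding a_minus_def by (rule submodD(4)[OF assms(1,2) submod_minus[OF assms(1,3)]])

lemma submod_carrier: "submod A M (carrier M)"
  by (rule submodI) auto

lemma submod_zero: "submod A M {\<zero>\<^bsub>M\<^esub>}"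
  by (rule submodI) auto

lemma submod_module: assumes "submod A M S" shows "left_module A (M\<lparr>carrier := S\<rparr>)"
proof -
  note S = submodD[OF assms]
  have "abelian_group (M\<lparr>carrier := S\<rparr>)"
  proof (rule abelian_groupI)
    fix x assume x: "x \<in> carrier (M\<lparr>carrier := S\<rparr>)"
    show "\<exists>y\<in>carrier (M\<lparr>carrier := S\<rparr>). y \<oplus>\<^bsub>M\<lparr>carrier := S\<rparr>\<^esub> x = \<zero>\<^bsub>M\<lparr>carrier := S\<rparr>\<^esub>"
      using x S submod_minus[OF assms] by (intro bexI[of _ "\<ominus>\<^bsub>M\<^esub> x"]) (auto simp: M.l_neg)
  qed (use S in \<open>auto simp: M.a_ac\<close>)
  then show ?thesis
    unfolding left_module_def left_module_axioms_def
    using S R.ring_axioms by (auto simp: smult_l_distr smult_r_distr smult_assoc1)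
qed

end

lemma lin_zero: assumes "left_module A M" "left_module A N" "lin A M N f"
  shows "f \<zero>\<^bsub>M\<^esub> = \<zero>\<^bsub>N\<^esub>"
proof -
  interpret M: left_module A M by fact
  interpret N: left_module A N by fact
  have "f (\<zero>\<^bsub>A\<^esub> \<odot>\<^bsub>M\<^esub> \<zero>\<^bsub>M\<^esub>) = \<zero>\<^bsub>A\<^esub> \<odot>\<^bsub>N\<^esub> f \<zero>\<^bsub>M\<^esub>"
    using lin_smult[OF assms(3), of "\<zero>\<^bsub>A\<^esub>" "\<zero>\<^bsub>M\<^esub>"] by simp
  then show ?thesis using lin_closed[OF assms(3), of "\<zero>\<^bsub>M\<^esub>"] by simp
qed

lemma lin_minus: assumes "left_module A M" "left_module A N" "lin A M N f" "x \<in> carrier M"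
  shows "f (\<ominus>\<^bsub>M\<^esub> x) = \<ominus>\<^bsub>N\<^esub> f x"
proof -
  interpret M: left_module A M by fact
  interpret N: left_module A N by fact
  show ?thesis
    using lin_smult[OF assms(3), of "\<ominus>\<^bsub>A\<^esub> \<one>\<^bsub>A\<^esub>" x] assms(4) lin_closed[OF assms(3,4)]
    by (simp add: M.smult_l_minus N.smult_l_minus)
qed

lemma lin_diff: assumes "left_module A M" "left_module A N" "lin A M N f" "x \<in> carrier M" "y \<in> carrier M"
  shows "f (x \<ominus>\<^bsub>M\<^esub> y) = f x \<ominus>\<^bsub>N\<^esub> f y"
proof -
  interpret M: left_module A M by fact
  show ?thesis
    using assms(4,5) lin_add[OF assms(3), of x "\<ominus>\<^bsub>M\<^esub> y"] lin_minus[OF assms(1-3,5)]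
    unfolding a_minus_def by simp
qed

lemma lin_comp: "lin A M N f \<Longrightarrow> lin A N P g \<Longrightarrow> lin A M P (\<lambda>x. g (f x))"
  unfolding lin_def by auto

lemma lin_cong: "lin A M N f \<Longrightarrow> (\<And>x. x \<in> carrier M \<Longrightarrow> g x = f x) \<Longrightarrow> left_module A M \<Longrightarrow> lin A M N g"
  by (rule linI) (auto simp: lin_closed lin_add lin_smult left_module.smult_closed
      abelian_monoid.a_closed abelian_group.axioms(1) left_module.axioms(2))

lemma lin_id: "lin A M M (\<lambda>x. x)"
  unfolding lin_def by simp

lemma lin_restrict: "left_module A M \<Longrightarrow> lin A M N f \<Longrightarrow> restrict f (carrier M) \<in> mod_hom A M N"
  unfolding mod_hom_iff by (rule conjI, rule lin_cong) auto

lemma lin_zero_map: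
  assumes "left_module A M" "left_module A N" shows "lin A M N (\<lambda>x. \<zero>\<^bsub>N\<^esub>)"
proof -
  interpret N: left_module A N by fact
  show ?thesis by (rule linI) auto
qed

lemma lin_add_map:
  assumes "left_module A M" "left_module A N" "lin A M N f" "lin A M N g"
  shows "lin A M N (\<lambda>x. f x \<oplus>\<^bsub>N\<^esub> g x)"
proof -
  interpret M: left_module A M by fact
  interpret N: left_module A N by fact
  note [simp] = lin_closed[OF assms(3)] lin_closed[OF assms(4)]
  show ?thesis
    by (rule linI) (auto simp: lin_add[OF assms(3)] lin_add[OF assms(4)] lin_smult[OF assms(3)]
        lin_smult[OF assms(4)] N.smult_r_distr N.a_ac)
qed

lemma lin_diff_map:
  assumes "left_module A M" "left_module A N" "lin A M N f" "lin A M N g"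
  shows "lin A M N (\<lambda>x. f x \<ominus>\<^bsub>N\<^esub> g x)"
proof -
  interpret M: left_module A M by fact
  interpret N: left_module A N by fact
  note [simp] = lin_closed[OF assms(3)] lin_closed[OF assms(4)]
  show ?thesis unfolding a_minus_def
    by (rule linI) (auto simp: lin_add[OF assms(3)] lin_add[OF assms(4)] lin_smult[OF assms(3)]
        lin_smult[OF assms(4)] N.smult_r_distr N.smult_r_minus N.minus_add N.a_ac)
qed

lemma lin_smult_map:
  assumes "cring A" "left_module A M" "left_module A N" "lin A M N f" "a \<in> carrier A"
  shows "lin A M N (\<lambda>x. a \<odot>\<^bsub>N\<^esub> f x)"
proof -
  interpret M: left_module A M by fact
  interpret N: left_module A N by fact
  interpret A: cring A by fact
  note [simp] = lin_closed[OF assms(4)] assms(5)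
  show ?thesis
    by (rule linI) (auto simp: lin_add[OF assms(4)] lin_smult[OF assms(4)]
        N.smult_r_distr N.smult_assoc1[symmetric] A.m_comm)
qed

lemma regular_module_simps [simp]:
  "carrier (regular_module A) = carrier A" "smult (regular_module A) = (\<otimes>\<^bsub>A\<^esub>)"
  "ring.add (regular_module A) = (\<oplus>\<^bsub>A\<^esub>)" "ring.zero (regular_module A) = \<zero>\<^bsub>A\<^esub>"
  unfolding regular_module_def by simp_all

lemma abelian_group_cong:
  assumes "abelian_group G" "carrier H = carrier G" "ring.add H = ring.add G" "ring.zero H = ring.zero G"
  shows "abelian_group H"
proof -
  interpret G: abelian_group G by fact
  show ?thesis
  proof (rule abelian_groupI)
    fix x assume x: "x \<in> carrier H"
    show "\<exists>y\<in>carrier H. y \<oplus>\<^bsub>H\<^esub> x = \<zero>\<^bsub>H\<^esub>"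
      using x assms(2-4) G.l_neg by (intro bexI[of _ "\<ominus>\<^bsub>G\<^esub> x"]) auto
  qed (use assms(2-4) in \<open>auto simp: G.a_ac\<close>)
qed

lemma left_module_regular: assumes "ring A" shows "left_module A (regular_module A)"
proof -
  interpret ring A by fact
  have "abelian_group (regular_module A)"
    by (rule abelian_group_cong[OF abelian_group_axioms]) simp_all
  then show ?thesis
    unfolding left_module_def left_module_axioms_def
    by (auto simp: ring_axioms l_distr r_distr m_assoc)
qed

lemma lin_right_mult: assumes "left_module A N" "u \<in> carrier N"
  shows "lin A (regular_module A) N (\<lambda>a. a \<odot>\<^bsub>N\<^esub> u)"
proof -
  interpret N: left_module A N by fact
  show ?thesis using assms(2) by (intro linI) (auto simp: N.smult_l_distr N.smult_assoc1)
qed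

lemma lin_scalar: assumes "cring A" "left_module A N" "a \<in> carrier A"
  shows "lin A N N (\<lambda>x. a \<odot>\<^bsub>N\<^esub> x)"
  using lin_smult_map[OF assms(1,2,2) lin_id assms(3)] .

lemma submod_image:
  assumes "left_module A M" "left_module A N" "lin A M N f" "submod A M S"
  shows "submod A N (f ` S)"
proof (rule submodI)
  note S = submodD[OF assms(4)]
  show "f ` S \<subseteq> carrier N" using S lin_closed[OF assms(3)] by blast
  show "\<zero>\<^bsub>N\<^esub> \<in> f ` S" using S lin_zero[OF assms(1-3)] by (metis imageI)
  show "x \<oplus>\<^bsub>N\<^esub> y \<in> f ` S" if "x \<in> f ` S" "y \<in> f ` S" for x y
    using that S lin_add[OF assms(3)] by (smt (verit, best) imageE imageI)
  show "a \<odot>\<^bsub>N\<^esub> x \<in> f ` S" if "a \<in> carrier A" "x \<in> f ` S" for a x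
    using that S lin_smult[OF assms(3)] by (smt (verit, best) imageE imageI)
qed

lemma submod_vimage:
  assumes "left_module A M" "left_module A N" "lin A M N f" "submod A N S"
  shows "submod A M {x\<in>carrier M. f x \<in> S}"
proof -
  interpret M: left_module A M by fact
  show ?thesis
    by (rule submodI) (use submodD[OF assms(4)] lin_zero[OF assms(1-3)] in
        \<open>auto simp: lin_add[OF assms(3)] lin_smult[OF assms(3)]\<close>)
qed

lemma submod_kernel:
  assumes "left_module A M" "left_module A N" "lin A M N f"
  shows "submod A M {x\<in>carrier M. f x = \<zero>\<^bsub>N\<^esub>}"
  using submod_vimage[OF assms left_module.submod_zero[OF assms(2)]] by simp

section \<open>Generation by finitely many elements, and free modules of finite rank\<close>

definition adjoin :: "('a, 'c) ring_scheme \<Rightarrow> ('a, 'm, 'd) module_scheme \<Rightarrow> 'm set \<Rightarrow> 'm \<Rightarrow> 'm set" where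
  "adjoin A M S u = {s \<oplus>\<^bsub>M\<^esub> a \<odot>\<^bsub>M\<^esub> u | s a. s \<in> S \<and> a \<in> carrier A}"

lemma adjoinI: "s \<in> S \<Longrightarrow> a \<in> carrier A \<Longrightarrow> x = s \<oplus>\<^bsub>M\<^esub> a \<odot>\<^bsub>M\<^esub> u \<Longrightarrow> x \<in> adjoin A M S u"
  unfolding adjoin_def by blast

lemma adjoinE:
  assumes "x \<in> adjoin A M S u"
  obtains s a where "s \<in> S" "a \<in> carrier A" "x = s \<oplus>\<^bsub>M\<^esub> a \<odot>\<^bsub>M\<^esub> u"
  using assms unfolding adjoin_def by blast

lemma submod_adjoin: assumes "left_module A M" "submod A M S" "u \<in> carrier M"
  shows "submod A M (adjoin A M S u)" "S \<subseteq> adjoin A M S u" "u \<in> adjoin A M S u"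
proof -
  interpret M: left_module A M by fact
  note S = submodD[OF assms(2)]
  show "submod A M (adjoin A M S u)"
  proof (rule submodI)
    show "adjoin A M S u \<subseteq> carrier M" unfolding adjoin_def using S assms(3) by auto
    show "\<zero>\<^bsub>M\<^esub> \<in> adjoin A M S u"
      by (rule adjoinI[OF S(2), of "\<zero>\<^bsub>A\<^esub>"]) (use assms(3) in simp_all)
    fix x y assume "x \<in> adjoin A M S u" "y \<in> adjoin A M S u"
    then obtain s a t b where *: "x = s \<oplus>\<^bsub>M\<^esub> a \<odot>\<^bsub>M\<^esub> u" "y = t \<oplus>\<^bsub>M\<^esub> b \<odot>\<^bsub>M\<^esub> u" "s \<in> S" "t \<in> S"
      "a \<in> carrier A" "b \<in> carrier A" by (metis adjoinE)
    have "x \<oplus>\<^bsub>M\<^esub> y = (s \<oplus>\<^bsub>M\<^esub> t) \<oplus>\<^bsub>M\<^esub> (a \<oplus>\<^bsub>A\<^esub> b) \<odot>\<^bsub>M\<^esub> u"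
      using * S assms(3) by (simp add: M.smult_l_distr M.a_ac)
    then show "x \<oplus>\<^bsub>M\<^esub> y \<in> adjoin A M S u" using * S(4) by (intro adjoinI) auto
  next
    fix c x assume c: "c \<in> carrier A" and "x \<in> adjoin A M S u"
    then obtain s a where *: "x = s \<oplus>\<^bsub>M\<^esub> a \<odot>\<^bsub>M\<^esub> u" "s \<in> S" "a \<in> carrier A" by (metis adjoinE)
    have "c \<odot>\<^bsub>M\<^esub> x = c \<odot>\<^bsub>M\<^esub> s \<oplus>\<^bsub>M\<^esub> (c \<otimes>\<^bsub>A\<^esub> a) \<odot>\<^bsub>M\<^esub> u"
      using * c S assms(3) by (simp add: M.smult_r_distr M.smult_assoc1)
    then show "c \<odot>\<^bsub>M\<^esub> x \<in> adjoin A M S u" using * c S(5) by (intro adjoinI) auto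
  qed
  show "S \<subseteq> adjoin A M S u"
    by (rule subsetI, rule adjoinI[of _ _ "\<zero>\<^bsub>A\<^esub>"]) (use S(3) assms(3) in auto)
  show "u \<in> adjoin A M S u"
    by (rule adjoinI[OF S(2), of "\<one>\<^bsub>A\<^esub>"]) (use assms(3) in simp_all)
qed

lemma adjoin_subset: assumes "submod A M T" "S \<subseteq> T" "u \<in> T" shows "adjoin A M S u \<subseteq> T"
proof
  fix x assume "x \<in> adjoin A M S u"
  then obtain s a where "s \<in> S" "a \<in> carrier A" "x = s \<oplus>\<^bsub>M\<^esub> a \<odot>\<^bsub>M\<^esub> u" by (rule adjoinE)
  then show "x \<in> T" using submodD(4)[OF assms(1), of s "a \<odot>\<^bsub>M\<^esub> u"] submodD(5)[OF assms(1), of a u] assms(2,3) by auto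
qed

text \<open>Finite generation relative to a base submodule, as an induction over single generators.
  The relative form can be composed in towers and pulled back along maps, and its induction rule
  takes the place of sums over generating families.\<close>

inductive fg_over :: "('a, 'c) ring_scheme \<Rightarrow> ('a, 'm, 'd) module_scheme \<Rightarrow> 'm set \<Rightarrow> 'm set \<Rightarrow> bool"
  for A M B where
  base: "fg_over A M B B"
| step: "fg_over A M B S \<Longrightarrow> u \<in> carrier M \<Longrightarrow> fg_over A M B (adjoin A M S u)"

lemma fg_over_submod:
  assumes "fg_over A M B S" "left_module A M" "submod A M B"
  shows "submod A M S \<and> B \<subseteq> S"
  using assms(1)
proof induction
  case base then show ?case using assms(3) by simp
next
  case (step S u)
  then show ?case using submod_adjoin(1,2)[OF assms(2), of S u] by auto
qed

text \<open>A recursive form of finite sums, which lets images, kernels and finite generation be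
  treated by induction on the number of terms; \<open>lincomb_finsum\<close> relates it to the sums
  in the definitions.\<close>

primrec lincomb :: "('a, 'm, 'd) module_scheme \<Rightarrow> (nat \<Rightarrow> 'm) \<Rightarrow> nat \<Rightarrow> (nat \<Rightarrow> 'a) \<Rightarrow> 'm" where
  "lincomb M u 0 c = \<zero>\<^bsub>M\<^esub>"
| "lincomb M u (Suc n) c = lincomb M u n c \<oplus>\<^bsub>M\<^esub> c n \<odot>\<^bsub>M\<^esub> u n"

definition free_mod :: "('a, 'c) ring_scheme \<Rightarrow> nat \<Rightarrow> ('a, nat \<Rightarrow> 'a) module" where
  "free_mod A n = \<lparr>carrier = {..<n} \<rightarrow>\<^sub>E carrier A, monoid.mult = undefined, one = undefined,
     ring.zero = (\<lambda>i\<in>{..<n}. \<zero>\<^bsub>A\<^esub>), ring.add = (\<lambda>f g. \<lambda>i\<in>{..<n}. f i \<oplus>\<^bsub>A\<^esub> g i),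
     smult = (\<lambda>a f. \<lambda>i\<in>{..<n}. a \<otimes>\<^bsub>A\<^esub> f i)\<rparr>"

lemma free_mod_simps [simp]:
  "carrier (free_mod A n) = {..<n} \<rightarrow>\<^sub>E carrier A"
  "ring.zero (free_mod A n) = (\<lambda>i\<in>{..<n}. \<zero>\<^bsub>A\<^esub>)"
  "ring.add (free_mod A n) = (\<lambda>f g. \<lambda>i\<in>{..<n}. f i \<oplus>\<^bsub>A\<^esub> g i)"
  "smult (free_mod A n) = (\<lambda>a f. \<lambda>i\<in>{..<n}. a \<otimes>\<^bsub>A\<^esub> f i)"
  unfolding free_mod_def by simp_all

text \<open>One criterion for all groups of functions with pointwise addition: free modules, Hom
  modules, duals, coinduced modules and endomorphism rings differ only in which functions they
  admit.\<close>

lemma abelian_group_funs: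
  assumes "abelian_group N"
    and C: "carrier G \<subseteq> X \<rightarrow>\<^sub>E carrier N"
    and z: "ring.zero G = (\<lambda>x\<in>X. \<zero>\<^bsub>N\<^esub>)" "ring.zero G \<in> carrier G"
    and a: "ring.add G = (\<lambda>f g. \<lambda>x\<in>X. f x \<oplus>\<^bsub>N\<^esub> g x)"
    and cl: "\<And>f g. f \<in> carrier G \<Longrightarrow> g \<in> carrier G \<Longrightarrow> (\<lambda>x\<in>X. f x \<oplus>\<^bsub>N\<^esub> g x) \<in> carrier G"
    and mi: "\<And>f. f \<in> carrier G \<Longrightarrow> (\<lambda>x\<in>X. \<ominus>\<^bsub>N\<^esub> f x) \<in> carrier G"
  shows "abelian_group G"
proof -
  interpret N: abelian_group N by fact
  have v: "f x \<in> carrier N" if "f \<in> carrier G" "x \<in> X" for f x using C that by blast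
  have e: "f \<in> extensional X" if "f \<in> carrier G" for f using C that by (auto simp: PiE_def)
  show ?thesis
  proof (rule abelian_groupI)
    fix f g h assume f: "f \<in> carrier G" and g: "g \<in> carrier G" and h: "h \<in> carrier G"
    show "f \<oplus>\<^bsub>G\<^esub> g \<in> carrier G" using cl[OF f g] a by simp
    show "f \<oplus>\<^bsub>G\<^esub> g \<oplus>\<^bsub>G\<^esub> h = f \<oplus>\<^bsub>G\<^esub> (g \<oplus>\<^bsub>G\<^esub> h)"
      unfolding a using v f g h by (intro ext) (simp add: N.a_assoc)
    show "f \<oplus>\<^bsub>G\<^esub> g = g \<oplus>\<^bsub>G\<^esub> f"
      unfolding a using v f g by (intro ext) (simp add: N.a_comm)
    show "\<zero>\<^bsub>G\<^esub> \<oplus>\<^bsub>G\<^esub> f = f"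
      unfolding a z(1) using v[OF f] e[OF f] by (intro ext) (auto simp: extensional_def)
    show "\<exists>y\<in>carrier G. y \<oplus>\<^bsub>G\<^esub> f = \<zero>\<^bsub>G\<^esub>"
      unfolding a z(1) using mi[OF f] v[OF f]
      by (intro bexI[of _ "\<lambda>x\<in>X. \<ominus>\<^bsub>N\<^esub> f x"]) (auto simp: N.l_neg)
  qed (fact z(2))
qed

lemma left_module_free: assumes "ring A" shows "left_module A (free_mod A n)"
proof -
  interpret ring A by fact
  have "abelian_group (free_mod A n)"
    by (rule abelian_group_funs[of A _ "{..<n}"]) (auto simp: abelian_group_axioms)
  then show ?thesis
    unfolding left_module_def left_module_axioms_def
    by (auto simp: ring_axioms fun_eq_iff PiE_def extensional_def Pi_def l_distr r_distr m_assoc)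
qed

definition unit_vec :: "('a, 'c) ring_scheme \<Rightarrow> nat \<Rightarrow> nat \<Rightarrow> nat \<Rightarrow> 'a" where
  "unit_vec A n i = (\<lambda>j\<in>{..<n}. if j = i then \<one>\<^bsub>A\<^esub> else \<zero>\<^bsub>A\<^esub>)"

lemma unit_vec_closed: "ring A \<Longrightarrow> unit_vec A n i \<in> carrier (free_mod A n)"
  unfolding unit_vec_def by (auto simp: ring.ring_simprules)

lemma lincomb_closed:
  assumes "left_module A M" "\<And>i. i < n \<Longrightarrow> u i \<in> carrier M" "\<And>i. i < n \<Longrightarrow> c i \<in> carrier A"
  shows "lincomb M u n c \<in> carrier M"
proof -
  interpret M: left_module A M by fact
  show ?thesis using assms(2,3) by (induction n) auto
qed

lemma lincomb_cong:
  assumes "\<And>i. i < n \<Longrightarrow> u i = v i" "\<And>i. i < n \<Longrightarrow> c i = d i"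
  shows "lincomb M u n c = lincomb M v n d"
  using assms by (induction n) auto

lemma lin_lincomb:
  assumes "left_module A M" "\<And>i. i < n \<Longrightarrow> u i \<in> carrier M"
  shows "lin A (free_mod A n) M (lincomb M u n)"
proof -
  interpret M: left_module A M by fact
  have 1: "lincomb M u k c \<in> carrier M" if "k \<le> n" "c \<in> {..<n} \<rightarrow>\<^sub>E carrier A" for k c
    using that assms by (intro lincomb_closed) auto
  have 2: "lincomb M u k e = lincomb M u k c \<oplus>\<^bsub>M\<^esub> lincomb M u k d"
    if cd: "c \<in> {..<n} \<rightarrow>\<^sub>E carrier A" "d \<in> {..<n} \<rightarrow>\<^sub>E carrier A" and "k \<le> n" 
      and e: "\<And>i. i < n \<Longrightarrow> e i = c i \<oplus>\<^bsub>A\<^esub> d i" for c d e k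
    using that(3)
  proof (induction k)
    case (Suc k)
    then have k: "k < n" "k \<le> n" by auto
    have m: "c k \<in> carrier A" "d k \<in> carrier A" "u k \<in> carrier M" 
      using cd k assms(2) by (auto dest: PiE_mem)
    show ?case using Suc.IH[OF k(2)] 1[OF k(2) cd(1)] 1[OF k(2) cd(2)] m e[OF k(1)]
      by (simp add: M.smult_l_distr M.a_ac)
  qed simp
  have 3: "lincomb M u k e = a \<odot>\<^bsub>M\<^esub> lincomb M u k c"
    if c: "c \<in> {..<n} \<rightarrow>\<^sub>E carrier A" and a: "a \<in> carrier A" and "k \<le> n"
      and e: "\<And>i. i < n \<Longrightarrow> e i = a \<otimes>\<^bsub>A\<^esub> c i" for c a e k
    using that(3)
  proof (induction k)
    case (Suc k)
    then have k: "k < n" "k \<le> n" by auto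
    have m: "c k \<in> carrier A" "u k \<in> carrier M" 
      using c k assms(2) by (auto dest: PiE_mem)
    show ?case using Suc.IH[OF k(2)] 1[OF k(2) c] a m e[OF k(1)]
      by (simp add: M.smult_r_distr M.smult_assoc1)
  qed (use a in simp)
  show ?thesis
  proof (rule linI)
    fix c d a assume c: "c \<in> carrier (free_mod A n)" and d: "d \<in> carrier (free_mod A n)"
    show "lincomb M u n (c \<oplus>\<^bsub>free_mod A n\<^esub> d) = lincomb M u n c \<oplus>\<^bsub>M\<^esub> lincomb M u n d"
      using c d by (intro 2) auto
  next
    fix c a assume c: "c \<in> carrier (free_mod A n)" and a: "a \<in> carrier A"
    show "lincomb M u n (a \<odot>\<^bsub>free_mod A n\<^esub> c) = a \<odot>\<^bsub>M\<^esub> lincomb M u n c"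
      using c a by (intro 3) auto
  qed (use 1 in auto)
qed

lemma lincomb_map:
  assumes "left_module A M" "left_module A N" "lin A M N f"
    "\<And>i. i < n \<Longrightarrow> u i \<in> carrier M" "\<And>i. i < n \<Longrightarrow> c i \<in> carrier A"
  shows "f (lincomb M u n c) = lincomb N (\<lambda>i. f (u i)) n c"
proof -
  interpret M: left_module A M by fact
  show ?thesis
    using assms(4,5) 
  proof (induction n)
    case 0 show ?case by (simp add: lin_zero[OF assms(1-3)])
  next
    case (Suc n)
    then show ?case using lincomb_closed[OF assms(1), of n u c]
      by (simp add: lin_add[OF assms(3)] lin_smult[OF assms(3)])
  qed
qed

lemma free_mod_expand:
  assumes "ring A" "c \<in> carrier (free_mod A n)"
  shows "lincomb (free_mod A n) (unit_vec A n) n c = c"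
proof -
  interpret ring A by fact
  have "lincomb (free_mod A n) (unit_vec A n) k c = (\<lambda>i\<in>{..<n}. if i < k then c i else \<zero>\<^bsub>A\<^esub>)" if "k \<le> n" for k
    using that
  proof (induction k)
    case (Suc k)
    then show ?case using assms(2)
      by (auto simp: unit_vec_def fun_eq_iff PiE_def extensional_def Pi_def less_Suc_eq)
  qed auto
  from this[of n] show ?thesis using assms(2) by (auto simp: fun_eq_iff PiE_def extensional_def)
qed

lemma lin_free_eq_lincomb:
  assumes "ring A" "left_module A M" "lin A (free_mod A n) M f" "c \<in> carrier (free_mod A n)"
  shows "f c = lincomb M (\<lambda>i. f (unit_vec A n i)) n c"
  using lincomb_map[OF left_module_free[OF assms(1)] assms(2,3), of n "unit_vec A n" c]
    unit_vec_closed[OF assms(1)] free_mod_expand[OF assms(1,4)] assms(4) by auto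

lemma free_mod_lift:
  assumes "ring A" "left_module A M" "left_module A N" "lin A M N q" "q ` carrier M = carrier N"
    "lin A (free_mod A n) N f"
  obtains g where "lin A (free_mod A n) M g" "\<And>x. x \<in> carrier (free_mod A n) \<Longrightarrow> q (g x) = f x"
proof -
  have "\<exists>y\<in>carrier M. q y = f (unit_vec A n i)" for i
    using assms(5) lin_closed[OF assms(6) unit_vec_closed[OF assms(1)]] by (metis imageE)
  then obtain v where v: "\<And>i. v i \<in> carrier M" "\<And>i. q (v i) = f (unit_vec A n i)" by metis
  show ?thesis
  proof (rule that[of "lincomb M v n"])
    show "lin A (free_mod A n) M (lincomb M v n)" by (rule lin_lincomb) (use assms v in auto)
    show "q (lincomb M v n x) = f x" if "x \<in> carrier (free_mod A n)" for x
      using lincomb_map[OF assms(2-4), of n v x] v that lin_free_eq_lincomb[OF assms(1,3,6) that]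
      by auto
  qed
qed

lemma lincomb_finsum:
  assumes "left_module A M" "u \<in> {..<n} \<rightarrow> carrier M" "c \<in> {..<n} \<rightarrow> carrier A"
  shows "(\<Oplus>\<^bsub>M\<^esub>i\<in>{..<n}. c i \<odot>\<^bsub>M\<^esub> u i) = lincomb M u n c"
proof -
  interpret M: left_module A M by fact
  have "(\<Oplus>\<^bsub>M\<^esub>i\<in>{..<k}. c i \<odot>\<^bsub>M\<^esub> u i) = lincomb M u k c" if "k \<le> n" for k
    using that
  proof (induction k)
    case (Suc k)
    then show ?case using assms(2,3) lincomb_closed[OF assms(1), of k u c]
      by (simp add: lessThan_Suc M.finsum_insert Pi_def M.a_comm)
  qed simp
  then show ?thesis by simp
qed

lemma fg_module_iff:
  "fg_module A M \<longleftrightarrow> left_module A M \<and>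
     (\<exists>n u. (\<forall>i<n. u i \<in> carrier M) \<and> lincomb M u n ` carrier (free_mod A n) = carrier M)"
proof (cases "left_module A M")
  case True
  then interpret M: left_module A M .
  have *: "(\<forall>x\<in>carrier M. \<exists>a \<in> {..<n} \<rightarrow> carrier A. x = (\<Oplus>\<^bsub>M\<^esub>i\<in>{..<n}. a i \<odot>\<^bsub>M\<^esub> u i)) \<longleftrightarrow>
      lincomb M u n ` carrier (free_mod A n) = carrier M" if u: "u \<in> {..<n} \<rightarrow> carrier M" for n u
  proof
    assume L: "\<forall>x\<in>carrier M. \<exists>a \<in> {..<n} \<rightarrow> carrier A. x = (\<Oplus>\<^bsub>M\<^esub>i\<in>{..<n}. a i \<odot>\<^bsub>M\<^esub> u i)"
    show "lincomb M u n ` carrier (free_mod A n) = carrier M"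
    proof
      show "lincomb M u n ` carrier (free_mod A n) \<subseteq> carrier M"
        using lin_closed[OF lin_lincomb[OF True, of n u]] u by auto
      show "carrier M \<subseteq> lincomb M u n ` carrier (free_mod A n)"
      proof
        fix x assume "x \<in> carrier M"
        then obtain a where a: "a \<in> {..<n} \<rightarrow> carrier A" "x = lincomb M u n a"
          using L lincomb_finsum[OF True u] by metis
        then have "x = lincomb M u n (restrict a {..<n})" by (auto intro: lincomb_cong)
        then show "x \<in> lincomb M u n ` carrier (free_mod A n)" using a(1) by auto
      qed
    qed
  next
    assume R: "lincomb M u n ` carrier (free_mod A n) = carrier M"
    show "\<forall>x\<in>carrier M. \<exists>a \<in> {..<n} \<rightarrow> carrier A. x = (\<Oplus>\<^bsub>M\<^esub>i\<in>{..<n}. a i \<odot>\<^bsub>M\<^esub> u i)"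
    proof
      fix x assume "x \<in> carrier M"
      then obtain a where a: "a \<in> {..<n} \<rightarrow>\<^sub>E carrier A" "x = lincomb M u n a" using R by auto
      then have "a \<in> {..<n} \<rightarrow> carrier A" by auto
      then show "\<exists>a \<in> {..<n} \<rightarrow> carrier A. x = (\<Oplus>\<^bsub>M\<^esub>i\<in>{..<n}. a i \<odot>\<^bsub>M\<^esub> u i)"
        using lincomb_finsum[OF True u] a(2) by (intro bexI[of _ a]) simp_all
    qed
  qed
  then have "(\<exists>u. u \<in> {..<n} \<rightarrow> carrier M \<and>
        (\<forall>x\<in>carrier M. \<exists>a \<in> {..<n} \<rightarrow> carrier A. x = (\<Oplus>\<^bsub>M\<^esub>i\<in>{..<n}. a i \<odot>\<^bsub>M\<^esub> u i))) \<longleftrightarrow>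
      (\<exists>u. (\<forall>i<n. u i \<in> carrier M) \<and> lincomb M u n ` carrier (free_mod A n) = carrier M)" for n
  proof (intro ex_cong1 conj_cong)
    fix u :: "nat \<Rightarrow> 'c"
    show "u \<in> {..<n} \<rightarrow> carrier M \<longleftrightarrow> (\<forall>i<n. u i \<in> carrier M)" by auto
    assume u: "\<forall>i<n. u i \<in> carrier M"
    show "(\<forall>x\<in>carrier M. \<exists>a \<in> {..<n} \<rightarrow> carrier A. x = (\<Oplus>\<^bsub>M\<^esub>i\<in>{..<n}. a i \<odot>\<^bsub>M\<^esub> u i)) \<longleftrightarrow>
      lincomb M u n ` carrier (free_mod A n) = carrier M"
      by (rule *) (use u in auto)
  qed
  then show ?thesis unfolding fg_module_def using True by (simp only: simp_thms)
qed (simp add: fg_module_def)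

section \<open>Transport of structure\<close>

text \<open>Moves a module along an injection to another carrier type. The notions
  \<open>injective_module\<close>, \<open>projective_module\<close>, \<open>global_dim\<close> and
  \<open>CM\<close> range over modules on \<open>univ\<close>, and this is how modules on other
  types reach them.\<close>

definition transport :: "('m \<Rightarrow> 'n) \<Rightarrow> ('a, 'm, 'd) module_scheme \<Rightarrow> ('a, 'n) module" where
  "transport c M = (let i = inv_into (carrier M) c in
     \<lparr>carrier = c ` carrier M, monoid.mult = undefined, one = undefined,
      ring.zero = c \<zero>\<^bsub>M\<^esub>, ring.add = (\<lambda>x y. c (i x \<oplus>\<^bsub>M\<^esub> i y)), smult = (\<lambda>a x. c (a \<odot>\<^bsub>M\<^esub> i x))\<rparr>)"

lemma transport_simps [simp]:
  "carrier (transport c M) = c ` carrier M"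
  "ring.zero (transport c M) = c \<zero>\<^bsub>M\<^esub>"
  "ring.add (transport c M) = (\<lambda>x y. c (inv_into (carrier M) c x \<oplus>\<^bsub>M\<^esub> inv_into (carrier M) c y))"
  "smult (transport c M) = (\<lambda>a x. c (a \<odot>\<^bsub>M\<^esub> inv_into (carrier M) c x))"
  unfolding transport_def Let_def by simp_all

lemma transport:
  assumes "left_module A M" "inj_on c (carrier M)"
  shows "left_module A (transport c M)" "lin A M (transport c M) c"
    "lin A (transport c M) M (inv_into (carrier M) c)"
proof -
  interpret M: left_module A M by fact
  note [simp] = inv_into_f_f[OF assms(2)]
  have "abelian_group (transport c M)"
  proof (rule abelian_groupI)
    fix x assume "x \<in> carrier (transport c M)"
    then obtain y where y: "y \<in> carrier M" "x = c y" by auto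
    then show "\<exists>y\<in>carrier (transport c M). y \<oplus>\<^bsub>transport c M\<^esub> x = \<zero>\<^bsub>transport c M\<^esub>"
      by (intro bexI[of _ "c (\<ominus>\<^bsub>M\<^esub> y)"]) (auto simp: M.l_neg)
  qed (auto simp: M.a_ac)
  then show "left_module A (transport c M)"
    unfolding left_module_def left_module_axioms_def
    by (auto simp: M.R.ring_axioms M.smult_l_distr M.smult_r_distr M.smult_assoc1)
  show "lin A M (transport c M) c" by (rule linI) auto
  show "lin A (transport c M) M (inv_into (carrier M) c)" by (rule linI) auto
qed

lemma (in abelian_group) right_minus_eq:
  assumes "x \<in> carrier G" "y \<in> carrier G" shows "x \<ominus> y = \<zero> \<longleftrightarrow> x = y"
proof
  assume "x \<ominus> y = \<zero>"
  then have "x \<oplus> \<ominus> y \<oplus> y = y" using assms by (simp add: a_minus_def)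
  then show "x = y" using assms by (simp add: a_assoc l_neg)
qed (use assms in \<open>simp add: a_minus_def r_neg\<close>)

text \<open>Injectivity speaks only of injections between modules on \<open>univ\<close>, so the
  inclusion of T into N is transported along the code c, the map is extended there, and the result
  is pulled back.\<close>

lemma injective_extend:
  fixes c :: "'n \<Rightarrow> 'a univ" and A :: "('a, 'c) ring_scheme" and N :: "('a, 'n, 'd) module_scheme"
  assumes "injective_module A J" "left_module A N" "inj_on c (carrier N)"
    "submod A N T" "lin A (N\<lparr>carrier := T\<rparr>) J f"
  obtains g where "lin A N J g" "\<And>t. t \<in> T \<Longrightarrow> g t = f t"
proof -
  interpret N: left_module A N by fact
  let ?T = "N\<lparr>carrier := T\<rparr>"
  have T: "T \<subseteq> carrier N" "inj_on c T" using submodD(1)[OF assms(4)] assms(3) by (auto intro: inj_on_subset)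
  have mT: "left_module A ?T" using N.submod_module[OF assms(4)] .
  have cT: "inj_on c (carrier ?T)" using T by simp
  let ?M' = "transport c ?T :: 'a umodule" and ?N' = "transport c N :: 'a umodule"
  note tT = transport[OF mT cT] and tN = transport[OF assms(2,3)]
  have inc: "lin A ?M' ?N' (\<lambda>x. x)"
  proof (rule lin_cong[OF _ _ tT(1)])
    have "lin A ?T N (\<lambda>x. x)" using T by (intro linI) auto
    from lin_comp[OF tT(3) lin_comp[OF this tN(2)]]
    show "lin A ?M' ?N' (\<lambda>x. c (inv_into (carrier ?T) c x))" .
    show "x = c (inv_into (carrier ?T) c x)" if "x \<in> carrier ?M'" for x
      using that f_inv_into_f[of x c T] by auto
  qed
  let ?i = "restrict (\<lambda>x. x) (carrier ?M')"
  let ?f = "restrict (\<lambda>x. f (inv_into (carrier ?T) c x)) (carrier ?M')"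
  have i: "?i \<in> mod_hom A ?M' ?N'" by (rule lin_restrict[OF tT(1) inc])
  have f: "?f \<in> mod_hom A ?M' J" by (rule lin_restrict[OF tT(1) lin_comp[OF tT(3) assms(5)]])
  have ii: "inj_on ?i (carrier ?M')" by (auto simp: inj_on_def)
  obtain g where g: "g \<in> mod_hom A ?N' J" "\<forall>x\<in>carrier ?M'. g (?i x) = ?f x"
    using assms(1) tT(1) tN(1) i ii f unfolding injective_module_def by blast
  show ?thesis
  proof (rule that[of "\<lambda>x. g (c x)"])
    show "lin A N J (\<lambda>x. g (c x))" using lin_comp[OF tN(2)] g(1) mod_hom_iff by blast
    show "g (c t) = f t" if "t \<in> T" for t
      using g(2) that inv_into_f_f[OF T(2) that] by simp
  qed
qed

text \<open>Injectivity of J against the embedding of M modulo the preimage of S into N/S, without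
  forming either quotient: f is defined on p(M) + S by forgetting the summand from S, and extended
  from there to N.\<close>

lemma injective_factor:
  fixes c :: "'n \<Rightarrow> 'a univ" and A :: "('a, 'c) ring_scheme" and N :: "('a, 'n, 'd) module_scheme"
  assumes "injective_module A J" "left_module A M" "left_module A N" "inj_on c (carrier N)"
    "submod A N S" "lin A M N p" "lin A M J f"
    and ext_vanishes: "\<And>x. x \<in> carrier M \<Longrightarrow> p x \<in> S \<Longrightarrow> f x = \<zero>\<^bsub>J\<^esub>"
  obtains g where "lin A N J g" "\<And>s. s \<in> S \<Longrightarrow> g s = \<zero>\<^bsub>J\<^esub>" "\<And>x. x \<in> carrier M \<Longrightarrow> g (p x) = f x"
proof -
  interpret M: left_module A M by fact
  interpret N: left_module A N by fact
  have mJ: "left_module A J" using assms(1) unfolding injective_module_def by blast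
  interpret J: left_module A J by fact
  define T where "T = {p x \<oplus>\<^bsub>N\<^esub> s | x s. x \<in> carrier M \<and> s \<in> S}"
  note S = submodD[OF assms(5)]
  note [simp] = lin_closed[OF assms(6)] lin_closed[OF assms(7)] S(3)
  \<comment> \<open>Two presentations of one element of p(M) + S differ by some x - x' that p sends
    into S, where f vanishes.\<close>
  have unique: "f x = f x'" if "x \<in> carrier M" "x' \<in> carrier M" "s \<in> S" "s' \<in> S" "p x \<oplus>\<^bsub>N\<^esub> s = p x' \<oplus>\<^bsub>N\<^esub> s'" for x x' s s'
  proof -
    have "p x \<ominus>\<^bsub>N\<^esub> p x' = s' \<ominus>\<^bsub>N\<^esub> s"
    proof -
      have c: "p x \<in> carrier N" "p x' \<in> carrier N" "s \<in> carrier N" "s' \<in> carrier N" using that by auto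
      have "p x = p x' \<oplus>\<^bsub>N\<^esub> s' \<oplus>\<^bsub>N\<^esub> \<ominus>\<^bsub>N\<^esub> s"
        using that(5) c by (metis N.add.inv_solve_right N.a_closed)
      moreover have "p x' \<oplus>\<^bsub>N\<^esub> (\<ominus>\<^bsub>N\<^esub> s \<oplus>\<^bsub>N\<^esub> \<ominus>\<^bsub>N\<^esub> p x') = \<ominus>\<^bsub>N\<^esub> s"
        using N.a_comm[of "\<ominus>\<^bsub>N\<^esub> s" "\<ominus>\<^bsub>N\<^esub> p x'"] c by (simp add: N.r_neg2)
      ultimately show ?thesis using c by (simp add: a_minus_def N.a_ac)
    qed
    then have "p (x \<ominus>\<^bsub>M\<^esub> x') \<in> S"
      using N.submod_diff[OF assms(5) that(4,3)] lin_diff[OF assms(2,3,6) that(1,2)] by simp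
    then have "f (x \<ominus>\<^bsub>M\<^esub> x') = \<zero>\<^bsub>J\<^esub>" using that(1,2) by (intro ext_vanishes) auto
    then have "f x \<ominus>\<^bsub>J\<^esub> f x' = \<zero>\<^bsub>J\<^esub>" using lin_diff[OF assms(2) mJ assms(7) that(1,2)] by simp
    then show ?thesis using that(1,2) J.right_minus_eq[of "f x" "f x'"] by simp
  qed
  define h where "h y = f (SOME x. x \<in> carrier M \<and> (\<exists>s\<in>S. y = p x \<oplus>\<^bsub>N\<^esub> s))" for y
  have h: "h (p x \<oplus>\<^bsub>N\<^esub> s) = f x" if "x \<in> carrier M" "s \<in> S" for x s
  proof -
    let ?P = "\<lambda>x'. x' \<in> carrier M \<and> (\<exists>s'\<in>S. p x \<oplus>\<^bsub>N\<^esub> s = p x' \<oplus>\<^bsub>N\<^esub> s')"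
    have "?P x" using that by auto
    then have P: "?P (Eps ?P)" by (rule someI)
    then obtain s' where s': "s' \<in> S" "p x \<oplus>\<^bsub>N\<^esub> s = p (Eps ?P) \<oplus>\<^bsub>N\<^esub> s'" by blast
    have "f x = f (Eps ?P)" by (rule unique[OF that(1) _ that(2) s']) (use P in blast)
    then show ?thesis unfolding h_def by simp
  qed
  have sT: "submod A N T"
  proof (rule submodI)
    show "T \<subseteq> carrier N" unfolding T_def by auto
    show "\<zero>\<^bsub>N\<^esub> \<in> T" unfolding T_def using S(2) lin_zero[OF assms(2,3,6)]
      by (intro CollectI exI[of _ "\<zero>\<^bsub>M\<^esub>"] exI[of _ "\<zero>\<^bsub>N\<^esub>"]) auto
  next
    fix y y' assume "y \<in> T" "y' \<in> T"
    then obtain x s x' s' where *: "x \<in> carrier M" "s \<in> S" "y = p x \<oplus>\<^bsub>N\<^esub> s"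
      "x' \<in> carrier M" "s' \<in> S" "y' = p x' \<oplus>\<^bsub>N\<^esub> s'" unfolding T_def by blast
    have "y \<oplus>\<^bsub>N\<^esub> y' = p (x \<oplus>\<^bsub>M\<^esub> x') \<oplus>\<^bsub>N\<^esub> (s \<oplus>\<^bsub>N\<^esub> s')" using * lin_add[OF assms(6)] by (simp add: N.a_ac)
    then show "y \<oplus>\<^bsub>N\<^esub> y' \<in> T" unfolding T_def using * S(4)[OF *(2,5)] by blast
  next
    fix a y assume a: "a \<in> carrier A" and "y \<in> T"
    then obtain x s where *: "x \<in> carrier M" "s \<in> S" "y = p x \<oplus>\<^bsub>N\<^esub> s" unfolding T_def by blast
    have "a \<odot>\<^bsub>N\<^esub> y = p (a \<odot>\<^bsub>M\<^esub> x) \<oplus>\<^bsub>N\<^esub> a \<odot>\<^bsub>N\<^esub> s" using * a lin_smult[OF assms(6)] by (simp add: N.smult_r_distr)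
    then show "a \<odot>\<^bsub>N\<^esub> y \<in> T" unfolding T_def using * a S(5)[OF a *(2)] by blast
  qed
  have lh: "lin A (N\<lparr>carrier := T\<rparr>) J h"
  proof (rule linI)
    fix y assume "y \<in> carrier (N\<lparr>carrier := T\<rparr>)"
    then show "h y \<in> carrier J" unfolding T_def using h by auto
  next
    fix y y' assume "y \<in> carrier (N\<lparr>carrier := T\<rparr>)" "y' \<in> carrier (N\<lparr>carrier := T\<rparr>)"
    then obtain x s x' s' where *: "x \<in> carrier M" "s \<in> S" "y = p x \<oplus>\<^bsub>N\<^esub> s"
      "x' \<in> carrier M" "s' \<in> S" "y' = p x' \<oplus>\<^bsub>N\<^esub> s'" unfolding T_def by auto
    have "y \<oplus>\<^bsub>N\<^esub> y' = p (x \<oplus>\<^bsub>M\<^esub> x') \<oplus>\<^bsub>N\<^esub> (s \<oplus>\<^bsub>N\<^esub> s')" using * lin_add[OF assms(6)] by (simp add: N.a_ac)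
    then show "h (y \<oplus>\<^bsub>N\<lparr>carrier := T\<rparr>\<^esub> y') = h y \<oplus>\<^bsub>J\<^esub> h y'"
      using * h[of "x \<oplus>\<^bsub>M\<^esub> x'" "s \<oplus>\<^bsub>N\<^esub> s'"] S(4)[OF *(2,5)] h lin_add[OF assms(7)] by simp
  next
    fix a y assume a: "a \<in> carrier A" and "y \<in> carrier (N\<lparr>carrier := T\<rparr>)"
    then obtain x s where *: "x \<in> carrier M" "s \<in> S" "y = p x \<oplus>\<^bsub>N\<^esub> s" unfolding T_def by auto
    have "a \<odot>\<^bsub>N\<^esub> y = p (a \<odot>\<^bsub>M\<^esub> x) \<oplus>\<^bsub>N\<^esub> a \<odot>\<^bsub>N\<^esub> s" using * a lin_smult[OF assms(6)] by (simp add: N.smult_r_distr)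
    then show "h (a \<odot>\<^bsub>N\<lparr>carrier := T\<rparr>\<^esub> y) = a \<odot>\<^bsub>J\<^esub> h y"
      using * a h[of "a \<odot>\<^bsub>M\<^esub> x" "a \<odot>\<^bsub>N\<^esub> s"] S(5)[OF a *(2)] h lin_smult[OF assms(7)] by simp
  qed
  obtain g where g: "lin A N J g" "\<And>t. t \<in> T \<Longrightarrow> g t = h t"
    using injective_extend[OF assms(1,3,4) sT lh] by blast
  show ?thesis
  proof (rule that[OF g(1)])
    show "g s = \<zero>\<^bsub>J\<^esub>" if "s \<in> S" for s
    proof -
      have e: "s = p \<zero>\<^bsub>M\<^esub> \<oplus>\<^bsub>N\<^esub> s" using that lin_zero[OF assms(2,3,6)] by simp
      then have "s \<in> T" unfolding T_def using that by blast
      then show ?thesis using g(2) h[of "\<zero>\<^bsub>M\<^esub>" s] e that lin_zero[OF assms(2) mJ assms(7)] by simp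
    qed
    show "g (p x) = f x" if "x \<in> carrier M" for x
    proof -
      have e: "p x = p x \<oplus>\<^bsub>N\<^esub> \<zero>\<^bsub>N\<^esub>" using that by simp
      then have "p x \<in> T" unfolding T_def using that S(2) by blast
      then show ?thesis using g(2) h[OF that S(2)] e by simp
    qed
  qed
qed

text \<open>An element is coded by the set of its coefficient vectors, that is, by its coset in a
  presentation. These sets are nonempty since the presentation is onto, so distinct elements have
  distinct codes.\<close>

lemma fg_module_code:
  assumes "fg_module A M"
  obtains c :: "'m \<Rightarrow> 'a univ" where "inj_on c (carrier (M :: ('a, 'm, 'd) module_scheme))"
proof -
  from assms obtain n u where u: "lincomb M u n ` carrier (free_mod A n) = carrier M"
    unfolding fg_module_iff by blast
  show ?thesis
  proof (rule that[of "\<lambda>x. {a \<in> carrier (free_mod A n). lincomb M u n a = x}"], rule inj_onI)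
    fix x y assume x: "x \<in> carrier M" and
      e: "{a \<in> carrier (free_mod A n). lincomb M u n a = x} = {a \<in> carrier (free_mod A n). lincomb M u n a = y}"
    have "x \<in> lincomb M u n ` carrier (free_mod A n)" using x u by simp
    then obtain a where "x = lincomb M u n a" "a \<in> carrier (free_mod A n)" by (rule imageE)
    then have "a \<in> {a \<in> carrier (free_mod A n). lincomb M u n a = y}" unfolding e[symmetric] by simp
    then show "x = y" using \<open>x = lincomb M u n a\<close> by simp
  qed
qed

section \<open>Finite generation\<close>

lemma image_adjoin:
  assumes "lin A M N f" "left_module A M" "submod A M S" "u \<in> carrier M"
  shows "f ` adjoin A M S u = adjoin A N (f ` S) (f u)"
proof -
  interpret M: left_module A M by fact
  note S = submodD(3)[OF assms(3)]
  have e: "f (s \<oplus>\<^bsub>M\<^esub> a \<odot>\<^bsub>M\<^esub> u) = f s \<oplus>\<^bsub>N\<^esub> a \<odot>\<^bsub>N\<^esub> f u" if "s \<in> S" "a \<in> carrier A" for s a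
    using that S assms(4) by (simp add: lin_add[OF assms(1)] lin_smult[OF assms(1)])
  show ?thesis
  proof (intro subset_antisym subsetI)
    fix y assume "y \<in> f ` adjoin A M S u"
    then show "y \<in> adjoin A N (f ` S) (f u)" using e by (auto elim!: adjoinE intro: adjoinI)
  next
    fix y assume "y \<in> adjoin A N (f ` S) (f u)"
    then obtain t a where "t \<in> f ` S" "a \<in> carrier A" "y = t \<oplus>\<^bsub>N\<^esub> a \<odot>\<^bsub>N\<^esub> f u" by (rule adjoinE)
    then obtain s where "s \<in> S" "a \<in> carrier A" "y = f (s \<oplus>\<^bsub>M\<^esub> a \<odot>\<^bsub>M\<^esub> u)" using e by auto
    then show "y \<in> f ` adjoin A M S u" by (auto intro: adjoinI)
  qed
qed

lemma fg_over_image: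
  assumes "fg_over A M B S" "lin A M N f" "left_module A M" "submod A M B"
  shows "fg_over A N (f ` B) (f ` S)"
  using assms(1)
proof induction
  case base show ?case by (rule fg_over.base)
next
  case (step S u)
  have "submod A M S" using fg_over_submod[OF step.hyps(1) assms(3,4)] by blast
  then show ?case using image_adjoin[OF assms(2,3) _ step.hyps(2)] fg_over.step[OF step.IH lin_closed[OF assms(2) step.hyps(2)]] by simp
qed

lemma fg_over_trans: "fg_over A M C T \<Longrightarrow> fg_over A M B C \<Longrightarrow> fg_over A M B T"
  by (induction rule: fg_over.induct) (auto intro: fg_over.intros)

lemma free_mod_Suc:
  assumes "c \<in> carrier (free_mod A (Suc n))"
  shows "restrict c {..<n} \<in> carrier (free_mod A n)" "c n \<in> carrier A"
  using assms by (auto simp: PiE_iff)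

lemma free_mod_snoc:
  assumes "c \<in> carrier (free_mod A n)" "a \<in> carrier A"
  shows "(\<lambda>i\<in>{..<Suc n}. if i < n then c i else a) \<in> carrier (free_mod A (Suc n))"
  using assms by (auto simp: PiE_iff)

lemma fg_over_lincomb:
  assumes "left_module A M" "\<And>i. i < n \<Longrightarrow> u i \<in> carrier M"
  shows "fg_over A M {\<zero>\<^bsub>M\<^esub>} (lincomb M u n ` carrier (free_mod A n))"
  using assms(2)
proof (induction n)
  case 0
  then show ?case by (simp add: fg_over.base)
next
  case (Suc n)
  have "lincomb M u (Suc n) ` carrier (free_mod A (Suc n)) = adjoin A M (lincomb M u n ` carrier (free_mod A n)) (u n)"
  proof (intro subset_antisym subsetI)
    fix x assume "x \<in> lincomb M u (Suc n) ` carrier (free_mod A (Suc n))"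
    then obtain c where c: "c \<in> carrier (free_mod A (Suc n))" "x = lincomb M u (Suc n) c" by blast
    have "x = lincomb M u n (restrict c {..<n}) \<oplus>\<^bsub>M\<^esub> c n \<odot>\<^bsub>M\<^esub> u n"
      using c lincomb_cong[of n u u c "restrict c {..<n}" M] by simp
    moreover have "restrict c {..<n} \<in> carrier (free_mod A n)" "c n \<in> carrier A" using free_mod_Suc[OF c(1)] by auto
    ultimately show "x \<in> adjoin A M (lincomb M u n ` carrier (free_mod A n)) (u n)" by (intro adjoinI) auto
  next
    fix x assume "x \<in> adjoin A M (lincomb M u n ` carrier (free_mod A n)) (u n)"
    then obtain s a where "s \<in> lincomb M u n ` carrier (free_mod A n)" "a \<in> carrier A" "x = s \<oplus>\<^bsub>M\<^esub> a \<odot>\<^bsub>M\<^esub> u n" by (rule adjoinE)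
    then obtain c where c: "c \<in> carrier (free_mod A n)" "x = lincomb M u n c \<oplus>\<^bsub>M\<^esub> a \<odot>\<^bsub>M\<^esub> u n" "a \<in> carrier A" by blast
    have "x = lincomb M u (Suc n) (\<lambda>i\<in>{..<Suc n}. if i < n then c i else a)"
      using c(2) lincomb_cong[of n u u c "\<lambda>i\<in>{..<Suc n}. if i < n then c i else a" M] by simp
    moreover have "(\<lambda>i\<in>{..<Suc n}. if i < n then c i else a) \<in> carrier (free_mod A (Suc n))"
      using free_mod_snoc[OF c(1,3)] .
    ultimately show "x \<in> lincomb M u (Suc n) ` carrier (free_mod A (Suc n))" by blast
  qed
  then show ?case using Suc by (auto intro!: fg_over.step)
qed

lemma fg_over_imp_lincomb:
  assumes "left_module A M" "fg_over A M {\<zero>\<^bsub>M\<^esub>} S"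
  shows "\<exists>n u. (\<forall>i<n. u i \<in> carrier M) \<and> lincomb M u n ` carrier (free_mod A n) = S"
  using assms(2)
proof induction
  case base
  have "lincomb M u 0 ` carrier (free_mod A 0) = {\<zero>\<^bsub>M\<^esub>}" for u by simp
  then show ?case by blast
next
  case (step S v)
  then obtain n u where u: "\<forall>i<n. u i \<in> carrier M" "lincomb M u n ` carrier (free_mod A n) = S" by blast
  let ?u = "u(n := v)"
  have e: "lincomb M ?u n c = lincomb M u n c" for c by (rule lincomb_cong) auto
  have "lincomb M ?u (Suc n) ` carrier (free_mod A (Suc n)) = adjoin A M S v"
  proof (intro subset_antisym subsetI)
    fix x assume "x \<in> lincomb M ?u (Suc n) ` carrier (free_mod A (Suc n))"
    then obtain c where c: "c \<in> carrier (free_mod A (Suc n))" "x = lincomb M ?u (Suc n) c" by blast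
    have "x = lincomb M u n (restrict c {..<n}) \<oplus>\<^bsub>M\<^esub> c n \<odot>\<^bsub>M\<^esub> v"
      using c lincomb_cong[of n u u c "restrict c {..<n}" M] e by simp
    moreover have "restrict c {..<n} \<in> carrier (free_mod A n)" "c n \<in> carrier A" using free_mod_Suc[OF c(1)] by auto
    ultimately show "x \<in> adjoin A M S v" using u(2) by (intro adjoinI) auto
  next
    fix x assume "x \<in> adjoin A M S v"
    then obtain s a where "s \<in> S" "a \<in> carrier A" "x = s \<oplus>\<^bsub>M\<^esub> a \<odot>\<^bsub>M\<^esub> v" by (rule adjoinE)
    then obtain c where c: "c \<in> carrier (free_mod A n)" "x = lincomb M u n c \<oplus>\<^bsub>M\<^esub> a \<odot>\<^bsub>M\<^esub> v" "a \<in> carrier A" using u(2) by blast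
    have "x = lincomb M ?u (Suc n) (\<lambda>i\<in>{..<Suc n}. if i < n then c i else a)"
      using c(2) lincomb_cong[of n u u c "\<lambda>i\<in>{..<Suc n}. if i < n then c i else a" M] e by simp
    moreover have "(\<lambda>i\<in>{..<Suc n}. if i < n then c i else a) \<in> carrier (free_mod A (Suc n))"
      using free_mod_snoc[OF c(1,3)] .
    ultimately show "x \<in> lincomb M ?u (Suc n) ` carrier (free_mod A (Suc n))" by blast
  qed
  moreover have "\<forall>i<Suc n. ?u i \<in> carrier M" using u(1) step.hyps(2) by auto
  ultimately show ?case by blast
qed

lemma fg_module_iff_fg_over: "fg_module A M \<longleftrightarrow> left_module A M \<and> fg_over A M {\<zero>\<^bsub>M\<^esub>} (carrier M)"
  unfolding fg_module_iff using fg_over_lincomb[of A M] fg_over_imp_lincomb[of A M "carrier M"] by metis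

text \<open>Subtracting a multiple of a lift w of the newest generator moves an element of S into
  the preimage of the previous stage, so lifts of the generators of U generate over the preimage of
  B. A nonzero base is allowed because \<open>fg_ext\<close> pulls back cocycles over
  coboundaries.\<close>

lemma fg_over_lift_rel:
  assumes "left_module A M" "left_module A N" "lin A M N q" "submod A M S"
    and "submod A N B" "fg_over A N B U" "U \<subseteq> q ` S"
  shows "fg_over A M {s \<in> S. q s \<in> B} {s \<in> S. q s \<in> U}"
  using assms(6,7)
proof induction
  case base
  show ?case by (simp add: fg_over.base)
next
  case (step U v)
  interpret M: left_module A M by fact
  interpret N: left_module A N by fact
  note S = submodD[OF assms(4)]
  have sU: "submod A N U" using fg_over_submod[OF step.hyps(1) assms(2,5)] by blast
  note sv = submod_adjoin[OF assms(2) sU step.hyps(2)]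
  obtain w where w: "w \<in> S" "q w = v" using step.prems sv(3) by blast
  have "{s \<in> S. q s \<in> adjoin A N U v} = adjoin A M {s \<in> S. q s \<in> U} w"
  proof (intro subset_antisym subsetI)
    fix s assume "s \<in> {s \<in> S. q s \<in> adjoin A N U v}"
    then have s: "s \<in> S" and "q s \<in> adjoin A N U v" by auto
    then obtain t a where t: "t \<in> U" "a \<in> carrier A" "q s = t \<oplus>\<^bsub>N\<^esub> a \<odot>\<^bsub>N\<^esub> v" by (metis adjoinE)
    let ?s = "s \<ominus>\<^bsub>M\<^esub> a \<odot>\<^bsub>M\<^esub> w"
    have aw: "a \<odot>\<^bsub>M\<^esub> w \<in> S" using S(5)[OF t(2) w(1)] .
    have tN: "t \<in> carrier N" using submodD(3)[OF sU t(1)] .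
    have "q ?s = t"
      using lin_diff[OF assms(1-3), of s "a \<odot>\<^bsub>M\<^esub> w"] s aw S(3) lin_smult[OF assms(3) t(2) S(3)[OF w(1)]] w(2) t(2,3) tN step.hyps(2)
      by (simp add: a_minus_def N.a_assoc N.r_neg)
    moreover have "?s \<in> S" using M.submod_diff[OF assms(4) s aw] .
    moreover have "s = ?s \<oplus>\<^bsub>M\<^esub> a \<odot>\<^bsub>M\<^esub> w" using S(3)[OF s] S(3)[OF aw]
      by (simp add: a_minus_def M.a_assoc M.l_neg)
    ultimately show "s \<in> adjoin A M {s \<in> S. q s \<in> U} w" using t by (intro adjoinI) auto
  next
    fix s assume "s \<in> adjoin A M {s \<in> S. q s \<in> U} w"
    then obtain t a where t: "t \<in> S" "q t \<in> U" "a \<in> carrier A" "s = t \<oplus>\<^bsub>M\<^esub> a \<odot>\<^bsub>M\<^esub> w" by (auto elim: adjoinE)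
    have aw: "a \<odot>\<^bsub>M\<^esub> w \<in> S" using S(5)[OF t(3) w(1)] .
    have "q s = q t \<oplus>\<^bsub>N\<^esub> a \<odot>\<^bsub>N\<^esub> v"
      using lin_add[OF assms(3), of t "a \<odot>\<^bsub>M\<^esub> w"] lin_smult[OF assms(3) t(3) S(3)[OF w(1)]] S(3)[OF t(1)] S(3)[OF aw] w(2) t(4) by simp
    then show "s \<in> {s \<in> S. q s \<in> adjoin A N U v}"
      using S(4)[OF t(1) aw] t by (auto intro: adjoinI)
  qed
  moreover have "fg_over A M {s \<in> S. q s \<in> B} {s \<in> S. q s \<in> U}"
    using step.IH step.prems sv(2) by blast
  ultimately show ?case using fg_over.step[OF _ S(3)[OF w(1)]] by metis
qed

lemma fg_over_lift:
  assumes "left_module A M" "left_module A N" "lin A M N q" "submod A M S"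
    and "fg_over A N {\<zero>\<^bsub>N\<^esub>} U" "U \<subseteq> q ` S"
  shows "fg_over A M {s \<in> S. q s = \<zero>\<^bsub>N\<^esub>} {s \<in> S. q s \<in> U}"
  using fg_over_lift_rel[OF assms(1-4) left_module.submod_zero[OF assms(2)] assms(5,6)] by simp

lemma lin_subset: "lin A M N q \<Longrightarrow> S \<subseteq> carrier M \<Longrightarrow> lin A (M\<lparr>carrier := S\<rparr>) N q"
  unfolding lin_def by (simp add: subset_iff)

section \<open>Noetherian modules\<close>

definition noetherian_mod :: "('a, 'c) ring_scheme \<Rightarrow> ('a, 'm, 'd) module_scheme \<Rightarrow> bool" where
  "noetherian_mod A M \<longleftrightarrow> left_module A M \<and> (\<forall>S. submod A M S \<longrightarrow> fg_over A M {\<zero>\<^bsub>M\<^esub>} S)"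

lemma noetherian_modD:
  assumes "noetherian_mod A M"
  shows "left_module A M" "submod A M S \<Longrightarrow> fg_over A M {\<zero>\<^bsub>M\<^esub>} S" "fg_module A M"
  using assms left_module.submod_carrier[of A M] unfolding noetherian_mod_def fg_module_iff_fg_over by auto

text \<open>Lifts of generators of q(S) generate S over the part of S that q kills. Only submodules
  inside the kernel remain, and the last hypothesis deals with them in place of an exact
  sequence.\<close>

lemma noetherian_extension:
  assumes "left_module A M" "noetherian_mod A N" "lin A M N q"
    "\<And>S. submod A M S \<Longrightarrow> (\<And>s. s \<in> S \<Longrightarrow> q s = \<zero>\<^bsub>N\<^esub>) \<Longrightarrow> fg_over A M {\<zero>\<^bsub>M\<^esub>} S"
  shows "noetherian_mod A M"
  unfolding noetherian_mod_def
proof (intro conjI allI impI)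
  fix S assume S: "submod A M S"
  note N = noetherian_modD[OF assms(2)]
  have "fg_over A M {s \<in> S. q s = \<zero>\<^bsub>N\<^esub>} {s \<in> S. q s \<in> q ` S}"
    by (rule fg_over_lift[OF assms(1) N(1) assms(3) S N(2)]) (use submod_image[OF assms(1) N(1) assms(3) S] in auto)
  moreover have "{s \<in> S. q s \<in> q ` S} = S" by auto
  moreover have "fg_over A M {\<zero>\<^bsub>M\<^esub>} {s \<in> S. q s = \<zero>\<^bsub>N\<^esub>}"
  proof (rule assms(4))
    have "{s \<in> S. q s = \<zero>\<^bsub>N\<^esub>} = {x \<in> carrier (M\<lparr>carrier := S\<rparr>). q x = \<zero>\<^bsub>N\<^esub>}" by simp
    moreover have "submod A (M\<lparr>carrier := S\<rparr>) {x \<in> carrier (M\<lparr>carrier := S\<rparr>). q x = \<zero>\<^bsub>N\<^esub>}"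
      by (rule submod_kernel[OF left_module.submod_module[OF assms(1) S] N(1)])
        (rule lin_subset[OF assms(3) submodD(1)[OF S]])
    ultimately show "submod A M {s \<in> S. q s = \<zero>\<^bsub>N\<^esub>}"
      using submodD(1)[OF S] unfolding submod_def by auto
  qed auto
  ultimately show "fg_over A M {\<zero>\<^bsub>M\<^esub>} S" using fg_over_trans by fastforce
qed (fact assms(1))

lemma noetherian_inj:
  assumes "left_module A M" "noetherian_mod A N" "lin A M N q" "inj_on q (carrier M)"
  shows "noetherian_mod A M"
proof (rule noetherian_extension[OF assms(1-3)])
  fix S assume S: "submod A M S" "\<And>s. s \<in> S \<Longrightarrow> q s = \<zero>\<^bsub>N\<^esub>"
  interpret M: left_module A M by fact
  have "s = \<zero>\<^bsub>M\<^esub>" if "s \<in> S" for s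
    using that S lin_zero[OF assms(1) noetherian_modD(1)[OF assms(2)] assms(3)] assms(4) submodD(3)[OF S(1)]
    by (metis inj_onD M.zero_closed)
  then have "S = {\<zero>\<^bsub>M\<^esub>}" using submodD(2)[OF S(1)] by blast
  then show "fg_over A M {\<zero>\<^bsub>M\<^esub>} S" by (simp add: fg_over.base)
qed

lemma noetherian_image:
  assumes "noetherian_mod A M" "left_module A N" "lin A M N q" "q ` carrier M = carrier N"
  shows "noetherian_mod A N"
  unfolding noetherian_mod_def
proof (intro conjI allI impI)
  fix S assume S: "submod A N S"
  note M = noetherian_modD[OF assms(1)]
  let ?S = "{x \<in> carrier M. q x \<in> S}"
  have "q ` ?S = S"
  proof (intro subset_antisym subsetI)
    fix y assume y: "y \<in> S"
    then have "y \<in> q ` carrier M" using submodD(1)[OF S] assms(4) by auto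
    then show "y \<in> q ` ?S" using y by auto
  qed auto
  moreover have "fg_over A N (q ` {\<zero>\<^bsub>M\<^esub>}) (q ` ?S)"
    by (rule fg_over_image[OF M(2)[OF submod_vimage[OF M(1) assms(2,3) S]] assms(3) M(1) left_module.submod_zero[OF M(1)]])
  ultimately show "fg_over A N {\<zero>\<^bsub>N\<^esub>} S" using lin_zero[OF M(1) assms(2,3)] by simp
qed (fact assms(2))

lemma noetherian_free:
  assumes "noetherian_mod A (regular_module A)"
  shows "noetherian_mod A (free_mod A n)"
proof (induction n)
  have A: "ring A" using noetherian_modD(1)[OF assms] by (simp add: left_module_def)
  interpret A: ring A by fact
  case 0
  have "S = {\<zero>\<^bsub>free_mod A 0\<^esub>}" if "submod A (free_mod A 0) S" for S
    using submodD(1,2)[OF that] by (auto simp: fun_eq_iff)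
  then show ?case unfolding noetherian_mod_def using left_module_free[OF A] fg_over.base by metis
next
  have A: "ring A" using noetherian_modD(1)[OF assms] by (simp add: left_module_def)
  interpret A: ring A by fact
  case (Suc n)
  show ?case
  proof (rule noetherian_extension[OF left_module_free[OF A] assms, where q = "\<lambda>f. f n"])
    show "lin A (free_mod A (Suc n)) (regular_module A) (\<lambda>f. f n)"
      by (rule linI) (auto simp: PiE_iff)
    fix S assume S: "submod A (free_mod A (Suc n)) S" "\<And>s. s \<in> S \<Longrightarrow> s n = \<zero>\<^bsub>regular_module A\<^esub>"
    \<comment> \<open>Padding by zero identifies the free module of rank n with the kernel of the
      last coordinate, so S is the image of a submodule of it.\<close>
    let ?j = "\<lambda>f. \<lambda>i\<in>{..<Suc n}. if i < n then f i else \<zero>\<^bsub>A\<^esub>"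
    have j: "lin A (free_mod A n) (free_mod A (Suc n)) ?j"
      by (rule linI) (auto simp: fun_eq_iff PiE_iff)
    let ?T = "{f \<in> carrier (free_mod A n). ?j f \<in> S}"
    have "?j ` ?T = S"
    proof (intro subset_antisym subsetI)
      fix s assume s: "s \<in> S"
      then have c: "s \<in> carrier (free_mod A (Suc n))" using submodD(3)[OF S(1)] by blast
      then have "restrict s {..<n} \<in> carrier (free_mod A n)" by (rule free_mod_Suc)
      moreover have "?j (restrict s {..<n}) = s"
        using c S(2)[OF s] by (auto simp: fun_eq_iff PiE_def extensional_def less_Suc_eq)
      ultimately show "s \<in> ?j ` ?T" using s by (intro image_eqI[of _ _ "restrict s {..<n}"]) auto
    qed auto
    moreover have "fg_over A (free_mod A (Suc n)) (?j ` {\<zero>\<^bsub>free_mod A n\<^esub>}) (?j ` ?T)"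
      by (rule fg_over_image[OF noetherian_modD(2)[OF Suc] j left_module_free[OF A] left_module.submod_zero])
        (rule submod_vimage[OF _ _ j S(1)] left_module_free[OF A])+
    ultimately show "fg_over A (free_mod A (Suc n)) {\<zero>\<^bsub>free_mod A (Suc n)\<^esub>} S"
      using lin_zero[OF left_module_free[OF A] left_module_free[OF A] j] by simp
  qed
qed

lemma ideal_iff_submod:
  assumes "cring R" shows "ideal J R \<longleftrightarrow> submod R (regular_module R) J"
proof -
  interpret R: cring R by fact
  interpret M: left_module R "regular_module R" by (rule left_module_regular) (rule R.ring_axioms)
  show ?thesis
  proof
    assume "ideal J R"
    then interpret ideal J R .
    show "submod R (regular_module R) J" by (rule submodI) (use a_subset I_l_closed in auto)
  next
    assume J: "submod R (regular_module R) J"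
    note S = submodD[OF J]
    have m: "\<ominus>\<^bsub>R\<^esub> x \<in> J" if "x \<in> J" for x
      using S(5)[of "\<ominus>\<^bsub>R\<^esub> \<one>\<^bsub>R\<^esub>" x] that S(3)[OF that] by (simp add: R.l_minus)
    show "ideal J R"
    proof (rule idealI)
      show "subgroup J (add_monoid R)"
        using S m by (intro subgroup.intro) (auto simp: a_inv_def[symmetric])
      fix a x assume "a \<in> J" "x \<in> carrier R"
      then show "x \<otimes>\<^bsub>R\<^esub> a \<in> J" "a \<otimes>\<^bsub>R\<^esub> x \<in> J" using S(5)[of x a] S(3)[of a] by (auto simp: R.m_comm)
    qed (rule R.ring_axioms)
  qed
qed

lemma noetherian_regular:
  assumes "cring R" "noetherian_ring R"
  shows "noetherian_mod R (regular_module R)"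
  unfolding noetherian_mod_def
proof (intro conjI allI impI)
  interpret R: cring R by fact
  show M: "left_module R (regular_module R)" by (rule left_module_regular) (rule R.ring_axioms)
  fix J assume "submod R (regular_module R) J"
  then have "ideal J R" using ideal_iff_submod[OF assms(1)] by blast
  then obtain C where C: "C \<subseteq> carrier R" "finite C" "J = Idl\<^bsub>R\<^esub> C"
    using noetherian_ring.finetely_gen[OF assms(2)] by blast
  have "fg_over R (regular_module R) {\<zero>\<^bsub>R\<^esub>} (Idl\<^bsub>R\<^esub> C)" using C(2,1)
  proof (induction rule: finite_induct)
    case empty
    have "Idl\<^bsub>R\<^esub> {} = {\<zero>\<^bsub>R\<^esub>}"
      using R.genideal_minimal[OF R.zeroideal, of "{}"] additive_subgroup.zero_closed[OF ideal.axioms(1)[OF R.genideal_ideal[of "{}"]]] by blast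
    then show ?case by (simp add: fg_over.base)
  next
    case (insert x F)
    have i: "ideal (Idl\<^bsub>R\<^esub> F) R" and i': "ideal (Idl\<^bsub>R\<^esub> (insert x F)) R" using insert.prems by (auto intro: R.genideal_ideal)
    have s: "submod R (regular_module R) (Idl\<^bsub>R\<^esub> F)" "submod R (regular_module R) (Idl\<^bsub>R\<^esub> (insert x F))"
      using i i' ideal_iff_submod[OF assms(1)] by auto
    have x: "x \<in> carrier (regular_module R)" using insert.prems by simp
    note a = submod_adjoin[OF M s(1) x]
    have sub: "insert x F \<subseteq> Idl\<^bsub>R\<^esub> (insert x F)" "F \<subseteq> Idl\<^bsub>R\<^esub> F"
      using insert.prems R.genideal_self[of "insert x F"] R.genideal_self[of F] by auto
    have "Idl\<^bsub>R\<^esub> (insert x F) = adjoin R (regular_module R) (Idl\<^bsub>R\<^esub> F) x"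
    proof
      show "Idl\<^bsub>R\<^esub> (insert x F) \<subseteq> adjoin R (regular_module R) (Idl\<^bsub>R\<^esub> F) x"
        by (rule R.genideal_minimal) (use a sub ideal_iff_submod[OF assms(1)] in auto)
      show "adjoin R (regular_module R) (Idl\<^bsub>R\<^esub> F) x \<subseteq> Idl\<^bsub>R\<^esub> (insert x F)"
        by (rule adjoin_subset[OF s(2) R.genideal_minimal[OF i']]) (use sub in auto)
    qed
    then show ?case using insert x by (auto intro: fg_over.step)
  qed
  then show "fg_over R (regular_module R) {\<zero>\<^bsub>regular_module R\<^esub>} J" using C by simp
qed

section \<open>Maps of finite rank and projectivity\<close>

text \<open>By the dual basis lemma the identity of \<open>P\<close> has finite rank if and only if \<open>P\<close> is finitely generated
  projective. This form of projectivity does not quantify over modules.\<close>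

inductive finite_rank ::
  "('a, 'c) ring_scheme \<Rightarrow> ('a, 'm, 'd) module_scheme \<Rightarrow> ('a, 'n, 'e) module_scheme \<Rightarrow> ('m \<Rightarrow> 'n) \<Rightarrow> bool"
  for A M N where
  zero: "(\<And>x. x \<in> carrier M \<Longrightarrow> f x = \<zero>\<^bsub>N\<^esub>) \<Longrightarrow> finite_rank A M N f"
| step: "finite_rank A M N h \<Longrightarrow> lin A M (regular_module A) c \<Longrightarrow> n \<in> carrier N \<Longrightarrow>
    (\<And>x. x \<in> carrier M \<Longrightarrow> f x = h x \<oplus>\<^bsub>N\<^esub> c x \<odot>\<^bsub>N\<^esub> n) \<Longrightarrow> finite_rank A M N f"

lemma finite_rank_lin:
  assumes "finite_rank A M N f" "left_module A M" "left_module A N"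
  shows "lin A M N f"
  using assms(1)
proof induction
  case (zero f)
  show ?case by (rule lin_cong[OF lin_zero_map[OF assms(2,3)]]) (use zero assms(2) in auto)
next
  case (step h c n f)
  show ?case
    by (rule lin_cong[OF lin_add_map[OF assms(2,3) step.IH lin_comp[OF step.hyps(2) lin_right_mult[OF assms(3) step.hyps(3)]]]])
      (use step assms(2) in auto)
qed

lemma finite_rank_cong:
  assumes "finite_rank A M N f" "\<And>x. x \<in> carrier M \<Longrightarrow> g x = f x"
  shows "finite_rank A M N g"
  using assms
proof (induction arbitrary: g)
  case (zero f)
  then show ?case by (intro finite_rank.zero) auto
next
  case (step h c n f)
  show ?case by (rule finite_rank.step[OF step.hyps(1,2,3)]) (use step in auto)
qed

lemma finite_rank_post:
  assumes "finite_rank A M N f" "left_module A M" "left_module A N" "left_module A P" "lin A N P g"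
  shows "finite_rank A M P (\<lambda>x. g (f x))"
  using assms(1)
proof induction
  case (zero f)
  then show ?case using lin_zero[OF assms(3-5)] by (intro finite_rank.zero) auto
next
  case (step h c n f)
  interpret N: left_module A N by fact
  show ?case
  proof (rule finite_rank.step[OF step.IH step.hyps(2) lin_closed[OF assms(5) step.hyps(3)]])
    fix x assume x: "x \<in> carrier M"
    have c: "h x \<in> carrier N" "c x \<in> carrier A"
      using lin_closed[OF finite_rank_lin[OF step.hyps(1) assms(2,3)] x] lin_closed[OF step.hyps(2) x] by auto
    show "g (f x) = g (h x) \<oplus>\<^bsub>P\<^esub> c x \<odot>\<^bsub>P\<^esub> g n"
      using step.hyps(3) step.hyps(4)[OF x] c lin_add[OF assms(5), of "h x" "c x \<odot>\<^bsub>N\<^esub> n"] lin_smult[OF assms(5), of "c x" n]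
      by simp
  qed
qed

lemma finite_rank_pre:
  assumes "finite_rank A M N f" "lin A P M g"
  shows "finite_rank A P N (\<lambda>x. f (g x))"
  using assms(1)
proof induction
  case (zero f)
  show ?case by (rule finite_rank.zero) (use zero lin_closed[OF assms(2)] in auto)
next
  case (step h c n f)
  show ?case
    by (rule finite_rank.step[OF step.IH lin_comp[OF assms(2) step.hyps(2)] step.hyps(3)])
      (use step.hyps(4) lin_closed[OF assms(2)] in auto)
qed

lemma finite_rank_add:
  assumes "finite_rank A M N g" "finite_rank A M N f" "left_module A M" "left_module A N"
    "\<And>x. x \<in> carrier M \<Longrightarrow> k x = f x \<oplus>\<^bsub>N\<^esub> g x"
  shows "finite_rank A M N k"
  using assms(1,5)
proof (induction arbitrary: k)
  case (zero g)
  interpret N: left_module A N by fact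
  show ?case
    by (rule finite_rank_cong[OF assms(2)]) (use zero lin_closed[OF finite_rank_lin[OF assms(2-4)]] in auto)
next
  case (step h c n g)
  interpret N: left_module A N by fact
  show ?case
  proof (rule finite_rank.step[OF step.IH step.hyps(2,3)])
    fix x assume x: "x \<in> carrier M"
    have "f x \<in> carrier N" "h x \<in> carrier N" "c x \<in> carrier A" 
      using lin_closed[OF finite_rank_lin[OF assms(2-4)] x] lin_closed[OF finite_rank_lin[OF step.hyps(1) assms(3,4)] x]
        lin_closed[OF step.hyps(2) x] by auto
    then show "k x = (f x \<oplus>\<^bsub>N\<^esub> h x) \<oplus>\<^bsub>N\<^esub> c x \<odot>\<^bsub>N\<^esub> n"
      using step.prems[OF x] step.hyps(4)[OF x] step.hyps(3) by (simp add: N.a_ac)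
  qed auto
qed

text \<open>Collecting the functionals of the rank one summands into one map shows that a map of
  finite rank factors through a free module; \<open>lincomb_finite_rank\<close> is the
  converse.\<close>

lemma finite_rank_lincomb:
  assumes "finite_rank A M N f" "left_module A M"
  shows "\<exists>n u c. (\<forall>i<n. u i \<in> carrier N) \<and> lin A M (free_mod A n) c \<and> (\<forall>x\<in>carrier M. f x = lincomb N u n (c x))"
  using assms(1)
proof induction
  case (zero f)
  have A: "ring A" using assms(2) by (simp add: left_module_def)
  show ?case
    using zero lin_zero_map[OF assms(2) left_module_free[OF A, of 0]] by (intro exI[of _ "0::nat"]) auto
next
  case (step h d v f)
  then obtain n u c where *: "\<forall>i<n. u i \<in> carrier N" "lin A M (free_mod A n) c" "\<forall>x\<in>carrier M. h x = lincomb N u n (c x)"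
    by blast
  have cn: "c x \<in> carrier (free_mod A n)" if "x \<in> carrier M" for x using lin_closed[OF *(2) that] .
  interpret M: left_module A M by fact
  show ?case
  proof (intro exI conjI)
    show "\<forall>i<Suc n. (u(n := v)) i \<in> carrier N" using *(1) step.hyps(3) by auto
    let ?c = "\<lambda>x. \<lambda>i\<in>{..<Suc n}. if i < n then c x i else d x"
    show "lin A M (free_mod A (Suc n)) ?c"
    proof (rule linI)
      show "?c x \<in> carrier (free_mod A (Suc n))" if "x \<in> carrier M" for x
        using free_mod_snoc[OF cn[OF that], of "d x"] lin_closed[OF step.hyps(2) that] by simp
    qed (auto simp: fun_eq_iff lin_add[OF *(2)] lin_add[OF step.hyps(2)] lin_smult[OF *(2)] lin_smult[OF step.hyps(2)])
    show "\<forall>x\<in>carrier M. f x = lincomb N (u(n := v)) (Suc n) (?c x)"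
    proof
      fix x assume x: "x \<in> carrier M"
      have "lincomb N (u(n := v)) n (?c x) = lincomb N u n (c x)" by (rule lincomb_cong) auto
      then show "f x = lincomb N (u(n := v)) (Suc n) (?c x)" using step.hyps(4)[OF x] *(3) x by simp
    qed
  qed
qed

lemma lincomb_finite_rank:
  assumes "left_module A M" "left_module A N" "\<And>i. i < n \<Longrightarrow> u i \<in> carrier N" "lin A M (free_mod A n) c"
  shows "finite_rank A M N (\<lambda>x. lincomb N u n (c x))"
proof -
  have "finite_rank A M N (\<lambda>x. lincomb N u k (c x))" if "k \<le> n" for k
    using that
  proof (induction k)
    case 0 show ?case by (rule finite_rank.zero) simp
  next
    case (Suc k)
    have "k < n" "k \<le> n" using Suc.prems by auto
    have c: "lin A M (regular_module A) (\<lambda>x. c x k)"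
      using \<open>k < n\<close> lin_closed[OF assms(4)] by (intro linI) (auto simp: lin_add[OF assms(4)] lin_smult[OF assms(4)] PiE_iff)
    show ?case by (rule finite_rank.step[OF Suc.IH[OF \<open>k \<le> n\<close>] c assms(3)[OF \<open>k < n\<close>]]) simp
  qed
  then show ?thesis by simp
qed

lemma fg_image:
  assumes "fg_module A M" "left_module A N" "lin A M N q" "q ` carrier M = carrier N"
  shows "fg_module A N"
  using assms fg_over_image[of A M "{\<zero>\<^bsub>M\<^esub>}" "carrier M" N q] left_module.submod_zero[of A M] lin_zero[of A M N q]
  unfolding fg_module_iff_fg_over by auto

lemma fg_free: "ring A \<Longrightarrow> fg_module A (free_mod A n)"
  unfolding fg_module_iff
proof (intro conjI exI)
  assume A: "ring A"
  show "left_module A (free_mod A n)" using left_module_free[OF A] .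
  show "\<forall>i<n. unit_vec A n i \<in> carrier (free_mod A n)" using unit_vec_closed[OF A] by blast
  show "lincomb (free_mod A n) (unit_vec A n) n ` carrier (free_mod A n) = carrier (free_mod A n)"
    using free_mod_expand[OF A] by (simp cong: image_cong)
qed

text \<open>A section of a presentation of P by a free module writes the identity as a sum of rank
  one maps. Both modules are first copied to \<open>univ\<close>, the free one by singletons and P
  by its code, since \<open>projective_module\<close> admits only lifting problems posed
  there.\<close>

lemma projective_finite_rank_id:
  fixes A :: "('a, 'c) ring_scheme" and P :: "('a, 'm, 'd) module_scheme"
  assumes "projective_module A P" "fg_module A P"
  shows "finite_rank A P P (\<lambda>x. x)"
proof -
  have P: "left_module A P" and A: "ring A" using assms(2) unfolding fg_module_def left_module_def by auto
  obtain n u where u: "\<forall>i<n. u i \<in> carrier P" "lincomb P u n ` carrier (free_mod A n) = carrier P"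
    using assms(2) unfolding fg_module_iff by blast
  obtain c :: "'m \<Rightarrow> 'a univ" where c: "inj_on c (carrier P)" using fg_module_code[OF assms(2)] .
  let ?s = "\<lambda>x :: nat \<Rightarrow> 'a. {x}" and ?F = "free_mod A n"
  let ?Fu = "transport ?s ?F" and ?Pu = "transport c P" and ?i = "inv_into (carrier ?F) ?s"
  have s: "inj_on ?s (carrier ?F)" by auto
  note tP = transport[OF P c] and tF = transport[OF left_module_free[OF A] s]
  let ?q = "restrict (\<lambda>y. c (lincomb P u n (?i y))) (carrier ?Fu)"
  have lq: "lin A ?Fu ?Pu (\<lambda>y. c (lincomb P u n (?i y)))"
    by (rule lin_comp[OF lin_comp[OF tF(3) lin_lincomb[OF P]] tP(2)]) (use u in auto)
  have q: "?q \<in> mod_hom A ?Fu ?Pu" by (rule lin_restrict[OF tF(1) lq])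
  have f: "restrict c (carrier P) \<in> mod_hom A P ?Pu" by (rule lin_restrict[OF P tP(2)])
  have "?q ` carrier ?Fu = (\<lambda>y. c (lincomb P u n (?i y))) ` carrier ?Fu" by (rule image_cong) auto
  also have "\<dots> = (\<lambda>y. c (lincomb P u n (?i (?s y)))) ` carrier ?F" by (simp add: image_image)
  also have "\<dots> = c ` (lincomb P u n ` carrier ?F)" using inv_into_f_f[OF s] unfolding image_image by (intro image_cong) simp_all
  finally have surj: "?q ` carrier ?Fu = carrier ?Pu" using u(2) by simp
  obtain g where g: "g \<in> mod_hom A P ?Fu" "\<forall>x\<in>carrier P. ?q (g x) = restrict c (carrier P) x"
    using assms(1) tF(1) tP(1) q surj f unfolding projective_module_def by blast
  have lg: "lin A P ?Fu g" using g(1) mod_hom_iff by blast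
  have "finite_rank A P P (\<lambda>x. lincomb P u n (?i (g x)))"
    by (rule lincomb_finite_rank[OF P P _ lin_comp[OF lg tF(3)]]) (use u in auto)
  then show ?thesis
  proof (rule finite_rank_cong)
    fix x assume x: "x \<in> carrier P"
    have gx: "g x \<in> carrier ?Fu" using lin_closed[OF lg x] .
    have "lincomb P u n (?i (g x)) \<in> carrier P"
      using u(2) lin_closed[OF tF(3) gx] by blast
    moreover have "c (lincomb P u n (?i (g x))) = c x" using g(2) x gx by auto
    ultimately show "x = lincomb P u n (?i (g x))" using c x by (metis inj_onD)
  qed
qed

text \<open>The free module on the type that \<open>proj_factoring_maps\<close> prescribes for the
  projective module in the middle of a factorisation.\<close>

definition free_umodule :: "('a, 'c) ring_scheme \<Rightarrow> nat \<Rightarrow> 'a umodule" where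
  "free_umodule A n = transport (\<lambda>x. {x}) (free_mod A n)"

lemma free_umodule:
  fixes A :: "('a, 'c) ring_scheme"
  assumes "ring A"
  shows "fg_module A (free_umodule A n)" "projective_module A (free_umodule A n)"
    "lin A (free_mod A n) (free_umodule A n) (\<lambda>x. {x})" "lin A (free_umodule A n) (free_mod A n) the_elem"
proof -
  let ?s = "\<lambda>x :: nat \<Rightarrow> 'a. {x}" and ?F = "free_mod A n"
  let ?i = "inv_into (carrier ?F) ?s"
  have s: "inj_on ?s (carrier ?F)" by auto
  note t = transport[OF left_module_free[OF assms] s, folded free_umodule_def]
  show "fg_module A (free_umodule A n)"
    by (rule fg_image[OF fg_free[OF assms] t(1,2)]) (simp add: free_umodule_def)
  show "lin A (free_mod A n) (free_umodule A n) (\<lambda>x. {x})" by (rule t(2))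
  have e: "the_elem y = ?i y" if "y \<in> carrier (free_umodule A n)" for y
    using that inv_into_f_f[OF s] unfolding free_umodule_def by auto
  show l: "lin A (free_umodule A n) (free_mod A n) the_elem" by (rule lin_cong[OF t(3) e t(1)])
  show "projective_module A (free_umodule A n)"
    unfolding projective_module_def
  proof (intro conjI allI impI)
    fix M N :: "'a umodule" and p f
    assume M: "left_module A M" and N: "left_module A N" and p: "p \<in> mod_hom A M N" "p ` carrier M = carrier N"
      and f: "f \<in> mod_hom A (free_umodule A n) N"
    have lf: "lin A (free_mod A n) N (\<lambda>x. f {x})"
      using lin_comp[OF t(2)] f mod_hom_iff by blast
    obtain g where g: "lin A (free_mod A n) M g" "\<And>x. x \<in> carrier (free_mod A n) \<Longrightarrow> p (g x) = f {x}"
      using free_mod_lift[OF assms M N _ p(2) lf] p(1) mod_hom_iff by blast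
    let ?g = "restrict (\<lambda>x. g (the_elem x)) (carrier (free_umodule A n))"
    have "?g \<in> mod_hom A (free_umodule A n) M" by (rule lin_restrict[OF t(1) lin_comp[OF l g(1)]])
    moreover have "p (?g x) = f x" if "x \<in> carrier (free_umodule A n)" for x
      using that g(2) unfolding free_umodule_def by auto
    ultimately show "\<exists>g\<in>mod_hom A (free_umodule A n) M. \<forall>x\<in>carrier (free_umodule A n). p (g x) = f x" by blast
  qed (rule t(1))
qed

section \<open>Modules of homomorphisms\<close>

definition hom_mod ::
  "('a, 'c) ring_scheme \<Rightarrow> ('a, 'm, 'd) module_scheme \<Rightarrow> ('a, 'n, 'e) module_scheme \<Rightarrow> ('a, 'm \<Rightarrow> 'n) module" where
  "hom_mod R M N = \<lparr>carrier = mod_hom R M N, monoid.mult = undefined, one = undefined,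
     ring.zero = (\<lambda>x\<in>carrier M. \<zero>\<^bsub>N\<^esub>), ring.add = (\<lambda>f g. \<lambda>x\<in>carrier M. f x \<oplus>\<^bsub>N\<^esub> g x),
     smult = (\<lambda>r f. \<lambda>x\<in>carrier M. r \<odot>\<^bsub>N\<^esub> f x)\<rparr>"

lemma hom_mod_simps [simp]:
  "carrier (hom_mod R M N) = mod_hom R M N"
  "ring.zero (hom_mod R M N) = (\<lambda>x\<in>carrier M. \<zero>\<^bsub>N\<^esub>)"
  "ring.add (hom_mod R M N) = (\<lambda>f g. \<lambda>x\<in>carrier M. f x \<oplus>\<^bsub>N\<^esub> g x)"
  "smult (hom_mod R M N) = (\<lambda>r f. \<lambda>x\<in>carrier M. r \<odot>\<^bsub>N\<^esub> f x)"
  unfolding hom_mod_def by simp_all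

lemma mod_hom_lin: "f \<in> mod_hom A M N \<Longrightarrow> lin A M N f" unfolding mod_hom_iff by blast
lemma mod_hom_closed: "f \<in> mod_hom A M N \<Longrightarrow> x \<in> carrier M \<Longrightarrow> f x \<in> carrier N" unfolding mod_hom_def by auto
lemma mod_hom_eqI:
  "f \<in> mod_hom A M N \<Longrightarrow> g \<in> mod_hom A M N' \<Longrightarrow> (\<And>x. x \<in> carrier M \<Longrightarrow> f x = g x) \<Longrightarrow> f = g"
  unfolding mod_hom_def by (auto intro: PiE_ext)
lemma mod_hom_sub: "mod_hom A M N \<subseteq> carrier M \<rightarrow>\<^sub>E carrier N" unfolding mod_hom_def by auto

lemma abelian_group_homs:
  assumes "left_module A M" "left_module A N"
    and "carrier G = mod_hom A M N" "ring.zero G = (\<lambda>x\<in>carrier M. \<zero>\<^bsub>N\<^esub>)"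
    "ring.add G = (\<lambda>f g. \<lambda>x\<in>carrier M. f x \<oplus>\<^bsub>N\<^esub> g x)"
  shows "abelian_group G"
proof (rule abelian_group_funs[of N G "carrier M"])
  interpret N: left_module A N by fact
  show "abelian_group N" by (rule N.abelian_group_axioms)
  show "carrier G \<subseteq> carrier M \<rightarrow>\<^sub>E carrier N" unfolding assms(3) by (rule mod_hom_sub)
  show "\<zero>\<^bsub>G\<^esub> \<in> carrier G" unfolding assms(3,4) by (rule lin_restrict[OF assms(1) lin_zero_map[OF assms(1,2)]])
  show "(\<lambda>x\<in>carrier M. f x \<oplus>\<^bsub>N\<^esub> g x) \<in> carrier G" if "f \<in> carrier G" "g \<in> carrier G" for f g
    using that unfolding assms(3) by (intro lin_restrict[OF assms(1)] lin_add_map[OF assms(1,2)] mod_hom_lin)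
  show "(\<lambda>x\<in>carrier M. \<ominus>\<^bsub>N\<^esub> f x) \<in> carrier G" if "f \<in> carrier G" for f
  proof -
    have f: "lin A M N f" using that unfolding assms(3) by (rule mod_hom_lin)
    have "lin A M N (\<lambda>x. \<ominus>\<^bsub>N\<^esub> f x)"
      by (rule lin_cong[OF lin_diff_map[OF assms(1,2) lin_zero_map[OF assms(1,2)] f] _ assms(1)])
        (simp add: a_minus_def lin_closed[OF f])
    then show ?thesis unfolding assms(3) by (rule lin_restrict[OF assms(1)])
  qed
qed (use assms(4,5) in auto)

lemma left_module_hom:
  assumes "cring R" "left_module R M" "left_module R N"
  shows "left_module R (hom_mod R M N)"
proof -
  interpret R: cring R by fact
  interpret M: left_module R M by fact
  interpret N: left_module R N by fact
  have "abelian_group (hom_mod R M N)" by (rule abelian_group_homs[OF assms(2,3)]) simp_all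
  moreover have "(\<lambda>x\<in>carrier M. r \<odot>\<^bsub>N\<^esub> f x) \<in> mod_hom R M N" if "r \<in> carrier R" "f \<in> mod_hom R M N" for r f
    by (rule lin_restrict[OF assms(2) lin_smult_map[OF assms mod_hom_lin[OF that(2)] that(1)]])
  moreover have "(\<lambda>x\<in>carrier M. \<one>\<^bsub>R\<^esub> \<odot>\<^bsub>N\<^esub> f x) = f" if "f \<in> mod_hom R M N" for f
    by (rule ext) (use that mod_hom_closed[OF that] in \<open>auto simp: mod_hom_iff extensional_def\<close>)
  ultimately show ?thesis
    unfolding left_module_def left_module_axioms_def hom_mod_simps
    by (intro conjI allI impI restrict_ext)
      (simp_all add: R.ring_axioms N.smult_l_distr N.smult_r_distr N.smult_assoc1 mod_hom_closed)
qed

lemma lin_eval: "u \<in> carrier M \<Longrightarrow> lin R (hom_mod R M N) N (\<lambda>f. f u)"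
  by (rule linI) (auto simp: mod_hom_closed)

text \<open>\<open>Q T\<close> concerns submodules of maps that vanish on T. Evaluation at a further
  generator u takes values in the Noetherian module N, and its kernel consists of maps that vanish
  at u as well; so \<open>Q\<close> descends along generators of M, from the whole of M, where only
  the zero map is left, to {0}.\<close>

lemma noetherian_hom:
  assumes "cring R" "fg_module R M" "noetherian_mod R N"
  shows "noetherian_mod R (hom_mod R M N)"
proof -
  have M: "left_module R M" "fg_over R M {\<zero>\<^bsub>M\<^esub>} (carrier M)" using assms(2) unfolding fg_module_iff_fg_over by auto
  note N = noetherian_modD[OF assms(3)]
  interpret M: left_module R M by fact
  interpret N: left_module R N by (rule N(1))
  let ?H = "hom_mod R M N"
  have H: "left_module R ?H" by (rule left_module_hom[OF assms(1) M(1) N(1)])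
  define Q where "Q T \<longleftrightarrow> (\<forall>S. submod R ?H S \<longrightarrow> (\<forall>s\<in>S. \<forall>t\<in>T. s t = \<zero>\<^bsub>N\<^esub>) \<longrightarrow> fg_over R ?H {\<zero>\<^bsub>?H\<^esub>} S)" for T
  have "Q T \<Longrightarrow> Q {\<zero>\<^bsub>M\<^esub>}" if "fg_over R M {\<zero>\<^bsub>M\<^esub>} T" for T
    using that
  proof induction
    case (step T u)
    have sT: "submod R M T" using fg_over_submod[OF step.hyps(1) M(1) M.submod_zero] by blast
    have "Q T" unfolding Q_def
    proof (intro allI impI)
      fix S assume S: "submod R ?H S" "\<forall>s\<in>S. \<forall>t\<in>T. s t = \<zero>\<^bsub>N\<^esub>"
      have sub: "S \<subseteq> mod_hom R M N" using submodD(1)[OF S(1)] by simp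
      let ?S = "{s \<in> S. s u = \<zero>\<^bsub>N\<^esub>}"
      have "fg_over R ?H {s \<in> S. s u = \<zero>\<^bsub>N\<^esub>} {s \<in> S. s u \<in> (\<lambda>s. s u) ` S}"
        by (rule fg_over_lift[OF H N(1) lin_eval[OF step.hyps(2)] S(1) N(2)])
          (use submod_image[OF H N(1) lin_eval[OF step.hyps(2)] S(1)] in auto)
      moreover have "{s \<in> S. s u \<in> (\<lambda>s. s u) ` S} = S" by auto
      moreover have "fg_over R ?H {\<zero>\<^bsub>?H\<^esub>} ?S"
      proof -
        have "submod R ?H ?S"
        proof -
          have "submod R ?H {x \<in> carrier ?H. x u = \<zero>\<^bsub>N\<^esub>}" by (rule submod_kernel[OF H N(1) lin_eval[OF step.hyps(2)]])
          then show ?thesis using S(1) unfolding submod_def by auto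
        qed
        moreover have "\<forall>s\<in>?S. \<forall>t\<in>adjoin R M T u. s t = \<zero>\<^bsub>N\<^esub>"
        proof (intro ballI)
          fix s t assume s: "s \<in> ?S" and "t \<in> adjoin R M T u"
          then obtain t' a where t: "t' \<in> T" "a \<in> carrier R" "t = t' \<oplus>\<^bsub>M\<^esub> a \<odot>\<^bsub>M\<^esub> u" by (metis adjoinE)
          have l: "lin R M N s" using s sub by (auto intro: mod_hom_lin)
          show "s t = \<zero>\<^bsub>N\<^esub>"
            using lin_add[OF l, of t' "a \<odot>\<^bsub>M\<^esub> u"] lin_smult[OF l t(2) step.hyps(2)] t(2,3) bspec[OF bspec[OF S(2), of s] t(1)] s submodD(3)[OF sT t(1)] step.hyps(2) by simp
        qed
        ultimately show ?thesis using step.prems unfolding Q_def by blast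
      qed
      ultimately show "fg_over R ?H {\<zero>\<^bsub>?H\<^esub>} S" using fg_over_trans by fastforce
    qed
    then show ?case by (rule step.IH)
  qed
  moreover have "Q (carrier M)" unfolding Q_def
  proof (intro allI impI)
    fix S assume S: "submod R ?H S" "\<forall>s\<in>S. \<forall>t\<in>carrier M. s t = \<zero>\<^bsub>N\<^esub>"
    have "s = \<zero>\<^bsub>?H\<^esub>" if "s \<in> S" for s
      using S(2) that submodD(3)[OF S(1) that] by (auto simp: mod_hom_def PiE_iff extensional_def fun_eq_iff)
    then have "S = {\<zero>\<^bsub>?H\<^esub>}" using submodD(2)[OF S(1)] by blast
    then show "fg_over R ?H {\<zero>\<^bsub>?H\<^esub>} S" by (simp only: fg_over.base)
  qed
  ultimately have Q: "Q {\<zero>\<^bsub>M\<^esub>}" using M(2) by blast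
  show ?thesis unfolding noetherian_mod_def
  proof (intro conjI allI impI)
    fix S assume S: "submod R ?H S"
    have "s \<zero>\<^bsub>M\<^esub> = \<zero>\<^bsub>N\<^esub>" if "s \<in> S" for s
      using lin_zero[OF M(1) N(1) mod_hom_lin] submodD(3)[OF S that] by simp
    then show "fg_over R ?H {\<zero>\<^bsub>?H\<^esub>} S" using Q S unfolding Q_def by blast
  qed (rule H)
qed

section \<open>Regular pairs\<close>

text \<open>An M-regular sequence a, b in terms of elements, without the condition of
  \<open>regular_sequence\<close> that (a, b)M be different from M. In this weak form it passes to
  Hom modules, which may be zero.\<close>

definition regular_pair :: "('a, 'c) ring_scheme \<Rightarrow> ('a, 'm, 'd) module_scheme \<Rightarrow> 'a \<Rightarrow> 'a \<Rightarrow> bool" where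
  "regular_pair R M a b \<longleftrightarrow> (\<forall>x\<in>carrier M. a \<odot>\<^bsub>M\<^esub> x = \<zero>\<^bsub>M\<^esub> \<longrightarrow> x = \<zero>\<^bsub>M\<^esub>) \<and>
     (\<forall>x\<in>carrier M. \<forall>y\<in>carrier M. b \<odot>\<^bsub>M\<^esub> x = a \<odot>\<^bsub>M\<^esub> y \<longrightarrow> (\<exists>z\<in>carrier M. x = a \<odot>\<^bsub>M\<^esub> z))"

text \<open>Division by a is unique in N, so the pointwise quotients of f by a again form a linear
  map.\<close>

lemma regular_pair_hom:
  assumes "cring R" "left_module R M" "left_module R N" "regular_pair R N a b" "a \<in> carrier R" "b \<in> carrier R"
  shows "regular_pair R (hom_mod R M N) a b"
proof -
  interpret M: left_module R M by fact
  interpret N: left_module R N by fact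
  interpret R: cring R by fact
  have reg: "x = y" if "x \<in> carrier N" "y \<in> carrier N" "a \<odot>\<^bsub>N\<^esub> x = a \<odot>\<^bsub>N\<^esub> y" for x y
  proof -
    have "a \<odot>\<^bsub>N\<^esub> (x \<ominus>\<^bsub>N\<^esub> y) = \<zero>\<^bsub>N\<^esub>"
      using that assms(5) by (simp add: a_minus_def N.smult_r_distr N.smult_r_minus N.r_neg)
    then show ?thesis using assms(4) that N.right_minus_eq[of x y] unfolding regular_pair_def by blast
  qed
  show ?thesis unfolding regular_pair_def hom_mod_simps
  proof (intro conjI ballI impI)
    fix f assume f: "f \<in> mod_hom R M N" "(\<lambda>x\<in>carrier M. a \<odot>\<^bsub>N\<^esub> f x) = (\<lambda>x\<in>carrier M. \<zero>\<^bsub>N\<^esub>)"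
    have "f x = \<zero>\<^bsub>N\<^esub>" if "x \<in> carrier M" for x
      using fun_cong[OF f(2), of x] that assms(4) mod_hom_closed[OF f(1) that] unfolding regular_pair_def by simp
    then show "f = (\<lambda>x\<in>carrier M. \<zero>\<^bsub>N\<^esub>)" using f(1) unfolding mod_hom_def
      by (auto simp: PiE_iff extensional_def fun_eq_iff)
  next
    fix f g assume f: "f \<in> mod_hom R M N" and g: "g \<in> mod_hom R M N" 
      and e: "(\<lambda>x\<in>carrier M. b \<odot>\<^bsub>N\<^esub> f x) = (\<lambda>x\<in>carrier M. a \<odot>\<^bsub>N\<^esub> g x)"
    have "\<exists>z\<in>carrier N. f x = a \<odot>\<^bsub>N\<^esub> z" if "x \<in> carrier M" for x
      using fun_cong[OF e, of x] that assms(4) mod_hom_closed[OF f that] mod_hom_closed[OF g that] unfolding regular_pair_def by auto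
    then obtain h where h: "\<And>x. x \<in> carrier M \<Longrightarrow> h x \<in> carrier N" "\<And>x. x \<in> carrier M \<Longrightarrow> f x = a \<odot>\<^bsub>N\<^esub> h x" by metis
    have lf: "lin R M N f" by (rule mod_hom_lin[OF f])
    have "lin R M N h"
    proof (rule linI)
      fix x y assume xy: "x \<in> carrier M" "y \<in> carrier M"
      show "h (x \<oplus>\<^bsub>M\<^esub> y) = h x \<oplus>\<^bsub>N\<^esub> h y"
        by (rule reg) (use xy h lin_add[OF lf xy] assms(5) in \<open>auto simp: N.smult_r_distr\<close>)
    next
      fix r x assume rx: "r \<in> carrier R" "x \<in> carrier M"
      have "a \<odot>\<^bsub>N\<^esub> (r \<odot>\<^bsub>N\<^esub> h x) = r \<odot>\<^bsub>N\<^esub> f x"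
        using rx h assms(5) by (simp add: N.smult_assoc1[symmetric] R.m_comm)
      moreover have rx': "r \<odot>\<^bsub>M\<^esub> x \<in> carrier M" using rx by simp
      ultimately have "a \<odot>\<^bsub>N\<^esub> h (r \<odot>\<^bsub>M\<^esub> x) = a \<odot>\<^bsub>N\<^esub> (r \<odot>\<^bsub>N\<^esub> h x)"
        using lin_smult[OF lf rx] h(2)[OF rx'] by simp
      then show "h (r \<odot>\<^bsub>M\<^esub> x) = r \<odot>\<^bsub>N\<^esub> h x"
        by (rule reg[rotated 2]) (rule h(1)[OF rx'] N.smult_closed[OF rx(1) h(1)[OF rx(2)]])+
    qed (rule h(1))
    then have "restrict h (carrier M) \<in> mod_hom R M N" by (rule lin_restrict[OF assms(2)])
    moreover have "f = (\<lambda>x\<in>carrier M. a \<odot>\<^bsub>N\<^esub> restrict h (carrier M) x)"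
      using h(2) f unfolding mod_hom_def by (auto simp: PiE_iff extensional_def fun_eq_iff)
    ultimately show "\<exists>z\<in>mod_hom R M N. f = (\<lambda>x\<in>carrier M. a \<odot>\<^bsub>N\<^esub> z x)" by blast
  qed
qed

section \<open>Restriction of scalars and duals\<close>

definition res :: "('a \<Rightarrow> 'l) \<Rightarrow> ('l, 'm, 'd) module_scheme \<Rightarrow> ('a, 'm) module" where
  "res \<phi> M = \<lparr>carrier = carrier M, monoid.mult = monoid.mult M, one = one M,
     ring.zero = \<zero>\<^bsub>M\<^esub>, ring.add = ring.add M, smult = (\<lambda>r x. \<phi> r \<odot>\<^bsub>M\<^esub> x)\<rparr>"

lemma res_simps [simp]:
  "carrier (res \<phi> M) = carrier M" "ring.zero (res \<phi> M) = \<zero>\<^bsub>M\<^esub>" "ring.add (res \<phi> M) = ring.add M"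
  "smult (res \<phi> M) = (\<lambda>r x. \<phi> r \<odot>\<^bsub>M\<^esub> x)"
  unfolding res_def by simp_all

lemma res_regular: "res \<phi> (regular_module L) = algebra_module L \<phi>"
  unfolding res_def regular_module_def algebra_module_def by simp

lemma is_algebraD:
  assumes "is_algebra R L \<phi>"
  shows "cring R" "ring L" "r \<in> carrier R \<Longrightarrow> \<phi> r \<in> carrier L"
    "r \<in> carrier R \<Longrightarrow> s \<in> carrier R \<Longrightarrow> \<phi> (r \<otimes>\<^bsub>R\<^esub> s) = \<phi> r \<otimes>\<^bsub>L\<^esub> \<phi> s"
    "r \<in> carrier R \<Longrightarrow> s \<in> carrier R \<Longrightarrow> \<phi> (r \<oplus>\<^bsub>R\<^esub> s) = \<phi> r \<oplus>\<^bsub>L\<^esub> \<phi> s" "\<phi> \<one>\<^bsub>R\<^esub> = \<one>\<^bsub>L\<^esub>"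
    "r \<in> carrier R \<Longrightarrow> x \<in> carrier L \<Longrightarrow> \<phi> r \<otimes>\<^bsub>L\<^esub> x = x \<otimes>\<^bsub>L\<^esub> \<phi> r"
  using assms unfolding is_algebra_def ring_hom_def by auto

lemma left_module_res:
  assumes "is_algebra R L \<phi>" "left_module L M"
  shows "left_module R (res \<phi> M)"
proof -
  interpret M: left_module L M by fact
  interpret R: cring R by (rule is_algebraD(1)[OF assms(1)])
  note a = is_algebraD[OF assms(1)]
  have "abelian_group (res \<phi> M)" by (rule abelian_group_cong[OF M.abelian_group_axioms]) simp_all
  then show ?thesis unfolding left_module_def left_module_axioms_def
    by (intro conjI allI impI)
      (simp_all add: R.ring_axioms a(3-6) M.smult_l_distr M.smult_r_distr M.smult_assoc1)
qed

lemma lin_res: "is_algebra R L \<phi> \<Longrightarrow> lin L M N f \<Longrightarrow> lin R (res \<phi> M) (res \<phi> N) f"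
  using is_algebraD(3)[of R L \<phi>] unfolding lin_def by auto

lemma submod_res: "is_algebra R L \<phi> \<Longrightarrow> submod L M S \<Longrightarrow> submod R (res \<phi> M) S"
  using is_algebraD(3)[of R L \<phi>] unfolding submod_def by auto

lemma res_carrier_update: "(res \<phi> M)\<lparr>carrier := S\<rparr> = res \<phi> (M\<lparr>carrier := S\<rparr>)"
  unfolding res_def by simp

text \<open>The R-dual of a left L-module with the right L-action on arguments, hence a module over
  \<open>op_ring L\<close>. The case of L itself is \<open>dual_module\<close>, by
  \<open>dual_over_regular\<close>.\<close>

definition dual_over ::
  "('a, 'c) ring_scheme \<Rightarrow> ('a \<Rightarrow> 'l) \<Rightarrow> ('l, 'm, 'd) module_scheme \<Rightarrow> ('l, 'm \<Rightarrow> 'a) module" where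
  "dual_over R \<phi> M = \<lparr>carrier = mod_hom R (res \<phi> M) (regular_module R),
     monoid.mult = undefined, one = undefined, ring.zero = (\<lambda>x\<in>carrier M. \<zero>\<^bsub>R\<^esub>),
     ring.add = (\<lambda>f g. \<lambda>x\<in>carrier M. f x \<oplus>\<^bsub>R\<^esub> g x), smult = (\<lambda>a f. \<lambda>x\<in>carrier M. f (a \<odot>\<^bsub>M\<^esub> x))\<rparr>"

lemma dual_over_simps [simp]:
  "carrier (dual_over R \<phi> M) = mod_hom R (res \<phi> M) (regular_module R)"
  "ring.zero (dual_over R \<phi> M) = (\<lambda>x\<in>carrier M. \<zero>\<^bsub>R\<^esub>)"
  "ring.add (dual_over R \<phi> M) = (\<lambda>f g. \<lambda>x\<in>carrier M. f x \<oplus>\<^bsub>R\<^esub> g x)"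
  "smult (dual_over R \<phi> M) = (\<lambda>a f. \<lambda>x\<in>carrier M. f (a \<odot>\<^bsub>M\<^esub> x))"
  unfolding dual_over_def by simp_all

lemma dual_over_regular: "dual_over R \<phi> (regular_module L) = dual_module R L \<phi>"
  unfolding dual_over_def dual_module_def res_regular by (simp cong: restrict_cong)

lemma op_ring_simps [simp]:
  "carrier (op_ring L) = carrier L" "monoid.mult (op_ring L) = (\<lambda>x y. y \<otimes>\<^bsub>L\<^esub> x)" "one (op_ring L) = \<one>\<^bsub>L\<^esub>"
  "ring.zero (op_ring L) = \<zero>\<^bsub>L\<^esub>" "ring.add (op_ring L) = ring.add L"
  unfolding op_ring_def by simp_all

lemma ring_op: assumes "ring L" shows "ring (op_ring L)"
proof -
  interpret ring L by fact
  have "abelian_group (op_ring L)" by (rule abelian_group_cong[OF abelian_group_axioms]) simp_all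
  then show ?thesis unfolding ring_def ring_axioms_def
    by (auto simp: l_distr r_distr m_assoc intro!: monoidI)
qed

lemma lin_res_smult:
  assumes "is_algebra R L \<phi>" "left_module L M" "a \<in> carrier L"
  shows "lin R (res \<phi> M) (res \<phi> M) (\<lambda>x. a \<odot>\<^bsub>M\<^esub> x)"
proof -
  interpret M: left_module L M by fact
  note a = is_algebraD[OF assms(1)]
  show ?thesis
  proof (rule linI)
    fix r x assume "r \<in> carrier R" "x \<in> carrier (res \<phi> M)"
    then show "a \<odot>\<^bsub>M\<^esub> (r \<odot>\<^bsub>res \<phi> M\<^esub> x) = r \<odot>\<^bsub>res \<phi> M\<^esub> (a \<odot>\<^bsub>M\<^esub> x)"
      using a(3,7)[of r] assms(3) by (simp add: M.smult_assoc1[symmetric])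
  qed (use assms(3) in \<open>auto simp: M.smult_r_distr\<close>)
qed

lemma left_module_dual_over:
  assumes "is_algebra R L \<phi>" "left_module L M"
  shows "left_module (op_ring L) (dual_over R \<phi> M)"
proof -
  note a = is_algebraD[OF assms(1)]
  interpret R: cring R by (rule a(1))
  interpret M: left_module L M by fact
  have rM: "left_module R (res \<phi> M)" by (rule left_module_res[OF assms])
  have rR: "left_module R (regular_module R)" by (rule left_module_regular) (rule R.ring_axioms)
  have "abelian_group (dual_over R \<phi> M)" by (rule abelian_group_homs[OF rM rR]) simp_all
  moreover have "(\<lambda>x\<in>carrier M. f (l \<odot>\<^bsub>M\<^esub> x)) \<in> mod_hom R (res \<phi> M) (regular_module R)"
    if "l \<in> carrier L" "f \<in> mod_hom R (res \<phi> M) (regular_module R)" for l f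
    using lin_restrict[OF rM lin_comp[OF lin_res_smult[OF assms that(1)] mod_hom_lin[OF that(2)]]] by simp
  moreover have "f (x \<oplus>\<^bsub>M\<^esub> y) = f x \<oplus>\<^bsub>R\<^esub> f y" 
    if "f \<in> mod_hom R (res \<phi> M) (regular_module R)" "x \<in> carrier M" "y \<in> carrier M" for f x y
    using lin_add[OF mod_hom_lin[OF that(1)]] that(2,3) by simp
  moreover have "(\<lambda>x\<in>carrier M. f (\<one>\<^bsub>L\<^esub> \<odot>\<^bsub>M\<^esub> x)) = f" if "f \<in> mod_hom R (res \<phi> M) (regular_module R)" for f
    by (rule ext) (use that in \<open>auto simp: mod_hom_iff extensional_def\<close>)
  ultimately show ?thesis
    unfolding left_module_def left_module_axioms_def dual_over_simps op_ring_simps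
    by (intro conjI allI impI restrict_ext)
      (simp_all add: ring_op[OF a(2)] M.smult_l_distr M.smult_r_distr M.smult_assoc1)
qed

section \<open>Vanishing of Ext\<close>

lemma (in abelian_group) diff_zero: "x \<in> carrier G \<Longrightarrow> x \<ominus> \<zero> = x"
  using l_neg[of \<zero>] by (simp add: a_minus_def)

definition in_jacobson :: "('a, 'c) ring_scheme \<Rightarrow> 'a \<Rightarrow> bool" where
  "in_jacobson R x \<longleftrightarrow> x \<in> carrier R \<and> (\<forall>r\<in>carrier R. \<one>\<^bsub>R\<^esub> \<ominus>\<^bsub>R\<^esub> x \<otimes>\<^bsub>R\<^esub> r \<in> Units R)"

text \<open>Write the newest generator as u = x (s + a u) + b with s in the span S of the others.
  Since 1 - x a is a unit, u lies in S; so generators can be stripped one by one until only B is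
  left.\<close>

lemma nakayama:
  assumes "cring R" "left_module R N" "submod R N B" "in_jacobson R x" "fg_over R N B Z"
    "\<And>z. z \<in> Z \<Longrightarrow> \<exists>z'\<in>Z. \<exists>b\<in>B. z = x \<odot>\<^bsub>N\<^esub> z' \<oplus>\<^bsub>N\<^esub> b"
  shows "Z = B"
  using assms(5,6)
proof induction
  case (step S u)
  interpret R: cring R by fact
  interpret N: left_module R N by fact
  have sS: "submod R N S" "B \<subseteq> S" using fg_over_submod[OF step.hyps(1) assms(2,3)] by auto
  note S = submodD[OF sS(1)]
  have x: "x \<in> carrier R" using assms(4) unfolding in_jacobson_def by blast
  have u: "u \<in> carrier N" by fact
  obtain z b where z: "z \<in> adjoin R N S u" "b \<in> B" "u = x \<odot>\<^bsub>N\<^esub> z \<oplus>\<^bsub>N\<^esub> b"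
    using step.prems[OF submod_adjoin(3)[OF assms(2) sS(1) u]] by blast
  obtain s a where sa: "s \<in> S" "a \<in> carrier R" "z = s \<oplus>\<^bsub>N\<^esub> a \<odot>\<^bsub>N\<^esub> u" using z(1) by (rule adjoinE)
  have b: "b \<in> S" using z(2) sS(2) by blast
  have sN: "s \<in> carrier N" "b \<in> carrier N" using S(3)[OF sa(1)] S(3)[OF b] by auto
  let ?e = "\<one>\<^bsub>R\<^esub> \<ominus>\<^bsub>R\<^esub> x \<otimes>\<^bsub>R\<^esub> a"
  have e: "?e \<in> Units R" using assms(4) sa(2) unfolding in_jacobson_def by blast
  have eR: "?e \<in> carrier R" "inv\<^bsub>R\<^esub> ?e \<in> carrier R" using e by (auto intro: R.Units_closed)
  have u_eq: "u = (x \<odot>\<^bsub>N\<^esub> s \<oplus>\<^bsub>N\<^esub> b) \<oplus>\<^bsub>N\<^esub> (x \<otimes>\<^bsub>R\<^esub> a) \<odot>\<^bsub>N\<^esub> u"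
  proof -
    have "x \<odot>\<^bsub>N\<^esub> z \<oplus>\<^bsub>N\<^esub> b = (x \<odot>\<^bsub>N\<^esub> s \<oplus>\<^bsub>N\<^esub> b) \<oplus>\<^bsub>N\<^esub> (x \<otimes>\<^bsub>R\<^esub> a) \<odot>\<^bsub>N\<^esub> u"
      using sa sN u x by (simp add: N.smult_r_distr N.smult_assoc1 N.a_ac)
    then show ?thesis using z(3) by simp
  qed
  have "?e \<odot>\<^bsub>N\<^esub> u = u \<oplus>\<^bsub>N\<^esub> \<ominus>\<^bsub>N\<^esub> ((x \<otimes>\<^bsub>R\<^esub> a) \<odot>\<^bsub>N\<^esub> u)"
    using x sa(2) u by (simp add: R.minus_eq N.smult_l_distr N.smult_l_minus)
  also have "\<dots> = ((x \<odot>\<^bsub>N\<^esub> s \<oplus>\<^bsub>N\<^esub> b) \<oplus>\<^bsub>N\<^esub> (x \<otimes>\<^bsub>R\<^esub> a) \<odot>\<^bsub>N\<^esub> u) \<oplus>\<^bsub>N\<^esub> \<ominus>\<^bsub>N\<^esub> ((x \<otimes>\<^bsub>R\<^esub> a) \<odot>\<^bsub>N\<^esub> u)"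
    using u_eq by simp
  also have "\<dots> = x \<odot>\<^bsub>N\<^esub> s \<oplus>\<^bsub>N\<^esub> b"
    using sN u x sa(2) by (simp add: N.a_assoc N.r_neg)
  finally have e_u: "?e \<odot>\<^bsub>N\<^esub> u = x \<odot>\<^bsub>N\<^esub> s \<oplus>\<^bsub>N\<^esub> b" .
  have "?e \<odot>\<^bsub>N\<^esub> u \<in> S" unfolding e_u by (rule S(4)[OF S(5)[OF x sa(1)] b])
  then have "inv\<^bsub>R\<^esub> ?e \<odot>\<^bsub>N\<^esub> (?e \<odot>\<^bsub>N\<^esub> u) \<in> S" by (rule S(5)[OF eR(2)])
  then have "u \<in> S" using N.smult_assoc1[OF eR(2,1) u] R.Units_l_inv[OF e] u by simp
  then have "adjoin R N S u \<subseteq> S" by (intro adjoin_subset[OF sS(1)]) auto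
  then have "adjoin R N S u = S" using submod_adjoin(2)[OF assms(2) sS(1) u] by auto
  then show ?case using step.IH step.prems by simp
qed simp

text \<open>The submodule S + x N. When N with S stands for N/S, this one stands for the reduction
  of N/S modulo x.\<close>

definition add_multiples :: "('a, 'm, 'd) module_scheme \<Rightarrow> 'm set \<Rightarrow> 'a \<Rightarrow> 'm set" where
  "add_multiples N S x = {s \<oplus>\<^bsub>N\<^esub> x \<odot>\<^bsub>N\<^esub> n | s n. s \<in> S \<and> n \<in> carrier N}"

lemma add_multiplesI: "s \<in> S \<Longrightarrow> n \<in> carrier N \<Longrightarrow> y = s \<oplus>\<^bsub>N\<^esub> x \<odot>\<^bsub>N\<^esub> n \<Longrightarrow> y \<in> add_multiples N S x"
  unfolding add_multiples_def by blast

lemma add_multiplesE: assumes "y \<in> add_multiples N S x"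
  obtains s n where "s \<in> S" "n \<in> carrier N" "y = s \<oplus>\<^bsub>N\<^esub> x \<odot>\<^bsub>N\<^esub> n"
  using assms unfolding add_multiples_def by blast

lemma submod_add_multiples:
  assumes "cring R" "left_module R N" "submod R N S" "x \<in> carrier R"
  shows "submod R N (add_multiples N S x)" "S \<subseteq> add_multiples N S x" "n \<in> carrier N \<Longrightarrow> x \<odot>\<^bsub>N\<^esub> n \<in> add_multiples N S x"
proof -
  interpret R: cring R by fact
  interpret N: left_module R N by fact
  note S = submodD[OF assms(3)]
  show 1: "S \<subseteq> add_multiples N S x"
    by (rule subsetI, rule add_multiplesI[of _ _ "\<zero>\<^bsub>N\<^esub>"]) (use S(3) assms(4) in auto)
  show "n \<in> carrier N \<Longrightarrow> x \<odot>\<^bsub>N\<^esub> n \<in> add_multiples N S x"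
    by (rule add_multiplesI[OF S(2)]) (use assms(4) in auto)
  show "submod R N (add_multiples N S x)"
  proof (rule submodI)
    show "add_multiples N S x \<subseteq> carrier N" unfolding add_multiples_def using S(3) assms(4) by auto
    show "\<zero>\<^bsub>N\<^esub> \<in> add_multiples N S x" using 1 S(2) by blast
  next
    fix y y' assume "y \<in> add_multiples N S x" "y' \<in> add_multiples N S x"
    then obtain s n s' n' where *: "s \<in> S" "n \<in> carrier N" "y = s \<oplus>\<^bsub>N\<^esub> x \<odot>\<^bsub>N\<^esub> n"
      "s' \<in> S" "n' \<in> carrier N" "y' = s' \<oplus>\<^bsub>N\<^esub> x \<odot>\<^bsub>N\<^esub> n'" by (metis add_multiplesE)
    show "y \<oplus>\<^bsub>N\<^esub> y' \<in> add_multiples N S x"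
      by (rule add_multiplesI[OF S(4)[OF *(1,4)], of "n \<oplus>\<^bsub>N\<^esub> n'"])
        (use * S(3)[OF *(1)] S(3)[OF *(4)] assms(4) in \<open>auto simp: N.smult_r_distr N.a_ac\<close>)
  next
    fix r y assume r: "r \<in> carrier R" and "y \<in> add_multiples N S x"
    then obtain s n where *: "s \<in> S" "n \<in> carrier N" "y = s \<oplus>\<^bsub>N\<^esub> x \<odot>\<^bsub>N\<^esub> n" by (metis add_multiplesE)
    show "r \<odot>\<^bsub>N\<^esub> y \<in> add_multiples N S x"
      by (rule add_multiplesI[OF S(5)[OF r *(1)], of "r \<odot>\<^bsub>N\<^esub> n"])
        (use * r S(3)[OF *(1)] assms(4) R.m_comm[of r x] in \<open>auto simp: N.smult_r_distr N.smult_assoc1[symmetric]\<close>)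
  qed
qed

text \<open>The ideal (S : u), which is the annihilator of the class of u in N/S.\<close>

definition colon :: "('a, 'c) ring_scheme \<Rightarrow> ('a, 'm, 'd) module_scheme \<Rightarrow> 'm set \<Rightarrow> 'm \<Rightarrow> 'a set" where
  "colon R N S u = {r \<in> carrier R. r \<odot>\<^bsub>N\<^esub> u \<in> S}"

lemma submod_colon:
  assumes "left_module R N" "submod R N S" "u \<in> carrier N"
  shows "submod R (regular_module R) (colon R N S u)"
proof -
  interpret N: left_module R N by fact
  have "submod R (regular_module R) {r \<in> carrier (regular_module R). r \<odot>\<^bsub>N\<^esub> u \<in> S}"
    by (rule submod_vimage[OF left_module_regular assms(1) lin_right_mult[OF assms(1,3)] assms(2)]) (rule N.R.ring_axioms)
  then show ?thesis unfolding colon_def by simp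
qed

section \<open>Ext computed by an injective resolution of the ring\<close>

text \<open>One resolution of R is fixed for the whole argument. Ext into R varies only in its first
  argument, so different resolutions never have to be compared.\<close>

locale inj_res =
  fixes R :: "('a, 'c) ring_scheme" and I :: "nat \<Rightarrow> 'a umodule"
    and \<epsilon> :: "'a \<Rightarrow> 'a univ" and d :: "nat \<Rightarrow> 'a univ \<Rightarrow> 'a univ"
  assumes cring: "cring R" and noeth: "noetherian_mod R (regular_module R)"
    and resol: "injective_resolution R (regular_module R) I \<epsilon> d"
begin

abbreviation "RR \<equiv> regular_module R"

lemma ring: "ring R" using cring by (simp add: cring_def)
lemma modRR: "left_module R RR" by (rule left_module_regular[OF ring])
lemmas resol_def = resol[unfolded injective_resolution_def]
lemma inj: "injective_module R (I j)" by (rule resol_def[THEN conjunct1, rule_format])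
lemma modI: "left_module R (I j)" by (rule inj[unfolded injective_module_def, THEN conjunct1])
lemma lin_d: "lin R (I j) (I (Suc j)) (d j)"
  by (rule mod_hom_lin[OF resol_def[THEN conjunct2, THEN conjunct2, THEN conjunct1, rule_format]])
lemma lin_\<epsilon>: "lin R RR (I 0) \<epsilon>"
  by (rule mod_hom_lin[OF resol_def[THEN conjunct2, THEN conjunct1]])
lemma inj_\<epsilon>: "inj_on \<epsilon> (carrier R)"
  using resol_def[THEN conjunct2, THEN conjunct2, THEN conjunct2, THEN conjunct1] by simp

lemma kernel_eq: "a_kernel M N h = {x \<in> carrier M. h x = \<zero>\<^bsub>N\<^esub>}"
  unfolding a_kernel_def kernel_def by simp

lemma im_\<epsilon>: "\<epsilon> ` carrier R = {x \<in> carrier (I 0). d 0 x = \<zero>\<^bsub>I (Suc 0)\<^esub>}"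
  using resol_def[THEN conjunct2, THEN conjunct2, THEN conjunct2, THEN conjunct2, THEN conjunct1] unfolding kernel_eq by simp
lemma im_d: "d j ` carrier (I j) = {x \<in> carrier (I (Suc j)). d (Suc j) x = \<zero>\<^bsub>I (Suc (Suc j))\<^esub>}"
  using resol_def[THEN conjunct2, THEN conjunct2, THEN conjunct2, THEN conjunct2, THEN conjunct2, rule_format, of j]
  unfolding kernel_eq .

lemma dd: "x \<in> carrier (I j) \<Longrightarrow> d (Suc j) (d j x) = \<zero>\<^bsub>I (Suc (Suc j))\<^esub>" using im_d[of j] by blast
lemma d_zero: "d j \<zero>\<^bsub>I j\<^esub> = \<zero>\<^bsub>I (Suc j)\<^esub>" by (rule lin_zero[OF modI modI lin_d])
lemma factor:
  assumes "left_module R M" "fg_module R N" "submod R N S" "lin R M N p" "lin R M (I j) f"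
    "\<And>x. x \<in> carrier M \<Longrightarrow> p x \<in> S \<Longrightarrow> f x = \<zero>\<^bsub>I j\<^esub>"
  obtains g where "lin R N (I j) g" "\<And>s. s \<in> S \<Longrightarrow> g s = \<zero>\<^bsub>I j\<^esub>" "\<And>x. x \<in> carrier M \<Longrightarrow> g (p x) = f x"
proof -
  obtain c :: "'e \<Rightarrow> 'a univ" where c: "inj_on c (carrier N)" using fg_module_code[OF assms(2)] .
  have N: "left_module R N" using assms(2) unfolding fg_module_def by blast
  show ?thesis by (rule injective_factor[OF inj assms(1) N c assms(3-6)]) (assumption+, rule that)
qed

text \<open>\<open>ext_vanishes i N S\<close> says that \<open>Ext\<^sup>i\<^sup>+\<^sup>1(N/S, R) = 0\<close>, computed with the injective resolution. Working with
  pairs \<open>(N, S)\<close> avoids quotient modules.\<close>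

definition cocycle :: "nat \<Rightarrow> ('a, 'n, 'e) module_scheme \<Rightarrow> 'n set \<Rightarrow> ('n \<Rightarrow> 'a univ) \<Rightarrow> bool" where
  "cocycle j N S f \<longleftrightarrow> lin R N (I j) f \<and> (\<forall>s\<in>S. f s = \<zero>\<^bsub>I j\<^esub>) \<and> (\<forall>x\<in>carrier N. d j (f x) = \<zero>\<^bsub>I (Suc j)\<^esub>)"

definition ext_vanishes :: "nat \<Rightarrow> ('a, 'n, 'e) module_scheme \<Rightarrow> 'n set \<Rightarrow> bool" where
  "ext_vanishes i N S \<longleftrightarrow> (\<forall>f. cocycle (Suc i) N S f \<longrightarrow>
     (\<exists>g. lin R N (I i) g \<and> (\<forall>s\<in>S. g s = \<zero>\<^bsub>I i\<^esub>) \<and> (\<forall>x\<in>carrier N. f x = d i (g x))))"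

lemma ext_vanishesD:
  assumes "ext_vanishes i N S" "lin R N (I (Suc i)) f" "\<And>s. s \<in> S \<Longrightarrow> f s = \<zero>\<^bsub>I (Suc i)\<^esub>"
    "\<And>x. x \<in> carrier N \<Longrightarrow> d (Suc i) (f x) = \<zero>\<^bsub>I (Suc (Suc i))\<^esub>"
  obtains g where "lin R N (I i) g" "\<And>s. s \<in> S \<Longrightarrow> g s = \<zero>\<^bsub>I i\<^esub>" "\<And>x. x \<in> carrier N \<Longrightarrow> d i (g x) = f x"
proof -
  have "cocycle (Suc i) N S f" unfolding cocycle_def using assms(2-4) by blast
  from assms(1)[unfolded ext_vanishes_def, THEN spec, THEN mp, OF this]
  obtain g where "lin R N (I i) g \<and> (\<forall>s\<in>S. g s = \<zero>\<^bsub>I i\<^esub>) \<and> (\<forall>x\<in>carrier N. f x = d i (g x))" ..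
  then show ?thesis by (intro that[of g]) auto
qed

lemma ext_vanishesI:
  assumes "\<And>f. lin R N (I (Suc i)) f \<Longrightarrow> (\<And>s. s \<in> S \<Longrightarrow> f s = \<zero>\<^bsub>I (Suc i)\<^esub>) \<Longrightarrow>
    (\<And>x. x \<in> carrier N \<Longrightarrow> d (Suc i) (f x) = \<zero>\<^bsub>I (Suc (Suc i))\<^esub>) \<Longrightarrow>
    \<exists>g. lin R N (I i) g \<and> (\<forall>s\<in>S. g s = \<zero>\<^bsub>I i\<^esub>) \<and> (\<forall>x\<in>carrier N. f x = d i (g x))"
  shows "ext_vanishes i N S"
  unfolding ext_vanishes_def cocycle_def using assms by auto

lemma ext_vanishes_zero_module:
  assumes "zero_module (I (Suc i))" "left_module R N" shows "ext_vanishes i N S"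
proof (rule ext_vanishesI)
  fix f assume f: "lin R N (I (Suc i)) f"
  have "f x = \<zero>\<^bsub>I (Suc i)\<^esub>" if "x \<in> carrier N" for x
    using lin_closed[OF f that] assms(1) unfolding zero_module_def by simp
  then show "\<exists>g. lin R N (I i) g \<and> (\<forall>s\<in>S. g s = \<zero>\<^bsub>I i\<^esub>) \<and> (\<forall>x\<in>carrier N. f x = d i (g x))"
    using lin_zero_map[OF assms(2) modI] d_zero by (intro exI[of _ "\<lambda>x. \<zero>\<^bsub>I i\<^esub>"]) auto
qed

lemma ext_vanishes_carrier:
  assumes "left_module R N" shows "ext_vanishes i N (carrier N)"
proof (rule ext_vanishesI)
  fix f assume "\<And>s. s \<in> carrier N \<Longrightarrow> f s = \<zero>\<^bsub>I (Suc i)\<^esub>"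
  then show "\<exists>g. lin R N (I i) g \<and> (\<forall>s\<in>carrier N. g s = \<zero>\<^bsub>I i\<^esub>) \<and> (\<forall>x\<in>carrier N. f x = d i (g x))"
    using lin_zero_map[OF assms modI] d_zero by (intro exI[of _ "\<lambda>x. \<zero>\<^bsub>I i\<^esub>"]) auto
qed

text \<open>By exactness f takes values in the image of d, and a map from a free module lifts along
  the surjection onto that image.\<close>

lemma lift_free:
  assumes "lin R (free_mod R m) (I (Suc i)) f"
    "\<And>x. x \<in> carrier (free_mod R m) \<Longrightarrow> d (Suc i) (f x) = \<zero>\<^bsub>I (Suc (Suc i))\<^esub>"
  obtains g where "lin R (free_mod R m) (I i) g" "\<And>x. x \<in> carrier (free_mod R m) \<Longrightarrow> d i (g x) = f x"
proof -
  let ?F = "free_mod R m" and ?K = "d i ` carrier (I i)"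
  let ?N = "I (Suc i)\<lparr>carrier := ?K\<rparr>"
  have "submod R (I (Suc i)) ?K"
    by (rule submod_image[OF modI modI lin_d left_module.submod_carrier[OF modI]])
  then have N: "left_module R ?N" by (rule left_module.submod_module[OF modI])
  have dN: "lin R (I i) ?N (d i)" using lin_d[of i] unfolding lin_def by auto
  have "f x \<in> ?K" if "x \<in> carrier ?F" for x unfolding im_d using assms(2)[OF that] lin_closed[OF assms(1) that] by auto
  then have fN: "lin R ?F ?N f" using assms(1) unfolding lin_def by auto
  show ?thesis by (rule free_mod_lift[OF ring modI N dN _ fN]) (simp, rule that)
qed

lemma ext_vanishes_free: "ext_vanishes i (free_mod R m) {\<zero>\<^bsub>free_mod R m\<^esub>}"
proof (rule ext_vanishesI)
  let ?F = "free_mod R m"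
  fix f assume f: "lin R ?F (I (Suc i)) f" "\<And>x. x \<in> carrier ?F \<Longrightarrow> d (Suc i) (f x) = \<zero>\<^bsub>I (Suc (Suc i))\<^esub>"
  obtain g where g: "lin R ?F (I i) g" "\<And>x. x \<in> carrier ?F \<Longrightarrow> d i (g x) = f x" by (rule lift_free[OF f]) auto
  then show "\<exists>g. lin R ?F (I i) g \<and> (\<forall>s\<in>{\<zero>\<^bsub>?F\<^esub>}. g s = \<zero>\<^bsub>I i\<^esub>) \<and> (\<forall>x\<in>carrier ?F. f x = d i (g x))"
    using lin_zero[OF left_module_free[OF ring] modI g(1)] by (intro exI[of _ g]) (simp del: free_mod_simps)
qed

text \<open>M modulo the preimage of S is isomorphic to N/S. Together with
  \<open>ext_vanishes_of_pullback\<close> this makes the vanishing of Ext a property of the quotient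
  and not of the pair that presents it.\<close>

lemma ext_vanishes_pullback:
  assumes "left_module R M" "fg_module R N" "submod R N S" "lin R M N p" "p ` carrier M = carrier N" "ext_vanishes i N S"
  shows "ext_vanishes i M {x \<in> carrier M. p x \<in> S}"
proof (rule ext_vanishesI)
  fix f assume f: "lin R M (I (Suc i)) f" "\<And>s. s \<in> {x \<in> carrier M. p x \<in> S} \<Longrightarrow> f s = \<zero>\<^bsub>I (Suc i)\<^esub>"
    "\<And>x. x \<in> carrier M \<Longrightarrow> d (Suc i) (f x) = \<zero>\<^bsub>I (Suc (Suc i))\<^esub>"
  obtain g where g: "lin R N (I (Suc i)) g" "\<And>s. s \<in> S \<Longrightarrow> g s = \<zero>\<^bsub>I (Suc i)\<^esub>"
    "\<And>x. x \<in> carrier M \<Longrightarrow> g (p x) = f x" by (rule factor[OF assms(1-4) f(1)]) (use f(2) in auto)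
  have dg: "d (Suc i) (g y) = \<zero>\<^bsub>I (Suc (Suc i))\<^esub>" if "y \<in> carrier N" for y
  proof -
    have "y \<in> p ` carrier M" using that assms(5) by simp
    then show ?thesis using g(3) f(3) by auto
  qed
  obtain h where h: "lin R N (I i) h" "\<And>s. s \<in> S \<Longrightarrow> h s = \<zero>\<^bsub>I i\<^esub>" "\<And>x. x \<in> carrier N \<Longrightarrow> d i (h x) = g x"
    by (rule ext_vanishesD[OF assms(6) g(1,2) dg]) auto
  show "\<exists>g. lin R M (I i) g \<and> (\<forall>s\<in>{x \<in> carrier M. p x \<in> S}. g s = \<zero>\<^bsub>I i\<^esub>) \<and> (\<forall>x\<in>carrier M. f x = d i (g x))"
    using lin_comp[OF assms(4) h(1)] h(2,3) g(3) lin_closed[OF assms(4)] by (intro exI[of _ "\<lambda>x. h (p x)"]) auto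
qed

lemma ext_vanishes_of_pullback:
  assumes "left_module R M" "fg_module R N" "submod R N S" "lin R M N p" "p ` carrier M = carrier N"
    "ext_vanishes i M {x \<in> carrier M. p x \<in> S}"
  shows "ext_vanishes i N S"
proof (rule ext_vanishesI)
  fix f assume f: "lin R N (I (Suc i)) f" "\<And>s. s \<in> S \<Longrightarrow> f s = \<zero>\<^bsub>I (Suc i)\<^esub>"
    "\<And>x. x \<in> carrier N \<Longrightarrow> d (Suc i) (f x) = \<zero>\<^bsub>I (Suc (Suc i))\<^esub>"
  obtain g where g: "lin R M (I i) g" "\<And>s. s \<in> {x \<in> carrier M. p x \<in> S} \<Longrightarrow> g s = \<zero>\<^bsub>I i\<^esub>"
    "\<And>x. x \<in> carrier M \<Longrightarrow> d i (g x) = f (p x)"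
    by (rule ext_vanishesD[OF assms(6) lin_comp[OF assms(4) f(1)]]) (use f(2,3) lin_closed[OF assms(4)] in auto)
  obtain h where h: "lin R N (I i) h" "\<And>s. s \<in> S \<Longrightarrow> h s = \<zero>\<^bsub>I i\<^esub>" "\<And>x. x \<in> carrier M \<Longrightarrow> h (p x) = g x"
    by (rule factor[OF assms(1-4) g(1)]) (use g(2) in auto)
  have "f y = d i (h y)" if "y \<in> carrier N" for y
  proof -
    have "y \<in> p ` carrier M" using that assms(5) by simp
    then show ?thesis using h(3) g(3) by auto
  qed
  then show "\<exists>g. lin R N (I i) g \<and> (\<forall>s\<in>S. g s = \<zero>\<^bsub>I i\<^esub>) \<and> (\<forall>x\<in>carrier N. f x = d i (g x))"
    using h by blast
qed

text \<open>From the long exact sequence: Ext^(i+1) of T lies between Ext^(i+1) of N and Ext^(i+2)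
  of N/T. Concretely, f extends to some g on N; then d g is a cocycle on N/T, and if h on N/T has
  the same differential, g - h is a cocycle on N.\<close>

lemma ext_vanishes_submodule:
  assumes "fg_module R N" "submod R N T" "ext_vanishes (Suc i) N T" "ext_vanishes i N {\<zero>\<^bsub>N\<^esub>}"
  shows "ext_vanishes i (N\<lparr>carrier := T\<rparr>) {\<zero>\<^bsub>N\<^esub>}"
proof (rule ext_vanishesI)
  let ?T = "N\<lparr>carrier := T\<rparr>"
  have N: "left_module R N" using assms(1) unfolding fg_module_def by blast
  interpret N: left_module R N by fact
  have mT: "left_module R ?T" by (rule N.submod_module[OF assms(2)])
  have T: "T \<subseteq> carrier N" using submodD(1)[OF assms(2)] .
  have inc: "lin R ?T N (\<lambda>x. x)" using T by (intro linI) auto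
  fix f assume f: "lin R ?T (I (Suc i)) f" "\<And>s. s \<in> {\<zero>\<^bsub>N\<^esub>} \<Longrightarrow> f s = \<zero>\<^bsub>I (Suc i)\<^esub>"
    "\<And>x. x \<in> carrier ?T \<Longrightarrow> d (Suc i) (f x) = \<zero>\<^bsub>I (Suc (Suc i))\<^esub>"
  obtain g where g: "lin R N (I (Suc i)) g" "\<And>x. x \<in> T \<Longrightarrow> g x = f x"
    by (rule factor[OF mT assms(1) N.submod_zero inc f(1)]) (use f(2) in auto)
  obtain h where h: "lin R N (I (Suc i)) h" "\<And>s. s \<in> T \<Longrightarrow> h s = \<zero>\<^bsub>I (Suc i)\<^esub>"
    "\<And>x. x \<in> carrier N \<Longrightarrow> d (Suc i) (h x) = d (Suc i) (g x)"
    by (rule ext_vanishesD[OF assms(3) lin_comp[OF g(1) lin_d]]) (use g(2) f(3) lin_closed[OF g(1)] dd in auto)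
  have gh: "lin R N (I (Suc i)) (\<lambda>x. g x \<ominus>\<^bsub>I (Suc i)\<^esub> h x)" by (rule lin_diff_map[OF N modI g(1) h(1)])
  interpret J: left_module R "I (Suc i)" by (rule modI)
  interpret J': left_module R "I (Suc (Suc i))" by (rule modI)
  obtain k where k: "lin R N (I i) k" "\<And>x. x \<in> carrier N \<Longrightarrow> d i (k x) = g x \<ominus>\<^bsub>I (Suc i)\<^esub> h x"
  proof (rule ext_vanishesD[OF assms(4) gh])
    show "g s \<ominus>\<^bsub>I (Suc i)\<^esub> h s = \<zero>\<^bsub>I (Suc i)\<^esub>" if "s \<in> {\<zero>\<^bsub>N\<^esub>}" for s
      using lin_zero[OF N modI gh] that by simp
    show "d (Suc i) (g x \<ominus>\<^bsub>I (Suc i)\<^esub> h x) = \<zero>\<^bsub>I (Suc (Suc i))\<^esub>" if x: "x \<in> carrier N" for x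
      using lin_diff[OF modI modI lin_d lin_closed[OF g(1) x] lin_closed[OF h(1) x]] h(3)[OF x]
        lin_closed[OF lin_d lin_closed[OF g(1) x]] by (simp add: J'.right_minus_eq)
  qed blast
  have "f x = d i (k x)" if "x \<in> T" for x
    using k(2)[of x] g(2)[OF that] h(2)[OF that] that subsetD[OF T that] lin_closed[OF f(1), of x]
    by (simp add: J.diff_zero)
  moreover have "lin R ?T (I i) k" by (rule lin_subset[OF k(1) T])
  ultimately show "\<exists>g. lin R ?T (I i) g \<and> (\<forall>s\<in>{\<zero>\<^bsub>N\<^esub>}. g s = \<zero>\<^bsub>I i\<^esub>) \<and> (\<forall>x\<in>carrier ?T. f x = d i (g x))"
    using lin_zero[OF N modI k(1)] by (intro exI[of _ k]) auto
qed

lemma ker_d0: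
  assumes "left_module R N" "lin R N (I 0) f" "\<And>x. x \<in> carrier N \<Longrightarrow> d 0 (f x) = \<zero>\<^bsub>I (Suc 0)\<^esub>"
  obtains g where "lin R N RR g" "\<And>x. x \<in> carrier N \<Longrightarrow> f x = \<epsilon> (g x)"
proof -
  have "\<exists>r\<in>carrier R. f x = \<epsilon> r" if "x \<in> carrier N" for x
  proof -
    have "f x \<in> \<epsilon> ` carrier R" unfolding im_\<epsilon> using assms(3)[OF that] lin_closed[OF assms(2) that] by simp
    then show ?thesis by blast
  qed
  then obtain g where g: "\<And>x. x \<in> carrier N \<Longrightarrow> g x \<in> carrier R" "\<And>x. x \<in> carrier N \<Longrightarrow> f x = \<epsilon> (g x)" by metis
  interpret N: left_module R N by fact
  have "lin R N RR g"
  proof (rule linI)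
    fix x y assume x: "x \<in> carrier N" and y: "y \<in> carrier N"
    have "\<epsilon> (g (x \<oplus>\<^bsub>N\<^esub> y)) = \<epsilon> (g x \<oplus>\<^bsub>R\<^esub> g y)"
      using lin_add[OF assms(2) x y] lin_add[OF lin_\<epsilon>, of "g x" "g y"] g x y g(2)[of "x \<oplus>\<^bsub>N\<^esub> y"] by simp
    then show "g (x \<oplus>\<^bsub>N\<^esub> y) = g x \<oplus>\<^bsub>RR\<^esub> g y"
      using inj_onD[OF inj_\<epsilon>] g(1) x y by simp
  next
    fix r x assume r: "r \<in> carrier R" and x: "x \<in> carrier N"
    have "\<epsilon> (g (r \<odot>\<^bsub>N\<^esub> x)) = \<epsilon> (r \<otimes>\<^bsub>R\<^esub> g x)"
      using lin_smult[OF assms(2) r x] lin_smult[OF lin_\<epsilon> r, of "g x"] g x r g(2)[of "r \<odot>\<^bsub>N\<^esub> x"] by simp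
    then show "g (r \<odot>\<^bsub>N\<^esub> x) = r \<odot>\<^bsub>RR\<^esub> g x"
      using inj_onD[OF inj_\<epsilon>] g(1) x r by (simp add: N.R.m_closed)
  qed (use g in auto)
  then show ?thesis using that g(2) by blast
qed

text \<open>The hypothesis is that Ext^1 of N/T vanishes. Injectivity extends f as a map h into I 0;
  d h is a cocycle on N/T, and after subtracting some k with the same differential the values of h
  lie in the image of R.\<close>

lemma ext_vanishes_extend:
  assumes "fg_module R N" "submod R N T" "ext_vanishes 0 N T" "lin R (N\<lparr>carrier := T\<rparr>) RR f"
  obtains g where "lin R N RR g" "\<And>x. x \<in> T \<Longrightarrow> g x = f x"
proof -
  let ?T = "N\<lparr>carrier := T\<rparr>"
  have N: "left_module R N" using assms(1) unfolding fg_module_def by blast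
  interpret N: left_module R N by fact
  interpret I0: left_module R "I 0" by (rule modI)
  interpret I1: left_module R "I (Suc 0)" by (rule modI)
  have mT: "left_module R ?T" by (rule N.submod_module[OF assms(2)])
  have T: "T \<subseteq> carrier N" using submodD(1)[OF assms(2)] .
  have inc: "lin R ?T N (\<lambda>x. x)" using T by (intro linI) auto
  have ef: "lin R ?T (I 0) (\<lambda>x. \<epsilon> (f x))" by (rule lin_comp[OF assms(4) lin_\<epsilon>])
  obtain h where h: "lin R N (I 0) h" "\<And>x. x \<in> T \<Longrightarrow> h x = \<epsilon> (f x)"
    by (rule factor[OF mT assms(1) N.submod_zero inc ef]) (use lin_zero[OF mT modI ef] in auto)
  have fR: "f x \<in> carrier R" if "x \<in> T" for x using lin_closed[OF assms(4), of x] that by simp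
  obtain k where k: "lin R N (I 0) k" "\<And>s. s \<in> T \<Longrightarrow> k s = \<zero>\<^bsub>I 0\<^esub>" "\<And>x. x \<in> carrier N \<Longrightarrow> d 0 (k x) = d 0 (h x)"
  proof (rule ext_vanishesD[OF assms(3) lin_comp[OF h(1) lin_d]])
    show "d 0 (h s) = \<zero>\<^bsub>I (Suc 0)\<^esub>" if "s \<in> T" for s
      using h(2)[OF that] im_\<epsilon> fR[OF that] by auto
    show "d (Suc 0) (d 0 (h x)) = \<zero>\<^bsub>I (Suc (Suc 0))\<^esub>" if "x \<in> carrier N" for x
      using dd lin_closed[OF h(1) that] by blast
  qed blast
  obtain g where g: "lin R N RR g" "\<And>x. x \<in> carrier N \<Longrightarrow> h x \<ominus>\<^bsub>I 0\<^esub> k x = \<epsilon> (g x)"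
  proof (rule ker_d0[OF N lin_diff_map[OF N modI h(1) k(1)]])
    show "d 0 (h x \<ominus>\<^bsub>I 0\<^esub> k x) = \<zero>\<^bsub>I (Suc 0)\<^esub>" if x: "x \<in> carrier N" for x
      using lin_diff[OF modI modI lin_d lin_closed[OF h(1) x] lin_closed[OF k(1) x]] k(3)[OF x]
        lin_closed[OF lin_d lin_closed[OF h(1) x]] by (simp add: I1.right_minus_eq)
  qed blast
  have "g x = f x" if x: "x \<in> T" for x
  proof -
    have "\<epsilon> (g x) = \<epsilon> (f x)"
      using g(2)[of x] h(2)[OF x] k(2)[OF x] x subsetD[OF T x] lin_closed[OF h(1), of x] by (simp add: I0.diff_zero)
    then show ?thesis using inj_onD[OF inj_\<epsilon>] fR[OF x] lin_closed[OF g(1), of x] x T by auto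
  qed
  then show ?thesis using that g(1) by blast
qed

end

lemma lin_post:
  assumes "left_module R N" "lin R P Q q"
  shows "lin R (hom_mod R N P) (hom_mod R N Q) (\<lambda>f. restrict (\<lambda>x. q (f x)) (carrier N))"
proof (rule linI)
  interpret N: left_module R N by fact
  fix f assume f: "f \<in> carrier (hom_mod R N P)"
  then show "restrict (\<lambda>x. q (f x)) (carrier N) \<in> carrier (hom_mod R N Q)"
    using lin_restrict[OF assms(1) lin_comp[OF mod_hom_lin assms(2)]] by simp
qed (auto intro!: restrict_ext simp: lin_add[OF assms(2)] lin_smult[OF assms(2)] mod_hom_closed)

lemma lin_pre:
  assumes "left_module R M" "lin R M N p"
  shows "lin R (hom_mod R N P) (hom_mod R M P) (\<lambda>f. restrict (\<lambda>x. f (p x)) (carrier M))"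
proof (rule linI)
  interpret M: left_module R M by fact
  fix f assume f: "f \<in> carrier (hom_mod R N P)"
  then show "restrict (\<lambda>x. f (p x)) (carrier M) \<in> carrier (hom_mod R M P)"
    using lin_restrict[OF assms(1) lin_comp[OF assms(2) mod_hom_lin]] by simp
qed (auto intro!: restrict_ext simp: lin_closed[OF assms(2)])

section \<open>Finite generation of Ext\<close>

context inj_res
begin

text \<open>Hom(N/S, I j), realised as a submodule of Hom(N, I j).\<close>

definition killing :: "nat \<Rightarrow> ('a, 'n, 'e) module_scheme \<Rightarrow> 'n set \<Rightarrow> ('n \<Rightarrow> 'a univ) set" where
  "killing j N S = {f \<in> mod_hom R N (I j). \<forall>s\<in>S. f s = \<zero>\<^bsub>I j\<^esub>}"

definition post_d :: "nat \<Rightarrow> ('a, 'n, 'e) module_scheme \<Rightarrow> ('n \<Rightarrow> 'a univ) \<Rightarrow> 'n \<Rightarrow> 'a univ" where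
  "post_d j N f = restrict (\<lambda>x. d j (f x)) (carrier N)"

definition cocycles :: "nat \<Rightarrow> ('a, 'n, 'e) module_scheme \<Rightarrow> 'n set \<Rightarrow> ('n \<Rightarrow> 'a univ) set" where
  "cocycles j N S = {f \<in> killing j N S. \<forall>x\<in>carrier N. d j (f x) = \<zero>\<^bsub>I (Suc j)\<^esub>}"

text \<open>Degree 0 is included, with only the zero map, so that the induction in
  \<open>fg_ext\<close> can start from Ext^0, that is, from Hom(N/S, R).\<close>

definition coboundaries :: "nat \<Rightarrow> ('a, 'n, 'e) module_scheme \<Rightarrow> 'n set \<Rightarrow> ('n \<Rightarrow> 'a univ) set" where
  "coboundaries j N S = (case j of 0 \<Rightarrow> {\<lambda>x\<in>carrier N. \<zero>\<^bsub>I 0\<^esub>} | Suc i \<Rightarrow> post_d i N ` killing i N S)"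

lemma mod_hom_module: "left_module R N \<Longrightarrow> left_module R (hom_mod R N (I j))"
  by (rule left_module_hom[OF cring _ modI])

lemma lin_post_d: "left_module R N \<Longrightarrow> lin R (hom_mod R N (I j)) (hom_mod R N (I (Suc j))) (post_d j N)"
  unfolding post_d_def by (rule lin_post[OF _ lin_d])

lemma submod_killing:
  assumes "left_module R N" "S \<subseteq> carrier N"
  shows "submod R (hom_mod R N (I j)) (killing j N S)"
proof (rule submodI)
  interpret H: left_module R "hom_mod R N (I j)" by (rule mod_hom_module[OF assms(1)])
  interpret J: left_module R "I j" by (rule modI)
  show "killing j N S \<subseteq> carrier (hom_mod R N (I j))" unfolding killing_def by auto
  show "\<zero>\<^bsub>hom_mod R N (I j)\<^esub> \<in> killing j N S" using H.zero_closed assms(2) unfolding killing_def by auto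
  fix f g assume "f \<in> killing j N S" "g \<in> killing j N S"
  then show "f \<oplus>\<^bsub>hom_mod R N (I j)\<^esub> g \<in> killing j N S"
    using H.a_closed[of f g] assms(2) unfolding killing_def by auto
next
  interpret H: left_module R "hom_mod R N (I j)" by (rule mod_hom_module[OF assms(1)])
  interpret J: left_module R "I j" by (rule modI)
  fix r f assume "r \<in> carrier R" "f \<in> killing j N S"
  then show "r \<odot>\<^bsub>hom_mod R N (I j)\<^esub> f \<in> killing j N S"
    using H.smult_closed[of r f] assms(2) unfolding killing_def by auto
qed

lemma submod_coboundaries:
  assumes "left_module R N" "S \<subseteq> carrier N"
  shows "submod R (hom_mod R N (I j)) (coboundaries j N S)"
proof (cases j)
  case 0
  then show ?thesis using left_module.submod_zero[OF mod_hom_module[OF assms(1), of 0]] by (simp add: coboundaries_def)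
next
  case (Suc i)
  then show ?thesis
    using submod_image[OF mod_hom_module[OF assms(1)] mod_hom_module[OF assms(1)] lin_post_d[OF assms(1)] submod_killing[OF assms, of i]]
    by (simp add: coboundaries_def)
qed

lemma ext_vanishes_if_cocycles_subset:
  assumes "left_module R N" "S \<subseteq> carrier N" "cocycles (Suc i) N S \<subseteq> coboundaries (Suc i) N S"
  shows "ext_vanishes i N S"
proof (rule ext_vanishesI)
  fix f assume f: "lin R N (I (Suc i)) f" "\<And>s. s \<in> S \<Longrightarrow> f s = \<zero>\<^bsub>I (Suc i)\<^esub>"
    "\<And>x. x \<in> carrier N \<Longrightarrow> d (Suc i) (f x) = \<zero>\<^bsub>I (Suc (Suc i))\<^esub>"
  have "restrict f (carrier N) \<in> killing (Suc i) N S"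
    unfolding killing_def using lin_restrict[OF assms(1) f(1)] f(2) assms(2) by auto
  then have "restrict f (carrier N) \<in> cocycles (Suc i) N S" unfolding cocycles_def using f(3) by simp
  then have "restrict f (carrier N) \<in> post_d i N ` killing i N S" using assms(3) unfolding coboundaries_def by auto
  then obtain g where g: "g \<in> killing i N S" "restrict f (carrier N) = post_d i N g" by (rule imageE) auto
  have "f x = d i (g x)" if "x \<in> carrier N" for x
    using fun_cong[OF g(2), of x] that unfolding post_d_def by simp
  then show "\<exists>g. lin R N (I i) g \<and> (\<forall>s\<in>S. g s = \<zero>\<^bsub>I i\<^esub>) \<and> (\<forall>x\<in>carrier N. f x = d i (g x))"
    using g(1) unfolding killing_def by (intro exI[of _ g]) (auto intro: mod_hom_lin)
qed

text \<open>In degree 0 the cocycles are the maps from N/K to R followed by \<epsilon>, and they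
  form the image of a submodule of the Noetherian module Hom(N, R).\<close>

lemma fg_ext_0:
  assumes "fg_module R N" "submod R N K"
  shows "fg_over R (hom_mod R N (I 0)) (coboundaries 0 N K) (cocycles 0 N K)"
proof -
  have N: "left_module R N" using assms(1) unfolding fg_module_def by blast
  have K: "K \<subseteq> carrier N" by (rule submodD(1)[OF assms(2)])
  let ?H = "hom_mod R N RR" and ?H' = "hom_mod R N (I 0)"
  have H: "noetherian_mod R ?H" by (rule noetherian_hom[OF cring assms(1) noeth])
  note mH = noetherian_modD(1)[OF H]
  let ?U = "{f \<in> mod_hom R N RR. \<forall>s\<in>K. f s = \<zero>\<^bsub>R\<^esub>}"
  interpret H: left_module R ?H by (rule mH)
  interpret R: cring R by (rule cring)
  have sU: "submod R ?H ?U"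
  proof (rule submodI)
    show "\<zero>\<^bsub>?H\<^esub> \<in> ?U" using H.zero_closed K by auto
    show "f \<oplus>\<^bsub>?H\<^esub> g \<in> ?U" if "f \<in> ?U" "g \<in> ?U" for f g using H.a_closed[of f g] that K by auto
    show "r \<odot>\<^bsub>?H\<^esub> f \<in> ?U" if "r \<in> carrier R" "f \<in> ?U" for r f using H.smult_closed[of r f] that K by auto
  qed auto
  let ?q = "\<lambda>f. restrict (\<lambda>x. \<epsilon> (f x)) (carrier N)"
  have lq: "lin R ?H ?H' ?q" by (rule lin_post[OF N lin_\<epsilon>])
  have "fg_over R ?H' (?q ` {\<zero>\<^bsub>?H\<^esub>}) (?q ` ?U)"
    by (rule fg_over_image[OF noetherian_modD(2)[OF H sU] lq mH H.submod_zero])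
  moreover have "?q ` {\<zero>\<^bsub>?H\<^esub>} = coboundaries 0 N K" using lin_zero[OF mH mod_hom_module[OF N] lq] by (simp add: coboundaries_def)
  moreover have "?q ` ?U = cocycles 0 N K"
  proof (intro subset_antisym subsetI)
    fix h assume "h \<in> ?q ` ?U"
    then obtain f where f: "f \<in> ?U" "h = ?q f" by (rule imageE) auto
    have fl: "lin R N RR f" using f(1) mod_hom_lin by blast
    have "h \<in> mod_hom R N (I 0)" unfolding f(2) by (rule lin_restrict[OF N lin_comp[OF fl lin_\<epsilon>]])
    moreover have "h s = \<zero>\<^bsub>I 0\<^esub>" if "s \<in> K" for s
      using that K f lin_zero[OF modRR modI lin_\<epsilon>] by auto
    moreover have "d 0 (h x) = \<zero>\<^bsub>I (Suc 0)\<^esub>" if "x \<in> carrier N" for x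
    proof -
      have "\<epsilon> (f x) \<in> \<epsilon> ` carrier R" using lin_closed[OF fl that] by simp
      then show ?thesis unfolding im_\<epsilon> f(2) using that by simp
    qed
    ultimately show "h \<in> cocycles 0 N K" unfolding cocycles_def killing_def by simp
  next
    fix h assume h: "h \<in> cocycles 0 N K"
    then have hl: "h \<in> mod_hom R N (I 0)" unfolding cocycles_def killing_def by simp
    obtain f where f: "lin R N RR f" "\<And>x. x \<in> carrier N \<Longrightarrow> h x = \<epsilon> (f x)"
      by (rule ker_d0[OF N mod_hom_lin[OF hl]]) (use h in \<open>auto simp: cocycles_def\<close>)
    have "f s = \<zero>\<^bsub>R\<^esub>" if s: "s \<in> K" for s
    proof -
      have "\<epsilon> (f s) = \<epsilon> \<zero>\<^bsub>R\<^esub>"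
        using h s f(2)[OF subsetD[OF K s]] lin_zero[OF modRR modI lin_\<epsilon>] unfolding cocycles_def killing_def by simp
      then show ?thesis using inj_onD[OF inj_\<epsilon>] lin_closed[OF f(1) subsetD[OF K s]] by simp
    qed
    then have "restrict f (carrier N) \<in> ?U" using lin_restrict[OF N f(1)] K by auto
    moreover have "h = ?q (restrict f (carrier N))"
      by (rule ext) (use f(2) hl in \<open>auto simp: mod_hom_iff extensional_def\<close>)
    ultimately show "h \<in> ?q ` ?U" by (intro image_eqI[of h ?q "restrict f (carrier N)"])
  qed
  ultimately show ?thesis by simp
qed

text \<open>Dimension shifting in the first argument.\<close>

lemma fg_ext:
  "submod R (free_mod R m) S \<Longrightarrow> fg_over R (hom_mod R (free_mod R m) (I j)) (coboundaries j (free_mod R m) S) (cocycles j (free_mod R m) S)"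
proof (induction j arbitrary: m S)
  case 0
  show ?case by (rule fg_ext_0[OF fg_free[OF ring] 0])
next
  case (Suc i)
  let ?F = "free_mod R m"
  have F: "left_module R ?F" "fg_module R ?F" by (rule left_module_free[OF ring], rule fg_free[OF ring])
  have S: "S \<subseteq> carrier ?F" by (rule submodD(1)[OF Suc.prems])
  obtain k u where u: "\<forall>i<k. u i \<in> carrier ?F" "lincomb ?F u k ` carrier (free_mod R k) = S"
    using fg_over_imp_lincomb[OF F(1) noetherian_modD(2)[OF noetherian_free[OF noeth] Suc.prems]] by blast
  define p where "p = lincomb ?F u k"
  define F' where "F' = free_mod R k"
  define F0 where "F0 = ?F"
  have F': "left_module R F'" unfolding F'_def by (rule left_module_free[OF ring])
  have F0: "left_module R F0" "fg_module R F0" "S \<subseteq> carrier F0" "submod R F0 S" unfolding F0_def using F S Suc.prems by auto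
  have p: "lin R F' F0 p" unfolding p_def F'_def F0_def by (rule lin_lincomb[OF F(1)]) (use u(1) in auto)
  have pS: "p ` carrier F' = S" unfolding p_def F'_def by (rule u(2))
  have pc: "p x \<in> S" if "x \<in> carrier F'" for x using pS that by blast
  \<comment> \<open>F'/K is isomorphic to S. A cocycle of degree Suc i on F0/S is d g for some g on
    the free module F0, and the restriction of g to S is a cocycle of degree i on F'/K; this
    correspondence lowers the degree.\<close>
  let ?K = "{x \<in> carrier F'. p x = \<zero>\<^bsub>F0\<^esub>}"
  have sK: "submod R F' ?K" by (rule submod_kernel[OF F' F0(1) p])
  let ?pre = "\<lambda>f. restrict (\<lambda>x. f (p x)) (carrier F')"
  let ?G = "hom_mod R F0 (I i)" and ?G' = "hom_mod R F' (I i)"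
  note G = mod_hom_module[OF F0(1), of i] and G' = mod_hom_module[OF F', of i]
  have lpre: "lin R ?G ?G' ?pre" by (rule lin_pre[OF F' p])
  have z: "submod R F0 {\<zero>\<^bsub>F0\<^esub>}" by (rule left_module.submod_zero[OF F0(1)])
  \<comment> \<open>Injectivity of I j extends maps from S, seen as F'/K, to F0.\<close>
  have ex: "\<exists>g\<in>mod_hom R F0 (I j). \<forall>x\<in>carrier F'. g (p x) = f x" if f: "f \<in> killing j F' ?K" for j f
  proof -
    have fl: "lin R F' (I j) f" using f unfolding killing_def by (auto intro: mod_hom_lin)
    obtain g where g: "lin R F0 (I j) g" "\<And>x. x \<in> carrier F' \<Longrightarrow> g (p x) = f x"
      by (rule factor[OF F' F0(2) z p fl]) (use f in \<open>auto simp: killing_def\<close>)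
    show ?thesis
      by (rule bexI[of _ "restrict g (carrier F0)"]) (use lin_restrict[OF F0(1) g(1)] g(2) lin_closed[OF p] in auto)
  qed
  have "fg_over R ?G' (coboundaries i F' ?K) (cocycles i F' ?K)" unfolding F'_def by (rule Suc.IH) (use sK F'_def in simp)
  moreover have "cocycles i F' ?K \<subseteq> ?pre ` carrier ?G"
  proof
    fix f assume f: "f \<in> cocycles i F' ?K"
    then have fV: "f \<in> killing i F' ?K" unfolding cocycles_def by simp
    obtain g where g: "g \<in> mod_hom R F0 (I i)" "\<forall>x\<in>carrier F'. g (p x) = f x" using ex[OF fV] by (rule bexE)
    have "f = ?pre g"
      by (rule ext) (use fV g(2) in \<open>auto simp: killing_def mod_hom_iff extensional_def\<close>)
    then show "f \<in> ?pre ` carrier ?G" using g(1) by (intro image_eqI[of _ _ g]) simp_all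
  qed
  \<comment> \<open>Cocycles over coboundaries are pulled back along the restriction to S, and then
    pushed forward by d. The two image computations below identify the outcome with cocycles and
    coboundaries on F0/S.\<close>
  ultimately have "fg_over R ?G {g \<in> carrier ?G. ?pre g \<in> coboundaries i F' ?K} {g \<in> carrier ?G. ?pre g \<in> cocycles i F' ?K}"
    by (intro fg_over_lift_rel[OF G G' lpre left_module.submod_carrier[OF G] submod_coboundaries[OF F']]) auto
  then have "fg_over R (hom_mod R F0 (I (Suc i))) (post_d i F0 ` {g \<in> carrier ?G. ?pre g \<in> coboundaries i F' ?K})
      (post_d i F0 ` {g \<in> carrier ?G. ?pre g \<in> cocycles i F' ?K})"
    by (rule fg_over_image[OF _ lin_post_d[OF F0(1)] G submod_vimage[OF G G' lpre submod_coboundaries[OF F']]]) auto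
  moreover have "post_d i F0 ` {g \<in> carrier ?G. ?pre g \<in> coboundaries i F' ?K} = coboundaries (Suc i) F0 S"
  proof (intro subset_antisym subsetI)
    fix f assume "f \<in> coboundaries (Suc i) F0 S"
    then obtain g where g: "g \<in> killing i F0 S" "f = post_d i F0 g" unfolding coboundaries_def by auto
    have "?pre g = \<zero>\<^bsub>?G'\<^esub>" using g(1) pc unfolding killing_def by (auto intro!: restrict_ext)
    then have "?pre g \<in> coboundaries i F' ?K" using submodD(2)[OF submod_coboundaries[OF F', of ?K i]] by simp
    then show "f \<in> post_d i F0 ` {g \<in> carrier ?G. ?pre g \<in> coboundaries i F' ?K}" using g unfolding killing_def by simp
  next
    fix f assume "f \<in> post_d i F0 ` {g \<in> carrier ?G. ?pre g \<in> coboundaries i F' ?K}"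
    then obtain g where g: "g \<in> mod_hom R F0 (I i)" "?pre g \<in> coboundaries i F' ?K" "f = post_d i F0 g" by auto
    show "f \<in> coboundaries (Suc i) F0 S"
    proof (cases i)
      case 0
      then have e: "?pre g = (\<lambda>x\<in>carrier F'. \<zero>\<^bsub>I i\<^esub>)" using g(2) unfolding coboundaries_def by simp
      have gp: "g (p x) = \<zero>\<^bsub>I i\<^esub>" if x: "x \<in> carrier F'" for x
        using fun_cong[OF e, of x] unfolding restrict_apply'[OF x] .
      have "\<forall>s\<in>S. g s = \<zero>\<^bsub>I i\<^esub>" unfolding pS[symmetric] using gp by (simp only: ball_simps) blast
      then have "g \<in> killing i F0 S" using g(1) unfolding killing_def by simp
      then show ?thesis unfolding g(3) coboundaries_def nat.case by (rule imageI)
    next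
      case (Suc l)
      have "?pre g \<in> post_d l F' ` killing l F' ?K" using g(2) unfolding coboundaries_def Suc by (simp only: nat.case)
      then obtain h where h: "?pre g = post_d l F' h" "h \<in> killing l F' ?K" by (rule imageE)
      obtain h' where h': "h' \<in> mod_hom R F0 (I l)" "\<forall>x\<in>carrier F'. h' (p x) = h x" using ex[OF h(2)] by (rule bexE)
      interpret Ii: left_module R "I i" by (rule modI)
      interpret Ii': left_module R "I (Suc i)" by (rule modI)
      have li: "lin R (I l) (I i) (d l)" using lin_d[of l] Suc by simp
      have dh: "lin R F0 (I i) (\<lambda>x. d l (h' x))" by (rule lin_comp[OF mod_hom_lin[OF h'(1)] li])
      \<comment> \<open>On S the map g agrees with the differential of h', so the difference kills
        S; and d does not see the correction because d d = 0.\<close>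
      let ?g = "restrict (\<lambda>x. g x \<ominus>\<^bsub>I i\<^esub> d l (h' x)) (carrier F0)"
      have "?g \<in> mod_hom R F0 (I i)" by (rule lin_restrict[OF F0(1) lin_diff_map[OF F0(1) modI mod_hom_lin[OF g(1)] dh]])
      moreover have "?g s = \<zero>\<^bsub>I i\<^esub>" if "s \<in> S" for s
      proof -
        have "s \<in> p ` carrier F'" using that pS by simp
        then obtain x where x: "s = p x" "x \<in> carrier F'" by (rule imageE)
        have "g (p x) = d l (h' (p x))" using fun_cong[OF h(1), of x] x(2) h'(2) unfolding post_d_def by simp
        then show ?thesis
          using x that F0(3) mod_hom_closed[OF g(1), of "p x"] by (auto simp: a_minus_def Ii.r_neg)
      qed
      ultimately have gV: "?g \<in> killing i F0 S" unfolding killing_def by simp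
      have "post_d i F0 ?g = post_d i F0 g" unfolding post_d_def
      proof (rule restrict_ext)
        fix x assume x: "x \<in> carrier F0"
        have 1: "g x \<in> carrier (I i)" "d l (h' x) \<in> carrier (I i)" using mod_hom_closed[OF g(1) x] lin_closed[OF dh x] by auto
        have 2: "d i (d l (h' x)) = \<zero>\<^bsub>I (Suc i)\<^esub>" using dd[of "h' x" l] mod_hom_closed[OF h'(1) x] Suc by simp
        show "d i (?g x) = d i (g x)"
          using x lin_diff[OF modI modI lin_d 1] 2 lin_closed[OF lin_d 1(1)] by (simp add: Ii'.diff_zero)
      qed
      then show ?thesis using gV g(3) unfolding coboundaries_def by (auto intro!: image_eqI[of _ _ ?g])
    qed
  qed
  moreover have "post_d i F0 ` {g \<in> carrier ?G. ?pre g \<in> cocycles i F' ?K} = cocycles (Suc i) F0 S"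
  proof (intro subset_antisym subsetI)
    fix f assume "f \<in> post_d i F0 ` {g \<in> carrier ?G. ?pre g \<in> cocycles i F' ?K}"
    then obtain g where g: "g \<in> mod_hom R F0 (I i)" "?pre g \<in> cocycles i F' ?K" "f = post_d i F0 g" by auto
    have "f \<in> mod_hom R F0 (I (Suc i))" unfolding g(3) post_d_def
      by (rule lin_restrict[OF F0(1) lin_comp[OF mod_hom_lin[OF g(1)] lin_d]])
    moreover have "f s = \<zero>\<^bsub>I (Suc i)\<^esub>" if "s \<in> S" for s
    proof -
      have "s \<in> p ` carrier F'" using that pS by simp
      then obtain x where x: "s = p x" "x \<in> carrier F'" by (rule imageE)
      show ?thesis using g(2,3) x lin_closed[OF p x(2)] unfolding cocycles_def post_d_def by simp
    qed
    moreover have "d (Suc i) (f x) = \<zero>\<^bsub>I (Suc (Suc i))\<^esub>" if "x \<in> carrier F0" for x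
      using that dd mod_hom_closed[OF g(1) that] unfolding g(3) post_d_def by simp
    ultimately show "f \<in> cocycles (Suc i) F0 S" unfolding cocycles_def killing_def by simp
  next
    fix f assume f: "f \<in> cocycles (Suc i) F0 S"
    then have fl: "f \<in> mod_hom R F0 (I (Suc i))" unfolding cocycles_def killing_def by simp
    \<comment> \<open>Since F0 is free, f is a coboundary there, but g need not kill S: its
      restriction to S is the cocycle of degree i that represents f.\<close>
    obtain g where g: "lin R F0 (I i) g" "\<And>x. x \<in> carrier F0 \<Longrightarrow> d i (g x) = f x"
      unfolding F0_def
      by (rule lift_free[of m i f]) (use f fl mod_hom_lin in \<open>auto simp: cocycles_def F0_def simp del: free_mod_simps\<close>)
    let ?g = "restrict g (carrier F0)"
    have gh: "?g \<in> mod_hom R F0 (I i)" by (rule lin_restrict[OF F0(1) g(1)])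
    have "?pre ?g \<in> mod_hom R F' (I i)" using lin_closed[OF lpre, of ?g] gh by simp
    moreover have "?pre ?g x = \<zero>\<^bsub>I i\<^esub>" if "x \<in> ?K" for x
      using that lin_zero[OF F0(1) modI g(1)] left_module.submod_zero[OF F0(1)] submodD(2)[OF F0(4)] F0(3) by auto
    moreover have "d i (?pre ?g x) = \<zero>\<^bsub>I (Suc i)\<^esub>" if "x \<in> carrier F'" for x
      using that g(2) lin_closed[OF p that] f pc[OF that] unfolding cocycles_def killing_def by simp
    ultimately have "?pre ?g \<in> cocycles i F' ?K" unfolding cocycles_def killing_def by simp
    moreover have "f = post_d i F0 ?g"
      by (rule ext) (use g(2) fl in \<open>auto simp: post_d_def mod_hom_iff extensional_def\<close>)
    ultimately show "f \<in> post_d i F0 ` {g \<in> carrier ?G. ?pre g \<in> cocycles i F' ?K}" using gh by (intro image_eqI[of _ _ ?g]) auto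
  qed
  ultimately show ?case unfolding F0_def by simp
qed

text \<open>Multiplication by x embeds F/S into itself with cokernel F/(S + x F). If Ext^(i+2) of
  the cokernel vanishes, x acts surjectively on Ext^(i+1) of F/S; this is finitely generated by
  \<open>fg_ext\<close>, so Nakayama's lemma makes it zero.\<close>

lemma ext_vanishes_regular_free:
  assumes "submod R (free_mod R m) S" "in_jacobson R x" "ext_vanishes (Suc i) (free_mod R m) (add_multiples (free_mod R m) S x)"
    "\<And>n. n \<in> carrier (free_mod R m) \<Longrightarrow> x \<odot>\<^bsub>free_mod R m\<^esub> n \<in> S \<Longrightarrow> n \<in> S"
  shows "ext_vanishes i (free_mod R m) S"
proof -
  define F where "F = free_mod R m"
  have F: "left_module R F" "fg_module R F" unfolding F_def by (rule left_module_free[OF ring], rule fg_free[OF ring])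
  note a = assms[folded F_def]
  have x: "x \<in> carrier R" using a(2) unfolding in_jacobson_def by blast
  have S: "S \<subseteq> carrier F" by (rule submodD(1)[OF a(1)])
  interpret F: left_module R F by (rule F(1))
  interpret J: left_module R "I (Suc i)" by (rule modI)
  interpret J': left_module R "I (Suc (Suc i))" by (rule modI)
  let ?H = "hom_mod R F (I (Suc i))"
  interpret H: left_module R ?H by (rule mod_hom_module[OF F(1)])
  have lx: "lin R F F (\<lambda>n. x \<odot>\<^bsub>F\<^esub> n)" by (rule lin_scalar[OF cring F(1) x])
  note px = submod_add_multiples[OF cring F(1) a(1) x]
  have div: "\<exists>f'\<in>cocycles (Suc i) F S. \<exists>b\<in>coboundaries (Suc i) F S. f = x \<odot>\<^bsub>?H\<^esub> f' \<oplus>\<^bsub>?H\<^esub> b" if f: "f \<in> cocycles (Suc i) F S" for f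
  proof -
    have fh: "f \<in> mod_hom R F (I (Suc i))" and fS: "\<And>s. s \<in> S \<Longrightarrow> f s = \<zero>\<^bsub>I (Suc i)\<^esub>"
      and fd: "\<And>n. n \<in> carrier F \<Longrightarrow> d (Suc i) (f n) = \<zero>\<^bsub>I (Suc (Suc i))\<^esub>"
      using f unfolding cocycles_def killing_def by auto
    note fl = mod_hom_lin[OF fh]
    \<comment> \<open>Injectivity divides f by x. The quotient h need not be a cocycle, but d h
      kills S + x F, so the vanishing hypothesis supplies a correction e that is zero on S + x
      F.\<close>
    obtain h where h: "lin R F (I (Suc i)) h" "\<And>s. s \<in> S \<Longrightarrow> h s = \<zero>\<^bsub>I (Suc i)\<^esub>"
      "\<And>n. n \<in> carrier F \<Longrightarrow> h (x \<odot>\<^bsub>F\<^esub> n) = f n"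
      by (rule factor[OF F(1,2) a(1) lx fl]) (use fS a(4) in auto)
    have dh: "lin R F (I (Suc (Suc i))) (\<lambda>n. d (Suc i) (h n))" by (rule lin_comp[OF h(1) lin_d])
    obtain e where e: "lin R F (I (Suc i)) e" "\<And>s. s \<in> add_multiples F S x \<Longrightarrow> e s = \<zero>\<^bsub>I (Suc i)\<^esub>"
      "\<And>n. n \<in> carrier F \<Longrightarrow> d (Suc i) (e n) = d (Suc i) (h n)"
    proof (rule ext_vanishesD[OF a(3) dh])
      fix s assume "s \<in> add_multiples F S x"
      then obtain t n where t: "t \<in> S" "n \<in> carrier F" "s = t \<oplus>\<^bsub>F\<^esub> x \<odot>\<^bsub>F\<^esub> n" by (rule add_multiplesE)
      have "h s = f n"
        using lin_add[OF h(1) subsetD[OF S t(1)], of "x \<odot>\<^bsub>F\<^esub> n"] h(2)[OF t(1)] h(3)[OF t(2)] t(2,3) x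
          lin_closed[OF fl t(2)] by simp
      then show "d (Suc i) (h s) = \<zero>\<^bsub>I (Suc (Suc i))\<^esub>" using fd[OF t(2)] by simp
    next
      show "d (Suc (Suc i)) (d (Suc i) (h n)) = \<zero>\<^bsub>I (Suc (Suc (Suc i)))\<^esub>" if "n \<in> carrier F" for n
        by (rule dd[OF lin_closed[OF h(1) that]])
    qed blast
    let ?f = "restrict (\<lambda>n. h n \<ominus>\<^bsub>I (Suc i)\<^esub> e n) (carrier F)"
    have lf: "lin R F (I (Suc i)) (\<lambda>n. h n \<ominus>\<^bsub>I (Suc i)\<^esub> e n)" by (rule lin_diff_map[OF F(1) modI h(1) e(1)])
    have "?f \<in> mod_hom R F (I (Suc i))" by (rule lin_restrict[OF F(1) lf])
    moreover have "?f s = \<zero>\<^bsub>I (Suc i)\<^esub>" if "s \<in> S" for s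
      using that S h(2)[OF that] e(2)[OF subsetD[OF px(2) that]] by (auto simp: J.diff_zero)
    moreover have "d (Suc i) (?f n) = \<zero>\<^bsub>I (Suc (Suc i))\<^esub>" if n: "n \<in> carrier F" for n
      using n lin_diff[OF modI modI lin_d lin_closed[OF h(1) n] lin_closed[OF e(1) n]] e(3)[OF n]
        lin_closed[OF dh n] by (simp add: J'.right_minus_eq)
    ultimately have fZ: "?f \<in> cocycles (Suc i) F S" unfolding cocycles_def killing_def by simp
    \<comment> \<open>x (h n - e n) equals h (x n) - e (x n), where e is zero on x F. So f is x
      times a cocycle on the nose, and the coboundary term required by \<open>nakayama\<close> can
      be zero.\<close>
    have "f n = x \<odot>\<^bsub>I (Suc i)\<^esub> ?f n" if n: "n \<in> carrier F" for n
    proof -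
      have "x \<odot>\<^bsub>I (Suc i)\<^esub> ?f n = h (x \<odot>\<^bsub>F\<^esub> n) \<ominus>\<^bsub>I (Suc i)\<^esub> e (x \<odot>\<^bsub>F\<^esub> n)"
        using lin_smult[OF lf x n] n x by simp
      also have "\<dots> = f n" using h(3)[OF n] e(2)[OF px(3)[OF n]] lin_closed[OF fl n] by (simp add: J.diff_zero)
      finally show ?thesis by simp
    qed
    then have e1: "f = x \<odot>\<^bsub>?H\<^esub> ?f" by (intro ext) (use fh in \<open>auto simp: mod_hom_iff extensional_def\<close>)
    have e2: "x \<odot>\<^bsub>?H\<^esub> ?f \<in> carrier ?H" using fZ x by (intro H.smult_closed) (auto simp: cocycles_def killing_def)
    have "f = x \<odot>\<^bsub>?H\<^esub> ?f \<oplus>\<^bsub>?H\<^esub> \<zero>\<^bsub>?H\<^esub>"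
      by (rule trans[OF e1 H.r_zero[OF e2, symmetric]])
    then show ?thesis by (intro bexI[of _ ?f] bexI[of _ "\<zero>\<^bsub>?H\<^esub>"] fZ submodD(2)[OF submod_coboundaries[OF F(1) S]])
  qed
  have "cocycles (Suc i) F S = coboundaries (Suc i) F S"
    by (rule nakayama[OF cring mod_hom_module[OF F(1)] submod_coboundaries[OF F(1) S] a(2) _ div])
      (use fg_ext[OF assms(1)] F_def in auto)
  then have "ext_vanishes i F S" by (intro ext_vanishes_if_cocycles_subset[OF F(1) S]) simp
  then show ?thesis unfolding F_def .
qed

end

section \<open>Maximal ideals in a family, factorisation of maps, biduals\<close>

lemma max_submod:
  assumes "cring R" "noetherian_ring R" "P J" "\<And>J. P J \<Longrightarrow> submod R (regular_module R) J"
  obtains J' where "P J'" "\<And>K. P K \<Longrightarrow> J' \<subseteq> K \<Longrightarrow> K = J'"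
proof -
  have "\<exists>M\<in>Collect P. \<forall>X\<in>Collect P. M \<subseteq> X \<longrightarrow> X = M"
  proof (rule subset_Zorn_nonempty)
    show "Collect P \<noteq> {}" using assms(3) by auto
    fix C assume C: "C \<noteq> {}" "subset.chain (Collect P) C"
    have "C \<subseteq> {I. ideal I R}"
      using C(2) assms(4) ideal_iff_submod[OF assms(1)] unfolding pred_on.chain_def by blast
    then have "subset.chain {I. ideal I R} C" using C(2) unfolding pred_on.chain_def by blast
    then have "\<Union>C \<in> C" by (rule noetherian_ring.ideal_chain_is_trivial[OF assms(2) C(1)])
    then show "\<Union>C \<in> Collect P" using C(2) unfolding pred_on.chain_def by blast
  qed
  then show ?thesis using that by auto
qed

lemma lin_factor_surj:
  assumes "left_module A M" "left_module A N" "left_module A P" "lin A M N q" "q ` carrier M = carrier N" "lin A M P g"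
    "\<And>x. x \<in> carrier M \<Longrightarrow> q x = \<zero>\<^bsub>N\<^esub> \<Longrightarrow> g x = \<zero>\<^bsub>P\<^esub>"
  obtains h where "lin A N P h" "\<And>x. x \<in> carrier M \<Longrightarrow> h (q x) = g x"
proof -
  interpret M: left_module A M by fact
  interpret N: left_module A N by fact
  interpret P: left_module A P by fact
  have u: "g x = g y" if "x \<in> carrier M" "y \<in> carrier M" "q x = q y" for x y
  proof -
    have "q (x \<ominus>\<^bsub>M\<^esub> y) = \<zero>\<^bsub>N\<^esub>"
      using lin_diff[OF assms(1,2,4) that(1,2)] that(3) lin_closed[OF assms(4) that(2)] by (simp add: N.right_minus_eq)
    then have "g x \<ominus>\<^bsub>P\<^esub> g y = \<zero>\<^bsub>P\<^esub>"
      using assms(7)[of "x \<ominus>\<^bsub>M\<^esub> y"] lin_diff[OF assms(1,3,6) that(1,2)] that by simp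
    then show ?thesis using P.right_minus_eq lin_closed[OF assms(6)] that by simp
  qed
  define h where "h y = g (inv_into (carrier M) q y)" for y
  have i: "inv_into (carrier M) q y \<in> carrier M" "q (inv_into (carrier M) q y) = y" if "y \<in> carrier N" for y
    using that assms(5) inv_into_into[of y q "carrier M"] f_inv_into_f[of y q "carrier M"] by auto
  have h: "h (q x) = g x" if "x \<in> carrier M" for x
    unfolding h_def using that i[OF lin_closed[OF assms(4) that]] by (intro u) auto
  have "lin A N P h"
  proof (rule linI)
    fix y assume "y \<in> carrier N" then show "h y \<in> carrier P" unfolding h_def using i lin_closed[OF assms(6)] by simp
  next
    fix y z assume "y \<in> carrier N" "z \<in> carrier N"
    then obtain a b where "y = q a" "z = q b" "a \<in> carrier M" "b \<in> carrier M" using i by metis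
    then show "h (y \<oplus>\<^bsub>N\<^esub> z) = h y \<oplus>\<^bsub>P\<^esub> h z"
      using h[of "a \<oplus>\<^bsub>M\<^esub> b"] h[of a] h[of b] by (simp add: lin_add[OF assms(4)] lin_add[OF assms(6)])
  next
    fix r y assume "r \<in> carrier A" "y \<in> carrier N"
    then obtain a where "y = q a" "a \<in> carrier M" "r \<in> carrier A" using i by metis
    then show "h (r \<odot>\<^bsub>N\<^esub> y) = r \<odot>\<^bsub>P\<^esub> h y"
      using h[of "r \<odot>\<^bsub>M\<^esub> a"] h[of a] by (simp add: lin_smult[OF assms(4)] lin_smult[OF assms(6)])
  qed
  then show ?thesis using that h by blast
qed

lemma lin_inverse:
  assumes "left_module A M" "left_module A N" "lin A M N q" "inj_on q (carrier M)"
  obtains h where "lin A (N\<lparr>carrier := q ` carrier M\<rparr>) M h" "\<And>x. x \<in> carrier M \<Longrightarrow> h (q x) = x"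
proof -
  let ?N = "N\<lparr>carrier := q ` carrier M\<rparr>"
  have N: "left_module A ?N"
    by (rule left_module.submod_module[OF assms(2) submod_image[OF assms(1-3) left_module.submod_carrier[OF assms(1)]]])
  have l: "lin A M ?N q" using assms(3) unfolding lin_def by simp
  show ?thesis
  proof (rule lin_factor_surj[OF assms(1) N assms(1) l _ lin_id])
    fix x assume "x \<in> carrier M" "q x = \<zero>\<^bsub>?N\<^esub>"
    then show "x = \<zero>\<^bsub>M\<^esub>"
      using inj_onD[OF assms(4), of x "\<zero>\<^bsub>M\<^esub>"] lin_zero[OF assms(1-3)] submodD(2)[OF left_module.submod_carrier[OF assms(1)]] by simp
  qed (use that in auto)
qed

lemma lin_bidual:
  assumes "cring R" "left_module R X"
  shows "lin R X (hom_mod R (hom_mod R X (regular_module R)) (regular_module R))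
    (\<lambda>x. \<lambda>\<theta>\<in>mod_hom R X (regular_module R). \<theta> x)"
proof -
  let ?RR = "regular_module R"
  let ?DX = "hom_mod R X ?RR"
  let ?ev = "\<lambda>x. \<lambda>\<theta>\<in>mod_hom R X ?RR. \<theta> x"
  have RR: "left_module R ?RR" by (rule left_module_regular) (use assms(1) in \<open>simp add: cring_def\<close>)
  have mDX: "left_module R ?DX" by (rule left_module_hom[OF assms RR])
  show ?thesis
  proof (rule linI)
    show "?ev x \<in> carrier (hom_mod R ?DX ?RR)" if "x \<in> carrier X" for x
      using lin_restrict[OF mDX lin_eval[OF that]] by simp
    show "?ev (x \<oplus>\<^bsub>X\<^esub> y) = ?ev x \<oplus>\<^bsub>hom_mod R ?DX ?RR\<^esub> ?ev y" if "x \<in> carrier X" "y \<in> carrier X" for x y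
      unfolding hom_mod_simps using that by (intro restrict_ext) (simp add: lin_add[OF mod_hom_lin])
    show "?ev (r \<odot>\<^bsub>X\<^esub> x) = r \<odot>\<^bsub>hom_mod R ?DX ?RR\<^esub> ?ev x" if "r \<in> carrier R" "x \<in> carrier X" for r x
      unfolding hom_mod_simps using that by (intro restrict_ext) (simp add: lin_smult[OF mod_hom_lin])
  qed
qed

text \<open>If h is the sum of maps x \<mapsto> c x n, then \<theta> after h is the sum of the
  \<theta>(n) c, so \<Psi> sends it to \<theta> of the sum of the \<Psi>(c) n. With h the identity
  of a free module this says that each functional on its dual is an evaluation.\<close>

lemma finite_rank_bidual:
  assumes "finite_rank R M N h" "cring R" "left_module R M" "left_module R N" "lin R (hom_mod R M (regular_module R)) (regular_module R) \<Psi>"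
  shows "\<exists>n\<in>carrier N. \<forall>\<theta>\<in>mod_hom R N (regular_module R). \<Psi> (restrict (\<lambda>x. \<theta> (h x)) (carrier M)) = \<theta> n"
  using assms(1)
proof induction
  case (zero f)
  let ?RR = "regular_module R"
  interpret R: cring R by fact
  have RR: "left_module R ?RR" by (rule left_module_regular) (rule R.ring_axioms)
  interpret N: left_module R N by fact
  have "\<Psi> (restrict (\<lambda>x. \<theta> (f x)) (carrier M)) = \<theta> \<zero>\<^bsub>N\<^esub>" if t: "\<theta> \<in> mod_hom R N ?RR" for \<theta>
  proof -
    have z: "\<theta> \<zero>\<^bsub>N\<^esub> = \<zero>\<^bsub>R\<^esub>" using lin_zero[OF assms(4) RR mod_hom_lin[OF t]] by simp
    have "restrict (\<lambda>x. \<theta> (f x)) (carrier M) = \<zero>\<^bsub>hom_mod R M ?RR\<^esub>"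
      using zero z by (auto intro!: restrict_ext)
    then show ?thesis using lin_zero[OF left_module_hom[OF assms(2,3) RR] RR assms(5)] z by simp
  qed
  then show ?case using N.zero_closed by blast
next
  case (step h c n f)
  let ?RR = "regular_module R"
  interpret R: cring R by fact
  have RR: "left_module R ?RR" by (rule left_module_regular) (rule R.ring_axioms)
  interpret N: left_module R N by fact
  obtain k where k: "k \<in> carrier N" "\<forall>\<theta>\<in>mod_hom R N ?RR. \<Psi> (restrict (\<lambda>x. \<theta> (h x)) (carrier M)) = \<theta> k"
    using step.IH by (rule bexE)
  let ?c = "restrict c (carrier M)"
  have c: "?c \<in> mod_hom R M ?RR" by (rule lin_restrict[OF assms(3) step.hyps(2)])
  have hl: "lin R M N h" by (rule finite_rank_lin[OF step.hyps(1) assms(3,4)])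
  have pc: "\<Psi> ?c \<in> carrier R" using lin_closed[OF assms(5), of ?c] c by simp
  have "\<Psi> (restrict (\<lambda>x. \<theta> (f x)) (carrier M)) = \<theta> (k \<oplus>\<^bsub>N\<^esub> \<Psi> ?c \<odot>\<^bsub>N\<^esub> n)" if t: "\<theta> \<in> mod_hom R N ?RR" for \<theta>
  proof -
    note tl = mod_hom_lin[OF t]
    have tn: "\<theta> n \<in> carrier R" using mod_hom_closed[OF t step.hyps(3)] by simp
    let ?th = "restrict (\<lambda>x. \<theta> (h x)) (carrier M)"
    have th: "?th \<in> mod_hom R M ?RR" by (rule lin_restrict[OF assms(3) lin_comp[OF hl tl]])
    have "restrict (\<lambda>x. \<theta> (f x)) (carrier M) = ?th \<oplus>\<^bsub>hom_mod R M ?RR\<^esub> \<theta> n \<odot>\<^bsub>hom_mod R M ?RR\<^esub> ?c"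
    proof (simp only: hom_mod_simps, rule restrict_ext)
      fix x assume x: "x \<in> carrier M"
      have cx: "c x \<in> carrier R" "h x \<in> carrier N" using lin_closed[OF step.hyps(2) x] lin_closed[OF hl x] by auto
      show "\<theta> (f x) = ?th x \<oplus>\<^bsub>?RR\<^esub> (\<lambda>x\<in>carrier M. \<theta> n \<odot>\<^bsub>?RR\<^esub> ?c x) x"
        using x step.hyps(4)[OF x] lin_add[OF tl cx(2), of "c x \<odot>\<^bsub>N\<^esub> n"] lin_smult[OF tl cx(1) step.hyps(3)] cx(1) step.hyps(3) tn
        by (simp add: R.m_comm)
    qed
    then have "\<Psi> (restrict (\<lambda>x. \<theta> (f x)) (carrier M)) = \<Psi> ?th \<oplus>\<^bsub>R\<^esub> \<theta> n \<otimes>\<^bsub>R\<^esub> \<Psi> ?c"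
      using lin_add[OF assms(5), of ?th "\<theta> n \<odot>\<^bsub>hom_mod R M ?RR\<^esub> ?c"] lin_smult[OF assms(5) tn, of ?c] th c
        left_module.smult_closed[OF left_module_hom[OF assms(2,3) RR] tn, of ?c] by simp
    also have "\<dots> = \<theta> (k \<oplus>\<^bsub>N\<^esub> \<Psi> ?c \<odot>\<^bsub>N\<^esub> n)"
      using k t pc tn step.hyps(3) lin_add[OF tl k(1), of "\<Psi> ?c \<odot>\<^bsub>N\<^esub> n"] lin_smult[OF tl pc step.hyps(3)] by (simp add: R.m_comm)
    finally show ?thesis .
  qed
  moreover have "k \<oplus>\<^bsub>N\<^esub> \<Psi> ?c \<odot>\<^bsub>N\<^esub> n \<in> carrier N" using k(1) pc step.hyps(3) by simp
  ultimately show ?case by blast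
qed

text \<open>A map of finite rank sees its argument only through functionals. For the identity of a
  free module: functionals separate points.\<close>

lemma finite_rank_separates:
  assumes "finite_rank R M N h" "left_module R M" "x \<in> carrier M" "y \<in> carrier M"
    "\<And>c. c \<in> mod_hom R M (regular_module R) \<Longrightarrow> c x = c y"
  shows "h x = h y"
  using assms(1)
proof induction
  case (zero f)
  then show ?case using assms(3,4) by simp
next
  case (step h c n f)
  have "c x = c y" using assms(5)[OF lin_restrict[OF assms(2) step.hyps(2)]] assms(3,4) by simp
  then show ?case using step.hyps(4) step.IH assms(3,4) by simp
qed

lemma finite_rank_free_id: assumes "ring R" shows "finite_rank R (free_mod R m) (free_mod R m) (\<lambda>x. x)"
proof (rule finite_rank_cong)
  show "finite_rank R (free_mod R m) (free_mod R m) (\<lambda>x. lincomb (free_mod R m) (unit_vec R m) m x)"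
    by (rule lincomb_finite_rank[OF left_module_free[OF assms] left_module_free[OF assms] unit_vec_closed[OF assms] lin_id])
qed (use free_mod_expand[OF assms] in simp)

section \<open>Descent of vanishing from high degrees\<close>

context inj_res
begin

lemma fgD: "fg_module R N \<Longrightarrow> left_module R N" unfolding fg_module_def by blast

lemma fg_presentation:
  assumes "fg_module R N"
  obtains m p where "lin R (free_mod R m) N p" "p ` carrier (free_mod R m) = carrier N"
proof -
  obtain n u where u: "\<forall>i<n. u i \<in> carrier N" "lincomb N u n ` carrier (free_mod R n) = carrier N"
    using assms unfolding fg_module_iff by blast
  show ?thesis by (rule that[OF lin_lincomb[OF fgD[OF assms]] u(2)]) (use u(1) in auto)
qed

text \<open>Presenting N by a free module F reduces this to
  \<open>ext_vanishes_regular_free\<close>, because the preimage of S + x N is the preimage of S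
  plus x F.\<close>

lemma ext_vanishes_regular:
  assumes "fg_module R N" "submod R N S" "in_jacobson R x" "ext_vanishes (Suc i) N (add_multiples N S x)"
    "\<And>n. n \<in> carrier N \<Longrightarrow> x \<odot>\<^bsub>N\<^esub> n \<in> S \<Longrightarrow> n \<in> S"
  shows "ext_vanishes i N S"
proof -
  have N: "left_module R N" by (rule fgD[OF assms(1)])
  interpret N: left_module R N by (rule N)
  have x: "x \<in> carrier R" using assms(3) unfolding in_jacobson_def by blast
  obtain m p where p0: "lin R (free_mod R m) N p" "p ` carrier (free_mod R m) = carrier N" using fg_presentation[OF assms(1)] .
  define F where "F = free_mod R m"
  note p = p0[folded F_def]
  have F: "left_module R F" unfolding F_def by (rule left_module_free[OF ring])
  interpret F: left_module R F by (rule F)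
  let ?S = "{y \<in> carrier F. p y \<in> S}"
  have sS: "submod R F ?S" by (rule submod_vimage[OF F N p(1) assms(2)])
  have "{y \<in> carrier F. p y \<in> add_multiples N S x} = add_multiples F ?S x"
  proof (intro subset_antisym subsetI)
    fix y assume "y \<in> {y \<in> carrier F. p y \<in> add_multiples N S x}"
    then have y: "y \<in> carrier F" and "p y \<in> add_multiples N S x" by auto
    then obtain s n where sn: "s \<in> S" "n \<in> carrier N" "p y = s \<oplus>\<^bsub>N\<^esub> x \<odot>\<^bsub>N\<^esub> n" by (metis add_multiplesE)
    have "n \<in> p ` carrier F" using sn(2) p(2) by simp
    then obtain k where k: "n = p k" "k \<in> carrier F" by (rule imageE)
    have sN: "s \<in> carrier N" using submodD(3)[OF assms(2) sn(1)] .
    have xk: "x \<odot>\<^bsub>F\<^esub> k \<in> carrier F" using x k(2) by simp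
    have "p (y \<ominus>\<^bsub>F\<^esub> x \<odot>\<^bsub>F\<^esub> k) = s"
      using lin_diff[OF F N p(1) y xk] lin_smult[OF p(1) x k(2)] sn(3) k x sN sn(2)
      by (simp add: a_minus_def N.a_assoc N.r_neg)
    then have 1: "y \<ominus>\<^bsub>F\<^esub> x \<odot>\<^bsub>F\<^esub> k \<in> ?S" using sn(1) y xk by simp
    show "y \<in> add_multiples F ?S x"
      by (rule add_multiplesI[OF 1 k(2)]) (use y xk in \<open>simp add: a_minus_def F.a_assoc F.l_neg\<close>)
  next
    fix y assume "y \<in> add_multiples F ?S x"
    then obtain s n where sn: "s \<in> ?S" "n \<in> carrier F" "y = s \<oplus>\<^bsub>F\<^esub> x \<odot>\<^bsub>F\<^esub> n" by (rule add_multiplesE)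
    have "p y = p s \<oplus>\<^bsub>N\<^esub> x \<odot>\<^bsub>N\<^esub> p n"
      using sn x lin_add[OF p(1), of s "x \<odot>\<^bsub>F\<^esub> n"] lin_smult[OF p(1) x sn(2)] by simp
    then show "y \<in> {y \<in> carrier F. p y \<in> add_multiples N S x}"
      using sn x lin_closed[OF p(1) sn(2)] by (auto intro: add_multiplesI)
  qed
  then have v: "ext_vanishes (Suc i) F (add_multiples F ?S x)"
    using ext_vanishes_pullback[OF F assms(1) submod_add_multiples(1)[OF cring N assms(2) x] p assms(4)] by simp
  have "n \<in> ?S" if "n \<in> carrier F" "x \<odot>\<^bsub>F\<^esub> n \<in> ?S" for n
    using that assms(5)[OF lin_closed[OF p(1) that(1)]] lin_smult[OF p(1) x that(1)] by simp
  then have "ext_vanishes i F ?S"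
    using ext_vanishes_regular_free[OF sS[unfolded F_def] assms(3) v[unfolded F_def]] unfolding F_def by blast
  then show ?thesis by (rule ext_vanishes_of_pullback[OF F assms(1,2) p])
qed

text \<open>For x regular on N/S, Ext^(i+2) of N/(S + x N) lies between Ext^(i+1) and Ext^(i+2) of
  N/S. Starting from the ring itself, two applications bound the degrees in which R/(a) and R/(a, b)
  can have Ext.\<close>

lemma ext_vanishes_quotient:
  assumes "fg_module R N" "submod R N S" "x \<in> carrier R" "ext_vanishes i N S" "ext_vanishes (Suc i) N S"
    "\<And>n. n \<in> carrier N \<Longrightarrow> x \<odot>\<^bsub>N\<^esub> n \<in> S \<Longrightarrow> n \<in> S"
  shows "ext_vanishes (Suc i) N (add_multiples N S x)"
proof (rule ext_vanishesI)
  have N: "left_module R N" by (rule fgD[OF assms(1)])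
  interpret N: left_module R N by (rule N)
  interpret J: left_module R "I (Suc i)" by (rule modI)
  interpret J': left_module R "I (Suc (Suc i))" by (rule modI)
  note S = submodD[OF assms(2)]
  note px = submod_add_multiples[OF cring N assms(2,3)]
  have lx: "lin R N N (\<lambda>n. x \<odot>\<^bsub>N\<^esub> n)" by (rule lin_scalar[OF cring N assms(3)])
  fix f assume f: "lin R N (I (Suc (Suc i))) f" "\<And>s. s \<in> add_multiples N S x \<Longrightarrow> f s = \<zero>\<^bsub>I (Suc (Suc i))\<^esub>"
    "\<And>n. n \<in> carrier N \<Longrightarrow> d (Suc (Suc i)) (f n) = \<zero>\<^bsub>I (Suc (Suc (Suc i)))\<^esub>"
  have fS: "f s = \<zero>\<^bsub>I (Suc (Suc i))\<^esub>" if "s \<in> S" for s using f(2) px(2) that by blast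
  obtain g where g: "lin R N (I (Suc i)) g" "\<And>s. s \<in> S \<Longrightarrow> g s = \<zero>\<^bsub>I (Suc i)\<^esub>" "\<And>n. n \<in> carrier N \<Longrightarrow> d (Suc i) (g n) = f n"
    by (rule ext_vanishesD[OF assms(5) f(1) fS f(3)]) auto
  obtain e where e: "lin R N (I i) e" "\<And>s. s \<in> S \<Longrightarrow> e s = \<zero>\<^bsub>I i\<^esub>" "\<And>n. n \<in> carrier N \<Longrightarrow> d i (e n) = g (x \<odot>\<^bsub>N\<^esub> n)"
  proof (rule ext_vanishesD[OF assms(4) lin_comp[OF lx g(1)]])
    show "g (x \<odot>\<^bsub>N\<^esub> s) = \<zero>\<^bsub>I (Suc i)\<^esub>" if "s \<in> S" for s by (rule g(2)[OF S(5)[OF assms(3) that]])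
    show "d (Suc i) (g (x \<odot>\<^bsub>N\<^esub> n)) = \<zero>\<^bsub>I (Suc (Suc i))\<^esub>" if "n \<in> carrier N" for n
      using g(3)[of "x \<odot>\<^bsub>N\<^esub> n"] f(2)[OF px(3)[OF that]] that assms(3) by simp
  qed auto
  \<comment> \<open>Dividing e by x makes the differential of e' agree with g on x N, so that g
    minus this differential kills S + x N.\<close>
  obtain e' where e': "lin R N (I i) e'" "\<And>s. s \<in> S \<Longrightarrow> e' s = \<zero>\<^bsub>I i\<^esub>" "\<And>n. n \<in> carrier N \<Longrightarrow> e' (x \<odot>\<^bsub>N\<^esub> n) = e n"
    by (rule factor[OF N assms(1,2) lx e(1)]) (use e(2) assms(6) in auto)
  have de: "lin R N (I (Suc i)) (\<lambda>n. d i (e' n))" by (rule lin_comp[OF e'(1) lin_d])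
  have h: "lin R N (I (Suc i)) (\<lambda>n. g n \<ominus>\<^bsub>I (Suc i)\<^esub> d i (e' n))" by (rule lin_diff_map[OF N modI g(1) de])
  have "g t \<ominus>\<^bsub>I (Suc i)\<^esub> d i (e' t) = \<zero>\<^bsub>I (Suc i)\<^esub>" if tx: "t \<in> add_multiples N S x" for t
  proof -
    obtain s n where sn: "s \<in> S" "n \<in> carrier N" "t = s \<oplus>\<^bsub>N\<^esub> x \<odot>\<^bsub>N\<^esub> n" by (rule add_multiplesE[OF tx])
    have xn: "x \<odot>\<^bsub>N\<^esub> n \<in> carrier N" using sn(2) assms(3) by simp
    have 1: "g t = g (x \<odot>\<^bsub>N\<^esub> n)"
      using lin_add[OF g(1) S(3)[OF sn(1)] xn] g(2)[OF sn(1)] sn(3) lin_closed[OF g(1) xn] by simp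
    have "e' t = e n" using lin_add[OF e'(1) S(3)[OF sn(1)] xn] e'(2)[OF sn(1)] e'(3)[OF sn(2)] sn(3) lin_closed[OF e(1) sn(2)]
      left_module.axioms(2)[OF modI, THEN abelian_group.axioms(1), THEN abelian_monoid.l_zero] by simp
    then show ?thesis using 1 e(3)[OF sn(2)] lin_closed[OF g(1) xn] by (simp add: J.right_minus_eq)
  qed
  moreover have "f n = d (Suc i) (g n \<ominus>\<^bsub>I (Suc i)\<^esub> d i (e' n))" if n: "n \<in> carrier N" for n
    using lin_diff[OF modI modI lin_d lin_closed[OF g(1) n] lin_closed[OF de n]] g(3)[OF n] dd[OF lin_closed[OF e'(1) n]]
      lin_closed[OF f(1) n] by (simp add: J'.diff_zero)
  ultimately show "\<exists>g. lin R N (I (Suc i)) g \<and> (\<forall>s\<in>add_multiples N S x. g s = \<zero>\<^bsub>I (Suc i)\<^esub>) \<and> (\<forall>x\<in>carrier N. f x = d (Suc i) (g x))"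
    using h by blast
qed

text \<open>(S + R u)/S is the cyclic module R/(S : u), a submodule of N/S with quotient N/(S + R
  u); vanishing for the two outer terms gives it for N/S.\<close>

lemma ext_vanishes_adjoin:
  assumes "fg_module R N" "submod R N S" "u \<in> carrier N" "ext_vanishes i RR (colon R N S u)" "ext_vanishes i N (adjoin R N S u)"
  shows "ext_vanishes i N S"
proof (rule ext_vanishesI)
  have N: "left_module R N" by (rule fgD[OF assms(1)])
  interpret N: left_module R N by (rule N)
  interpret J: left_module R "I i" by (rule modI)
  interpret J': left_module R "I (Suc i)" by (rule modI)
  interpret J'': left_module R "I (Suc (Suc i))" by (rule modI)
  note S = submodD[OF assms(2)]
  note sa = submod_adjoin[OF N assms(2,3)]
  have lu: "lin R RR N (\<lambda>r. r \<odot>\<^bsub>N\<^esub> u)" by (rule lin_right_mult[OF N assms(3)])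
  fix f assume f: "lin R N (I (Suc i)) f" "\<And>s. s \<in> S \<Longrightarrow> f s = \<zero>\<^bsub>I (Suc i)\<^esub>"
    "\<And>n. n \<in> carrier N \<Longrightarrow> d (Suc i) (f n) = \<zero>\<^bsub>I (Suc (Suc i))\<^esub>"
  obtain g where g: "lin R RR (I i) g" "\<And>s. s \<in> colon R N S u \<Longrightarrow> g s = \<zero>\<^bsub>I i\<^esub>"
    "\<And>r. r \<in> carrier RR \<Longrightarrow> d i (g r) = f (r \<odot>\<^bsub>N\<^esub> u)"
    by (rule ext_vanishesD[OF assms(4) lin_comp[OF lu f(1)]]) (use f(2,3) assms(3) in \<open>auto simp: colon_def\<close>)
  obtain h where h: "lin R N (I i) h" "\<And>s. s \<in> S \<Longrightarrow> h s = \<zero>\<^bsub>I i\<^esub>" "\<And>r. r \<in> carrier RR \<Longrightarrow> h (r \<odot>\<^bsub>N\<^esub> u) = g r"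
    by (rule factor[OF modRR assms(1,2) lu g(1)]) (use g(2) in \<open>auto simp: colon_def\<close>)
  have dh: "lin R N (I (Suc i)) (\<lambda>n. d i (h n))" by (rule lin_comp[OF h(1) lin_d])
  have k: "lin R N (I (Suc i)) (\<lambda>n. f n \<ominus>\<^bsub>I (Suc i)\<^esub> d i (h n))" by (rule lin_diff_map[OF N modI f(1) dh])
  obtain e where e: "lin R N (I i) e" "\<And>s. s \<in> adjoin R N S u \<Longrightarrow> e s = \<zero>\<^bsub>I i\<^esub>"
    "\<And>n. n \<in> carrier N \<Longrightarrow> d i (e n) = f n \<ominus>\<^bsub>I (Suc i)\<^esub> d i (h n)"
  proof (rule ext_vanishesD[OF assms(5) k])
    fix t assume "t \<in> adjoin R N S u"
    then obtain s a where t: "s \<in> S" "a \<in> carrier R" "t = s \<oplus>\<^bsub>N\<^esub> a \<odot>\<^bsub>N\<^esub> u" by (rule adjoinE)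
    have au: "a \<odot>\<^bsub>N\<^esub> u \<in> carrier N" using t(2) assms(3) by simp
    have 1: "f t = f (a \<odot>\<^bsub>N\<^esub> u)"
      using lin_add[OF f(1) S(3)[OF t(1)] au] f(2)[OF t(1)] t(3) lin_closed[OF f(1) au] by simp
    have "h t = g a" using lin_add[OF h(1) S(3)[OF t(1)] au] h(2)[OF t(1)] h(3)[of a] t(2,3) lin_closed[OF g(1), of a] by simp
    then show "f t \<ominus>\<^bsub>I (Suc i)\<^esub> d i (h t) = \<zero>\<^bsub>I (Suc i)\<^esub>"
      using 1 g(3)[of a] t(2) lin_closed[OF f(1) au] by (simp add: J'.right_minus_eq)
  next
    fix n assume n: "n \<in> carrier N"
    show "d (Suc i) (f n \<ominus>\<^bsub>I (Suc i)\<^esub> d i (h n)) = \<zero>\<^bsub>I (Suc (Suc i))\<^esub>"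
      using lin_diff[OF modI modI lin_d lin_closed[OF f(1) n] lin_closed[OF dh n]] f(3)[OF n] dd[OF lin_closed[OF h(1) n]]
      by (simp add: J''.right_minus_eq)
  qed auto
  have "f n = d i (e n \<oplus>\<^bsub>I i\<^esub> h n)" if n: "n \<in> carrier N" for n
    using lin_add[OF lin_d lin_closed[OF e(1) n] lin_closed[OF h(1) n]] e(3)[OF n] lin_closed[OF f(1) n] lin_closed[OF dh n]
    by (simp add: a_minus_def J'.a_assoc J'.l_neg)
  moreover have "e s \<oplus>\<^bsub>I i\<^esub> h s = \<zero>\<^bsub>I i\<^esub>" if "s \<in> S" for s using e(2)[OF subsetD[OF sa(2) that]] h(2)[OF that] by simp
  ultimately show "\<exists>g. lin R N (I i) g \<and> (\<forall>s\<in>S. g s = \<zero>\<^bsub>I i\<^esub>) \<and> (\<forall>x\<in>carrier N. f x = d i (g x))"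
    using lin_add_map[OF N modI e(1) h(1)] by blast
qed

lemma fg_RR: "fg_module R RR" by (rule noetherian_modD(3)[OF noeth])

text \<open>Multiplication by u embeds R/(J : u) into R/J with cokernel R/(J + R u), so its Ext lies
  between that of R/J and the next one of the cokernel. With (J : u) the maximal ideal this reaches
  the residue field.\<close>

lemma ext_vanishes_colon:
  assumes "submod R RR J" "u \<in> carrier R" "ext_vanishes i RR J" "ext_vanishes (Suc i) RR (adjoin R RR J u)"
  shows "ext_vanishes i RR (colon R RR J u)"
proof (rule ext_vanishesI)
  interpret N: left_module R RR by (rule modRR)
  interpret J': left_module R "I (Suc i)" by (rule modI)
  interpret J'': left_module R "I (Suc (Suc i))" by (rule modI)
  note S = submodD[OF assms(1)]
  have u: "u \<in> carrier RR" using assms(2) by simp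
  note sa = submod_adjoin[OF modRR assms(1) u]
  have lu: "lin R RR RR (\<lambda>r. r \<odot>\<^bsub>RR\<^esub> u)" by (rule lin_right_mult[OF modRR u])
  fix f assume f: "lin R RR (I (Suc i)) f" "\<And>s. s \<in> colon R RR J u \<Longrightarrow> f s = \<zero>\<^bsub>I (Suc i)\<^esub>"
    "\<And>n. n \<in> carrier RR \<Longrightarrow> d (Suc i) (f n) = \<zero>\<^bsub>I (Suc (Suc i))\<^esub>"
  obtain h where h: "lin R RR (I (Suc i)) h" "\<And>s. s \<in> J \<Longrightarrow> h s = \<zero>\<^bsub>I (Suc i)\<^esub>"
    "\<And>r. r \<in> carrier RR \<Longrightarrow> h (r \<odot>\<^bsub>RR\<^esub> u) = f r"
    by (rule factor[OF modRR fg_RR assms(1) lu f(1)]) (use f(2) in \<open>auto simp: colon_def\<close>)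
  have dh: "lin R RR (I (Suc (Suc i))) (\<lambda>n. d (Suc i) (h n))" by (rule lin_comp[OF h(1) lin_d])
  obtain e where e: "lin R RR (I (Suc i)) e" "\<And>s. s \<in> adjoin R RR J u \<Longrightarrow> e s = \<zero>\<^bsub>I (Suc i)\<^esub>"
    "\<And>n. n \<in> carrier RR \<Longrightarrow> d (Suc i) (e n) = d (Suc i) (h n)"
  proof (rule ext_vanishesD[OF assms(4) dh])
    fix t assume "t \<in> adjoin R RR J u"
    then obtain s a where t: "s \<in> J" "a \<in> carrier R" "t = s \<oplus>\<^bsub>RR\<^esub> a \<odot>\<^bsub>RR\<^esub> u" by (rule adjoinE)
    have au: "a \<odot>\<^bsub>RR\<^esub> u \<in> carrier RR" by (rule N.smult_closed[OF t(2) u])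
    have "h t = f a"
      using lin_add[OF h(1) S(3)[OF t(1)] au] h(2)[OF t(1)] t(2,3) h(3)[of a] lin_closed[OF f(1), of a] by simp
    then show "d (Suc i) (h t) = \<zero>\<^bsub>I (Suc (Suc i))\<^esub>" using f(3)[of a] t(2) by simp
  next
    show "d (Suc (Suc i)) (d (Suc i) (h n)) = \<zero>\<^bsub>I (Suc (Suc (Suc i)))\<^esub>" if "n \<in> carrier RR" for n
      by (rule dd[OF lin_closed[OF h(1) that]])
  qed auto
  have k: "lin R RR (I (Suc i)) (\<lambda>n. h n \<ominus>\<^bsub>I (Suc i)\<^esub> e n)" by (rule lin_diff_map[OF modRR modI h(1) e(1)])
  obtain g where g: "lin R RR (I i) g" "\<And>s. s \<in> J \<Longrightarrow> g s = \<zero>\<^bsub>I i\<^esub>"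
    "\<And>n. n \<in> carrier RR \<Longrightarrow> d i (g n) = h n \<ominus>\<^bsub>I (Suc i)\<^esub> e n"
  proof (rule ext_vanishesD[OF assms(3) k])
    show "h s \<ominus>\<^bsub>I (Suc i)\<^esub> e s = \<zero>\<^bsub>I (Suc i)\<^esub>" if "s \<in> J" for s
      using h(2)[OF that] e(2)[OF subsetD[OF sa(2) that]] by (simp add: J'.diff_zero)
    show "d (Suc i) (h n \<ominus>\<^bsub>I (Suc i)\<^esub> e n) = \<zero>\<^bsub>I (Suc (Suc i))\<^esub>" if n: "n \<in> carrier RR" for n
      using lin_diff[OF modI modI lin_d lin_closed[OF h(1) n] lin_closed[OF e(1) n]] e(3)[OF n] lin_closed[OF dh n]
      by (simp add: J''.right_minus_eq)
  qed auto
  have "f r = d i (g (r \<odot>\<^bsub>RR\<^esub> u))" if r: "r \<in> carrier RR" for r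
  proof -
    have rR: "r \<in> carrier R" using r by simp
    have "r \<odot>\<^bsub>RR\<^esub> u \<in> adjoin R RR J u" by (rule submodD(5)[OF sa(1) rR sa(3)])
    then show ?thesis
      using g(3)[OF N.smult_closed[OF rR u]] h(3)[OF r] e(2) lin_closed[OF f(1) r] by (simp add: J'.diff_zero)
  qed
  moreover have "g (s \<odot>\<^bsub>RR\<^esub> u) = \<zero>\<^bsub>I i\<^esub>" if "s \<in> colon R RR J u" for s using g(2) that unfolding colon_def by simp
  ultimately show "\<exists>g. lin R RR (I i) g \<and> (\<forall>s\<in>colon R RR J u. g s = \<zero>\<^bsub>I i\<^esub>) \<and> (\<forall>x\<in>carrier RR. f x = d i (g x))"
    using lin_comp[OF lu g(1)] by blast
qed

lemma ext_vanishes_RR: "ext_vanishes i RR {\<zero>\<^bsub>R\<^esub>}"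
proof -
  let ?p = "\<lambda>f. f (0::nat)" and ?F = "free_mod R 1"
  interpret R: cring R by (rule cring)
  have p: "lin R ?F RR ?p" by (rule linI) (auto simp: PiE_iff)
  have s: "?p ` carrier ?F = carrier RR"
  proof (intro subset_antisym subsetI)
    fix r assume "r \<in> carrier RR"
    then show "r \<in> ?p ` carrier ?F" by (intro image_eqI[of _ _ "\<lambda>i\<in>{..<1}. r"]) auto
  qed (use lin_closed[OF p] in auto)
  have z: "submod R RR {\<zero>\<^bsub>R\<^esub>}" using left_module.submod_zero[OF modRR] by simp
  have "{x \<in> carrier ?F. x 0 \<in> {\<zero>\<^bsub>R\<^esub>}} = {\<zero>\<^bsub>?F\<^esub>}"
    by (auto simp: fun_eq_iff PiE_iff extensional_def)
  then show ?thesis using ext_vanishes_free[of i 1] by (intro ext_vanishes_of_pullback[OF left_module_free[OF ring] fg_RR z p s]) simp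
qed

text \<open>Adjoining generators one at a time filters N/S with cyclic quotients R/(S' : u), so
  cyclic modules suffice. The induction shrinks the part T that S must contain, from all of N, where
  N/S is zero, down to {0}.\<close>

lemma ext_vanishes_fg:
  assumes "\<And>J. submod R RR J \<Longrightarrow> ext_vanishes i RR J" "fg_module R N" "submod R N S"
  shows "ext_vanishes i N S"
proof -
  have N: "left_module R N" "fg_over R N {\<zero>\<^bsub>N\<^esub>} (carrier N)" using assms(2) unfolding fg_module_iff_fg_over by auto
  interpret N: left_module R N by fact
  have "(\<And>S. submod R N S \<Longrightarrow> T \<subseteq> S \<Longrightarrow> ext_vanishes i N S) \<Longrightarrow> submod R N S \<Longrightarrow> {\<zero>\<^bsub>N\<^esub>} \<subseteq> S \<Longrightarrow> ext_vanishes i N S"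
    if "fg_over R N {\<zero>\<^bsub>N\<^esub>} T" for T S
    using that
  proof (induction arbitrary: S)
    case (step T u)
    show ?case
    proof (rule step.IH[OF _ step.prems(2,3)])
      fix S' assume S': "submod R N S'" "T \<subseteq> S'"
      note sa = submod_adjoin[OF N(1) S'(1) step.hyps(2)]
      have "adjoin R N T u \<subseteq> adjoin R N S' u" by (rule adjoin_subset[OF sa(1) _ sa(3)]) (use S'(2) sa(2) in blast)
      then have "ext_vanishes i N (adjoin R N S' u)" by (rule step.prems(1)[OF sa(1)])
      then show "ext_vanishes i N S'"
        by (rule ext_vanishes_adjoin[OF assms(2) S'(1) step.hyps(2) assms(1)[OF submod_colon[OF N(1) S'(1) step.hyps(2)]]])
    qed
  qed
  moreover have "ext_vanishes i N S" if "submod R N S" "carrier N \<subseteq> S" for S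
    using ext_vanishes_carrier[OF N(1)] that submodD(1)[OF that(1)] by (metis subset_antisym)
  ultimately show ?thesis using N(2) assms(3) submodD(2)[OF assms(3)] by blast
qed

text \<open>Let K be maximal among the ideals that fail, and x in m but not in K. If (K : x) is
  larger than K, then neither it nor K + R x fails, and hence K does not. Otherwise x is regular on
  R/K and Nakayama's lemma applies.\<close>

lemma ext_vanishes_step:
  assumes "noetherian_ring R" "\<And>J. submod R RR J \<Longrightarrow> J = carrier R \<or> J \<subseteq> m" "submod R RR m" "\<And>x. x \<in> m \<Longrightarrow> in_jacobson R x"
    "ext_vanishes i RR m" "\<And>J. submod R RR J \<Longrightarrow> ext_vanishes (Suc i) RR J" "submod R RR J"
  shows "ext_vanishes i RR J"
proof (rule ccontr)
  let ?P = "\<lambda>J. submod R RR J \<and> \<not> ext_vanishes i RR J"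
  assume "\<not> ext_vanishes i RR J"
  then have "?P J" using assms(7) by simp
  then obtain K where K: "?P K" "\<And>K'. ?P K' \<Longrightarrow> K \<subseteq> K' \<Longrightarrow> K' = K"
    by (rule max_submod[OF cring assms(1), of ?P J]) auto
  have sK: "submod R RR K" using K(1) by simp
  interpret N: left_module R RR by (rule modRR)
  interpret R: cring R by (rule cring)
  have "K \<noteq> carrier R" using K(1) ext_vanishes_carrier[OF modRR] by auto
  then have "K \<subseteq> m" "K \<noteq> m" using assms(2)[OF sK] assms(5) K(1) by auto
  then obtain x where x: "x \<in> m" "x \<notin> K" by blast
  have xR: "x \<in> carrier RR" using submodD(3)[OF assms(3) x(1)] .
  note sa = submod_adjoin[OF modRR sK xR]
  have sc: "submod R RR (colon R RR K x)" by (rule submod_colon[OF modRR sK xR])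
  have Kc: "K \<subseteq> colon R RR K x"
  proof
    fix r assume r: "r \<in> K"
    then have rR: "r \<in> carrier R" using submodD(3)[OF sK] by simp
    have "x \<odot>\<^bsub>RR\<^esub> r \<in> K" by (rule submodD(5)[OF sK _ r]) (use xR in simp)
    then show "r \<in> colon R RR K x" unfolding colon_def using rR xR by (simp add: R.m_comm)
  qed
  have va: "ext_vanishes i RR (adjoin R RR K x)" using K(2)[OF _ sa(2)] sa(1,3) x(2) by blast
  show False
  proof (cases "colon R RR K x = K")
    case False
    then have "ext_vanishes i RR (colon R RR K x)" using K(2)[OF _ Kc] sc by blast
    then have "ext_vanishes i RR K" by (rule ext_vanishes_adjoin[OF fg_RR sK xR _ va])
    then show False using K(1) by simp
  next
    case True
    have "ext_vanishes i RR K"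
    proof (rule ext_vanishes_regular[OF fg_RR sK assms(4)[OF x(1)]])
      show "ext_vanishes (Suc i) RR (add_multiples RR K x)" by (rule assms(6)[OF submod_add_multiples(1)[OF cring modRR sK]]) (use xR in simp)
      show "n \<in> K" if "n \<in> carrier RR" "x \<odot>\<^bsub>RR\<^esub> n \<in> K" for n
        using that True xR unfolding colon_def by (auto simp: R.m_comm)
    qed
    then show False using K(1) by simp
  qed
qed

text \<open>In each degree the residue field comes first: it is R/(J0 : u), so
  \<open>ext_vanishes_colon\<close> asks only for J0 in this degree and an ideal in the next one.
  Then \<open>ext_vanishes_step\<close> covers all ideals. The index 2 stands for Ext^3, the first
  degree past the length of the sequence that will generate J0.\<close>

lemma ext_vanishes_all:
  assumes "noetherian_ring R" "\<And>J. submod R RR J \<Longrightarrow> J = carrier R \<or> J \<subseteq> m" "\<And>x. x \<in> m \<Longrightarrow> in_jacobson R x"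
    "submod R RR J0" "u \<in> carrier R" "colon R RR J0 u = m" "\<And>i. i \<ge> 2 \<Longrightarrow> ext_vanishes i RR J0"
    "\<And>i J. i \<ge> n \<Longrightarrow> ext_vanishes i RR J" "i \<ge> 2" "submod R RR J"
  shows "ext_vanishes i RR J"
proof -
  have u: "u \<in> carrier RR" using assms(5) by simp
  have sm: "submod R RR m" using submod_colon[OF modRR assms(4) u] assms(6) by simp
  \<comment> \<open>The descending induction is run on k, which bounds the distance of the degree
    below n.\<close>
  have "\<forall>i J. i \<ge> 2 \<longrightarrow> i + k \<ge> n \<longrightarrow> submod R RR J \<longrightarrow> ext_vanishes i RR J" for k
  proof (induction k)
    case 0 show ?case using assms(8) by simp
  next
    case (Suc k)
    show ?case
    proof (intro allI impI)
      fix i J assume i: "2 \<le> i" "n \<le> i + Suc k" and J: "submod R RR J"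
      have v: "ext_vanishes (Suc i) RR J" if "submod R RR J" for J using Suc i that by simp
      have "ext_vanishes i RR m"
        using ext_vanishes_colon[OF assms(4,5) assms(7)[OF i(1)] v[OF submod_adjoin(1)[OF modRR assms(4) u]]] assms(6) by simp
      then show "ext_vanishes i RR J" by (intro ext_vanishes_step[OF assms(1,2) sm assms(3) _ v J])
    qed
  qed
  from this[of n] show ?thesis using assms(9,10) by simp
qed

section \<open>Modules of depth two: vanishing of Ext and reflexivity\<close>

text \<open>N/(a, b)N has no Ext from degree 3 on, by \<open>ext_vanishes_fg\<close>. Undoing the
  reduction modulo one regular element lowers the bound by one, so N/aN has none from degree 2 on
  and N none from degree 1 on.\<close>

lemma ext_vanishes_regular_pair:
  assumes "\<forall>i J. 2 \<le> i \<longrightarrow> submod R RR J \<longrightarrow> ext_vanishes i RR J" "fg_module R N" "in_jacobson R a" "in_jacobson R b" "regular_pair R N a b"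
  shows "ext_vanishes i N {\<zero>\<^bsub>N\<^esub>}"
proof -
  have N: "left_module R N" by (rule fgD[OF assms(2)])
  interpret N: left_module R N by (rule N)
  have ab: "a \<in> carrier R" "b \<in> carrier R" using assms(3,4) unfolding in_jacobson_def by auto
  let ?a = "add_multiples N {\<zero>\<^bsub>N\<^esub>} a"
  have sa: "submod R N ?a" by (rule submod_add_multiples(1)[OF cring N N.submod_zero ab(1)])
  have v2: "ext_vanishes i N S" if "i \<ge> 2" "submod R N S" for i S
    by (rule ext_vanishes_fg[OF assms(1)[rule_format, OF that(1)] assms(2) that(2)])
  have aI: "y \<in> ?a \<longleftrightarrow> (\<exists>n\<in>carrier N. y = a \<odot>\<^bsub>N\<^esub> n)" for y
  proof
    assume "y \<in> ?a"
    then obtain n where "n \<in> carrier N" "y = \<zero>\<^bsub>N\<^esub> \<oplus>\<^bsub>N\<^esub> a \<odot>\<^bsub>N\<^esub> n" by (auto elim: add_multiplesE)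
    then show "\<exists>n\<in>carrier N. y = a \<odot>\<^bsub>N\<^esub> n" using ab by auto
  qed (use ab in \<open>auto intro: add_multiplesI\<close>)
  have rega: "n \<in> {\<zero>\<^bsub>N\<^esub>}" if "n \<in> carrier N" "a \<odot>\<^bsub>N\<^esub> n \<in> {\<zero>\<^bsub>N\<^esub>}" for n
    using assms(5) that unfolding regular_pair_def by auto
  have regb: "n \<in> ?a" if "n \<in> carrier N" "b \<odot>\<^bsub>N\<^esub> n \<in> ?a" for n
    using assms(5) that unfolding regular_pair_def aI by blast
  have a1: "ext_vanishes 1 N ?a"
    by (rule ext_vanishes_regular[OF assms(2) sa assms(4) _ regb]) (use v2 submod_add_multiples(1)[OF cring N sa ab(2)] in auto)
  have 1: "ext_vanishes 1 N {\<zero>\<^bsub>N\<^esub>}"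
    by (rule ext_vanishes_regular[OF assms(2) N.submod_zero assms(3) _ rega]) (use v2 sa in auto)
  have 0: "ext_vanishes 0 N {\<zero>\<^bsub>N\<^esub>}"
    by (rule ext_vanishes_regular[OF assms(2) N.submod_zero assms(3) _ rega]) (use a1 in auto)
  show ?thesis
  proof (cases "i \<ge> 2")
    case False
    then have "i = 0 \<or> i = 1" by auto
    then show ?thesis using 0 1 by auto
  qed (rule v2[OF _ N.submod_zero])
qed

text \<open>If \<open>F \<rightarrow> X\<close> is onto with \<open>F\<close> free and kernel \<open>K\<close>, then \<open>0 \<rightarrow> X\<^sup>* \<rightarrow> F\<^sup>* \<rightarrow> K\<^sup>* \<rightarrow> 0\<close> is exact and
  \<open>Ext\<^sup>1(K\<^sup>*, R) = 0\<close>, so that functionals on \<open>X\<^sup>*\<close> extend to \<open>F\<^sup>*\<close>.\<close>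

lemma bidual_of_presentation:
  assumes A: "\<forall>i J. 2 \<le> i \<longrightarrow> submod R RR J \<longrightarrow> ext_vanishes i RR J" and ab: "in_jacobson R a" "in_jacobson R b" "regular_pair R RR a b"
    and X: "fg_module R X" "\<And>i. ext_vanishes i X {\<zero>\<^bsub>X\<^esub>}"
    and p: "lin R (free_mod R m) X p" "p ` carrier (free_mod R m) = carrier X"
    and F: "F = free_mod R m" and K: "K = {x \<in> carrier F. p x = \<zero>\<^bsub>X\<^esub>}"
  shows "fg_module R (F\<lparr>carrier := K\<rparr>)" "ext_vanishes i (F\<lparr>carrier := K\<rparr>) {\<zero>\<^bsub>F\<^esub>}"
    "(\<lambda>f. restrict f K) ` mod_hom R F RR = mod_hom R (F\<lparr>carrier := K\<rparr>) RR"
    "\<Psi> \<in> mod_hom R (hom_mod R X RR) RR \<Longrightarrow> \<exists>x\<in>carrier X. \<forall>\<theta>\<in>mod_hom R X RR. \<Psi> \<theta> = \<theta> x"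
proof -
  let ?K = "F\<lparr>carrier := K\<rparr>"
  note pF = p[folded F]
  have mF: "left_module R F" "fg_module R F" unfolding F by (rule left_module_free[OF ring], rule fg_free[OF ring])
  have mX: "left_module R X" by (rule fgD[OF X(1)])
  interpret FF: left_module R F by (rule mF(1))
  have sK: "submod R F K" unfolding K by (rule submod_kernel[OF mF(1) mX pF(1)])
  have KF: "K \<subseteq> carrier F" by (rule submodD(1)[OF sK])
  have inc: "lin R ?K F (\<lambda>x. x)" using KF by (intro linI) auto
  have mK: "left_module R ?K" by (rule FF.submod_module[OF sK])
  have nF: "noetherian_mod R F" unfolding F by (rule noetherian_free[OF noeth])
  show fK: "fg_module R ?K"
    by (rule noetherian_modD(3)[OF noetherian_inj[OF mK nF inc]]) auto
  have vF: "ext_vanishes i F K" for i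
  proof -
    have "{x \<in> carrier F. p x \<in> {\<zero>\<^bsub>X\<^esub>}} = K" unfolding K by auto
    then show ?thesis using ext_vanishes_pullback[OF mF(1) X(1) left_module.submod_zero[OF mX] pF X(2)] by simp
  qed
  show "ext_vanishes i ?K {\<zero>\<^bsub>F\<^esub>}" by (rule ext_vanishes_submodule[OF mF(2) sK vF]) (unfold F, rule ext_vanishes_free)
  let ?DF = "hom_mod R F RR" and ?DK = "hom_mod R ?K RR" and ?DX = "hom_mod R X RR"
  let ?r = "\<lambda>f. restrict f K"
  have lr: "lin R ?DF ?DK ?r" using lin_pre[OF mK inc] by simp
  show surj: "?r ` mod_hom R F RR = mod_hom R ?K RR"
  proof (intro subset_antisym subsetI)
    fix f assume f: "f \<in> mod_hom R ?K RR"
    obtain g where g: "lin R F RR g" "\<And>x. x \<in> K \<Longrightarrow> g x = f x"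
      by (rule ext_vanishes_extend[OF mF(2) sK vF mod_hom_lin[OF f]]) auto
    have "f = ?r (restrict g (carrier F))"
      by (rule ext) (use f g(2) KF in \<open>auto simp: mod_hom_iff extensional_def\<close>)
    then show "f \<in> ?r ` mod_hom R F RR" using lin_restrict[OF mF(1) g(1)] by (intro image_eqI[of _ ?r]) auto
  qed (use lin_closed[OF lr] in auto)
  have mDF: "left_module R ?DF" by (rule left_module_hom[OF cring mF(1) modRR])
  have mDX: "left_module R ?DX" by (rule left_module_hom[OF cring mX modRR])
  have fDF: "fg_module R ?DF" by (rule noetherian_modD(3)[OF noetherian_hom[OF cring mF(2) noeth]])
  have fDK: "fg_module R ?DK" by (rule noetherian_modD(3)[OF noetherian_hom[OF cring fK noeth]])
  have abR: "a \<in> carrier R" "b \<in> carrier R" using ab(1,2) unfolding in_jacobson_def by auto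
  \<comment> \<open>The dual of K is a Hom module into R and so inherits the regular pair.\<close>
  have vDK: "ext_vanishes i ?DK {\<zero>\<^bsub>?DK\<^esub>}" for i
    by (rule ext_vanishes_regular_pair[OF A fDK ab(1,2) regular_pair_hom[OF cring mK modRR ab(3) abR]])
  \<comment> \<open>T consists of the functionals on F that vanish on K; it is the image of the dual
    of X, and the quotient by it is the dual of K.\<close>
  let ?T = "{f \<in> carrier ?DF. ?r f \<in> {\<zero>\<^bsub>?DK\<^esub>}}"
  have vT: "ext_vanishes i ?DF ?T" for i
    by (rule ext_vanishes_pullback[OF mDF fDK left_module.submod_zero[OF fgD[OF fDK]] lr _ vDK]) (use surj in simp)
  have sT: "submod R ?DF ?T"
    by (rule submod_vimage[OF mDF fgD[OF fDK] lr left_module.submod_zero[OF fgD[OF fDK]]])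
  let ?q = "\<lambda>\<theta>. restrict (\<lambda>x. \<theta> (p x)) (carrier F)"
  have lq: "lin R ?DX ?DF ?q" by (rule lin_pre[OF mF(1) pF(1)])
  have px: "\<exists>y\<in>carrier F. x = p y" if "x \<in> carrier X" for x using that pF(2) by blast
  have iq: "inj_on ?q (carrier ?DX)"
  proof (rule inj_onI)
    fix s t assume s: "s \<in> carrier ?DX" and t: "t \<in> carrier ?DX" and e: "?q s = ?q t"
    have "s x = t x" if x: "x \<in> carrier X" for x
    proof -
      obtain y where y: "y \<in> carrier F" "x = p y" using px[OF x] by blast
      then show ?thesis using fun_cong[OF e, of y] by simp
    qed
    then show "s = t" using s t by (intro mod_hom_eqI[of s R X RR t RR]) auto
  qed
  have T: "?q ` carrier ?DX = ?T"
  proof (intro subset_antisym subsetI)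
    fix f assume "f \<in> ?q ` carrier ?DX"
    then obtain s where s: "f = ?q s" "s \<in> carrier ?DX" by (rule imageE)
    have s0: "s \<zero>\<^bsub>X\<^esub> = \<zero>\<^bsub>R\<^esub>" using lin_zero[OF mX modRR mod_hom_lin] s(2) by simp
    have "?r f = \<zero>\<^bsub>?DK\<^esub>"
      unfolding s(1) hom_mod_simps using KF s0 by (auto intro!: restrict_ext simp: K)
    then show "f \<in> ?T" using lin_closed[OF lq s(2)] s(1) by simp
  next
    fix f assume f: "f \<in> ?T"
    then have fl: "lin R F RR f" using mod_hom_lin by auto
    have fK: "f x = \<zero>\<^bsub>R\<^esub>" if "x \<in> K" for x
    proof -
      have "?r f = (\<lambda>x\<in>K. \<zero>\<^bsub>R\<^esub>)" using f by simp
      from fun_cong[OF this, of x] show ?thesis using that by simp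
    qed
    obtain s where s: "lin R X RR s" "\<And>x. x \<in> carrier F \<Longrightarrow> s (p x) = f x"
      by (rule lin_factor_surj[OF mF(1) mX modRR pF fl]) (use fK K in auto)
    have "f = ?q (restrict s (carrier X))"
      by (rule ext) (use f s(2) lin_closed[OF pF(1)] in \<open>auto simp: mod_hom_iff extensional_def\<close>)
    then show "f \<in> ?q ` carrier ?DX" using lin_restrict[OF mX s(1)] by (intro image_eqI[of _ ?q]) auto
  qed
  assume Psi: "\<Psi> \<in> mod_hom R ?DX RR"
  obtain h where h: "lin R (?DF\<lparr>carrier := ?q ` carrier ?DX\<rparr>) ?DX h" "\<And>x. x \<in> carrier ?DX \<Longrightarrow> h (?q x) = x"
    by (rule lin_inverse[OF mDX mDF lq iq]) auto
  have lh: "lin R (?DF\<lparr>carrier := ?T\<rparr>) RR (\<lambda>t. \<Psi> (h t))" using lin_comp[OF h(1) mod_hom_lin[OF Psi]] unfolding T .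
  obtain \<Phi> where P: "lin R ?DF RR \<Phi>" "\<And>t. t \<in> ?T \<Longrightarrow> \<Phi> t = \<Psi> (h t)"
    by (rule ext_vanishes_extend[OF fDF sT vT lh]) auto
  \<comment> \<open>The extension of \<Psi> to the dual of the free module F is evaluation at some
    f; on functionals that come from X this is evaluation at p f.\<close>
  have "finite_rank R F F (\<lambda>x. x)" unfolding F by (rule finite_rank_free_id[OF ring])
  from finite_rank_bidual[OF this cring mF(1) mF(1) P(1)]
  obtain f where f: "f \<in> carrier F" "\<forall>\<theta>\<in>mod_hom R F RR. \<Phi> (restrict (\<lambda>x. \<theta> x) (carrier F)) = \<theta> f" by (rule bexE)
  have "\<Psi> \<theta> = \<theta> (p f)" if t: "\<theta> \<in> mod_hom R X RR" for \<theta>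
  proof -
    have tD: "\<theta> \<in> carrier ?DX" using t by simp
    have qt: "?q \<theta> \<in> mod_hom R F RR" using lin_closed[OF lq tD] by simp
    have "?q \<theta> \<in> ?T" unfolding T[symmetric] using tD by (rule imageI)
    then have "\<Psi> \<theta> = \<Phi> (?q \<theta>)" using P(2) h(2)[OF tD] by simp
    moreover have "restrict (\<lambda>x. ?q \<theta> x) (carrier F) = ?q \<theta>" by (rule ext) simp
    ultimately have "\<Psi> \<theta> = ?q \<theta> f" using bspec[OF f(2) qt] by simp
    then show ?thesis using f(1) by simp
  qed
  then show "\<exists>x\<in>carrier X. \<forall>\<theta>\<in>mod_hom R X RR. \<Psi> \<theta> = \<theta> x" using lin_closed[OF pF(1) f(1)] by blast
qed

text \<open>Each functional on the dual of X is an evaluation by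
  \<open>bidual_of_presentation\<close>. For injectivity let all functionals vanish at x = p f. Then
  evaluation at f depends only on restrictions to K, so it is a functional on the dual of K, and
  hence evaluation at some k in K. Since functionals separate points of F, f = k and x = 0.\<close>

lemma reflexive:
  assumes A: "\<forall>i J. 2 \<le> i \<longrightarrow> submod R RR J \<longrightarrow> ext_vanishes i RR J" and ab: "in_jacobson R a" "in_jacobson R b" "regular_pair R RR a b"
    and X: "fg_module R X" "\<And>i. ext_vanishes i X {\<zero>\<^bsub>X\<^esub>}"
  obtains r where "lin R (hom_mod R (hom_mod R X RR) RR) X r"
    "\<And>x. x \<in> carrier X \<Longrightarrow> r (\<lambda>\<theta>\<in>mod_hom R X RR. \<theta> x) = x"
proof -
  obtain m p where p: "lin R (free_mod R m) X p" "p ` carrier (free_mod R m) = carrier X" using fg_presentation[OF X(1)] .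
  define F where "F = free_mod R m"
  define K where "K = {x \<in> carrier F. p x = \<zero>\<^bsub>X\<^esub>}"
  note S = bidual_of_presentation[OF A ab X p F_def K_def]
  let ?K = "F\<lparr>carrier := K\<rparr>"
  let ?DF = "hom_mod R F RR" and ?DK = "hom_mod R ?K RR" and ?DX = "hom_mod R X RR" and ?r = "\<lambda>f. restrict f K"
  have mX: "left_module R X" by (rule fgD[OF X(1)])
  have mF: "left_module R F" unfolding F_def by (rule left_module_free[OF ring])
  have mK: "left_module R ?K" by (rule fgD[OF S(1)])
  interpret X: left_module R X by (rule mX)
  interpret R: cring R by (rule cring)
  have mDX: "left_module R ?DX" by (rule left_module_hom[OF cring mX modRR])
  have mDF: "left_module R ?DF" by (rule left_module_hom[OF cring mF modRR])
  have mDK: "left_module R ?DK" by (rule left_module_hom[OF cring mK modRR])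
  have mDD: "left_module R (hom_mod R ?DX RR)" by (rule left_module_hom[OF cring mDX modRR])
  have inc: "lin R ?K F (\<lambda>x. x)" by (intro linI) (auto simp: K_def)
  have lr: "lin R ?DF ?DK ?r" using lin_pre[OF mK inc] by simp
  let ?ev = "\<lambda>x. \<lambda>\<theta>\<in>mod_hom R X RR. \<theta> x"
  have lev: "lin R X (hom_mod R ?DX RR) ?ev" by (rule lin_bidual[OF cring mX])
  have evc: "?ev x \<in> mod_hom R ?DX RR" if "x \<in> carrier X" for x
    using lin_closed[OF lev that] by simp
  have ker: "x = \<zero>\<^bsub>X\<^esub>" if x: "x \<in> carrier X" and v: "\<And>\<theta>. \<theta> \<in> mod_hom R X RR \<Longrightarrow> \<theta> x = \<zero>\<^bsub>R\<^esub>" for x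
  proof -
    have "x \<in> p ` carrier F" using x p(2) unfolding F_def by simp
    then obtain f where f: "x = p f" "f \<in> carrier F" by (rule imageE)
    have gl: "lin R ?DF RR (\<lambda>\<theta>. \<theta> f)" by (rule lin_eval[OF f(2)])
    have van0: "t f = \<zero>\<^bsub>RR\<^esub>" if t: "t \<in> carrier ?DF" "?r t = \<zero>\<^bsub>?DK\<^esub>" for t
    proof -
      have tl: "lin R F RR t" using t(1) mod_hom_lin by simp
      have tK: "t k = \<zero>\<^bsub>R\<^esub>" if "k \<in> K" for k using fun_cong[OF t(2), of k] that by simp
      obtain s where s: "lin R X RR s" "\<And>x. x \<in> carrier F \<Longrightarrow> s (p x) = t x"
        by (rule lin_factor_surj[OF mF mX modRR p[folded F_def] tl]) (use tK K_def in auto)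
      show ?thesis using v[OF lin_restrict[OF mX s(1)]] s(2)[OF f(2)] f(1) x by simp
    qed
    have sj: "?r ` carrier ?DF = carrier ?DK" using S(3) by simp
    obtain \<Psi> where Psi: "lin R ?DK RR \<Psi>" "\<And>t. t \<in> carrier ?DF \<Longrightarrow> \<Psi> (?r t) = t f"
    proof (rule lin_factor_surj[OF mDF mDK modRR lr sj gl])
      show "t f = \<zero>\<^bsub>RR\<^esub>" if "t \<in> carrier ?DF" "?r t = \<zero>\<^bsub>?DK\<^esub>" for t by (rule van0[OF that])
    qed blast
    obtain m' p' where p': "lin R (free_mod R m') ?K p'" "p' ` carrier (free_mod R m') = carrier ?K"
      using fg_presentation[OF S(1)] .
    have vK: "ext_vanishes i ?K {\<zero>\<^bsub>?K\<^esub>}" for i using S(2)[of i] by simp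
    have Psi': "restrict \<Psi> (carrier ?DK) \<in> mod_hom R ?DK RR" by (rule lin_restrict[OF mDK Psi(1)])
    \<comment> \<open>The bidual statement is applied to K in place of X; its hypotheses are the
      first two conclusions for X.\<close>
    obtain k where k: "k \<in> carrier ?K" "\<forall>\<theta>\<in>mod_hom R ?K RR. restrict \<Psi> (carrier ?DK) \<theta> = \<theta> k"
      using bidual_of_presentation(4)[OF A ab S(1) vK p' refl refl Psi'] by (rule bexE)
    have kK: "k \<in> K" "k \<in> carrier F" using k(1) unfolding K_def by auto
    have "t f = t k" if t: "t \<in> mod_hom R F RR" for t
    proof -
      have rt: "?r t \<in> mod_hom R ?K RR" using lin_closed[OF lr, of t] t by simp
      show ?thesis using bspec[OF k(2) rt] Psi(2)[of t] t rt kK(1) by simp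
    qed
    then have "f = k"
      using finite_rank_separates[OF finite_rank_free_id[OF ring, of m, folded F_def] mF f(2) kK(2)] by blast
    then show "x = \<zero>\<^bsub>X\<^esub>" using f(1) kK(1) unfolding K_def by simp
  qed
  have surj: "?ev ` carrier X = carrier (hom_mod R ?DX RR)"
  proof (intro subset_antisym subsetI)
    fix \<Psi> assume "\<Psi> \<in> carrier (hom_mod R ?DX RR)"
    then have Psi: "\<Psi> \<in> mod_hom R ?DX RR" by simp
    obtain x where x: "x \<in> carrier X" "\<forall>\<theta>\<in>mod_hom R X RR. \<Psi> \<theta> = \<theta> x" using S(4)[OF Psi] by (rule bexE)
    have "\<Psi> = ?ev x" by (rule mod_hom_eqI[OF Psi evc[OF x(1)]]) (use x(2) in simp)
    then show "\<Psi> \<in> ?ev ` carrier X" using x(1) by (intro image_eqI[of _ ?ev])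
  qed (use evc in auto)
  show ?thesis
  proof (rule lin_factor_surj[OF mX mDD mX lev surj lin_id])
    fix x assume x: "x \<in> carrier X" "?ev x = \<zero>\<^bsub>hom_mod R ?DX RR\<^esub>"
    show "x = \<zero>\<^bsub>X\<^esub>"
    proof (rule ker[OF x(1)])
      fix \<theta> assume "\<theta> \<in> mod_hom R X RR"
      then show "\<theta> x = \<zero>\<^bsub>R\<^esub>" using fun_cong[OF x(2), of \<theta>] by simp
    qed
  qed (use that in auto)
qed

end

section \<open>Local rings of dimension two\<close>

text \<open>An ideal maximal among those that contain J and avoid the multiplicative set S is prime:
  if a and b lay outside it, adjoining either would meet S, and the product of two meeting points
  would lie both in S and in the ideal.\<close>

lemma prime_avoiding:
  assumes "cring R" "noetherian_ring R" "submod R (regular_module R) J" "J \<inter> S = {}" "\<one>\<^bsub>R\<^esub> \<in> S"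
    "\<And>s t. s \<in> S \<Longrightarrow> t \<in> S \<Longrightarrow> s \<otimes>\<^bsub>R\<^esub> t \<in> S"
  obtains p where "primeideal p R" "J \<subseteq> p" "p \<inter> S = {}"
proof -
  let ?RR = "regular_module R"
  interpret R: cring R by fact
  have M: "left_module R ?RR" by (rule left_module_regular) (rule R.ring_axioms)
  let ?P = "\<lambda>K. submod R ?RR K \<and> J \<subseteq> K \<and> K \<inter> S = {}"
  have "?P J" using assms(3,4) by simp
  then obtain K where K: "?P K" "\<And>K'. ?P K' \<Longrightarrow> K \<subseteq> K' \<Longrightarrow> K' = K"
    by (rule max_submod[OF assms(1,2), of ?P J]) auto
  have sK: "submod R ?RR K" using K(1) by simp
  note SK = submodD[OF sK]
  have meet: "\<exists>k\<in>K. \<exists>r\<in>carrier R. k \<oplus>\<^bsub>R\<^esub> r \<otimes>\<^bsub>R\<^esub> a \<in> S" if a: "a \<in> carrier R" "a \<notin> K" for a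
  proof -
    have aM: "a \<in> carrier ?RR" using a(1) by simp
    note sa = submod_adjoin[OF M sK aM]
    have "\<not> ?P (adjoin R ?RR K a)" using K(2)[of "adjoin R ?RR K a"] sa a(2) by auto
    then obtain y where y: "y \<in> adjoin R ?RR K a" "y \<in> S" using sa K(1) by blast
    obtain k r where "k \<in> K" "r \<in> carrier R" "y = k \<oplus>\<^bsub>?RR\<^esub> r \<odot>\<^bsub>?RR\<^esub> a" using y(1) by (rule adjoinE)
    then show ?thesis using y(2) by auto
  qed
  have KR: "k \<in> carrier R" if "k \<in> K" for k using SK(3)[OF that] by simp
  have mul: "r \<otimes>\<^bsub>R\<^esub> k \<in> K" if "r \<in> carrier R" "k \<in> K" for r k using SK(5)[OF that] by simp
  have add: "k \<oplus>\<^bsub>R\<^esub> l \<in> K" if "l \<in> K" "k \<in> K" for k l using SK(4)[OF that(2,1)] by simp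
  have "primeideal K R"
  proof (rule primeidealI)
    show "ideal K R" using ideal_iff_submod[OF assms(1)] sK by simp
    show "carrier R \<noteq> K" using K(1) assms(5) by auto
    show "a \<in> K \<or> b \<in> K" if ab: "a \<in> carrier R" "b \<in> carrier R" "a \<otimes>\<^bsub>R\<^esub> b \<in> K" for a b
    proof (rule ccontr)
      assume "\<not> (a \<in> K \<or> b \<in> K)"
      then obtain k r l q where *: "k \<in> K" "r \<in> carrier R" "k \<oplus>\<^bsub>R\<^esub> r \<otimes>\<^bsub>R\<^esub> a \<in> S" "l \<in> K" "q \<in> carrier R" "l \<oplus>\<^bsub>R\<^esub> q \<otimes>\<^bsub>R\<^esub> b \<in> S"
        using meet[OF ab(1)] meet[OF ab(2)] by blast
      have "(k \<oplus>\<^bsub>R\<^esub> r \<otimes>\<^bsub>R\<^esub> a) \<otimes>\<^bsub>R\<^esub> (l \<oplus>\<^bsub>R\<^esub> q \<otimes>\<^bsub>R\<^esub> b) =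
          ((l \<oplus>\<^bsub>R\<^esub> q \<otimes>\<^bsub>R\<^esub> b) \<otimes>\<^bsub>R\<^esub> k \<oplus>\<^bsub>R\<^esub> (r \<otimes>\<^bsub>R\<^esub> a) \<otimes>\<^bsub>R\<^esub> l) \<oplus>\<^bsub>R\<^esub> (r \<otimes>\<^bsub>R\<^esub> q) \<otimes>\<^bsub>R\<^esub> (a \<otimes>\<^bsub>R\<^esub> b)"
        using KR[OF *(1)] KR[OF *(4)] *(2,5) ab(1,2) by algebra
      moreover have "\<dots> \<in> K"
        by (rule add[OF mul[OF _ ab(3)] add[OF mul[OF _ *(4)] mul[OF _ *(1)]]]) (use * ab KR in auto)
      moreover have "(k \<oplus>\<^bsub>R\<^esub> r \<otimes>\<^bsub>R\<^esub> a) \<otimes>\<^bsub>R\<^esub> (l \<oplus>\<^bsub>R\<^esub> q \<otimes>\<^bsub>R\<^esub> b) \<in> S" by (rule assms(6)[OF *(3,6)])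
      ultimately show False using K(1) by auto
    qed
  qed (rule assms(1))
  then show ?thesis using that K(1) by blast
qed

text \<open>A regular element on R/J avoids the minimal primes over J. The products of powers of z
  with elements outside p form a multiplicative set that misses J, and a prime that avoids it lies
  inside p and omits z.\<close>

lemma prime_below:
  assumes "cring R" "noetherian_ring R" "primeideal p R" "submod R (regular_module R) J" "J \<subseteq> p" "z \<in> p"
    "\<And>r. r \<in> carrier R \<Longrightarrow> z \<otimes>\<^bsub>R\<^esub> r \<in> J \<Longrightarrow> r \<in> J"
  obtains q where "primeideal q R" "J \<subseteq> q" "q \<subset> p"
proof -
  interpret p: primeideal p R by fact
  let ?S = "{s \<otimes>\<^bsub>R\<^esub> z [^]\<^bsub>R\<^esub> n | s n. s \<in> carrier R - p \<and> n \<in> (UNIV :: nat set)}"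
  have one: "\<one>\<^bsub>R\<^esub> \<in> carrier R - p" using p.one_imp_carrier p.I_notcarr by auto
  have z: "z \<in> carrier R" using assms(6) p.a_subset by auto
  have pw: "r \<in> J" if "r \<in> carrier R" "r \<otimes>\<^bsub>R\<^esub> z [^]\<^bsub>R\<^esub> (n::nat) \<in> J" for r n
    using that
  proof (induction n)
    case (Suc n)
    have "z \<otimes>\<^bsub>R\<^esub> (r \<otimes>\<^bsub>R\<^esub> z [^]\<^bsub>R\<^esub> n) = r \<otimes>\<^bsub>R\<^esub> z [^]\<^bsub>R\<^esub> Suc n"
      using Suc.prems(1) z by (simp add: p.m_ac)
    then have "r \<otimes>\<^bsub>R\<^esub> z [^]\<^bsub>R\<^esub> n \<in> J" using assms(7)[of "r \<otimes>\<^bsub>R\<^esub> z [^]\<^bsub>R\<^esub> n"] Suc.prems z by simp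
    then show ?case using Suc.IH Suc.prems(1) by simp
  qed simp
  have d: "J \<inter> ?S = {}" using pw assms(5) by blast
  have o: "\<one>\<^bsub>R\<^esub> \<in> ?S" using one by (intro CollectI exI[of _ "\<one>\<^bsub>R\<^esub>"] exI[of _ "0::nat"]) simp
  have m: "s \<otimes>\<^bsub>R\<^esub> t \<in> ?S" if st: "s \<in> ?S" "t \<in> ?S" for s t
  proof -
    obtain a n where 1: "a \<in> carrier R - p" "s = a \<otimes>\<^bsub>R\<^esub> z [^]\<^bsub>R\<^esub> (n::nat)"
      using st(1) by auto
    obtain b k where 2: "b \<in> carrier R - p" "t = b \<otimes>\<^bsub>R\<^esub> z [^]\<^bsub>R\<^esub> (k::nat)"
      using st(2) by auto
    note * = 1 2
    have "s \<otimes>\<^bsub>R\<^esub> t = (a \<otimes>\<^bsub>R\<^esub> b) \<otimes>\<^bsub>R\<^esub> z [^]\<^bsub>R\<^esub> (n + k)"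
      using * z by (simp add: p.nat_pow_mult[symmetric] p.m_ac)
    moreover have "a \<otimes>\<^bsub>R\<^esub> b \<in> carrier R - p" using * p.I_prime[of a b] by auto
    ultimately show ?thesis by blast
  qed
  obtain q where q: "primeideal q R" "J \<subseteq> q" "q \<inter> ?S = {}" by (rule prime_avoiding[OF assms(1,2,4) d o m]) auto
  interpret q: primeideal q R by (rule q(1))
  have "q \<subseteq> p"
  proof
    fix s assume s: "s \<in> q"
    have sR: "s \<in> carrier R" using s q.a_subset by auto
    show "s \<in> p"
    proof (rule ccontr)
      assume "s \<notin> p"
      then have "s \<in> ?S" using sR by (intro CollectI exI[of _ s] exI[of _ "0::nat"]) simp
      then show False using q(3) s by blast
    qed
  qed
  moreover have "z \<in> ?S" using one z by (intro CollectI exI[of _ "\<one>\<^bsub>R\<^esub>"] exI[of _ "1::nat"]) simp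
  then have "z \<notin> q" using q(3) by blast
  ultimately show ?thesis using that[OF q(1,2)] assms(6) by blast
qed

lemma noetherian_local_ringD:
  assumes "noetherian_local_ring R"
  shows "cring R" "noetherian_ring R" "maximalideal (the_maximal_ideal R) R"
    "noetherian_mod R (regular_module R)"
    "submod R (regular_module R) J \<Longrightarrow> J = carrier R \<or> J \<subseteq> the_maximal_ideal R"
    "x \<in> the_maximal_ideal R \<Longrightarrow> in_jacobson R x"
proof -
  let ?RR = "regular_module R" and ?m = "the_maximal_ideal R"
  have ex: "\<exists>!m. maximalideal m R" using assms unfolding noetherian_local_ring_def by blast
  have cr: "cring R" and nr: "noetherian_ring R" using assms unfolding noetherian_local_ring_def by blast+
  show "cring R" "noetherian_ring R" by (rule cr, rule nr)
  show mm: "maximalideal ?m R" unfolding the_maximal_ideal_def by (rule theI'[OF ex])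
  show "noetherian_mod R ?RR" by (rule noetherian_regular[OF cr nr])
  interpret R: cring R by (rule cr)
  interpret m: maximalideal ?m R by (rule mm)
  have M: "left_module R ?RR" by (rule left_module_regular) (rule R.ring_axioms)
  interpret M: left_module R ?RR by (rule M)
  have proper: "J = carrier R \<or> J \<subseteq> ?m" if J: "submod R ?RR J" for J
  proof (rule ccontr)
    assume n: "\<not> (J = carrier R \<or> J \<subseteq> ?m)"
    let ?P = "\<lambda>K. submod R ?RR K \<and> J \<subseteq> K \<and> K \<noteq> carrier R"
    have "?P J" using J n by simp
    then obtain K where K: "?P K" "\<And>K'. ?P K' \<Longrightarrow> K \<subseteq> K' \<Longrightarrow> K' = K"
      by (rule max_submod[OF cr nr, of ?P J]) auto
    have "maximalideal K R"
    proof (rule maximalidealI)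
      show "ideal K R" using K(1) ideal_iff_submod[OF cr] by blast
      show "carrier R \<noteq> K" using K(1) by auto
      show "I = K \<or> I = carrier R" if "ideal I R" "K \<subseteq> I" "I \<subseteq> carrier R" for I
        using K(2)[of I] K(1) that ideal_iff_submod[OF cr] by blast
    qed
    then have "K = ?m" using ex mm by blast
    then show False using K(1) n by blast
  qed
  show "submod R ?RR J \<Longrightarrow> J = carrier R \<or> J \<subseteq> ?m" by (rule proper)
  assume x: "x \<in> ?m"
  have xR: "x \<in> carrier R" using x m.a_subset by auto
  show "in_jacobson R x" unfolding in_jacobson_def
  proof (intro conjI ballI)
    fix r assume r: "r \<in> carrier R"
    let ?e = "\<one>\<^bsub>R\<^esub> \<ominus>\<^bsub>R\<^esub> x \<otimes>\<^bsub>R\<^esub> r"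
    have e: "?e \<in> carrier R" using xR r by simp
    have eM: "?e \<in> carrier ?RR" using e by simp
    note sa = submod_adjoin[OF M M.submod_zero eM]
    have "adjoin R ?RR {\<zero>\<^bsub>?RR\<^esub>} ?e = carrier R"
    proof (rule ccontr)
      assume "adjoin R ?RR {\<zero>\<^bsub>?RR\<^esub>} ?e \<noteq> carrier R"
      then have "?e \<in> ?m" using proper[OF sa(1)] sa(3) by blast
      moreover have "x \<otimes>\<^bsub>R\<^esub> r \<in> ?m" using m.I_r_closed[OF x r] .
      ultimately have "?e \<oplus>\<^bsub>R\<^esub> x \<otimes>\<^bsub>R\<^esub> r \<in> ?m" by (rule m.a_closed)
      moreover have "?e \<oplus>\<^bsub>R\<^esub> x \<otimes>\<^bsub>R\<^esub> r = \<one>\<^bsub>R\<^esub>" using xR r by (simp add: R.minus_eq R.a_assoc R.l_neg)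
      ultimately show False using m.one_imp_carrier m.I_notcarr by auto
    qed
    then have "\<one>\<^bsub>R\<^esub> \<in> adjoin R ?RR {\<zero>\<^bsub>?RR\<^esub>} ?e" by simp
    then obtain z a where "z \<in> {\<zero>\<^bsub>?RR\<^esub>}" and a: "a \<in> carrier R" and "\<one>\<^bsub>R\<^esub> = z \<oplus>\<^bsub>?RR\<^esub> a \<odot>\<^bsub>?RR\<^esub> ?e" by (rule adjoinE)
    then have "a \<otimes>\<^bsub>R\<^esub> ?e = \<one>\<^bsub>R\<^esub>" using e by simp
    then show "?e \<in> Units R" using a e R.m_comm[of a ?e] unfolding Units_def by auto
  qed (rule xR)
qed

lemma krull_dim_chain:
  assumes "primeideal p0 R" "primeideal p1 R" "primeideal p2 R" "primeideal p3 R" "p0 \<subset> p1" "p1 \<subset> p2" "p2 \<subset> p3"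
  shows "krull_dim R \<ge> 3"
proof -
  define p where "p i = (if i = 0 then p0 else if i = 1 then p1 else if i = 2 then p2 else p3)" for i :: nat
  have 1: "\<forall>i\<le>3. primeideal (p i) R" using assms(1-4) by (simp add: p_def)
  have 2: "\<forall>i<3. p i \<subset> p (Suc i)"
  proof (intro allI impI)
    fix i :: nat assume "i < 3"
    then consider "i = 0" | "i = 1" | "i = 2" by linarith
    then show "p i \<subset> p (Suc i)" using assms(5-7) by cases (simp_all add: p_def)
  qed
  have "enat 3 \<le> krull_dim R" unfolding krull_dim_def
    by (intro SUP_upper CollectI exI[of _ p] conjI 1 2)
  then show ?thesis by (simp add: numeral_eq_enat)
qed

text \<open>A prime over J0 other than m would have a smaller prime over (a) below it, as b is
  regular modulo a, and below that another one, as a is regular: a chain of length 3. So m is the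
  only prime over J0. An ideal maximal among the (J0 : u) with u outside J0 is prime, hence equal to
  m.\<close>

lemma exists_socle_element:
  assumes R: "noetherian_local_ring R" and kd: "krull_dim R = 2"
    and ab: "a \<in> the_maximal_ideal R" "b \<in> the_maximal_ideal R" "regular_pair R (regular_module R) a b"
    and J0: "J0 = add_multiples (regular_module R) (add_multiples (regular_module R) {\<zero>\<^bsub>R\<^esub>} a) b"
  obtains u where "u \<in> carrier R" "colon R (regular_module R) J0 u = the_maximal_ideal R"
proof -
  let ?RR = "regular_module R" and ?m = "the_maximal_ideal R"
  note lr = noetherian_local_ringD[OF R]
  interpret R: cring R by (rule lr(1))
  interpret m: maximalideal ?m R by (rule lr(3))
  have M: "left_module R ?RR" by (rule left_module_regular) (rule R.ring_axioms)
  interpret M: left_module R ?RR by (rule M)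
  have abR: "a \<in> carrier R" "b \<in> carrier R" using ab(1,2) m.a_subset by auto
  have z: "submod R ?RR {\<zero>\<^bsub>R\<^esub>}" using M.submod_zero by simp
  let ?A = "add_multiples ?RR {\<zero>\<^bsub>R\<^esub>} a"
  note pA = submod_add_multiples[OF lr(1) M z abR(1)]
  note pJ = submod_add_multiples[OF lr(1) M pA(1) abR(2), folded J0]
  have aA: "a \<in> ?A" using pA(3)[of "\<one>\<^bsub>R\<^esub>"] abR by simp
  have bJ: "b \<in> J0" using pJ(3)[of "\<one>\<^bsub>R\<^esub>"] abR by simp
  have aJ: "a \<in> J0" using aA pJ(2) by blast
  have sm: "submod R ?RR ?m" using ideal_iff_submod[OF lr(1)] m.is_ideal by blast
  have Am: "?A \<subseteq> ?m"
  proof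
    fix y assume "y \<in> ?A"
    then obtain s n where "s \<in> {\<zero>\<^bsub>R\<^esub>}" "n \<in> carrier ?RR" "y = s \<oplus>\<^bsub>?RR\<^esub> a \<odot>\<^bsub>?RR\<^esub> n" by (rule add_multiplesE)
    then show "y \<in> ?m" using m.I_r_closed[OF ab(1)] abR by simp
  qed
  have Jm: "J0 \<subseteq> ?m"
  proof
    fix y assume "y \<in> J0"
    then obtain s n where "s \<in> ?A" "n \<in> carrier ?RR" "y = s \<oplus>\<^bsub>?RR\<^esub> b \<odot>\<^bsub>?RR\<^esub> n" unfolding J0 by (rule add_multiplesE)
    then show "y \<in> ?m" using m.I_r_closed[OF ab(2)] m.a_closed[of s] Am by auto
  qed
  have AI: "y \<in> ?A \<longleftrightarrow> (\<exists>n\<in>carrier R. y = a \<otimes>\<^bsub>R\<^esub> n)" for y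
  proof
    assume "y \<in> ?A"
    then obtain s n where "s \<in> {\<zero>\<^bsub>R\<^esub>}" "n \<in> carrier ?RR" "y = s \<oplus>\<^bsub>?RR\<^esub> a \<odot>\<^bsub>?RR\<^esub> n" by (rule add_multiplesE)
    then show "\<exists>n\<in>carrier R. y = a \<otimes>\<^bsub>R\<^esub> n" using abR by auto
  qed (use pA(3) in auto)
  have only: "p = ?m" if p: "primeideal p R" "J0 \<subseteq> p" for p
  proof (rule ccontr)
    assume ne: "p \<noteq> ?m"
    interpret p: primeideal p R by (rule p(1))
    have "submod R ?RR p" using ideal_iff_submod[OF lr(1)] p.is_ideal by blast
    then have pm: "p \<subset> ?m" using lr(5)[of p] p.I_notcarr ne by blast
    have regb: "r \<in> ?A" if "r \<in> carrier R" "b \<otimes>\<^bsub>R\<^esub> r \<in> ?A" for r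
      using ab(3) that unfolding regular_pair_def AI by simp
    obtain p1 where p1: "primeideal p1 R" "?A \<subseteq> p1" "p1 \<subset> p"
      by (rule prime_below[OF lr(1,2) p(1) pA(1) _ _ regb]) (use p(2) pJ(2) bJ in auto)
    have rega: "r \<in> {\<zero>\<^bsub>R\<^esub>}" if "r \<in> carrier R" "a \<otimes>\<^bsub>R\<^esub> r \<in> {\<zero>\<^bsub>R\<^esub>}" for r
      using ab(3) that unfolding regular_pair_def by simp
    interpret p1: primeideal p1 R by (rule p1(1))
    obtain p0 where p0: "primeideal p0 R" "p0 \<subset> p1"
      by (rule prime_below[OF lr(1,2) p1(1) z _ _ rega]) (use p1(2) aA in auto)
    have "krull_dim R \<ge> 3"
      by (rule krull_dim_chain[OF p0(1) p1(1) p(1) R.maximalideal_prime[OF lr(3)] p0(2) p1(3) pm])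
    then show False using kd by (simp add: numeral_eq_enat)
  qed
  let ?P = "\<lambda>K. \<exists>u\<in>carrier R - J0. K = colon R ?RR J0 u"
  have one: "\<one>\<^bsub>R\<^esub> \<notin> J0" using Jm m.one_imp_carrier m.I_notcarr by auto
  then have "?P (colon R ?RR J0 \<one>\<^bsub>R\<^esub>)" by blast
  then obtain K where K: "?P K" "\<And>K'. ?P K' \<Longrightarrow> K \<subseteq> K' \<Longrightarrow> K' = K"
    by (rule max_submod[OF lr(1,2), of ?P]) (use submod_colon[OF M pJ(1)] in auto)
  then obtain u where u: "u \<in> carrier R" "u \<notin> J0" "K = colon R ?RR J0 u" by blast
  have sJ: "r \<otimes>\<^bsub>R\<^esub> k \<in> J0" if "r \<in> carrier R" "k \<in> J0" for r k using submodD(5)[OF pJ(1) that] by simp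
  have JR: "k \<in> carrier R" if "k \<in> J0" for k using submodD(3)[OF pJ(1) that] by simp
  have "primeideal K R"
  proof (rule primeidealI)
    show "ideal K R" using ideal_iff_submod[OF lr(1)] submod_colon[OF M pJ(1), of u] u by simp
    show "carrier R \<noteq> K"
    proof
      assume "carrier R = K"
      then have "\<one>\<^bsub>R\<^esub> \<in> K" by auto
      then show False using u unfolding colon_def by simp
    qed
    show "r \<in> K \<or> s \<in> K" if rs: "r \<in> carrier R" "s \<in> carrier R" "r \<otimes>\<^bsub>R\<^esub> s \<in> K" for r s
    proof (rule disjCI)
      assume "s \<notin> K"
      then have su: "s \<otimes>\<^bsub>R\<^esub> u \<in> carrier R - J0" using u rs unfolding colon_def by auto
      have "K \<subseteq> colon R ?RR J0 (s \<otimes>\<^bsub>R\<^esub> u)"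
      proof
        fix t assume "t \<in> K"
        then have t: "t \<in> carrier R" "t \<otimes>\<^bsub>R\<^esub> u \<in> J0" using u unfolding colon_def by auto
        have "t \<otimes>\<^bsub>R\<^esub> (s \<otimes>\<^bsub>R\<^esub> u) = s \<otimes>\<^bsub>R\<^esub> (t \<otimes>\<^bsub>R\<^esub> u)" using t u rs by (simp add: R.m_lcomm)
        then show "t \<in> colon R ?RR J0 (s \<otimes>\<^bsub>R\<^esub> u)" using sJ[OF rs(2) t(2)] t unfolding colon_def by simp
      qed
      then have "colon R ?RR J0 (s \<otimes>\<^bsub>R\<^esub> u) = K" using K(2) su by blast
      moreover have "r \<in> colon R ?RR J0 (s \<otimes>\<^bsub>R\<^esub> u)" using rs u unfolding colon_def by (simp add: R.m_assoc)
      ultimately show "r \<in> K" by simp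
    qed
  qed (rule lr(1))
  moreover have "J0 \<subseteq> K" using sJ[OF u(1)] JR u R.m_comm[OF u(1)] unfolding colon_def by auto
  ultimately have "K = ?m" by (rule only)
  then show ?thesis using that u by blast
qed

text \<open>Finite injective dimension gives the degree at which the descent starts. The ideal J0 =
  (a, b) has no Ext from degree 3 on, since R has none from degree 1 on and each of the two
  reductions by a regular element raises the bound by one.\<close>

lemma gorenstein_ext_vanishing:
  fixes R :: "('a, 'c) ring_scheme"
  assumes "gorenstein_local_ring R" "krull_dim R = 2" "a \<in> the_maximal_ideal R" "b \<in> the_maximal_ideal R"
    "regular_pair R (regular_module R) a b"
  obtains I \<epsilon> d where "inj_res R I \<epsilon> d" "\<forall>i J. 2 \<le> i \<longrightarrow> submod R (regular_module R) J \<longrightarrow> inj_res.ext_vanishes R I d i (regular_module R) J"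
proof -
  let ?RR = "regular_module R" and ?m = "the_maximal_ideal R"
  have nl: "noetherian_local_ring R" and fin: "inj_dim R ?RR < \<infinity>" using assms(1) unfolding gorenstein_local_ring_def by auto
  note lr = noetherian_local_ringD[OF nl]
  interpret R: cring R by (rule lr(1))
  have M: "left_module R ?RR" by (rule left_module_regular) (rule R.ring_axioms)
  interpret M: left_module R ?RR by (rule M)
  let ?S = "{enat n | n. \<exists>I \<epsilon> d. injective_resolution R ?RR I \<epsilon> d \<and> (\<forall>j>n. zero_module (I j))}"
  \<comment> \<open>The infimum of the empty set in \<open>enat\<close> is \<infinity>, so a finite
    dimension comes with an actual resolution.\<close>
  have "?S \<noteq> {}"
  proof
    assume "?S = {}"
    then have "inj_dim R ?RR = \<infinity>" unfolding inj_dim_def by (simp only: Inf_enat_def simp_thms if_True)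
    then show False using fin by simp
  qed
  then obtain n I \<epsilon> d where res: "injective_resolution R ?RR I \<epsilon> d" "\<forall>j>n. zero_module (I j)" by blast
  interpret inj_res R I \<epsilon> d by (unfold_locales) (fact lr(1) lr(4) res(1))+
  define J0 where "J0 = add_multiples ?RR (add_multiples ?RR {\<zero>\<^bsub>R\<^esub>} a) b"
  obtain u where u: "u \<in> carrier R" "colon R ?RR J0 u = ?m"
    by (rule exists_socle_element[OF nl assms(2-5) J0_def])
  have abR: "a \<in> carrier R" "b \<in> carrier R" using lr(6) assms(3,4) unfolding in_jacobson_def by auto
  have z: "submod R ?RR {\<zero>\<^bsub>R\<^esub>}" using M.submod_zero by simp
  let ?A = "add_multiples ?RR {\<zero>\<^bsub>R\<^esub>} a"
  note pA = submod_add_multiples[OF lr(1) M z abR(1)]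
  note pJ = submod_add_multiples[OF lr(1) M pA(1) abR(2), folded J0_def]
  have AI: "y \<in> ?A \<longleftrightarrow> (\<exists>n\<in>carrier R. y = a \<otimes>\<^bsub>R\<^esub> n)" for y
  proof
    assume "y \<in> ?A"
    then obtain s n where "s \<in> {\<zero>\<^bsub>R\<^esub>}" "n \<in> carrier ?RR" "y = s \<oplus>\<^bsub>?RR\<^esub> a \<odot>\<^bsub>?RR\<^esub> n" by (rule add_multiplesE)
    then show "\<exists>n\<in>carrier R. y = a \<otimes>\<^bsub>R\<^esub> n" using abR by auto
  qed (use pA(3) in auto)
  have A: "ext_vanishes (Suc i) ?RR ?A" for i
    by (rule ext_vanishes_quotient[OF fg_RR z abR(1) ext_vanishes_RR ext_vanishes_RR]) (use assms(5) in \<open>auto simp: regular_pair_def\<close>)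
  have J: "ext_vanishes (Suc (Suc i)) ?RR J0" for i
    unfolding J0_def by (rule ext_vanishes_quotient[OF fg_RR pA(1) abR(2) A A]) (use assms(5) in \<open>auto simp: regular_pair_def AI\<close>)
  have J2: "ext_vanishes i ?RR J0" if "i \<ge> 2" for i
    using J[of "i - 2"] that by (simp add: numeral_2_eq_2 Suc_diff_Suc)
  \<comment> \<open>\<open>ext_vanishes i\<close> concerns the term I (Suc i), so the vanishing of I
    j for j > n covers every i \<ge> n.\<close>
  have "ext_vanishes i ?RR J" if "2 \<le> i" "submod R ?RR J" for i J
    by (rule ext_vanishes_all[OF lr(2) lr(5) lr(6) pJ(1) u J2 _ that, of n])
      (use ext_vanishes_zero_module[OF _ M] res(2) in auto)
  then show ?thesis using that[OF inj_res_axioms] by blast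
qed

section \<open>Duality over an order\<close>

text \<open>The lifting property of a projective module, now for modules on arbitrary types: the
  identity of P factors through a free module, from which maps can be lifted.\<close>

lemma finite_rank_lift:
  assumes "finite_rank A P P (\<lambda>x. x)" "left_module A P" "left_module A M" "left_module A N" "lin A M N q"
    "q ` carrier M = carrier N" "lin A P N f"
  obtains g where "lin A P M g" "\<And>x. x \<in> carrier P \<Longrightarrow> q (g x) = f x"
proof -
  have A: "ring A" using assms(2) by (simp add: left_module_def)
  obtain n u c where *: "\<forall>i<n. u i \<in> carrier P" "lin A P (free_mod A n) c" "\<forall>x\<in>carrier P. x = lincomb P u n (c x)"
    using finite_rank_lincomb[OF assms(1,2)] by (elim exE conjE)
  have lu: "lin A (free_mod A n) P (lincomb P u n)" by (rule lin_lincomb[OF assms(2)]) (use *(1) in auto)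
  obtain h where h: "lin A (free_mod A n) M h" "\<And>x. x \<in> carrier (free_mod A n) \<Longrightarrow> q (h x) = f (lincomb P u n x)"
    by (rule free_mod_lift[OF A assms(3,4,5,6) lin_comp[OF lu assms(7)]]) auto
  show ?thesis
  proof (rule that[OF lin_comp[OF *(2) h(1)]])
    fix x assume x: "x \<in> carrier P"
    show "q (h (c x)) = f x" using h(2)[OF lin_closed[OF *(2) x]] bspec[OF *(3) x] by simp
  qed
qed

lemma is_algebra_op: assumes "is_algebra R L \<phi>" shows "is_algebra R (op_ring L) \<phi>"
proof -
  note a = is_algebraD[OF assms]
  have "\<phi> \<in> ring_hom R (op_ring L)"
  proof (rule ring_hom_memI)
    fix x y assume x: "x \<in> carrier R" and y: "y \<in> carrier R"
    show "\<phi> (x \<otimes>\<^bsub>R\<^esub> y) = \<phi> x \<otimes>\<^bsub>op_ring L\<^esub> \<phi> y"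
      using a(4)[OF x y] a(7)[OF x a(3)[OF y]] by simp
  qed (simp_all add: a(3,5,6))
  then show ?thesis unfolding is_algebra_def using a(1) ring_op[OF a(2)] a(7)[symmetric] by simp
qed

lemma lin_dual_over:
  assumes "is_algebra R L \<phi>" "left_module L M" "left_module L N" "lin L M N f"
  shows "lin (op_ring L) (dual_over R \<phi> N) (dual_over R \<phi> M) (\<lambda>\<theta>. restrict (\<lambda>x. \<theta> (f x)) (carrier M))"
proof -
  interpret M: left_module L M by fact
  interpret N: left_module L N by fact
  have rM: "left_module R (res \<phi> M)" by (rule left_module_res[OF assms(1,2)])
  have fc: "f x \<in> carrier N" if "x \<in> carrier M" for x by (rule lin_closed[OF assms(4) that])
  show ?thesis
  proof (rule linI)
    fix \<theta> assume "\<theta> \<in> carrier (dual_over R \<phi> N)"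
    then show "restrict (\<lambda>x. \<theta> (f x)) (carrier M) \<in> carrier (dual_over R \<phi> M)"
      using lin_restrict[OF rM lin_comp[OF lin_res[OF assms(1,4)] mod_hom_lin]] by simp
  next
    fix \<theta> \<eta>
    show "(\<lambda>x\<in>carrier M. (\<theta> \<oplus>\<^bsub>dual_over R \<phi> N\<^esub> \<eta>) (f x)) =
      (\<lambda>x\<in>carrier M. \<theta> (f x)) \<oplus>\<^bsub>dual_over R \<phi> M\<^esub> (\<lambda>x\<in>carrier M. \<eta> (f x))"
      unfolding dual_over_simps by (rule restrict_ext) (simp add: fc)
  next
    fix a \<theta> assume "a \<in> carrier (op_ring L)"
    then show "(\<lambda>x\<in>carrier M. (a \<odot>\<^bsub>dual_over R \<phi> N\<^esub> \<theta>) (f x)) = a \<odot>\<^bsub>dual_over R \<phi> M\<^esub> (\<lambda>x\<in>carrier M. \<theta> (f x))"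
      unfolding dual_over_simps by (intro restrict_ext) (simp add: fc lin_smult[OF assms(4)])
  qed
qed

lemma dual_over_add_map:
  assumes "is_algebra R L \<phi>" "left_module L N" "\<theta> \<in> carrier (dual_over R \<phi> N)" "x \<in> carrier N" "y \<in> carrier N"
  shows "\<theta> (x \<oplus>\<^bsub>N\<^esub> y) = \<theta> x \<oplus>\<^bsub>R\<^esub> \<theta> y"
  using lin_add[OF mod_hom_lin[of \<theta> R "res \<phi> N" "regular_module R"], of x y] assms(3-5) by simp

text \<open>A rank one map factors as P \<rightarrow> L \<rightarrow> P', so its dual factors
  through the dual of L, whose identity has finite rank. Consequently duals of projectives are
  projective as soon as the dual of L is.\<close>

lemma finite_rank_dual_over:
  assumes alg: "is_algebra R L \<phi>" and P: "left_module L P" "left_module L P'"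
    and om: "finite_rank (op_ring L) (dual_over R \<phi> (regular_module L)) (dual_over R \<phi> (regular_module L)) (\<lambda>x. x)"
    and h: "finite_rank L P P' h"
  shows "finite_rank (op_ring L) (dual_over R \<phi> P') (dual_over R \<phi> P) (\<lambda>\<theta>. restrict (\<lambda>x. \<theta> (h x)) (carrier P))"
  using h
proof induction
  case (zero f)
  interpret P': left_module L P' by (rule P(2))
  have rR: "left_module R (regular_module R)" by (rule left_module_regular) (use is_algebraD(1)[OF alg] in \<open>simp add: cring_def\<close>)
  show ?case
  proof (rule finite_rank.zero)
    fix \<theta> assume "\<theta> \<in> carrier (dual_over R \<phi> P')"
    then have "\<theta> \<zero>\<^bsub>P'\<^esub> = \<zero>\<^bsub>R\<^esub>" using lin_zero[OF left_module_res[OF alg P(2)] rR mod_hom_lin] by simp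
    then show "restrict (\<lambda>x. \<theta> (f x)) (carrier P) = \<zero>\<^bsub>dual_over R \<phi> P\<^esub>"
      unfolding dual_over_simps by (intro restrict_ext) (simp add: zero)
  qed
next
  case (step h c n f)
  let ?LL = "regular_module L"
  have LL: "left_module L ?LL" by (rule left_module_regular[OF is_algebraD(2)[OF alg]])
  interpret P': left_module L P' by (rule P(2))
  note mo = left_module_dual_over[OF alg]
  let ?\<alpha> = "\<lambda>\<theta>. restrict (\<lambda>l. \<theta> (l \<odot>\<^bsub>P'\<^esub> n)) (carrier ?LL)" and ?\<beta> = "\<lambda>\<eta>. restrict (\<lambda>x. \<eta> (c x)) (carrier P)"
  have la: "lin (op_ring L) (dual_over R \<phi> P') (dual_over R \<phi> ?LL) ?\<alpha>"
    by (rule lin_dual_over[OF alg LL P(2) lin_right_mult[OF P(2) step.hyps(3)]])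
  have lb: "lin (op_ring L) (dual_over R \<phi> ?LL) (dual_over R \<phi> P) ?\<beta>" by (rule lin_dual_over[OF alg P(1) LL step.hyps(2)])
  have fr: "finite_rank (op_ring L) (dual_over R \<phi> P') (dual_over R \<phi> P) (\<lambda>\<theta>. ?\<beta> (?\<alpha> \<theta>))"
    by (rule finite_rank_post[OF finite_rank_pre[OF om la] mo[OF P(2)] mo[OF LL] mo[OF P(1)] lb])
  show ?case
  proof (rule finite_rank_add[OF fr step.IH mo[OF P(2)] mo[OF P(1)]])
    fix \<theta> assume t: "\<theta> \<in> carrier (dual_over R \<phi> P')"
    have hl: "h x \<in> carrier P'" "c x \<in> carrier L" if "x \<in> carrier P" for x
      using lin_closed[OF finite_rank_lin[OF step.hyps(1) P] that] lin_closed[OF step.hyps(2) that] by auto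
    show "restrict (\<lambda>x. \<theta> (f x)) (carrier P) =
      restrict (\<lambda>x. \<theta> (h x)) (carrier P) \<oplus>\<^bsub>dual_over R \<phi> P\<^esub> ?\<beta> (?\<alpha> \<theta>)"
      unfolding dual_over_simps
    proof (rule restrict_ext)
      fix x assume x: "x \<in> carrier P"
      have "\<theta> (f x) = \<theta> (h x) \<oplus>\<^bsub>R\<^esub> \<theta> (c x \<odot>\<^bsub>P'\<^esub> n)"
        using step.hyps(4)[OF x] dual_over_add_map[OF alg P(2) t, of "h x" "c x \<odot>\<^bsub>P'\<^esub> n"] hl[OF x] step.hyps(3) by simp
      then show "\<theta> (f x) = restrict (\<lambda>x. \<theta> (h x)) (carrier P) x \<oplus>\<^bsub>R\<^esub> ?\<beta> (?\<alpha> \<theta>) x"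
        using x hl(2)[OF x] by simp
    qed
  qed
qed

text \<open>After multiplication by r, a rank one map P \<rightarrow> L \<rightarrow> P' passes
  through multiplication by r on L, which has finite rank over R. With h the identity, a scalar that
  is stably zero on L is so on every finitely generated projective L-module.\<close>

lemma finite_rank_smult_res:
  assumes alg: "is_algebra R L \<phi>" and P: "left_module L P" "left_module L P'" and r: "r \<in> carrier R"
    and om: "finite_rank R (res \<phi> (regular_module L)) (res \<phi> (regular_module L)) (\<lambda>x. \<phi> r \<otimes>\<^bsub>L\<^esub> x)"
    and h: "finite_rank L P P' h"
  shows "finite_rank R (res \<phi> P) (res \<phi> P') (\<lambda>x. \<phi> r \<odot>\<^bsub>P'\<^esub> h x)"
  using h
proof induction
  case (zero f)
  interpret P': left_module L P' by (rule P(2))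
  show ?case by (rule finite_rank.zero) (use zero is_algebraD(3)[OF alg r] in simp)
next
  case (step h c n f)
  let ?LL = "regular_module L"
  have LL: "left_module L ?LL" by (rule left_module_regular[OF is_algebraD(2)[OF alg]])
  interpret P': left_module L P' by (rule P(2))
  note mr = left_module_res[OF alg]
  have fr: "finite_rank R (res \<phi> P) (res \<phi> P') (\<lambda>x. (\<phi> r \<otimes>\<^bsub>L\<^esub> c x) \<odot>\<^bsub>P'\<^esub> n)"
    by (rule finite_rank_post[OF finite_rank_pre[OF om lin_res[OF alg step.hyps(2)]] mr[OF P(1)] mr[OF LL] mr[OF P(2)]
          lin_res[OF alg lin_right_mult[OF P(2) step.hyps(3)]]])
  show ?case
  proof (rule finite_rank_add[OF fr step.IH mr[OF P(1)] mr[OF P(2)]])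
    fix x assume "x \<in> carrier (res \<phi> P)"
    then have x: "x \<in> carrier P" by simp
    have "h x \<in> carrier P'" "c x \<in> carrier L"
      using lin_closed[OF finite_rank_lin[OF step.hyps(1) P] x] lin_closed[OF step.hyps(2) x] by auto
    then show "\<phi> r \<odot>\<^bsub>P'\<^esub> f x = \<phi> r \<odot>\<^bsub>P'\<^esub> h x \<oplus>\<^bsub>res \<phi> P'\<^esub> (\<phi> r \<otimes>\<^bsub>L\<^esub> c x) \<odot>\<^bsub>P'\<^esub> n"
      using step.hyps(3) step.hyps(4)[OF x] is_algebraD(3)[OF alg r] by (simp add: P'.smult_r_distr P'.smult_assoc1)
  qed
qed

text \<open>Both conditions of \<open>regular_pair\<close> are stated for h in place of the
  identity, because in this form they add up over rank one summands. For h the identity they give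
  \<open>projective_regular_pair\<close>.\<close>

lemma finite_rank_regular_pair:
  assumes alg: "is_algebra R L \<phi>" and P: "left_module L P" "left_module L P'" and ab: "a \<in> carrier R" "b \<in> carrier R"
    and w: "regular_pair R (res \<phi> (regular_module L)) a b" and h: "finite_rank L P P' h"
  shows "(\<forall>x\<in>carrier P. \<phi> a \<odot>\<^bsub>P\<^esub> x = \<zero>\<^bsub>P\<^esub> \<longrightarrow> h x = \<zero>\<^bsub>P'\<^esub>) \<and>
     (\<forall>x\<in>carrier P. \<forall>y\<in>carrier P. \<phi> b \<odot>\<^bsub>P\<^esub> x = \<phi> a \<odot>\<^bsub>P\<^esub> y \<longrightarrow> (\<exists>z\<in>carrier P'. h x = \<phi> a \<odot>\<^bsub>P'\<^esub> z))"
  using h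
proof induction
  case (zero f)
  interpret P': left_module L P' by (rule P(2))
  show ?case using zero is_algebraD(3)[OF alg ab(1)] by (auto intro!: bexI[of _ "\<zero>\<^bsub>P'\<^esub>"])
next
  case (step h c n f)
  interpret P': left_module L P' by (rule P(2))
  interpret P: left_module L P by (rule P(1))
  have LL: "left_module L (regular_module L)" by (rule left_module_regular[OF is_algebraD(2)[OF alg]])
  note a = is_algebraD(3)[OF alg ab(1)] and b = is_algebraD(3)[OF alg ab(2)]
  have hl: "h x \<in> carrier P'" "c x \<in> carrier L" if "x \<in> carrier P" for x
    using lin_closed[OF finite_rank_lin[OF step.hyps(1) P] that] lin_closed[OF step.hyps(2) that] by auto
  have cs: "c (l \<odot>\<^bsub>P\<^esub> x) = l \<otimes>\<^bsub>L\<^esub> c x" if "l \<in> carrier L" "x \<in> carrier P" for l x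
    using lin_smult[OF step.hyps(2) that] by simp
  have c0: "c \<zero>\<^bsub>P\<^esub> = \<zero>\<^bsub>L\<^esub>" using lin_zero[OF P(1) LL step.hyps(2)] by simp
  show ?case
  proof (intro conjI ballI impI)
    fix x assume x: "x \<in> carrier P" "\<phi> a \<odot>\<^bsub>P\<^esub> x = \<zero>\<^bsub>P\<^esub>"
    have "\<phi> a \<otimes>\<^bsub>L\<^esub> c x = \<zero>\<^bsub>L\<^esub>" using cs[OF a x(1)] x(2) c0 by simp
    then have "c x = \<zero>\<^bsub>L\<^esub>" using w hl(2)[OF x(1)] unfolding regular_pair_def by simp
    moreover have "h x = \<zero>\<^bsub>P'\<^esub>" using step.IH x by blast
    ultimately show "f x = \<zero>\<^bsub>P'\<^esub>" using step.hyps(3) step.hyps(4)[OF x(1)] by simp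
  next
    fix x y assume xy: "x \<in> carrier P" "y \<in> carrier P" "\<phi> b \<odot>\<^bsub>P\<^esub> x = \<phi> a \<odot>\<^bsub>P\<^esub> y"
    have "\<phi> b \<otimes>\<^bsub>L\<^esub> c x = \<phi> a \<otimes>\<^bsub>L\<^esub> c y" using cs[OF b xy(1)] cs[OF a xy(2)] xy(3) by simp
    then have "\<exists>z\<in>carrier L. c x = \<phi> a \<otimes>\<^bsub>L\<^esub> z"
      using w hl(2)[OF xy(1)] hl(2)[OF xy(2)] unfolding regular_pair_def by auto
    then obtain z where z: "z \<in> carrier L" "c x = \<phi> a \<otimes>\<^bsub>L\<^esub> z" by (rule bexE)
    obtain w where w: "w \<in> carrier P'" "h x = \<phi> a \<odot>\<^bsub>P'\<^esub> w" using step.IH xy by blast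
    have "f x = \<phi> a \<odot>\<^bsub>P'\<^esub> (w \<oplus>\<^bsub>P'\<^esub> z \<odot>\<^bsub>P'\<^esub> n)"
      using step.hyps(3) step.hyps(4)[OF xy(1)] z w a by (simp add: P'.smult_r_distr P'.smult_assoc1)
    moreover have "w \<oplus>\<^bsub>P'\<^esub> z \<odot>\<^bsub>P'\<^esub> n \<in> carrier P'" using z w step.hyps(3) by simp
    ultimately show "\<exists>z\<in>carrier P'. f x = \<phi> a \<odot>\<^bsub>P'\<^esub> z" by (rule bexI)
  qed
qed

lemma projective_regular_pair:
  assumes "is_algebra R L \<phi>" "left_module L P" "finite_rank L P P (\<lambda>x. x)" "a \<in> carrier R" "b \<in> carrier R"
    "regular_pair R (res \<phi> (regular_module L)) a b"
  shows "regular_pair R (res \<phi> P) a b"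
  using finite_rank_regular_pair[OF assms(1,2,2,4,5,6,3)] unfolding regular_pair_def by simp

text \<open>The dual of the rank one map x \<mapsto> c x n is \<theta> \<mapsto> \<theta>(n) c,
  again of rank one.\<close>

lemma finite_rank_dual:
  assumes R: "cring R" and M: "left_module R M" "left_module R N" and h: "finite_rank R M N h"
  shows "finite_rank R (hom_mod R N (regular_module R)) (hom_mod R M (regular_module R)) (\<lambda>\<theta>. restrict (\<lambda>x. \<theta> (h x)) (carrier M))"
  using h
proof induction
  case (zero f)
  interpret R: cring R by (rule R)
  have rR: "left_module R (regular_module R)" by (rule left_module_regular) (rule R.ring_axioms)
  show ?case
  proof (rule finite_rank.zero)
    fix \<theta> assume "\<theta> \<in> carrier (hom_mod R N (regular_module R))"
    then have "\<theta> \<zero>\<^bsub>N\<^esub> = \<zero>\<^bsub>R\<^esub>" using lin_zero[OF M(2) rR mod_hom_lin] by simp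
    then show "restrict (\<lambda>x. \<theta> (f x)) (carrier M) = \<zero>\<^bsub>hom_mod R M (regular_module R)\<^esub>"
      unfolding hom_mod_simps by (intro restrict_ext) (simp add: zero)
  qed
next
  case (step h c n f)
  interpret R: cring R by (rule R)
  interpret N: left_module R N by (rule M(2))
  let ?RR = "regular_module R"
  show ?case
  proof (rule finite_rank.step[OF step.IH lin_eval[OF step.hyps(3)]])
    show "restrict c (carrier M) \<in> carrier (hom_mod R M ?RR)" using lin_restrict[OF M(1) step.hyps(2)] by simp
    fix \<theta> assume t: "\<theta> \<in> carrier (hom_mod R N ?RR)"
    then have tl: "lin R N ?RR \<theta>" using mod_hom_lin by simp
    show "restrict (\<lambda>x. \<theta> (f x)) (carrier M) =
      restrict (\<lambda>x. \<theta> (h x)) (carrier M) \<oplus>\<^bsub>hom_mod R M ?RR\<^esub> \<theta> n \<odot>\<^bsub>hom_mod R M ?RR\<^esub> restrict c (carrier M)"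
    proof (simp only: hom_mod_simps, rule restrict_ext)
      fix x assume x: "x \<in> carrier M"
      have cx: "c x \<in> carrier R" "h x \<in> carrier N"
        using lin_closed[OF step.hyps(2) x] lin_closed[OF finite_rank_lin[OF step.hyps(1) M] x] by auto
      have tn: "\<theta> n \<in> carrier R" using lin_closed[OF tl step.hyps(3)] by simp
      show "\<theta> (f x) = restrict (\<lambda>x. \<theta> (h x)) (carrier M) x \<oplus>\<^bsub>?RR\<^esub> (\<lambda>x\<in>carrier M. \<theta> n \<odot>\<^bsub>?RR\<^esub> restrict c (carrier M) x) x"
        using x step.hyps(4)[OF x] lin_add[OF tl cx(2), of "c x \<odot>\<^bsub>N\<^esub> n"] lin_smult[OF tl cx(1) step.hyps(3)] cx(1) step.hyps(3) tn
        by (simp add: R.m_comm)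
    qed
  qed
qed

lemma hom_smult_eq_dual_over:
  assumes "r \<in> carrier R" "\<eta> \<in> mod_hom R (res \<phi> K) (regular_module R)"
  shows "r \<odot>\<^bsub>hom_mod R (res \<phi> K) (regular_module R)\<^esub> \<eta> = \<phi> r \<odot>\<^bsub>dual_over R \<phi> K\<^esub> \<eta>"
  unfolding hom_mod_simps dual_over_simps res_simps
  using lin_smult[OF mod_hom_lin[OF assms(2)] assms(1)] by (intro restrict_ext) simp

lemma lin_res_dual_over:
  assumes alg: "is_algebra R L \<phi>" and M: "left_module L M" "left_module L N"
    and t: "lin (op_ring L) (dual_over R \<phi> M) (dual_over R \<phi> N) t"
  shows "lin R (hom_mod R (res \<phi> M) (regular_module R)) (hom_mod R (res \<phi> N) (regular_module R)) t"
proof (rule linI)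
  fix \<theta> assume "\<theta> \<in> carrier (hom_mod R (res \<phi> M) (regular_module R))"
  then show "t \<theta> \<in> carrier (hom_mod R (res \<phi> N) (regular_module R))" using lin_closed[OF t, of \<theta>] by simp
next
  fix \<theta> \<eta> assume "\<theta> \<in> carrier (hom_mod R (res \<phi> M) (regular_module R))" "\<eta> \<in> carrier (hom_mod R (res \<phi> M) (regular_module R))"
  then show "t (\<theta> \<oplus>\<^bsub>hom_mod R (res \<phi> M) (regular_module R)\<^esub> \<eta>) = t \<theta> \<oplus>\<^bsub>hom_mod R (res \<phi> N) (regular_module R)\<^esub> t \<eta>"
    using lin_add[OF t, of \<theta> \<eta>] by simp
next
  fix r \<theta> assume r: "r \<in> carrier R" and th: "\<theta> \<in> carrier (hom_mod R (res \<phi> M) (regular_module R))"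
  have th': "\<theta> \<in> mod_hom R (res \<phi> M) (regular_module R)" using th by simp
  have tt: "t \<theta> \<in> mod_hom R (res \<phi> N) (regular_module R)" using lin_closed[OF t, of \<theta>] th' by simp
  have pr: "\<phi> r \<in> carrier (op_ring L)" using is_algebraD(3)[OF alg r] by simp
  show "t (r \<odot>\<^bsub>hom_mod R (res \<phi> M) (regular_module R)\<^esub> \<theta>) = r \<odot>\<^bsub>hom_mod R (res \<phi> N) (regular_module R)\<^esub> t \<theta>"
    unfolding hom_smult_eq_dual_over[OF r th'] hom_smult_eq_dual_over[OF r tt] using lin_smult[OF t pr, of \<theta>] th' by simp
qed

lemma fg_res_imp_fg:
  assumes alg: "is_algebra R L \<phi>" and M: "left_module L M" and fg: "fg_module R (res \<phi> M)"
  shows "fg_module L M"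
proof -
  note a = is_algebraD[OF alg]
  obtain n u where u: "\<forall>i<n. u i \<in> carrier M" "lincomb (res \<phi> M) u n ` carrier (free_mod R n) = carrier M"
    using fg unfolding fg_module_iff by auto
  have "lincomb M u n ` carrier (free_mod L n) = carrier M"
  proof (intro subset_antisym subsetI)
    fix x assume "x \<in> carrier M"
    then have "x \<in> lincomb (res \<phi> M) u n ` carrier (free_mod R n)" using u(2) by simp
    then obtain c where c: "x = lincomb (res \<phi> M) u n c" "c \<in> carrier (free_mod R n)" by (rule imageE)
    have e: "lincomb (res \<phi> M) u k c = lincomb M u k (\<lambda>i. \<phi> (c i))" for k by (induction k) auto
    have "lincomb M u n (\<lambda>i. \<phi> (c i)) = lincomb M u n (\<lambda>i\<in>{..<n}. \<phi> (c i))" by (rule lincomb_cong) auto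
    moreover have "(\<lambda>i\<in>{..<n}. \<phi> (c i)) \<in> carrier (free_mod L n)" using c(2) a(3) by (auto simp: PiE_iff)
    ultimately show "x \<in> lincomb M u n ` carrier (free_mod L n)" using c(1) e by (intro image_eqI[of _ _ "\<lambda>i\<in>{..<n}. \<phi> (c i)"]) simp_all
  next
    fix x assume "x \<in> lincomb M u n ` carrier (free_mod L n)"
    then show "x \<in> carrier M" using lin_closed[OF lin_lincomb[OF M, of n u]] u(1) by auto
  qed
  then show ?thesis unfolding fg_module_iff using M u(1) by blast
qed

text \<open>Each generator u over L contributes the submodule L u, which is finitely generated over
  R as an image of L.\<close>

lemma fg_imp_fg_res:
  assumes alg: "is_algebra R L \<phi>" and nR: "noetherian_mod R (regular_module R)"
    and L: "fg_module R (res \<phi> (regular_module L))" and fg: "fg_module L M"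
  shows "fg_module R (res \<phi> M)"
proof -
  have M: "left_module L M" "fg_over L M {\<zero>\<^bsub>M\<^esub>} (carrier M)" using fg unfolding fg_module_iff_fg_over by auto
  interpret M: left_module L M by (rule M(1))
  let ?LL = "regular_module L"
  have LL: "left_module L ?LL" by (rule left_module_regular[OF is_algebraD(2)[OF alg]])
  interpret LL: left_module L ?LL by (rule LL)
  have rM: "left_module R (res \<phi> M)" by (rule left_module_res[OF alg M(1)])
  have rL: "left_module R (res \<phi> ?LL)" by (rule left_module_res[OF alg LL])
  have plus: "fg_over R (res \<phi> M) S {s \<oplus>\<^bsub>M\<^esub> t | s t. s \<in> S \<and> t \<in> T}"
    if "fg_over R (res \<phi> M) {\<zero>\<^bsub>M\<^esub>} T" "submod R (res \<phi> M) S" for S T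
    using that(1)
  proof induction
    case base
    have "{s \<oplus>\<^bsub>M\<^esub> t | s t. s \<in> S \<and> t \<in> {\<zero>\<^bsub>M\<^esub>}} = S"
      using submodD(3)[OF that(2)] by force
    then show ?case using fg_over.base by metis
  next
    case (step T u)
    have T: "submod R (res \<phi> M) T" using fg_over_submod[OF step.hyps(1) rM] left_module.submod_zero[OF rM] by simp
    have "{s \<oplus>\<^bsub>M\<^esub> t | s t. s \<in> S \<and> t \<in> adjoin R (res \<phi> M) T u} = adjoin R (res \<phi> M) {s \<oplus>\<^bsub>M\<^esub> t | s t. s \<in> S \<and> t \<in> T} u"
    proof (intro subset_antisym subsetI)
      fix y assume "y \<in> {s \<oplus>\<^bsub>M\<^esub> t | s t. s \<in> S \<and> t \<in> adjoin R (res \<phi> M) T u}"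
      then obtain s t where st: "s \<in> S" "t \<in> adjoin R (res \<phi> M) T u" "y = s \<oplus>\<^bsub>M\<^esub> t" by auto
      obtain t' a where t: "t' \<in> T" "a \<in> carrier R" "t = t' \<oplus>\<^bsub>res \<phi> M\<^esub> a \<odot>\<^bsub>res \<phi> M\<^esub> u" using st(2) by (rule adjoinE)
      have "y = (s \<oplus>\<^bsub>M\<^esub> t') \<oplus>\<^bsub>res \<phi> M\<^esub> a \<odot>\<^bsub>res \<phi> M\<^esub> u"
        using st t submodD(3)[OF that(2) st(1)] submodD(3)[OF T t(1)] step.hyps(2) is_algebraD(3)[OF alg t(2)] by (simp add: M.a_assoc)
      then show "y \<in> adjoin R (res \<phi> M) {s \<oplus>\<^bsub>M\<^esub> t | s t. s \<in> S \<and> t \<in> T} u"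
        by (intro adjoinI[of "s \<oplus>\<^bsub>M\<^esub> t'" _ a]) (use st t in auto)
    next
      fix y assume "y \<in> adjoin R (res \<phi> M) {s \<oplus>\<^bsub>M\<^esub> t | s t. s \<in> S \<and> t \<in> T} u"
      then obtain k a where k: "k \<in> {s \<oplus>\<^bsub>M\<^esub> t | s t. s \<in> S \<and> t \<in> T}" "a \<in> carrier R" "y = k \<oplus>\<^bsub>res \<phi> M\<^esub> a \<odot>\<^bsub>res \<phi> M\<^esub> u" by (rule adjoinE)
      obtain s t where st: "s \<in> S" "t \<in> T" "k = s \<oplus>\<^bsub>M\<^esub> t" using k(1) by auto
      have "y = s \<oplus>\<^bsub>M\<^esub> (t \<oplus>\<^bsub>res \<phi> M\<^esub> a \<odot>\<^bsub>res \<phi> M\<^esub> u)"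
        using st k submodD(3)[OF that(2) st(1)] submodD(3)[OF T st(2)] step.hyps(2) is_algebraD(3)[OF alg k(2)] by (simp add: M.a_assoc)
      moreover have "t \<oplus>\<^bsub>res \<phi> M\<^esub> a \<odot>\<^bsub>res \<phi> M\<^esub> u \<in> adjoin R (res \<phi> M) T u" by (rule adjoinI[OF st(2) k(2) refl])
      ultimately show "y \<in> {s \<oplus>\<^bsub>M\<^esub> t | s t. s \<in> S \<and> t \<in> adjoin R (res \<phi> M) T u}" using st(1) by blast
    qed
    then show ?case using fg_over.step[OF step.IH step.hyps(2)] by simp
  qed
  have "fg_over R (res \<phi> M) {\<zero>\<^bsub>M\<^esub>} T" if "fg_over L M {\<zero>\<^bsub>M\<^esub>} T" for T
    using that
  proof induction
    case (step T u)
    have T: "submod L M T" using fg_over_submod[OF step.hyps(1) M(1) M.submod_zero] by blast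
    let ?T = "(\<lambda>l. l \<odot>\<^bsub>M\<^esub> u) ` carrier L"
    have "fg_over R (res \<phi> M) ((\<lambda>l. l \<odot>\<^bsub>M\<^esub> u) ` {\<zero>\<^bsub>res \<phi> ?LL\<^esub>}) ((\<lambda>l. l \<odot>\<^bsub>M\<^esub> u) ` carrier (res \<phi> ?LL))"
      by (rule fg_over_image[OF _ lin_res[OF alg lin_right_mult[OF M(1) step.hyps(2)]] rL left_module.submod_zero[OF rL]])
        (use L in \<open>simp add: fg_module_iff_fg_over\<close>)
    then have "fg_over R (res \<phi> M) {\<zero>\<^bsub>M\<^esub>} ?T" using step.hyps(2) by simp
    from plus[OF this submod_res[OF alg T]]
    have "fg_over R (res \<phi> M) T {s \<oplus>\<^bsub>M\<^esub> t | s t. s \<in> T \<and> t \<in> ?T}" .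
    moreover have "{s \<oplus>\<^bsub>M\<^esub> t | s t. s \<in> T \<and> t \<in> ?T} = adjoin L M T u" unfolding adjoin_def by blast
    ultimately show ?case using fg_over_trans[OF _ step.IH] by simp
  qed (rule fg_over.base)
  from this[OF M(2)] show ?thesis unfolding fg_module_iff_fg_over using rM by simp
qed

lemma dual_over_finite_rank_id:
  assumes "is_algebra R L \<phi>" "left_module L P"
    "finite_rank (op_ring L) (dual_over R \<phi> (regular_module L)) (dual_over R \<phi> (regular_module L)) (\<lambda>x. x)" "finite_rank L P P (\<lambda>x. x)"
  shows "finite_rank (op_ring L) (dual_over R \<phi> P) (dual_over R \<phi> P) (\<lambda>x. x)"
proof (rule finite_rank_cong[OF finite_rank_dual_over[OF assms(1,2,2,3,4)]])
  fix \<theta> assume "\<theta> \<in> carrier (dual_over R \<phi> P)"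
  then show "\<theta> = restrict (\<lambda>x. \<theta> x) (carrier P)" by (intro ext) (auto simp: mod_hom_iff extensional_def)
qed

context inj_res
begin

text \<open>Vanishing of Ext^1 of Y makes 0 \<rightarrow> Y* \<rightarrow> P* \<rightarrow> K*
  \<rightarrow> 0 exact over \<open>op_ring L\<close>. Projectivity of K* splits it, so Y* is a
  summand of P* and inherits projectivity from it. The retraction t is kept because the final
  argument composes with it.\<close>

lemma dual_step:
  assumes alg: "is_algebra R L \<phi>" and P: "left_module L P" and Y: "left_module L Y" and p: "lin L P Y p" "p ` carrier P = carrier Y"
    and K: "K = {x \<in> carrier P. p x = \<zero>\<^bsub>Y\<^esub>}" and fg: "fg_module R (res \<phi> P)" and vY: "ext_vanishes 0 (res \<phi> P) K"
    and om: "finite_rank (op_ring L) (dual_over R \<phi> (regular_module L)) (dual_over R \<phi> (regular_module L)) (\<lambda>x. x)"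
    and fP: "finite_rank L P P (\<lambda>x. x)"
    and fK: "finite_rank (op_ring L) (dual_over R \<phi> (P\<lparr>carrier := K\<rparr>)) (dual_over R \<phi> (P\<lparr>carrier := K\<rparr>)) (\<lambda>x. x)"
  shows "finite_rank (op_ring L) (dual_over R \<phi> Y) (dual_over R \<phi> Y) (\<lambda>x. x)"
    "\<exists>t. lin (op_ring L) (dual_over R \<phi> P) (dual_over R \<phi> Y) t \<and>
       (\<forall>\<theta>\<in>carrier (dual_over R \<phi> Y). t (restrict (\<lambda>x. \<theta> (p x)) (carrier P)) = \<theta>)"
proof -
  let ?K = "P\<lparr>carrier := K\<rparr>" and ?DP = "dual_over R \<phi> P" and ?DY = "dual_over R \<phi> Y" and ?o = "op_ring L"
  let ?DK = "dual_over R \<phi> ?K"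
  interpret P: left_module L P by (rule P)
  have sK: "submod L P K" unfolding K by (rule submod_kernel[OF P Y p(1)])
  have KP: "K \<subseteq> carrier P" by (rule submodD(1)[OF sK])
  have mK: "left_module L ?K" by (rule P.submod_module[OF sK])
  note mo = left_module_dual_over[OF alg]
  note mDP = mo[OF P] and mDY = mo[OF Y] and mDK = mo[OF mK]
  have rP: "left_module R (res \<phi> P)" and rY: "left_module R (res \<phi> Y)" by (rule left_module_res[OF alg P], rule left_module_res[OF alg Y])
  interpret DP: left_module ?o ?DP by (rule mDP)
  interpret DK: left_module ?o ?DK by (rule mDK)
  have inc: "lin L ?K P (\<lambda>x. x)" using KP by (intro linI) auto
  let ?r = "\<lambda>\<theta>. restrict \<theta> K" and ?q = "\<lambda>\<theta>. restrict (\<lambda>x. \<theta> (p x)) (carrier P)"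
  have lr: "lin ?o ?DP ?DK ?r" using lin_dual_over[OF alg mK P inc] by simp
  have lq: "lin ?o ?DY ?DP ?q" by (rule lin_dual_over[OF alg P Y p(1)])
  have surj: "?r ` carrier ?DP = carrier ?DK"
  proof (intro subset_antisym subsetI)
    fix f assume "f \<in> carrier ?DK"
    then have f: "f \<in> mod_hom R (res \<phi> ?K) RR" by simp
    have fl: "lin R (res \<phi> P\<lparr>carrier := K\<rparr>) RR f" unfolding res_carrier_update by (rule mod_hom_lin[OF f])
    obtain g where g: "lin R (res \<phi> P) RR g" "\<And>x. x \<in> K \<Longrightarrow> g x = f x"
      by (rule ext_vanishes_extend[OF fg submod_res[OF alg sK] vY fl]) auto
    have "f = ?r (restrict g (carrier P))"
      by (rule ext) (use f g(2) KP in \<open>auto simp: mod_hom_iff extensional_def\<close>)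
    moreover have "restrict g (carrier P) \<in> carrier ?DP" using lin_restrict[OF rP g(1)] by simp
    ultimately show "f \<in> ?r ` carrier ?DP" by (rule image_eqI)
  qed (use lin_closed[OF lr] in auto)
  obtain s where s: "lin ?o ?DK ?DP s" "\<And>x. x \<in> carrier ?DK \<Longrightarrow> ?r (s x) = x"
    by (rule finite_rank_lift[OF fK mDK mDP mDK lr surj lin_id]) auto
  have px: "\<exists>y\<in>carrier P. x = p y" if "x \<in> carrier Y" for x using that p(2) by blast
  have iq: "inj_on ?q (carrier ?DY)"
  proof (rule inj_onI)
    fix s t assume s: "s \<in> carrier ?DY" and t: "t \<in> carrier ?DY" and e: "?q s = ?q t"
    have "s x = t x" if x: "x \<in> carrier Y" for x
    proof -
      obtain y where y: "y \<in> carrier P" "x = p y" using px[OF x] by blast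
      then show ?thesis using fun_cong[OF e, of y] by simp
    qed
    then show "s = t" using s t by (intro mod_hom_eqI[of s R "res \<phi> Y" RR t RR]) auto
  qed
  obtain h where h: "lin ?o (?DP\<lparr>carrier := ?q ` carrier ?DY\<rparr>) ?DY h" "\<And>x. x \<in> carrier ?DY \<Longrightarrow> h (?q x) = x"
    by (rule lin_inverse[OF mDY mDP lq iq]) auto
  \<comment> \<open>Subtracting s applied to the restriction to K leaves a functional that vanishes
    on K, hence one that comes from Y; this is the retraction before its values are read in
    Y*.\<close>
  let ?e = "\<lambda>\<theta>. \<theta> \<ominus>\<^bsub>?DP\<^esub> s (?r \<theta>)"
  have le: "lin ?o ?DP ?DP ?e" by (rule lin_diff_map[OF mDP mDP lin_id lin_comp[OF lr s(1)]])
  have im: "?e \<theta> \<in> ?q ` carrier ?DY" if t: "\<theta> \<in> carrier ?DP" for \<theta>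
  proof -
    have e: "?e \<theta> \<in> carrier ?DP" by (rule lin_closed[OF le t])
    have rt: "?r \<theta> \<in> carrier ?DK" by (rule lin_closed[OF lr t])
    have "?r (?e \<theta>) = ?r \<theta> \<ominus>\<^bsub>?DK\<^esub> ?r (s (?r \<theta>))" by (rule lin_diff[OF mDP mDK lr t lin_closed[OF s(1) rt]])
    then have r0: "?r (?e \<theta>) = \<zero>\<^bsub>?DK\<^esub>" using s(2)[OF rt] DK.right_minus_eq[OF rt rt] by simp
    have eK: "?e \<theta> x = \<zero>\<^bsub>R\<^esub>" if "x \<in> K" for x using fun_cong[OF r0, of x] that by simp
    have el: "lin R (res \<phi> P) RR (?e \<theta>)" using e mod_hom_lin by simp
    have pl: "lin R (res \<phi> P) (res \<phi> Y) p" by (rule lin_res[OF alg p(1)])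
    obtain g where g: "lin R (res \<phi> Y) RR g" "\<And>x. x \<in> carrier (res \<phi> P) \<Longrightarrow> g (p x) = ?e \<theta> x"
    proof (rule lin_factor_surj[OF rP rY modRR pl _ el])
      show "p ` carrier (res \<phi> P) = carrier (res \<phi> Y)" using p(2) by simp
      show "?e \<theta> x = \<zero>\<^bsub>RR\<^esub>" if "x \<in> carrier (res \<phi> P)" "p x = \<zero>\<^bsub>res \<phi> Y\<^esub>" for x
        using eK[of x] that K by simp
    qed blast
    have "?e \<theta> = ?q (restrict g (carrier Y))"
      by (rule ext) (use e g(2) lin_closed[OF p(1)] in \<open>auto simp: mod_hom_iff extensional_def\<close>)
    moreover have "restrict g (carrier Y) \<in> carrier ?DY" using lin_restrict[OF rY g(1)] by simp
    ultimately show ?thesis by (rule image_eqI)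
  qed
  have le': "lin ?o ?DP (?DP\<lparr>carrier := ?q ` carrier ?DY\<rparr>) ?e"
    by (rule linI) (use im lin_add[OF le] lin_smult[OF le] in simp_all)
  let ?t = "\<lambda>\<theta>. h (?e \<theta>)"
  have lt: "lin ?o ?DP ?DY ?t" by (rule lin_comp[OF le' h(1)])
  have tq: "?t (?q \<theta>) = \<theta>" if t: "\<theta> \<in> carrier ?DY" for \<theta>
  proof -
    have qt: "?q \<theta> \<in> carrier ?DP" by (rule lin_closed[OF lq t])
    have t0: "\<theta> \<zero>\<^bsub>Y\<^esub> = \<zero>\<^bsub>R\<^esub>" using lin_zero[OF rY modRR mod_hom_lin] t by simp
    have "?r (?q \<theta>) = \<zero>\<^bsub>?DK\<^esub>" unfolding dual_over_simps using KP t0 by (auto intro!: restrict_ext simp: K)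
    then have "s (?r (?q \<theta>)) = \<zero>\<^bsub>?DP\<^esub>" using lin_zero[OF mDK mDP s(1)] by simp
    then have "?e (?q \<theta>) = ?q \<theta>" using DP.diff_zero[OF qt] by simp
    then show ?thesis using h(2)[OF t] by simp
  qed
  have "finite_rank ?o ?DP ?DP (\<lambda>x. x)" by (rule dual_over_finite_rank_id[OF alg P om fP])
  from finite_rank_post[OF finite_rank_pre[OF this lq] mDY mDP mDY lt]
  show "finite_rank ?o ?DY ?DY (\<lambda>x. x)" by (rule finite_rank_cong) (use tq in simp)
  show "\<exists>t. lin ?o ?DP ?DY t \<and> (\<forall>\<theta>\<in>carrier ?DY. t (?q \<theta>) = \<theta>)" using lt tq by blast
qed

text \<open>Induction on the length of the resolution, for all Y at once. The kernel K of P 0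
  \<rightarrow> Y has the shifted resolution and satisfies the same hypothesis on Ext, so its dual
  is projective and \<open>dual_step\<close> applies.\<close>

lemma dual_projective:
  fixes L :: "('l, 'e) ring_scheme" and Y :: "'l umodule"
  assumes alg: "is_algebra R L \<phi>" and fgL: "fg_module R (res \<phi> (regular_module L))"
    and high: "\<forall>i J. 2 \<le> i \<longrightarrow> submod R RR J \<longrightarrow> ext_vanishes i RR J"
    and ab: "in_jacobson R a" "in_jacobson R b" "regular_pair R (res \<phi> (regular_module L)) a b"
    and om: "finite_rank (op_ring L) (dual_over R \<phi> (regular_module L)) (dual_over R \<phi> (regular_module L)) (\<lambda>x. x)"
    and Y: "left_module L Y" "\<And>i. ext_vanishes i (res \<phi> Y) {\<zero>\<^bsub>Y\<^esub>}"
    and P: "projective_resolution L Y P \<eta> \<delta>" "\<forall>j\<ge>n. zero_module (P j)"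
  shows "finite_rank (op_ring L) (dual_over R \<phi> Y) (dual_over R \<phi> Y) (\<lambda>x. x) \<and>
    (\<exists>t. lin (op_ring L) (dual_over R \<phi> (P 0)) (dual_over R \<phi> Y) t \<and>
       (\<forall>\<theta>\<in>carrier (dual_over R \<phi> Y). t (restrict (\<lambda>x. \<theta> (\<eta> x)) (carrier (P 0))) = \<theta>))"
  using Y P
proof (induction n arbitrary: Y P \<eta> \<delta>)
  \<comment> \<open>All terms of the resolution are zero, and so is Y, a quotient of P 0.\<close>
  case (0 Y P \<eta> \<delta>)
  note res = "0.prems"(3)[unfolded projective_resolution_def]
  have zP: "carrier (P 0) = {\<zero>\<^bsub>P 0\<^esub>}" using "0.prems"(4) unfolding zero_module_def by blast
  have mP: "left_module L (P 0)" using res[THEN conjunct1] unfolding fg_module_def by blast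
  have e: "lin L (P 0) Y \<eta>" by (rule mod_hom_lin[OF res[THEN conjunct2, THEN conjunct1]])
  have im: "\<eta> ` carrier (P 0) = carrier Y" by (rule res[THEN conjunct2, THEN conjunct2, THEN conjunct2, THEN conjunct1])
  have zY: "carrier Y = {\<zero>\<^bsub>Y\<^esub>}" using im zP lin_zero[OF mP "0.prems"(1) e] by simp
  have rY: "left_module R (res \<phi> Y)" by (rule left_module_res[OF alg "0.prems"(1)])
  have z: "\<theta> = \<zero>\<^bsub>dual_over R \<phi> Y\<^esub>" if "\<theta> \<in> carrier (dual_over R \<phi> Y)" for \<theta>
  proof (rule ext)
    fix x
    have "\<theta> \<zero>\<^bsub>Y\<^esub> = \<zero>\<^bsub>R\<^esub>" using lin_zero[OF rY modRR mod_hom_lin] that by simp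
    then show "\<theta> x = \<zero>\<^bsub>dual_over R \<phi> Y\<^esub> x" using that zY by (auto simp: mod_hom_iff extensional_def)
  qed
  have "finite_rank (op_ring L) (dual_over R \<phi> Y) (dual_over R \<phi> Y) (\<lambda>x. x)" by (rule finite_rank.zero[OF z])
  moreover have "lin (op_ring L) (dual_over R \<phi> (P 0)) (dual_over R \<phi> Y) (\<lambda>x. \<zero>\<^bsub>dual_over R \<phi> Y\<^esub>)"
    by (rule lin_zero_map[OF left_module_dual_over[OF alg mP] left_module_dual_over[OF alg "0.prems"(1)]])
  ultimately show ?case using z by (metis (no_types, lifting))
next
  case (Suc n Y P \<eta> \<delta>)
  note res = Suc.prems(3)[unfolded projective_resolution_def]
  have fgP: "fg_module L (P j)" and prP: "projective_module L (P j)" for j using res[THEN conjunct1] by auto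
  have mP: "left_module L (P j)" for j using fgP[of j] unfolding fg_module_def by blast
  have dh: "\<delta> j \<in> mod_hom L (P (Suc j)) (P j)" for j by (rule res[THEN conjunct2, THEN conjunct2, THEN conjunct1, rule_format])
  have e: "lin L (P 0) Y \<eta>" by (rule mod_hom_lin[OF res[THEN conjunct2, THEN conjunct1]])
  have im: "\<eta> ` carrier (P 0) = carrier Y" by (rule res[THEN conjunct2, THEN conjunct2, THEN conjunct2, THEN conjunct1])
  define K where "K = {x \<in> carrier (P 0). \<eta> x = \<zero>\<^bsub>Y\<^esub>}"
  have imd: "\<delta> 0 ` carrier (P (Suc 0)) = K"
    using res[THEN conjunct2, THEN conjunct2, THEN conjunct2, THEN conjunct2, THEN conjunct1] unfolding kernel_eq K_def .
  have ex: "\<delta> (Suc j) ` carrier (P (Suc (Suc j))) = a_kernel (P (Suc j)) (P j) (\<delta> j)" for j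
    by (rule res[THEN conjunct2, THEN conjunct2, THEN conjunct2, THEN conjunct2, THEN conjunct2, rule_format])
  let ?K = "P 0\<lparr>carrier := K\<rparr>"
  have sK: "submod L (P 0) K" unfolding K_def by (rule submod_kernel[OF mP Suc.prems(1) e])
  have mK: "left_module L ?K" by (rule left_module.submod_module[OF mP sK])
  have fr: "finite_rank L (P 0) (P 0) (\<lambda>x. x)" by (rule projective_finite_rank_id[OF prP fgP])
  have fgr: "fg_module R (res \<phi> (P 0))" by (rule fg_imp_fg_res[OF alg noeth fgL fgP])
  have rY: "left_module R (res \<phi> Y)" by (rule left_module_res[OF alg Suc.prems(1)])
  have rP: "left_module R (res \<phi> (P 0))" by (rule left_module_res[OF alg mP])
  have re: "lin R (res \<phi> (P 0)) (res \<phi> Y) \<eta>" by (rule lin_res[OF alg e])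
  have fgY: "fg_module R (res \<phi> Y)" by (rule fg_image[OF fgr rY re]) (use im in simp)
  have vK: "ext_vanishes i (res \<phi> (P 0)) K" for i
  proof -
    have "{x \<in> carrier (res \<phi> (P 0)). \<eta> x \<in> {\<zero>\<^bsub>res \<phi> Y\<^esub>}} = K" unfolding K_def by auto
    then show ?thesis
      using ext_vanishes_pullback[OF rP fgY left_module.submod_zero[OF rY] re, of i] im Suc.prems(2)[of i] by simp
  qed
  have abR: "a \<in> carrier R" "b \<in> carrier R" using ab(1,2) unfolding in_jacobson_def by auto
  have wP: "regular_pair R (res \<phi> (P 0)) a b" by (rule projective_regular_pair[OF alg mP fr abR ab(3)])
  have v0: "ext_vanishes i (res \<phi> (P 0)) {\<zero>\<^bsub>res \<phi> (P 0)\<^esub>}" for i by (rule ext_vanishes_regular_pair[OF high fgr ab(1,2) wP])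
  \<comment> \<open>Ext of K lies between that of P 0, which has the regular pair of L, and the next
    one of Y = P 0/K.\<close>
  have vK0: "ext_vanishes i (res \<phi> ?K) {\<zero>\<^bsub>?K\<^esub>}" for i
    using ext_vanishes_submodule[OF fgr submod_res[OF alg sK] vK v0] unfolding res_carrier_update by simp
  have "projective_resolution L ?K (\<lambda>j. P (Suc j)) (\<delta> 0) (\<lambda>j. \<delta> (Suc j))"
    unfolding projective_resolution_def
  proof (intro conjI allI)
    show "\<delta> 0 \<in> mod_hom L (P (Suc 0)) ?K" using dh[of 0] imd unfolding mod_hom_def by auto
    show "\<delta> 0 ` carrier (P (Suc 0)) = carrier ?K" using imd by simp
    show "\<delta> (Suc 0) ` carrier (P (Suc (Suc 0))) = a_kernel (P (Suc 0)) ?K (\<delta> 0)" using ex[of 0] unfolding kernel_eq by simp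
  qed (rule fgP prP dh ex)+
  moreover have "\<forall>j\<ge>n. zero_module (P (Suc j))" using Suc.prems(4) by simp
  ultimately have fK: "finite_rank (op_ring L) (dual_over R \<phi> ?K) (dual_over R \<phi> ?K) (\<lambda>x. x)"
    using Suc.IH[OF mK vK0] by blast
  show ?case using dual_step[OF alg mP Suc.prems(1) e im K_def fgr vK om fr fK] by blast
qed

end

section \<open>Transfer along isomorphisms\<close>

lemma lin_inv_into:
  assumes "left_module A M" "left_module A N" "lin A M N q" "bij_betw q (carrier M) (carrier N)"
  shows "lin A N M (inv_into (carrier M) q)"
proof -
  have i: "inj_on q (carrier M)" "q ` carrier M = carrier N" using assms(4) unfolding bij_betw_def by auto
  obtain h where h: "lin A (N\<lparr>carrier := q ` carrier M\<rparr>) M h" "\<And>x. x \<in> carrier M \<Longrightarrow> h (q x) = x"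
    by (rule lin_inverse[OF assms(1-3) i(1)]) auto
  have hN: "lin A N M h" using h(1) unfolding lin_def i(2) by simp
  show ?thesis
  proof (rule lin_cong[OF hN _ assms(2)])
    fix y assume "y \<in> carrier N"
    then have "y \<in> q ` carrier M" using i(2) by simp
    then obtain x where "y = q x" "x \<in> carrier M" by (rule imageE)
    then show "inv_into (carrier M) q y = h y" using h(2) inv_into_f_f[OF i(1)] by simp
  qed
qed

lemma regular_pair_iso:
  assumes "left_module R M" "left_module R N" "lin R M N q" "bij_betw q (carrier M) (carrier N)" "regular_pair R M a b"
    "a \<in> carrier R" "b \<in> carrier R"
  shows "regular_pair R N a b"
proof -
  let ?i = "inv_into (carrier M) q"
  have il: "lin R N M ?i" by (rule lin_inv_into[OF assms(1-4)])
  have qi: "q (?i y) = y" if "y \<in> carrier N" for y using bij_betw_inv_into_right[OF assms(4) that] .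
  show ?thesis unfolding regular_pair_def
  proof (intro conjI ballI impI)
    fix x assume x: "x \<in> carrier N" "a \<odot>\<^bsub>N\<^esub> x = \<zero>\<^bsub>N\<^esub>"
    have "a \<odot>\<^bsub>M\<^esub> ?i x = \<zero>\<^bsub>M\<^esub>" using lin_smult[OF il assms(6) x(1)] x(2) lin_zero[OF assms(2,1) il] by simp
    then have "?i x = \<zero>\<^bsub>M\<^esub>" using assms(5) lin_closed[OF il x(1)] unfolding regular_pair_def by blast
    then show "x = \<zero>\<^bsub>N\<^esub>" using qi[OF x(1)] lin_zero[OF assms(1-3)] by simp
  next
    fix x y assume xy: "x \<in> carrier N" "y \<in> carrier N" "b \<odot>\<^bsub>N\<^esub> x = a \<odot>\<^bsub>N\<^esub> y"
    have "b \<odot>\<^bsub>M\<^esub> ?i x = a \<odot>\<^bsub>M\<^esub> ?i y"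
      using lin_smult[OF il assms(7) xy(1)] lin_smult[OF il assms(6) xy(2)] xy(3) by simp
    then obtain z where z: "z \<in> carrier M" "?i x = a \<odot>\<^bsub>M\<^esub> z"
      using assms(5) lin_closed[OF il xy(1)] lin_closed[OF il xy(2)] unfolding regular_pair_def by blast
    have "x = a \<odot>\<^bsub>N\<^esub> q z" using qi[OF xy(1)] z lin_smult[OF assms(3,6) z(1)] by simp
    then show "\<exists>z\<in>carrier N. x = a \<odot>\<^bsub>N\<^esub> z" using lin_closed[OF assms(3) z(1)] by blast
  qed
qed

lemma finite_rank_scalar_iso:
  assumes "left_module R M" "left_module R N" "lin R M N q" "bij_betw q (carrier M) (carrier N)" "r \<in> carrier R"
    "finite_rank R N N (\<lambda>x. r \<odot>\<^bsub>N\<^esub> x)"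
  shows "finite_rank R M M (\<lambda>x. r \<odot>\<^bsub>M\<^esub> x)"
proof -
  interpret M: left_module R M by fact
  let ?i = "inv_into (carrier M) q"
  have il: "lin R N M ?i" by (rule lin_inv_into[OF assms(1-4)])
  from finite_rank_post[OF finite_rank_pre[OF assms(6,3)] assms(1,2,1) il]
  show ?thesis
  proof (rule finite_rank_cong)
    fix x assume x: "x \<in> carrier M"
    have "?i (q (r \<odot>\<^bsub>M\<^esub> x)) = r \<odot>\<^bsub>M\<^esub> x" using bij_betw_inv_into_left[OF assms(4)] x assms(5) by simp
    then show "r \<odot>\<^bsub>M\<^esub> x = ?i (r \<odot>\<^bsub>N\<^esub> q x)" using lin_smult[OF assms(3,5) x] by simp
  qed
qed

section \<open>The coinduced module, and transfer of scalars from the order to modules of depth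
  two\<close>

text \<open>Coinduction of W from R to L. Right multiplication on the argument gives a left
  L-module, which over R is the usual Hom.\<close>

definition ohom ::
  "('a, 'c) ring_scheme \<Rightarrow> ('l, 'e) ring_scheme \<Rightarrow> ('a \<Rightarrow> 'l) \<Rightarrow> ('a, 'w, 'd) module_scheme \<Rightarrow> ('l, 'l \<Rightarrow> 'w) module" where
  "ohom R L \<phi> W = \<lparr>carrier = mod_hom R (res \<phi> (regular_module L)) W, monoid.mult = undefined, one = undefined,
     ring.zero = (\<lambda>x\<in>carrier L. \<zero>\<^bsub>W\<^esub>), ring.add = (\<lambda>f g. \<lambda>x\<in>carrier L. f x \<oplus>\<^bsub>W\<^esub> g x),
     smult = (\<lambda>a f. \<lambda>x\<in>carrier L. f (x \<otimes>\<^bsub>L\<^esub> a))\<rparr>"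

lemma ohom_simps [simp]:
  "carrier (ohom R L \<phi> W) = mod_hom R (res \<phi> (regular_module L)) W"
  "ring.zero (ohom R L \<phi> W) = (\<lambda>x\<in>carrier L. \<zero>\<^bsub>W\<^esub>)"
  "ring.add (ohom R L \<phi> W) = (\<lambda>f g. \<lambda>x\<in>carrier L. f x \<oplus>\<^bsub>W\<^esub> g x)"
  "smult (ohom R L \<phi> W) = (\<lambda>a f. \<lambda>x\<in>carrier L. f (x \<otimes>\<^bsub>L\<^esub> a))"
  unfolding ohom_def by simp_all

lemma left_module_ohom:
  assumes alg: "is_algebra R L \<phi>" and W: "left_module R W"
  shows "left_module L (ohom R L \<phi> W)"
proof -
  note a = is_algebraD[OF alg]
  interpret L: ring L by (rule a(2))
  let ?LL = "regular_module L"
  have LL: "left_module L ?LL" by (rule left_module_regular[OF a(2)])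
  have rL: "left_module R (res \<phi> ?LL)" by (rule left_module_res[OF alg LL])
  interpret W: left_module R W by (rule W)
  have "abelian_group (ohom R L \<phi> W)" by (rule abelian_group_homs[OF rL W]) simp_all
  moreover have sm: "(\<lambda>x\<in>carrier L. f (x \<otimes>\<^bsub>L\<^esub> l)) \<in> mod_hom R (res \<phi> ?LL) W"
    if l: "l \<in> carrier L" and f: "f \<in> mod_hom R (res \<phi> ?LL) W" for l f
    using lin_restrict[OF rL lin_comp[OF lin_res[OF alg lin_right_mult[OF LL, of l]] mod_hom_lin[OF f]]] l by simp
  moreover have "f (x \<oplus>\<^bsub>L\<^esub> y) = f x \<oplus>\<^bsub>W\<^esub> f y"
    if "f \<in> mod_hom R (res \<phi> ?LL) W" "x \<in> carrier L" "y \<in> carrier L" for f x y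
    using lin_add[OF mod_hom_lin[OF that(1)]] that(2,3) by simp
  moreover have "(\<lambda>x\<in>carrier L. f (x \<otimes>\<^bsub>L\<^esub> \<one>\<^bsub>L\<^esub>)) = f" if "f \<in> mod_hom R (res \<phi> ?LL) W" for f
    by (rule ext) (use that in \<open>auto simp: mod_hom_iff extensional_def\<close>)
  ultimately show ?thesis
    unfolding left_module_def left_module_axioms_def ohom_simps
    by (intro conjI allI impI restrict_ext)
      (simp_all add: a(2) L.r_distr L.m_assoc)
qed

text \<open>Acting with R on values or through \<phi> on arguments is the same, since \<phi> maps
  into the centre of L.\<close>

lemma lin_hom_ohom:
  assumes alg: "is_algebra R L \<phi>"
  shows "lin R (hom_mod R (res \<phi> (regular_module L)) W) (res \<phi> (ohom R L \<phi> W)) (\<lambda>f. f)"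
proof (rule linI)
  fix r f assume r: "r \<in> carrier R" and f: "f \<in> carrier (hom_mod R (res \<phi> (regular_module L)) W)"
  then have fl: "lin R (res \<phi> (regular_module L)) W f" using mod_hom_lin by simp
  show "r \<odot>\<^bsub>hom_mod R (res \<phi> (regular_module L)) W\<^esub> f = r \<odot>\<^bsub>res \<phi> (ohom R L \<phi> W)\<^esub> f"
    unfolding hom_mod_simps res_simps ohom_simps regular_module_simps
  proof (rule restrict_ext)
    fix x assume "x \<in> carrier L"
    then show "r \<odot>\<^bsub>W\<^esub> f x = f (x \<otimes>\<^bsub>L\<^esub> \<phi> r)" using lin_smult[OF fl r, of x] is_algebraD(7)[OF alg r, of x] by simp
  qed
qed auto

lemma finite_proj_dim:
  fixes L :: "('l, 'e) ring_scheme" and Y :: "'l umodule"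
  assumes "global_dim L < \<infinity>" "fg_module L Y"
  obtains n P \<eta> \<delta> where "projective_resolution L Y P \<eta> \<delta>" "\<forall>j\<ge>n. zero_module (P j)"
proof -
  have "proj_dim L Y \<le> global_dim L" unfolding global_dim_def by (rule SUP_upper) (use assms(2) in simp)
  then have fin: "proj_dim L Y < \<infinity>" using assms(1) by (rule le_less_trans)
  let ?S = "{enat n | n. \<exists>P \<epsilon> d. projective_resolution L Y P \<epsilon> d \<and> (\<forall>j>n. zero_module (P j))}"
  have "?S \<noteq> {}"
  proof
    assume "?S = {}"
    then have "proj_dim L Y = \<infinity>" unfolding proj_dim_def by (simp only: Inf_enat_def simp_thms if_True)
    then show False using fin by simp
  qed
  then obtain n P \<eta> \<delta> where "projective_resolution L Y P \<eta> \<delta>" "\<forall>j>n. zero_module (P j)" by blast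
  \<comment> \<open>\<open>Suc n\<close> turns the bound j > n of \<open>proj_dim\<close> into the j
    \<ge> n on which \<open>dual_projective\<close> inducts.\<close>
  then show ?thesis using that[of P \<eta> \<delta> "Suc n"] by (simp add: Suc_le_eq)
qed

context inj_res
begin

text \<open>Multiplication by r on X is a composite X \<rightarrow> W* \<rightarrow> Y*
  \<rightarrow> P0* \<rightarrow> P0* \<rightarrow> Y* \<rightarrow> W* \<rightarrow> X, with W the
  dual of X, whose middle map is multiplication by r. That map has finite rank because P0 is
  projective over L, and finite rank is kept under composition on either side.\<close>

lemma scalar_finite_rank_transfer:
  fixes L :: "('l, 'e) ring_scheme" and X :: "('a, 'x, 'd) module_scheme"
  assumes alg: "is_algebra R L \<phi>" and fgL: "fg_module R (res \<phi> (regular_module L))"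
    and high: "\<forall>i J. 2 \<le> i \<longrightarrow> submod R RR J \<longrightarrow> ext_vanishes i RR J"
    and ab: "in_jacobson R a" "in_jacobson R b" "regular_pair R (res \<phi> (regular_module L)) a b" "regular_pair R RR a b"
    and om: "finite_rank (op_ring L) (dual_over R \<phi> (regular_module L)) (dual_over R \<phi> (regular_module L)) (\<lambda>x. x)"
    and gd: "global_dim L < \<infinity>"
    and rho: "lin R (res \<phi> (regular_module L)) RR \<rho>" "\<rho> \<one>\<^bsub>L\<^esub> = \<one>\<^bsub>R\<^esub>"
    and X: "fg_module R X" "\<And>i. ext_vanishes i X {\<zero>\<^bsub>X\<^esub>}"
    and r: "r \<in> carrier R" "finite_rank R (res \<phi> (regular_module L)) (res \<phi> (regular_module L)) (\<lambda>x. \<phi> r \<otimes>\<^bsub>L\<^esub> x)"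
  shows "finite_rank R X X (\<lambda>x. r \<odot>\<^bsub>X\<^esub> x)"
proof -
  let ?LL = "regular_module L"
  let ?Lr = "res \<phi> ?LL"
  note a = is_algebraD[OF alg]
  interpret L: ring L by (rule a(2))
  have LL: "left_module L ?LL" by (rule left_module_regular[OF a(2)])
  have rL: "left_module R ?Lr" by (rule left_module_res[OF alg LL])
  have abR: "a \<in> carrier R" "b \<in> carrier R" using ab(1,2) unfolding in_jacobson_def by auto
  have mX: "left_module R X" by (rule fgD[OF X(1)])
  interpret X: left_module R X by (rule mX)
  define W where "W = hom_mod R X RR"
  have nW: "noetherian_mod R W" unfolding W_def by (rule noetherian_hom[OF cring X(1) noeth])
  have mW: "left_module R W" by (rule noetherian_modD(1)[OF nW])
  interpret W: left_module R W by (rule mW)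
  have wW: "regular_pair R W a b" unfolding W_def by (rule regular_pair_hom[OF cring mX modRR ab(4) abR])
  let ?H = "hom_mod R ?Lr W" and ?Y0 = "ohom R L \<phi> W"
  have nH: "noetherian_mod R ?H" by (rule noetherian_hom[OF cring fgL nW])
  have mH: "left_module R ?H" by (rule noetherian_modD(1)[OF nH])
  have wH: "regular_pair R ?H a b" by (rule regular_pair_hom[OF cring rL mW wW abR])
  have mY0: "left_module L ?Y0" by (rule left_module_ohom[OF alg mW])
  have rY0: "left_module R (res \<phi> ?Y0)" by (rule left_module_res[OF alg mY0])
  have HY: "lin R ?H (res \<phi> ?Y0) (\<lambda>f. f)" by (rule lin_hom_ohom[OF alg])
  have fgY0r: "fg_module R (res \<phi> ?Y0)" by (rule fg_image[OF noetherian_modD(3)[OF nH] rY0 HY]) simp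
  have fgY0: "fg_module L ?Y0" by (rule fg_res_imp_fg[OF alg mY0 fgY0r])
  \<comment> \<open>\<open>global_dim\<close> ranges over modules on \<open>univ\<close>, so the
    coinduced module is copied there.\<close>
  obtain c :: "('l \<Rightarrow> 'x \<Rightarrow> 'a) \<Rightarrow> 'l univ" where c: "inj_on c (carrier ?Y0)" using fg_module_code[OF fgY0] .
  define Y where "Y = transport c ?Y0"
  note tY = transport[OF mY0 c, folded Y_def]
  have cY: "carrier Y = c ` carrier ?Y0" unfolding Y_def by simp
  have mY: "left_module L Y" by (rule tY(1))
  have fgY: "fg_module L Y" by (rule fg_image[OF fgY0 mY tY(2)]) (use cY in simp)
  have rY: "left_module R (res \<phi> Y)" by (rule left_module_res[OF alg mY])
  have HYc: "lin R ?H (res \<phi> Y) c" by (rule lin_comp[OF HY lin_res[OF alg tY(2)]])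
  have bij: "bij_betw c (carrier ?H) (carrier (res \<phi> Y))" using c cY unfolding bij_betw_def by simp
  have wY: "regular_pair R (res \<phi> Y) a b" by (rule regular_pair_iso[OF mH rY HYc bij wH abR])
  have fgYr: "fg_module R (res \<phi> Y)" by (rule fg_image[OF noetherian_modD(3)[OF nH] rY HYc]) (use bij in \<open>simp add: bij_betw_def\<close>)
  have vY: "ext_vanishes i (res \<phi> Y) {\<zero>\<^bsub>Y\<^esub>}" for i using ext_vanishes_regular_pair[OF high fgYr ab(1,2) wY] by simp
  obtain n P \<eta> \<delta> where P: "projective_resolution L Y P \<eta> \<delta>" "\<forall>j\<ge>n. zero_module (P j)"
    by (rule finite_proj_dim[OF gd fgY])
  define P0 where "P0 = P 0"
  note res = P(1)[unfolded projective_resolution_def, folded P0_def]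
  have fgP: "fg_module L P0" and prP: "projective_module L P0" using res[THEN conjunct1, rule_format, of 0] unfolding P0_def by auto
  have mP: "left_module L P0" using fgP unfolding fg_module_def by blast
  have rP: "left_module R (res \<phi> P0)" by (rule left_module_res[OF alg mP])
  have e: "lin L P0 Y \<eta>" by (rule mod_hom_lin[OF res[THEN conjunct2, THEN conjunct1]])
  obtain t where t: "lin (op_ring L) (dual_over R \<phi> P0) (dual_over R \<phi> Y) t"
      "\<forall>\<theta>\<in>carrier (dual_over R \<phi> Y). t (restrict (\<lambda>x. \<theta> (\<eta> x)) (carrier P0)) = \<theta>"
    using dual_projective[OF alg fgL high ab(1-3) om mY vY P] unfolding P0_def by blast
  let ?D = "\<lambda>M. hom_mod R M RR"
  let ?DP = "hom_mod R (res \<phi> P0) RR" and ?DY = "hom_mod R (res \<phi> Y) RR" and ?DW = "hom_mod R W RR"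
  have mDP: "left_module R ?DP" and mDY: "left_module R ?DY" and mDW: "left_module R ?DW"
    by (rule left_module_hom[OF cring _ modRR], fact)+
  have lt: "lin R ?DP ?DY t" by (rule lin_res_dual_over[OF alg mP mY t(1)])
  have "finite_rank R (res \<phi> P0) (res \<phi> P0) (\<lambda>x. \<phi> r \<odot>\<^bsub>P0\<^esub> x)"
    by (rule finite_rank_smult_res[OF alg mP mP r projective_finite_rank_id[OF prP fgP]])
  then have fP: "finite_rank R ?DP ?DP (\<lambda>\<theta>. restrict (\<lambda>x. \<theta> (\<phi> r \<odot>\<^bsub>P0\<^esub> x)) (carrier (res \<phi> P0)))"
    by (rule finite_rank_dual[OF cring rP rP])
  \<comment> \<open>The splitting of R \<rightarrow> L makes W a summand of Y: w goes to the map l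
    \<mapsto> \<rho>(l) w, and evaluation at 1 recovers w because \<rho>(1) = 1.\<close>
  let ?\<sigma> = "\<lambda>w. c (restrict (\<lambda>l. \<rho> l \<odot>\<^bsub>W\<^esub> w) (carrier ?Lr))" and ?\<tau> = "\<lambda>y. inv_into (carrier ?H) c y \<one>\<^bsub>L\<^esub>"
  have l0: "lin R W ?H (\<lambda>w. restrict (\<lambda>l. \<rho> l \<odot>\<^bsub>W\<^esub> w) (carrier ?Lr))"
  proof (rule linI)
    have rc: "\<rho> l \<in> carrier R" if "l \<in> carrier L" for l using lin_closed[OF rho(1), of l] that by simp
    show "restrict (\<lambda>l. \<rho> l \<odot>\<^bsub>W\<^esub> w) (carrier ?Lr) \<in> carrier ?H" if "w \<in> carrier W" for w
      using lin_restrict[OF rL lin_comp[OF rho(1) lin_right_mult[OF mW that]]] by simp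
    show "restrict (\<lambda>l. \<rho> l \<odot>\<^bsub>W\<^esub> (w \<oplus>\<^bsub>W\<^esub> v)) (carrier ?Lr) =
      restrict (\<lambda>l. \<rho> l \<odot>\<^bsub>W\<^esub> w) (carrier ?Lr) \<oplus>\<^bsub>?H\<^esub> restrict (\<lambda>l. \<rho> l \<odot>\<^bsub>W\<^esub> v) (carrier ?Lr)"
      if "w \<in> carrier W" "v \<in> carrier W" for w v
      unfolding hom_mod_simps using that rc by (intro restrict_ext) (simp add: W.smult_r_distr)
    show "restrict (\<lambda>l. \<rho> l \<odot>\<^bsub>W\<^esub> (s \<odot>\<^bsub>W\<^esub> w)) (carrier ?Lr) = s \<odot>\<^bsub>?H\<^esub> restrict (\<lambda>l. \<rho> l \<odot>\<^bsub>W\<^esub> w) (carrier ?Lr)"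
      if "s \<in> carrier R" "w \<in> carrier W" for s w
      unfolding hom_mod_simps using that rc cring.cring_simprules(14)[OF cring, of s]
      by (intro restrict_ext) (simp add: W.smult_assoc1[symmetric])
  qed
  have ls: "lin R W (res \<phi> Y) ?\<sigma>" by (rule lin_comp[OF l0 HYc])
  have one: "\<one>\<^bsub>L\<^esub> \<in> carrier ?Lr" by simp
  have lta: "lin R (res \<phi> Y) W ?\<tau>"
    by (rule lin_comp[OF lin_inv_into[OF mH rY HYc bij] lin_eval[OF one]])
  have ts: "?\<tau> (?\<sigma> w) = w" if w: "w \<in> carrier W" for w
  proof -
    have "inv_into (carrier ?H) c (?\<sigma> w) = restrict (\<lambda>l. \<rho> l \<odot>\<^bsub>W\<^esub> w) (carrier ?Lr)"
      by (rule bij_betw_inv_into_left[OF bij lin_closed[OF l0 w]])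
    then show ?thesis using rho(2) w by simp
  qed
  obtain q where q: "lin R (hom_mod R W RR) X q" "\<And>x. x \<in> carrier X \<Longrightarrow> q (\<lambda>\<theta>\<in>mod_hom R X RR. \<theta> x) = x"
    unfolding W_def by (rule reflexive[OF high ab(1,2,4) X]) auto
  let ?ev = "\<lambda>x. \<lambda>\<theta>\<in>mod_hom R X RR. \<theta> x"
  have lev: "lin R X ?DW ?ev" unfolding W_def by (rule lin_bidual[OF cring mX])
  \<comment> \<open>\<open>?f1\<close> and \<open>?f5\<close> are dual to ?\<tau> and ?\<sigma>, and
    \<open>?f2\<close> is dual to the augmentation \<eta>. Between \<open>?f3\<close>, which is
    multiplication by r, and \<open>?f5\<close> stands the retraction t.\<close>
  let ?f1 = "\<lambda>\<Theta>. restrict (\<lambda>y. \<Theta> (?\<tau> y)) (carrier (res \<phi> Y))"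
  let ?f2 = "\<lambda>\<Theta>. restrict (\<lambda>x. \<Theta> (\<eta> x)) (carrier (res \<phi> P0))"
  let ?f3 = "\<lambda>\<theta>. restrict (\<lambda>x. \<theta> (\<phi> r \<odot>\<^bsub>P0\<^esub> x)) (carrier (res \<phi> P0))"
  let ?f5 = "\<lambda>\<Theta>. restrict (\<lambda>w. \<Theta> (?\<sigma> w)) (carrier W)"
  have f1: "lin R ?DW ?DY ?f1" by (rule lin_pre[OF rY lta])
  have f2: "lin R ?DY ?DP ?f2" by (rule lin_pre[OF rP lin_res[OF alg e]])
  have f5: "lin R ?DY ?DW ?f5" by (rule lin_pre[OF mW ls])
  have g: "lin R X ?DP (\<lambda>x. ?f2 (?f1 (?ev x)))" by (rule lin_comp[OF lin_comp[OF lev f1] f2])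
  have k: "lin R ?DP X (\<lambda>\<theta>. q (?f5 (t \<theta>)))" by (rule lin_comp[OF lin_comp[OF lt f5] q(1)])
  have "finite_rank R X X (\<lambda>x. q (?f5 (t (?f3 (?f2 (?f1 (?ev x)))))))"
    by (rule finite_rank_post[OF finite_rank_pre[OF fP g] mX mDP mX k])
  then show ?thesis
  proof (rule finite_rank_cong)
    fix x assume x: "x \<in> carrier X"
    let ?\<Theta> = "?f1 (?ev x)"
    have Th: "?\<Theta> \<in> carrier ?DY" using lin_closed[OF f1 lin_closed[OF lev x]] .
    have sTh: "r \<odot>\<^bsub>?DY\<^esub> ?\<Theta> \<in> carrier ?DY" by (rule left_module.smult_closed[OF mDY r(1) Th])
    have gx: "?f2 ?\<Theta> \<in> carrier ?DP" by (rule lin_closed[OF f2 Th])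
    have gl: "lin R (res \<phi> P0) RR (?f2 ?\<Theta>)" using gx mod_hom_lin by simp
    have "?f3 (?f2 ?\<Theta>) = restrict (\<lambda>y. r \<odot>\<^bsub>RR\<^esub> ?f2 ?\<Theta> y) (carrier (res \<phi> P0))"
    proof (rule restrict_ext)
      fix y assume y: "y \<in> carrier (res \<phi> P0)"
      show "?f2 ?\<Theta> (\<phi> r \<odot>\<^bsub>P0\<^esub> y) = r \<odot>\<^bsub>RR\<^esub> ?f2 ?\<Theta> y"
        using lin_smult[OF gl r(1) y] unfolding res_simps .
    qed
    also have "\<dots> = r \<odot>\<^bsub>?DP\<^esub> ?f2 ?\<Theta>" unfolding hom_mod_simps(4) ..
    also have "\<dots> = ?f2 (r \<odot>\<^bsub>?DY\<^esub> ?\<Theta>)" by (rule lin_smult[OF f2 r(1) Th, symmetric])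
    finally have "t (?f3 (?f2 ?\<Theta>)) = t (?f2 (r \<odot>\<^bsub>?DY\<^esub> ?\<Theta>))" by simp
    also have "\<dots> = r \<odot>\<^bsub>?DY\<^esub> ?\<Theta>"
      using bspec[OF t(2), of "r \<odot>\<^bsub>?DY\<^esub> ?\<Theta>"] sTh by (simp only: hom_mod_simps dual_over_simps res_simps)
    finally have tt: "t (?f3 (?f2 ?\<Theta>)) = r \<odot>\<^bsub>?DY\<^esub> ?\<Theta>" .
    have evW: "?ev x \<in> mod_hom R W RR" using lin_closed[OF lev x] by simp
    have "?f5 ?\<Theta> = ?ev x"
    proof (rule mod_hom_eqI[OF _ evW])
      show "?f5 ?\<Theta> \<in> mod_hom R W RR" using lin_closed[OF f5 Th] by simp
      show "?f5 ?\<Theta> w = ?ev x w" if w: "w \<in> carrier W" for w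
        using w lin_closed[OF ls w] ts[OF w] by simp
    qed
    then have "q (?f5 (t (?f3 (?f2 ?\<Theta>)))) = q (r \<odot>\<^bsub>?DW\<^esub> ?ev x)"
      unfolding tt using lin_smult[OF f5 r(1) Th] by simp
    also have "\<dots> = r \<odot>\<^bsub>X\<^esub> x" using lin_smult[OF q(1) r(1) lin_closed[OF lev x]] q(2)[OF x] by simp
    finally show "r \<odot>\<^bsub>X\<^esub> x = q (?f5 (t (?f3 (?f2 ?\<Theta>))))" by simp
  qed
qed

end

section \<open>Stable annihilators\<close>

text \<open>In one direction the identity of the projective module has finite rank, and so does
  every map through it; in the other, a map of finite rank factors through a free module, copied to
  \<open>univ\<close>.\<close>

lemma proj_factoring_maps_eq:
  fixes R :: "('a, 'c) ring_scheme"
  assumes "ring R" "left_module R M"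
  shows "proj_factoring_maps R M = {f \<in> mod_hom R M M. finite_rank R M M f}"
proof (intro subset_antisym subsetI)
  fix f assume "f \<in> proj_factoring_maps R M"
  then obtain P :: "'a umodule" and g h where *: "fg_module R P" "projective_module R P"
    "g \<in> mod_hom R M P" "h \<in> mod_hom R P M" "f = compose (carrier M) h g"
    unfolding proj_factoring_maps_def by blast
  have P: "left_module R P" using *(1) unfolding fg_module_def by blast
  have fr: "finite_rank R M M (\<lambda>x. h (g x))"
    by (rule finite_rank_post[OF finite_rank_pre[OF projective_finite_rank_id[OF *(2,1)] mod_hom_lin[OF *(3)]] assms(2) P assms(2) mod_hom_lin[OF *(4)]])
  have e: "f = restrict (\<lambda>x. h (g x)) (carrier M)" using *(5) unfolding compose_def by simp
  have "f \<in> mod_hom R M M"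
    unfolding e by (rule lin_restrict[OF assms(2) lin_comp[OF mod_hom_lin[OF *(3)] mod_hom_lin[OF *(4)]]])
  moreover have "finite_rank R M M f" by (rule finite_rank_cong[OF fr]) (simp add: e)
  ultimately show "f \<in> {f \<in> mod_hom R M M. finite_rank R M M f}" by simp
next
  fix f assume "f \<in> {f \<in> mod_hom R M M. finite_rank R M M f}"
  then have f: "f \<in> mod_hom R M M" "finite_rank R M M f" by auto
  obtain n u c where *: "\<forall>i<n. u i \<in> carrier M" "lin R M (free_mod R n) c" "\<forall>x\<in>carrier M. f x = lincomb M u n (c x)"
    using finite_rank_lincomb[OF f(2) assms(2)] by (elim exE conjE)
  note F = free_umodule[OF assms(1), of n]
  let ?P = "free_umodule R n"
  have P: "left_module R ?P" using F(1) unfolding fg_module_def by blast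
  have cl: "lin R M ?P (\<lambda>x. {c x})" by (rule lin_comp[OF *(2) F(3)])
  let ?g = "restrict (\<lambda>x. {c x}) (carrier M)" and ?h = "restrict (\<lambda>y. lincomb M u n (the_elem y)) (carrier ?P)"
  have g: "?g \<in> mod_hom R M ?P" by (rule lin_restrict[OF assms(2) cl])
  have h: "?h \<in> mod_hom R ?P M"
    by (rule lin_restrict[OF P lin_comp[OF F(4) lin_lincomb[OF assms(2)]]]) (use *(1) in auto)
  have "f = compose (carrier M) ?h ?g"
  proof (rule ext)
    fix x show "f x = compose (carrier M) ?h ?g x"
      using f(1) *(3) lin_closed[OF cl, of x] by (auto simp: compose_def mod_hom_iff extensional_def)
  qed
  then show "f \<in> proj_factoring_maps R M" unfolding proj_factoring_maps_def using F(1,2) g h by blast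
qed

lemma end_ring_simps [simp]:
  "carrier (end_ring R M) = mod_hom R M M" "monoid.mult (end_ring R M) = (\<lambda>f g. compose (carrier M) f g)"
  "one (end_ring R M) = (\<lambda>x\<in>carrier M. x)" "ring.zero (end_ring R M) = (\<lambda>x\<in>carrier M. \<zero>\<^bsub>M\<^esub>)"
  "ring.add (end_ring R M) = (\<lambda>f g. \<lambda>x\<in>carrier M. f x \<oplus>\<^bsub>M\<^esub> g x)"
  unfolding end_ring_def by simp_all

lemma compose_mod_hom:
  assumes "left_module R M" "f \<in> mod_hom R M M" "g \<in> mod_hom R M M"
  shows "compose (carrier M) f g \<in> mod_hom R M M"
  unfolding compose_def by (rule lin_restrict[OF assms(1) lin_comp[OF mod_hom_lin[OF assms(3)] mod_hom_lin[OF assms(2)]]])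

lemma ring_end: assumes "left_module R M" shows "ring (end_ring R M)"
proof (rule ringI)
  interpret M: left_module R M by fact
  show "abelian_group (end_ring R M)" by (rule abelian_group_homs[OF assms assms]) simp_all
  show "monoid (end_ring R M)"
  proof (rule monoidI)
    show "\<one>\<^bsub>end_ring R M\<^esub> \<in> carrier (end_ring R M)" using lin_restrict[OF assms lin_id] by simp
    show "f \<otimes>\<^bsub>end_ring R M\<^esub> g \<in> carrier (end_ring R M)" if "f \<in> carrier (end_ring R M)" "g \<in> carrier (end_ring R M)" for f g
      using compose_mod_hom[OF assms] that by simp
    show "(f \<otimes>\<^bsub>end_ring R M\<^esub> g) \<otimes>\<^bsub>end_ring R M\<^esub> h = f \<otimes>\<^bsub>end_ring R M\<^esub> (g \<otimes>\<^bsub>end_ring R M\<^esub> h)"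
      if "h \<in> carrier (end_ring R M)" for f g h
      using that mod_hom_closed[of h R M M] by (auto simp: compose_def fun_eq_iff)
    show "\<one>\<^bsub>end_ring R M\<^esub> \<otimes>\<^bsub>end_ring R M\<^esub> f = f" if "f \<in> carrier (end_ring R M)" for f
      using that mod_hom_closed[of f R M M] by (auto simp: compose_def fun_eq_iff mod_hom_iff extensional_def)
    show "f \<otimes>\<^bsub>end_ring R M\<^esub> \<one>\<^bsub>end_ring R M\<^esub> = f" if "f \<in> carrier (end_ring R M)" for f
      using that by (auto simp: compose_def fun_eq_iff mod_hom_iff extensional_def)
  qed
  fix f g h assume f: "f \<in> carrier (end_ring R M)" and g: "g \<in> carrier (end_ring R M)" and h: "h \<in> carrier (end_ring R M)"
  show "(f \<oplus>\<^bsub>end_ring R M\<^esub> g) \<otimes>\<^bsub>end_ring R M\<^esub> h = f \<otimes>\<^bsub>end_ring R M\<^esub> h \<oplus>\<^bsub>end_ring R M\<^esub> g \<otimes>\<^bsub>end_ring R M\<^esub> h"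
    using h mod_hom_closed[of h R M M] by (auto simp: compose_def fun_eq_iff)
  show "h \<otimes>\<^bsub>end_ring R M\<^esub> (f \<oplus>\<^bsub>end_ring R M\<^esub> g) = h \<otimes>\<^bsub>end_ring R M\<^esub> f \<oplus>\<^bsub>end_ring R M\<^esub> h \<otimes>\<^bsub>end_ring R M\<^esub> g"
    using f g lin_add[OF mod_hom_lin, of h R M M] h mod_hom_closed[of f R M M] mod_hom_closed[of g R M M]
    by (auto simp: compose_def fun_eq_iff)
qed

lemma ideal_proj_factoring_maps:
  assumes "cring R" "left_module R M"
  shows "ideal (proj_factoring_maps R M) (end_ring R M)"
proof -
  interpret R: cring R by fact
  interpret M: left_module R M by fact
  interpret E: ring "end_ring R M" by (rule ring_end[OF assms(2)])
  note eq = proj_factoring_maps_eq[OF R.ring_axioms assms(2)]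
  have cl: "f \<oplus>\<^bsub>end_ring R M\<^esub> g \<in> proj_factoring_maps R M" if "f \<in> proj_factoring_maps R M" "g \<in> proj_factoring_maps R M" for f g
  proof -
    have "f \<in> mod_hom R M M" "g \<in> mod_hom R M M" "finite_rank R M M f" "finite_rank R M M g" using that unfolding eq by auto
    then show ?thesis unfolding eq using E.a_closed[of f g] finite_rank_add[OF _ _ assms(2,2), of g f] by simp
  qed
  have lm: "compose (carrier M) g f \<in> proj_factoring_maps R M" if "f \<in> proj_factoring_maps R M" "g \<in> mod_hom R M M" for f g
  proof -
    have f: "f \<in> mod_hom R M M" "finite_rank R M M f" using that(1) unfolding eq by auto
    have "finite_rank R M M (compose (carrier M) g f)"
      by (rule finite_rank_cong[OF finite_rank_post[OF f(2) assms(2,2,2) mod_hom_lin[OF that(2)]]]) (simp add: compose_def)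
    then show ?thesis unfolding eq using compose_mod_hom[OF assms(2) that(2) f(1)] by simp
  qed
  have rm: "compose (carrier M) f g \<in> proj_factoring_maps R M" if "f \<in> proj_factoring_maps R M" "g \<in> mod_hom R M M" for f g
  proof -
    have f: "f \<in> mod_hom R M M" "finite_rank R M M f" using that(1) unfolding eq by auto
    have "finite_rank R M M (compose (carrier M) f g)"
      by (rule finite_rank_cong[OF finite_rank_pre[OF f(2) mod_hom_lin[OF that(2)]]]) (simp add: compose_def)
    then show ?thesis unfolding eq using compose_mod_hom[OF assms(2) f(1) that(2)] by simp
  qed
  have z: "\<zero>\<^bsub>end_ring R M\<^esub> \<in> proj_factoring_maps R M"
    unfolding eq using E.zero_closed by (auto intro: finite_rank.zero)
  have sub: "proj_factoring_maps R M \<subseteq> mod_hom R M M" unfolding eq by auto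
  have mi: "\<ominus>\<^bsub>end_ring R M\<^esub> f \<in> proj_factoring_maps R M" if "f \<in> proj_factoring_maps R M" for f
  proof -
    have fE: "f \<in> carrier (end_ring R M)" using that sub by auto
    have "(\<ominus>\<^bsub>end_ring R M\<^esub> \<one>\<^bsub>end_ring R M\<^esub>) \<otimes>\<^bsub>end_ring R M\<^esub> f = \<ominus>\<^bsub>end_ring R M\<^esub> f"
      using E.l_minus[OF E.one_closed fE] E.l_one[OF fE] by metis
    moreover have "(\<ominus>\<^bsub>end_ring R M\<^esub> \<one>\<^bsub>end_ring R M\<^esub>) \<otimes>\<^bsub>end_ring R M\<^esub> f \<in> proj_factoring_maps R M"
      using lm[OF that] E.a_inv_closed[OF E.one_closed] by simp
    ultimately show ?thesis by simp
  qed
  show ?thesis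
  proof (rule idealI)
    show "ring (end_ring R M)" by (rule E.ring_axioms)
    show "subgroup (proj_factoring_maps R M) (add_monoid (end_ring R M))"
    proof (rule subgroup.intro)
      show "inv\<^bsub>add_monoid (end_ring R M)\<^esub> f \<in> proj_factoring_maps R M" if "f \<in> proj_factoring_maps R M" for f
        using mi[OF that] unfolding a_inv_def .
    qed (use sub z cl in auto)
  qed (use lm rm in auto)
qed

text \<open>A scalar kills the stable endomorphism ring exactly if it kills its identity, that is,
  if multiplication by it lies in the ideal of maps through projectives.\<close>

lemma stable_ann_eq:
  assumes "cring R" "left_module R M"
  shows "stable_ann R M = {r \<in> carrier R. finite_rank R M M (\<lambda>x. r \<odot>\<^bsub>M\<^esub> x)}"
proof -
  interpret R: cring R by fact
  interpret M: left_module R M by fact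
  let ?E = "end_ring R M" and ?P = "proj_factoring_maps R M"
  interpret I: ideal ?P ?E by (rule ideal_proj_factoring_maps[OF assms])
  interpret S: ring "?E Quot ?P" by (rule I.quotient_is_ring)
  let ?mu = "\<lambda>r. \<lambda>x\<in>carrier M. r \<odot>\<^bsub>M\<^esub> x"
  have mu: "?mu r \<in> carrier ?E" if "r \<in> carrier R" for r
    using lin_restrict[OF assms(2) lin_scalar[OF assms that]] by simp
  have muP: "?mu r \<in> ?P \<longleftrightarrow> finite_rank R M M (\<lambda>x. r \<odot>\<^bsub>M\<^esub> x)" if "r \<in> carrier R" for r
    unfolding proj_factoring_maps_eq[OF R.ring_axioms assms(2)] using mu[OF that]
      finite_rank_cong[of R M M "?mu r" "\<lambda>x. r \<odot>\<^bsub>M\<^esub> x"] finite_rank_cong[of R M M "\<lambda>x. r \<odot>\<^bsub>M\<^esub> x" "?mu r"] by auto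
  have zero: "\<zero>\<^bsub>?E Quot ?P\<^esub> = ?P" unfolding FactRing_def by simp
  have one: "\<one>\<^bsub>?E Quot ?P\<^esub> = ?P +>\<^bsub>?E\<^esub> \<one>\<^bsub>?E\<^esub>" unfolding FactRing_def by simp
  have cos: "?P +>\<^bsub>?E\<^esub> ?mu r \<in> carrier (?E Quot ?P)" if "r \<in> carrier R" for r
    unfolding FactRing_def using mu[OF that] by (auto simp: A_RCOSETS_def')
  have key: "(\<forall>X\<in>carrier (?E Quot ?P). (?P +>\<^bsub>?E\<^esub> ?mu r) \<otimes>\<^bsub>?E Quot ?P\<^esub> X = \<zero>\<^bsub>?E Quot ?P\<^esub>) \<longleftrightarrow> ?mu r \<in> ?P"
    if r: "r \<in> carrier R" for r
  proof
    assume "\<forall>X\<in>carrier (?E Quot ?P). (?P +>\<^bsub>?E\<^esub> ?mu r) \<otimes>\<^bsub>?E Quot ?P\<^esub> X = \<zero>\<^bsub>?E Quot ?P\<^esub>"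
    from bspec[OF this S.one_closed] have "?P +>\<^bsub>?E\<^esub> ?mu r = \<zero>\<^bsub>?E Quot ?P\<^esub>"
      using S.r_one[OF cos[OF r]] by simp
    then have "?P +>\<^bsub>?E\<^esub> ?mu r = ?P" using zero by simp
    then show "?mu r \<in> ?P" using I.a_rcos_self[OF mu[OF r]] by simp
  next
    assume "?mu r \<in> ?P"
    then have "?P +>\<^bsub>?E\<^esub> ?mu r = \<zero>\<^bsub>?E Quot ?P\<^esub>" using I.a_rcos_const zero by simp
    then show "\<forall>X\<in>carrier (?E Quot ?P). (?P +>\<^bsub>?E\<^esub> ?mu r) \<otimes>\<^bsub>?E Quot ?P\<^esub> X = \<zero>\<^bsub>?E Quot ?P\<^esub>" by simp
  qed
  have "stable_ann R M = {r \<in> carrier R. \<forall>X\<in>carrier (?E Quot ?P). (?P +>\<^bsub>?E\<^esub> ?mu r) \<otimes>\<^bsub>?E Quot ?P\<^esub> X = \<zero>\<^bsub>?E Quot ?P\<^esub>}"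
    unfolding stable_ann_def annihilator_def stable_end_def Let_def by simp
  then show ?thesis using key muP by auto
qed

section \<open>Depth\<close>

lemma ideal_times_module_iff:
  assumes "left_module R M" "set xs \<subseteq> carrier R"
  shows "y \<in> ideal_times_module R M xs \<longleftrightarrow>
    (\<exists>m. (\<forall>i<length xs. m i \<in> carrier M) \<and> y = lincomb M m (length xs) ((!) xs))"
proof -
  have e: "(\<Oplus>\<^bsub>M\<^esub>j\<in>{..<length xs}. (xs ! j) \<odot>\<^bsub>M\<^esub> m j) = lincomb M m (length xs) ((!) xs)"
    if "\<forall>i<length xs. m i \<in> carrier M" for m
    by (rule lincomb_finsum[OF assms(1)]) (use that assms(2) in auto)
  show ?thesis
  proof
    assume "y \<in> ideal_times_module R M xs"
    then obtain m where m: "m \<in> {..<length xs} \<rightarrow> carrier M" "y = (\<Oplus>\<^bsub>M\<^esub>j\<in>{..<length xs}. (xs ! j) \<odot>\<^bsub>M\<^esub> m j)"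
      unfolding ideal_times_module_def by blast
    have m': "\<forall>i<length xs. m i \<in> carrier M" using m(1) by auto
    show "\<exists>m. (\<forall>i<length xs. m i \<in> carrier M) \<and> y = lincomb M m (length xs) ((!) xs)"
      by (rule exI[of _ m]) (use m' e[OF m'] m(2) in simp)
  next
    assume "\<exists>m. (\<forall>i<length xs. m i \<in> carrier M) \<and> y = lincomb M m (length xs) ((!) xs)"
    then obtain m where m: "\<forall>i<length xs. m i \<in> carrier M" "y = lincomb M m (length xs) ((!) xs)" by (elim exE conjE)
    have "m \<in> {..<length xs} \<rightarrow> carrier M" using m(1) by auto
    then show "y \<in> ideal_times_module R M xs" unfolding ideal_times_module_def using e[OF m(1)] m(2) by force
  qed
qed

lemma lin_ideal_times_module:
  assumes "left_module R M" "left_module R N" "lin R M N q" "set xs \<subseteq> carrier R" "m \<in> ideal_times_module R M xs"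
  shows "q m \<in> ideal_times_module R N xs"
proof -
  obtain k where k: "\<forall>i<length xs. k i \<in> carrier M" "m = lincomb M k (length xs) ((!) xs)"
    using assms(5) unfolding ideal_times_module_iff[OF assms(1,4)] by (elim exE conjE)
  have "q m = lincomb N (\<lambda>i. q (k i)) (length xs) ((!) xs)"
    unfolding k(2) by (rule lincomb_map[OF assms(1-3)]) (use k(1) assms(4) in auto)
  then show ?thesis unfolding ideal_times_module_iff[OF assms(2,4)]
    using k(1) lin_closed[OF assms(3)] by (intro exI[of _ "\<lambda>i. q (k i)"]) auto
qed

lemma regular_sequence_iso:
  assumes "left_module R M" "left_module R N" "lin R M N q" "bij_betw q (carrier M) (carrier N)" "regular_sequence R M xs"
  shows "regular_sequence R N xs"
proof -
  let ?i = "inv_into (carrier M) q"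
  have il: "lin R N M ?i" by (rule lin_inv_into[OF assms(1-4)])
  have xs: "set xs \<subseteq> carrier R" using assms(5) unfolding regular_sequence_def by blast
  have tk: "set (take i xs) \<subseteq> carrier R" for i using xs set_take_subset by fast
  have qi: "q (?i y) = y" if "y \<in> carrier N" for y using bij_betw_inv_into_right[OF assms(4) that] .
  have iq: "?i (q y) = y" if "y \<in> carrier M" for y using bij_betw_inv_into_left[OF assms(4) that] .
  have itM: "ideal_times_module R M xs \<subseteq> carrier M"
  proof
    fix y assume "y \<in> ideal_times_module R M xs"
    then obtain k where k: "\<forall>i<length xs. k i \<in> carrier M" "y = lincomb M k (length xs) ((!) xs)"
      unfolding ideal_times_module_iff[OF assms(1) xs] by (elim exE conjE)
    show "y \<in> carrier M" unfolding k(2) by (rule lincomb_closed[OF assms(1)]) (use k(1) xs in auto)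
  qed
  show ?thesis unfolding regular_sequence_def
  proof (intro conjI allI ballI impI)
    fix i m assume i: "i < length xs" and m: "m \<in> carrier N" and e: "(xs ! i) \<odot>\<^bsub>N\<^esub> m \<in> ideal_times_module R N (take i xs)"
    have xi: "xs ! i \<in> carrier R" using i xs by auto
    have "(xs ! i) \<odot>\<^bsub>M\<^esub> ?i m \<in> ideal_times_module R M (take i xs)"
      using lin_ideal_times_module[OF assms(2,1) il tk e] lin_smult[OF il xi m] by simp
    then have "?i m \<in> ideal_times_module R M (take i xs)"
      using assms(5) i lin_closed[OF il m] unfolding regular_sequence_def by blast
    from lin_ideal_times_module[OF assms(1-3) tk this]
    show "m \<in> ideal_times_module R N (take i xs)" using qi[OF m] by simp
  next
    have "ideal_times_module R M xs \<noteq> carrier M" using assms(5) unfolding regular_sequence_def by blast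
    then obtain m where m: "m \<in> carrier M" "m \<notin> ideal_times_module R M xs" using itM by blast
    have "q m \<notin> ideal_times_module R N xs"
      using lin_ideal_times_module[OF assms(2,1) il xs, of "q m"] iq[OF m(1)] m(2) by auto
    then show "ideal_times_module R N xs \<noteq> carrier N" using lin_closed[OF assms(3) m(1)] by blast
  qed (rule xs)
qed

text \<open>The order lives on its own type, while points of \<open>CM\<close> are classes of
  modules on \<open>univ\<close>; this carries the Cohen-Macaulay property to a copy there.\<close>

lemma max_cohen_macaulay_iso:
  assumes "left_module R M" "left_module R N" "lin R M N q" "bij_betw q (carrier M) (carrier N)" "max_cohen_macaulay R M"
  shows "max_cohen_macaulay R N"
proof -
  have il: "lin R N M (inv_into (carrier M) q)" by (rule lin_inv_into[OF assms(1-4)])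
  have ib: "bij_betw (inv_into (carrier M) q) (carrier N) (carrier M)" by (rule bij_betw_inv_into[OF assms(4)])
  have im: "q ` carrier M = carrier N" "inv_into (carrier M) q ` carrier N = carrier M"
    using assms(4) ib unfolding bij_betw_def by auto
  have 1: "regular_sequence R M xs \<longleftrightarrow> regular_sequence R N xs" for xs
    using regular_sequence_iso[OF assms(1-4)] regular_sequence_iso[OF assms(2,1) il ib] by blast
  have 2: "zero_module M \<longleftrightarrow> zero_module N"
  proof
    assume "zero_module M"
    then have "carrier N = q ` {\<zero>\<^bsub>M\<^esub>}" unfolding zero_module_def using im(1) by simp
    then show "zero_module N" unfolding zero_module_def using lin_zero[OF assms(1-3)] by simp
  next
    assume "zero_module N"
    then have "carrier M = inv_into (carrier M) q ` {\<zero>\<^bsub>N\<^esub>}" unfolding zero_module_def using im(2) by simp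
    then show "zero_module M" unfolding zero_module_def using lin_zero[OF assms(2,1) il] by simp
  qed
  have "depth R N = depth R M" unfolding depth_def 1 2 ..
  moreover have "fg_module R N" using fg_image[OF _ assms(2,3) im(1)] assms(5) unfolding max_cohen_macaulay_def by blast
  ultimately show ?thesis using assms(5) unfolding max_cohen_macaulay_def by simp
qed

text \<open>If all regular sequences had length at most 1, so would their supremum be at most 1.
  From a sequence of length at least 2 the first two members are kept.\<close>

lemma max_cohen_macaulay_regular_pair:
  assumes "max_cohen_macaulay R M" "krull_dim R = 2"
  obtains a b where "a \<in> the_maximal_ideal R" "b \<in> the_maximal_ideal R" "a \<in> carrier R" "b \<in> carrier R" "regular_pair R M a b"
proof -
  have M: "left_module R M" and d: "depth R M = 2" using assms unfolding max_cohen_macaulay_def fg_module_def by auto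
  interpret M: left_module R M by (rule M)
  let ?S = "{xs. regular_sequence R M xs \<and> set xs \<subseteq> the_maximal_ideal R}"
  \<comment> \<open>The zero module has depth \<infinity>, so depth 2 means that the supremum in
    \<open>depth\<close> is 2.\<close>
  have s: "(SUP xs\<in>?S. enat (length xs)) = 2" using d unfolding depth_def by (simp split: if_splits)
  have "\<exists>xs\<in>?S. 2 \<le> length xs"
  proof (rule ccontr)
    assume n: "\<not> (\<exists>xs\<in>?S. 2 \<le> length xs)"
    have "(SUP xs\<in>?S. enat (length xs)) \<le> 1"
    proof (rule SUP_least)
      fix xs assume "xs \<in> ?S"
      then have "length xs \<le> 1" using n by fastforce
      then show "enat (length xs) \<le> 1" by (simp add: one_enat_def)
    qed
    then show False unfolding s by (simp add: one_enat_def numeral_eq_enat)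
  qed
  then obtain xs where xs: "regular_sequence R M xs" "set xs \<subseteq> the_maximal_ideal R" "2 \<le> length xs" by blast
  obtain a ys where "xs = a # ys" "1 \<le> length ys" using xs(3) by (cases xs) auto
  then obtain b zs where l: "xs = a # b # zs" by (cases ys) auto
  have ab: "a \<in> carrier R" "b \<in> carrier R" using xs(1) l unfolding regular_sequence_def by auto
  note reg = xs(1)[unfolded regular_sequence_def, THEN conjunct2, THEN conjunct1, rule_format]
  have nil: "y \<in> ideal_times_module R M [] \<longleftrightarrow> y = \<zero>\<^bsub>M\<^esub>" for y
    using ideal_times_module_iff[OF M, of "[]" y] by simp
  have sing: "y \<in> ideal_times_module R M [a] \<longleftrightarrow> (\<exists>z\<in>carrier M. y = a \<odot>\<^bsub>M\<^esub> z)" for y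
  proof -
    have "y \<in> ideal_times_module R M [a] \<longleftrightarrow> (\<exists>m. m (0::nat) \<in> carrier M \<and> y = \<zero>\<^bsub>M\<^esub> \<oplus>\<^bsub>M\<^esub> a \<odot>\<^bsub>M\<^esub> m 0)"
      using ideal_times_module_iff[OF M, of "[a]" y] ab by simp
    also have "\<dots> \<longleftrightarrow> (\<exists>z\<in>carrier M. y = a \<odot>\<^bsub>M\<^esub> z)"
    proof
      assume "\<exists>m. m (0::nat) \<in> carrier M \<and> y = \<zero>\<^bsub>M\<^esub> \<oplus>\<^bsub>M\<^esub> a \<odot>\<^bsub>M\<^esub> m 0"
      then show "\<exists>z\<in>carrier M. y = a \<odot>\<^bsub>M\<^esub> z" using ab by auto
    next
      assume "\<exists>z\<in>carrier M. y = a \<odot>\<^bsub>M\<^esub> z"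
      then obtain z where "z \<in> carrier M" "y = a \<odot>\<^bsub>M\<^esub> z" by blast
      then show "\<exists>m. m (0::nat) \<in> carrier M \<and> y = \<zero>\<^bsub>M\<^esub> \<oplus>\<^bsub>M\<^esub> a \<odot>\<^bsub>M\<^esub> m 0"
        using ab by (intro exI[of _ "\<lambda>_. z"]) simp
    qed
    finally show ?thesis .
  qed
  have "regular_pair R M a b" unfolding regular_pair_def
  proof (intro conjI ballI impI)
    fix x assume x: "x \<in> carrier M" "a \<odot>\<^bsub>M\<^esub> x = \<zero>\<^bsub>M\<^esub>"
    show "x = \<zero>\<^bsub>M\<^esub>" using reg[of 0 x] x l nil by simp
  next
    fix x y assume xy: "x \<in> carrier M" "y \<in> carrier M" "b \<odot>\<^bsub>M\<^esub> x = a \<odot>\<^bsub>M\<^esub> y"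
    have "b \<odot>\<^bsub>M\<^esub> x \<in> ideal_times_module R M [a]" unfolding sing using xy by blast
    then have "x \<in> ideal_times_module R M [a]" using reg[of 1 x] xy(1) l by simp
    then show "\<exists>z\<in>carrier M. x = a \<odot>\<^bsub>M\<^esub> z" unfolding sing .
  qed
  then show ?thesis using that ab xs(2) l by auto
qed

section \<open>Compactness from a smallest stable annihilator\<close>

text \<open>With a point, a closed set contains all points of smaller annihilator, so every nonempty
  closed set contains C. An open set around C thus has empty complement, and the member of a cover
  that contains C covers everything.\<close>

lemma compact_space_CM:
  assumes C: "C \<in> CM R" "\<And>Y. Y \<in> CM R \<Longrightarrow> class_stable_ann R C \<subseteq> class_stable_ann R Y"
  shows "compact_space (CM_space R)"
proof -
  have all: "V = CM R" if V: "openin (CM_space R) V" "C \<in> V" for V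
  proof (rule ccontr)
    assume "V \<noteq> CM R"
    then obtain Y where Y: "Y \<in> CM R - V" using V(1) unfolding openin_CM_space by blast
    have "CM_closed R (CM R - V)" using V(1) unfolding openin_CM_space by blast
    then have "C \<in> CM R - V" using Y C unfolding CM_closed_iff by blast
    then show False using V(2) by blast
  qed
  show ?thesis unfolding compact_space_def compactin_def topspace_CM_space
  proof (intro conjI allI impI)
    fix \<U> assume U: "(\<forall>U\<in>\<U>. openin (CM_space R) U) \<and> CM R \<subseteq> \<Union>\<U>"
    then obtain V where V: "V \<in> \<U>" "C \<in> V" using C(1) by blast
    have "V = CM R" using all[OF _ V(2)] U V(1) by blast
    then show "\<exists>\<F>. finite \<F> \<and> \<F> \<subseteq> \<U> \<and> CM R \<subseteq> \<Union>\<F>" using V(1) by (intro exI[of _ "{V}"]) simp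
  qed simp
qed

text \<open>\<open>class_stable_ann\<close> evaluates a \<open>SOME\<close> representative;
  isomorphism being reflexive, classes are nonempty and the choice is a genuine member.\<close>

lemma CM_class:
  fixes R :: "('a, 'c) ring_scheme"
  assumes "Y \<in> CM R"
  obtains M where "M = (SOME M. M \<in> Y)" "max_cohen_macaulay R M"
proof -
  obtain M0 where Y: "Y = {(M :: 'a umodule, N :: 'a umodule). max_cohen_macaulay R M \<and> max_cohen_macaulay R N \<and> mod_iso R M N} `` {M0}"
    and "M0 \<in> {M. max_cohen_macaulay R M}"
    using assms unfolding CM_def by (rule quotientE)
  then have M0: "max_cohen_macaulay R M0" by simp
  have mM: "left_module R M0" using M0 unfolding max_cohen_macaulay_def fg_module_def by blast
  have "mod_iso R M0 M0" unfolding mod_iso_def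
    by (rule bexI[OF _ lin_restrict[OF mM lin_id]]) (auto simp: bij_betw_def inj_on_def)
  then have "M0 \<in> Y" unfolding Y using M0 by simp
  then have "(SOME M. M \<in> Y) \<in> Y" by (rule someI)
  moreover have "max_cohen_macaulay R M" if "M \<in> Y" for M using that unfolding Y by simp
  ultimately show ?thesis using that[OF refl] by blast
qed

theorem theorem4p3:
  fixes R :: "('a, 'c) ring_scheme" and L :: "('l, 'e) ring_scheme" and \<phi> :: "'a \<Rightarrow> 'l"
  assumes "gorenstein_local_ring R" and "krull_dim R = 2"
    and "nonsingular_order R L \<phi>"
    and "split_structure_map R L \<phi>"
  shows "compact_space (CM_space R)"
proof -
  let ?LL = "regular_module L" and ?RR = "regular_module R"
  let ?Lr = "res \<phi> ?LL"
  have nl: "noetherian_local_ring R" using assms(1) unfolding gorenstein_local_ring_def by blast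
  note lr = noetherian_local_ringD[OF nl]
  interpret R: cring R by (rule lr(1))
  have alg: "is_algebra R L \<phi>" and mcmL: "max_cohen_macaulay R ?Lr" and gd: "global_dim L < \<infinity>"
    and pom: "projective_module (op_ring L) (dual_over R \<phi> ?LL)"
    using assms(3) unfolding nonsingular_order_def gorenstein_order_def is_order_def res_regular dual_over_regular by auto
  note a = is_algebraD[OF alg]
  interpret L: ring L by (rule a(2))
  have RR: "left_module R ?RR" by (rule left_module_regular) (rule R.ring_axioms)
  have LL: "left_module L ?LL" by (rule left_module_regular[OF a(2)])
  have rL: "left_module R ?Lr" by (rule left_module_res[OF alg LL])
  have fgL: "fg_module R ?Lr" using mcmL unfolding max_cohen_macaulay_def by blast
  obtain s t where st: "s \<in> the_maximal_ideal R" "t \<in> the_maximal_ideal R" "s \<in> carrier R" "t \<in> carrier R" "regular_pair R ?Lr s t"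
    by (rule max_cohen_macaulay_regular_pair[OF mcmL assms(2)])
  obtain \<rho> where \<rho>: "\<rho> \<in> mod_hom R ?Lr ?RR" "\<forall>r\<in>carrier R. \<rho> (\<phi> r) = r"
    using assms(4) unfolding split_structure_map_def res_regular by (rule bexE)
  note \<rho>l = mod_hom_lin[OF \<rho>(1)]
  have \<rho>1: "\<rho> \<one>\<^bsub>L\<^esub> = \<one>\<^bsub>R\<^esub>" using bspec[OF \<rho>(2) R.one_closed] a(6) by simp
  have \<phi>0: "\<phi> r = \<zero>\<^bsub>L\<^esub> \<Longrightarrow> r \<in> carrier R \<Longrightarrow> r = \<zero>\<^bsub>R\<^esub>" for r
    using bspec[OF \<rho>(2), of r] lin_zero[OF rL RR \<rho>l] by simp
  \<comment> \<open>The pair regular on L stays regular on R. The left inverse \<rho> makes \<phi>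
    injective, and from \<phi>(x) = \<phi>(s) z it produces x = s \<rho>(z), so divisibility by s
    can be tested in L.\<close>
  have wR: "regular_pair R ?RR s t" unfolding regular_pair_def regular_module_simps
  proof (intro conjI ballI impI)
    fix x assume x: "x \<in> carrier R" "s \<otimes>\<^bsub>R\<^esub> x = \<zero>\<^bsub>R\<^esub>"
    have "\<phi> \<zero>\<^bsub>R\<^esub> = \<zero>\<^bsub>L\<^esub>" using a(3)[OF R.zero_closed] a(5)[OF R.zero_closed R.zero_closed] L.add.l_cancel_one' by fastforce
    then have "\<phi> s \<otimes>\<^bsub>L\<^esub> \<phi> x = \<zero>\<^bsub>L\<^esub>" using a(4)[OF st(3) x(1)] x(2) by simp
    then have "\<phi> x = \<zero>\<^bsub>L\<^esub>" using st(5) a(3)[OF x(1)] unfolding regular_pair_def by simp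
    then show "x = \<zero>\<^bsub>R\<^esub>" using \<phi>0 x(1) by blast
  next
    fix x y assume xy: "x \<in> carrier R" "y \<in> carrier R" "t \<otimes>\<^bsub>R\<^esub> x = s \<otimes>\<^bsub>R\<^esub> y"
    have "\<phi> t \<otimes>\<^bsub>L\<^esub> \<phi> x = \<phi> s \<otimes>\<^bsub>L\<^esub> \<phi> y" using a(4)[OF st(4) xy(1)] a(4)[OF st(3) xy(2)] xy(3) by simp
    then have "\<exists>z\<in>carrier L. \<phi> x = \<phi> s \<otimes>\<^bsub>L\<^esub> z" using st(5) a(3)[OF xy(1)] a(3)[OF xy(2)] unfolding regular_pair_def by auto
    then obtain z where z: "z \<in> carrier L" "\<phi> x = \<phi> s \<otimes>\<^bsub>L\<^esub> z" by (rule bexE)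
    have "x = s \<otimes>\<^bsub>R\<^esub> \<rho> z" using bspec[OF \<rho>(2) xy(1)] z lin_smult[OF \<rho>l st(3), of z] by simp
    then show "\<exists>z\<in>carrier R. x = s \<otimes>\<^bsub>R\<^esub> z" using lin_closed[OF \<rho>l, of z] z(1) by auto
  qed
  obtain I \<epsilon> d where I: "inj_res R I \<epsilon> d"
    "\<forall>i J. 2 \<le> i \<longrightarrow> submod R ?RR J \<longrightarrow> inj_res.ext_vanishes R I d i ?RR J"
    by (rule gorenstein_ext_vanishing[OF assms(1,2) st(1,2) wR])
  interpret inj_res R I \<epsilon> d by (rule I(1))
  \<comment> \<open>The dual of L is finitely generated, first over R as a Hom module and then over
    the opposite ring. This is what turns its projectivity into finite rank of the identity.\<close>
  have D: "noetherian_mod R (hom_mod R ?Lr ?RR)" by (rule noetherian_hom[OF lr(1) fgL lr(4)])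
  let ?\<omega> = "dual_over R \<phi> ?LL"
  note algo = is_algebra_op[OF alg]
  have mo: "left_module (op_ring L) ?\<omega>" by (rule left_module_dual_over[OF alg LL])
  have "lin R (hom_mod R ?Lr ?RR) (res \<phi> ?\<omega>) (\<lambda>f. f)"
  proof (rule linI)
    fix r f assume "r \<in> carrier R" "f \<in> carrier (hom_mod R ?Lr ?RR)"
    then show "r \<odot>\<^bsub>hom_mod R ?Lr ?RR\<^esub> f = r \<odot>\<^bsub>res \<phi> ?\<omega>\<^esub> f"
      using hom_smult_eq_dual_over[of r R f \<phi> ?LL] by (simp only: hom_mod_simps(1) res_simps)
  qed simp_all
  then have "fg_module R (res \<phi> ?\<omega>)"
    by (rule fg_image[OF noetherian_modD(3)[OF D] left_module_res[OF algo mo]]) simp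
  then have fgo: "fg_module (op_ring L) ?\<omega>" by (rule fg_res_imp_fg[OF algo mo])
  have om: "finite_rank (op_ring L) ?\<omega> ?\<omega> (\<lambda>x. x)" by (rule projective_finite_rank_id[OF pom fgo])
  \<comment> \<open>The point of the space that belongs to the order is the class C of a copy N of
    it on \<open>univ\<close>. The representative M chosen in \<open>class_stable_ann\<close> is
    merely isomorphic to N, so scalars are carried from M back to the order at the end.\<close>
  obtain c :: "'l \<Rightarrow> 'a univ" where c: "inj_on c (carrier ?Lr)" using fg_module_code[OF fgL] .
  define N where "N = transport c ?Lr"
  note tN = transport[OF rL c, folded N_def]
  have bN: "bij_betw c (carrier ?Lr) (carrier N)" unfolding bij_betw_def N_def using c by simp
  have mcmN: "max_cohen_macaulay R N" by (rule max_cohen_macaulay_iso[OF rL tN(1,2) bN mcmL])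
  let ?rel = "{(M :: 'a umodule, N :: 'a umodule). max_cohen_macaulay R M \<and> max_cohen_macaulay R N \<and> mod_iso R M N}"
  define C where "C = ?rel `` {N}"
  have CCM: "C \<in> CM R" unfolding C_def CM_def by (rule quotientI) (use mcmN in simp)
  obtain M where M: "M = (SOME M. M \<in> C)" "max_cohen_macaulay R M" by (rule CM_class[OF CCM])
  have mM: "left_module R M" using M(2) unfolding max_cohen_macaulay_def fg_module_def by blast
  have "mod_iso R N N" unfolding mod_iso_def
    by (rule bexI[OF _ lin_restrict[OF tN(1) lin_id]]) (auto simp: bij_betw_def inj_on_def)
  then have "N \<in> C" unfolding C_def using mcmN by simp
  then have "M \<in> C" unfolding M(1) by (rule someI)
  then have "mod_iso R N M" unfolding C_def by simp
  then obtain f where f0: "f \<in> mod_hom R N M" and fb: "bij_betw f (carrier N) (carrier M)"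
    unfolding mod_iso_def by (rule bexE)
  note f = mod_hom_lin[OF f0] fb
  have LM: "lin R ?Lr M (\<lambda>x. f (c x))" by (rule lin_comp[OF tN(2) f(1)])
  have bLM: "bij_betw (\<lambda>x. f (c x)) (carrier ?Lr) (carrier M)"
    using bij_betw_trans[OF bN f(2)] by (simp add: comp_def)
  show ?thesis
  proof (rule compact_space_CM[OF CCM])
    fix Y assume "Y \<in> CM R"
    then obtain X where X: "X = (SOME M. M \<in> Y)" "max_cohen_macaulay R X" by (rule CM_class)
    have fgX: "fg_module R X" using X(2) unfolding max_cohen_macaulay_def by blast
    have mX: "left_module R X" by (rule fgD[OF fgX])
    \<comment> \<open>The pair u, v may vary with X; only the vanishing of Ext that it yields is
      passed on.\<close>
    obtain u v where uv: "u \<in> the_maximal_ideal R" "v \<in> the_maximal_ideal R" "regular_pair R X u v"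
      by (rule max_cohen_macaulay_regular_pair[OF X(2) assms(2)])
    have vX: "ext_vanishes i X {\<zero>\<^bsub>X\<^esub>}" for i by (rule ext_vanishes_regular_pair[OF I(2) fgX lr(6)[OF uv(1)] lr(6)[OF uv(2)] uv(3)])
    show "class_stable_ann R C \<subseteq> class_stable_ann R Y"
      unfolding class_stable_ann_def M(1)[symmetric] X(1)[symmetric] stable_ann_eq[OF lr(1) mM] stable_ann_eq[OF lr(1) mX]
    proof (intro subsetI CollectI conjI)
      fix r assume "r \<in> {r \<in> carrier R. finite_rank R M M (\<lambda>x. r \<odot>\<^bsub>M\<^esub> x)}"
      then have r: "r \<in> carrier R" "finite_rank R M M (\<lambda>x. r \<odot>\<^bsub>M\<^esub> x)" by auto
      have "finite_rank R ?Lr ?Lr (\<lambda>x. r \<odot>\<^bsub>?Lr\<^esub> x)" by (rule finite_rank_scalar_iso[OF rL mM LM bLM r])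
      then have "finite_rank R ?Lr ?Lr (\<lambda>x. \<phi> r \<otimes>\<^bsub>L\<^esub> x)" by simp
      then show "finite_rank R X X (\<lambda>x. r \<odot>\<^bsub>X\<^esub> x)"
        by (rule scalar_finite_rank_transfer[OF alg fgL I(2) lr(6)[OF st(1)] lr(6)[OF st(2)] st(5) wR om gd \<rho>l \<rho>1 fgX vX r(1)])
      show "r \<in> carrier R" by (rule r(1))
    qed
  qed
qed

end
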